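(* Let $t\geq s\geq 2$ be fixed integers. For $n$ sufficiently large, every graph that maximizes the spread over the family $\mathcal{G}_{s,t}(n)$ of $K_{s,t}$-minor-free graphs on $n$ vertices has the form $$L_{max}\vee \left( \ell_0 K_t \cup \left(n-s+1- t \ell_0\right) P_1\right),$$ where (1) $L_{max}$ is a graph on $s-1$ vertices which maximizes, over all graphs $L$ on $s-1$ vertices, the function $$\psi(L)=3\sum_{v\in V(L)}d_L(v)^2-\frac{2}{s-1} \left(\sum_{v\in V(L)} d_L(v)\right)^2 - (t-1)\sum_{v\in V(L)} d_L(v);$$ (2) $\ell_0$ is an integer with $\ell_0=\left(\frac{2}{3t}-\frac{2|E(L_{max})|}{3t(t-1)(s-1)}\right)(n-s+1) +O(n^{\epsilon})$ for any $\epsilon>0$. In particular, $$\max_{G\in \mathcal{G}_{s,t}(n)}S(G)= 2\sqrt{(s-1)(n-s+1)} + \frac{(t-1)^2+\psi(L_{max})/(s-1)}{3\sqrt{(s-1)(n-s+1)}} + O\left(\frac{1}{n^{3/2}}\right).$$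
   Context: All graphs are finite and simple. For a graph $G$ on $n$ vertices, $\lambda_1(G)\ge\dots\ge\lambda_n(G)$ are the eigenvalues of its adjacency matrix, and the spread is $S(G)=\lambda_1(G)-\lambda_n(G)$. A graph $H$ is a minor of $G$ if a graph isomorphic to $H$ can be obtained from a subgraph of $G$ by contracting edges; $G$ is $H$-minor-free if $H$ is not a minor of $G$. $\mathcal{G}_{s,t}(n)$ is the family of all $K_{s,t}$-minor-free graphs on $n$ vertices. $G\vee H$ is the join (disjoint union plus all edges between $G$ and $H$), $G\cup H$ is the disjoint union, $kG$ is the disjoint union of $k$ copies of $G$, and $P_1$ is a single vertex. $d_L(v)$ is the degree of $v$ in $L$. Asymptotic notation is for $n\to\infty$ with $s,t$ fixed; implied constants may depend on $s,t$ (and on $\epsilon$ where it appears). *)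

theory Defs
  imports
    "Graph_Theory.Graph_Theory"
    "Jordan_Normal_Form.Spectral_Radius"
    "HOL-Library.Landau_Symbols"
begin

text \<open>
  Finite simple graphs are rendered by \<^locale>\<open>pair_graph\<close>: finite, loop-free, symmetric
  relations, so an undirected edge \<open>uv\<close> is present as the two arcs \<open>(u, v)\<close> and \<open>(v, u)\<close>.
  Graphs on \<open>n\<close> vertices are labelled by \<open>0, \<dots>, n - 1\<close>; up to isomorphism this is
  no restriction.
\<close>

definition graphs_on :: "nat \<Rightarrow> nat pair_pre_digraph set" where
  "graphs_on n = {G. pair_graph G \<and> pverts G = {..<n}}"

definition edge_set :: "'a pair_pre_digraph \<Rightarrow> 'a set set" where
  "edge_set G = (\<lambda>(u, v). {u, v}) ` parcs G"

definition complete_graph :: "nat \<Rightarrow> nat pair_pre_digraph" where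
  "complete_graph n =
     \<lparr>pverts = {..<n}, parcs = {(u, v). u < n \<and> v < n \<and> u \<noteq> v}\<rparr>"

definition disjoint_union ::
    "'a pair_pre_digraph \<Rightarrow> 'b pair_pre_digraph \<Rightarrow> ('a + 'b) pair_pre_digraph" where
  "disjoint_union G H =
     \<lparr>pverts = pverts G <+> pverts H,
      parcs = map_prod Inl Inl ` parcs G \<union> map_prod Inr Inr ` parcs H\<rparr>"

definition graph_join ::
    "'a pair_pre_digraph \<Rightarrow> 'b pair_pre_digraph \<Rightarrow> ('a + 'b) pair_pre_digraph" where
  "graph_join G H =
     \<lparr>pverts = pverts G <+> pverts H,
      parcs = parcs (disjoint_union G H)
        \<union> (Inl ` pverts G) \<times> (Inr ` pverts H)
        \<union> (Inr ` pverts H) \<times> (Inl ` pverts G)\<rparr>"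

definition copies :: "nat \<Rightarrow> 'a pair_pre_digraph \<Rightarrow> (nat \<times> 'a) pair_pre_digraph" where
  "copies k G =
     \<lparr>pverts = {..<k} \<times> pverts G,
      parcs = {((i, u), (i, v)) | i u v. i < k \<and> (u, v) \<in> parcs G}\<rparr>"

text \<open>
  Contracting the edge \<open>uv\<close> identifies \<open>v\<close> with \<open>u\<close>; the loop that arises is
  dropped, and parallel edges are merged because the arcs form a set of pairs.
\<close>

definition contract_edge :: "'a pair_pre_digraph \<Rightarrow> 'a \<Rightarrow> 'a \<Rightarrow> 'a pair_pre_digraph" where
  "contract_edge G u v =
     (let f = (\<lambda>x. if x = v then u else x)
      in \<lparr>pverts = pverts G - {v}, parcs = {(f x, f y) | x y. (x, y) \<in> parcs G \<and> f x \<noteq> f y}\<rparr>)"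

definition contraction_step :: "'a pair_pre_digraph \<Rightarrow> 'a pair_pre_digraph \<Rightarrow> bool" where
  "contraction_step G G' \<longleftrightarrow> (\<exists>u v. (u, v) \<in> parcs G \<and> G' = contract_edge G u v)"

definition is_minor :: "'b pair_pre_digraph \<Rightarrow> 'a pair_pre_digraph \<Rightarrow> bool" where
  "is_minor H G \<longleftrightarrow>
     (\<exists>G' M. pair_graph G' \<and> subgraph (with_proj G') (with_proj G)
        \<and> contraction_step\<^sup>*\<^sup>* G' M \<and> digraph_iso (with_proj M) (with_proj H))"

definition Kst_minor_free_graphs :: "nat \<Rightarrow> nat \<Rightarrow> nat \<Rightarrow> nat pair_pre_digraph set" where
  "Kst_minor_free_graphs s t n =
     {G \<in> graphs_on n.
        \<not> (\<exists>H :: nat pair_pre_digraph. K\<^bsub>s,t\<^esub> (with_proj H) \<and> is_minor H G)}"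

text \<open>The adjacency matrix is only meaningful for graphs with vertex set \<open>{..<n}\<close>.\<close>

definition adjacency_mat :: "nat pair_pre_digraph \<Rightarrow> real mat" where
  "adjacency_mat G =
     (let n = card (pverts G) in mat n n (\<lambda>(i, j). if (i, j) \<in> parcs G then 1 else 0))"

text \<open>
  The matrix is real symmetric, so all its eigenvalues are real, and its largest and smallest
  eigenvalues are the maximum and the minimum of its real spectrum.
\<close>

definition spread :: "nat pair_pre_digraph \<Rightarrow> real" where
  "spread G = Max (spectrum (adjacency_mat G)) - Min (spectrum (adjacency_mat G))"

text \<open>In a symmetric digraph, the out-degree is the degree of the underlying graph.\<close>

abbreviation degree_of :: "'a pair_pre_digraph \<Rightarrow> 'a \<Rightarrow> real" where
  "degree_of G v \<equiv> real (out_degree (with_proj G) v)"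

definition psi :: "nat \<Rightarrow> nat \<Rightarrow> nat pair_pre_digraph \<Rightarrow> real" where
  "psi s t L =
     3 * (\<Sum>v\<in>pverts L. (degree_of L v)\<^sup>2)
     - 2 / (real s - 1) * (\<Sum>v\<in>pverts L. degree_of L v)\<^sup>2
     - (real t - 1) * (\<Sum>v\<in>pverts L. degree_of L v)"

definition maximizes_psi :: "nat \<Rightarrow> nat \<Rightarrow> nat pair_pre_digraph \<Rightarrow> bool" where
  "maximizes_psi s t L \<longleftrightarrow> is_arg_max (psi s t) (\<lambda>L'. L' \<in> graphs_on (s - 1)) L"

definition maximizes_spread :: "nat \<Rightarrow> nat \<Rightarrow> nat \<Rightarrow> nat pair_pre_digraph \<Rightarrow> bool" where
  "maximizes_spread s t n G \<longleftrightarrow>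
     is_arg_max spread (\<lambda>G'. G' \<in> Kst_minor_free_graphs s t n) G"

end

theory Submission
  imports Defs "HOL-Analysis.Function_Topology" "HOL-Analysis.L2_Norm"
begin

text \<open>
  The eigenvectors of a near-extremal graph concentrate on \<open>k = s - 1\<close> hubs of almost full degree.
  Rewiring every vertex that misses a hub so that it sees exactly the hubs raises the largest eigenvalue
  and lowers the smallest one, so it suffices to study graphs in which a set \<open>K\<close> of \<open>k\<close> hubs is joined
  to the remaining \<open>m = n - k\<close> vertices, among which all degrees are at most \<open>\<tau> = t - 1\<close>. Eliminating the
  other coordinates turns the eigenvalue equation into a perturbed cubic
  \<open>(\<mu> - \<tau>) (\<mu>\<^sup>2 - b1 \<mu> + b1\<^sup>2 - b2 - k m) + O(1 / \<mu>) = k a - (defect)\<close>, where \<open>b1\<close>, \<open>b2\<close> are the degree moments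
  of the hub graph, \<open>a\<close> is the degree sum outside the hubs and the defect is proportional to
  \<open>\<Sum> d (\<tau> - d)\<close>. The two extremal eigenvalues \<open>p\<close>, \<open>q\<close> then satisfy
  \<open>(p - q)\<^sup>2 = 4 k m + 4/3 (\<tau>\<^sup>2 + \<psi> / k) - 3 (p + q - 2 (b1 + \<tau>) / 3)\<^sup>2 - (defect) + O(1 / m)\<close>.
  Comparison with disjoint cliques of the right total size forces defect zero and
  \<open>a = (2 \<tau> - b1) m / 3 + O(1)\<close>. So all degrees outside the hubs are \<open>0\<close> or \<open>t - 1\<close>, with linearly many
  isolated vertices, and any component other than \<open>K\<^sub>t\<close> would create a \<open>K\<^sub>s\<^sub>,\<^sub>t\<close> minor.
\<close>

section \<open>Minor models\<close>

text \<open>Taken by itself, the identity for the squared spread is too weak: its error of order 1/m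
  would leave the defect merely bounded and the degree sum outside the hubs known only up to order
  sqrt m. But that error comes from a remainder that depends only on the hub graph and the
  eigenvalue and is Lipschitz in the reciprocal eigenvalue. Against a competitor with the same hub
  graph the remainders therefore cancel to order 1/m^2. The defect then drops below one and, being
  an integer, vanishes, and the degree sum is known up to a constant. For this reason the hub part
  is expanded exactly, with an explicit tail, and never truncated. Comparison across different hub
  graphs can afford the error 1/m, since finitely many hub graphs leave a positive gap between the
  values of \<psi>. Another obstacle is that rewiring may create the forbidden minor, so
  minor-freeness of the rewired graph has to be recovered from the structure that the comparison
  yields. The number of cliques comes out with bounded error, so one constant serves every
  \<epsilon>.\<close>

definition ugraph :: "'a set \<Rightarrow> ('a \<times> 'a) set \<Rightarrow> bool" where
  "ugraph V E \<longleftrightarrow> finite V \<and> E \<subseteq> V \<times> V \<and> sym E \<and> irrefl E"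

lemma ugraphD:
  assumes "ugraph V E"
  shows "finite V" "finite E" "E \<subseteq> V \<times> V" "(x, y) \<in> E \<Longrightarrow> (y, x) \<in> E" "(x, x) \<notin> E"
    "(x, y) \<in> E \<Longrightarrow> x \<in> V" "(x, y) \<in> E \<Longrightarrow> y \<in> V"
proof -
  show fV: "finite V" and sub: "E \<subseteq> V \<times> V" using assms by (auto simp: ugraph_def)
  show "finite E" using fV sub by (meson finite_SigmaI finite_subset)
  show "(x, y) \<in> E \<Longrightarrow> (y, x) \<in> E" using assms by (auto simp: ugraph_def dest: symD)
  show "(x, x) \<notin> E" using assms by (auto simp: ugraph_def irrefl_def)
  show "(x, y) \<in> E \<Longrightarrow> x \<in> V" "(x, y) \<in> E \<Longrightarrow> y \<in> V" using sub by auto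
qed

lemma pair_graph_iff_ugraph: "pair_graph G \<longleftrightarrow> ugraph (pverts G) (parcs G)"
proof
  assume "pair_graph G"
  then interpret pair_graph G .
  show "ugraph (pverts G) (parcs G)"
    unfolding ugraph_def sym_def irrefl_def
    using pair_finite_verts arcs_symmetric no_loops' in_arcsD1 in_arcsD2 by auto
next
  assume u: "ugraph (pverts G) (parcs G)"
  show "pair_graph G"
    by unfold_locales
      (use u in \<open>auto dest: ugraphD simp: ugraphD(1,2) symmetric_def ugraph_def irrefl_def\<close>)
qed

section \<open>Connected vertex sets and branch sets\<close>

definition conn :: "('a \<times> 'a) set \<Rightarrow> 'a set \<Rightarrow> bool" where
  "conn E X \<longleftrightarrow> X \<noteq> {} \<and> (\<forall>x\<in>X. \<forall>y\<in>X. (x, y) \<in> (Restr E X)\<^sup>*)"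

lemma conn_singleton: "conn E {x}"
  by (simp add: conn_def)

lemma conn_mono:
  assumes "conn E X" "E \<inter> X \<times> X \<subseteq> E'"
  shows "conn E' X"
proof -
  have "Restr E X \<subseteq> Restr E' X" using assms(2) by auto
  then have "(Restr E X)\<^sup>* \<subseteq> (Restr E' X)\<^sup>*" by (rule rtrancl_mono)
  then show ?thesis using assms(1) unfolding conn_def by blast
qed

lemma conn_insert:
  assumes "conn E X" "x \<in> X" "(x, v) \<in> E" "(v, x) \<in> E"
  shows "conn E (insert v X)"
proof -
  let ?R = "Restr E (insert v X)"
  have mono: "(Restr E X)\<^sup>* \<subseteq> ?R\<^sup>*" by (rule rtrancl_mono) auto
  have 1: "(x, y) \<in> ?R\<^sup>*" "(y, x) \<in> ?R\<^sup>*" if "y \<in> insert v X" for y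
  proof -
    have "(x, v) \<in> ?R\<^sup>*" "(v, x) \<in> ?R\<^sup>*" using assms by auto
    moreover have "(x, y) \<in> ?R\<^sup>*" "(y, x) \<in> ?R\<^sup>*" if "y \<in> X" 
      using that assms(1,2) mono unfolding conn_def by blast+
    ultimately show "(x, y) \<in> ?R\<^sup>*" "(y, x) \<in> ?R\<^sup>*" using that by auto
  qed
  have "(a, b) \<in> ?R\<^sup>*" if "a \<in> insert v X" "b \<in> insert v X" for a b
    using 1(2)[OF that(1)] 1(1)[OF that(2)] by (rule rtrancl_trans)
  then show ?thesis unfolding conn_def by blast
qed

lemma conn_edge: "(u, v) \<in> E \<Longrightarrow> (v, u) \<in> E \<Longrightarrow> conn E {u, v}"
  using conn_insert[OF conn_singleton, of u u v E] by (simp add: insert_commute)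

text \<open>Branch sets \<open>f i\<close>, \<open>i \<in> J\<close>, of a minor with vertex set \<open>J\<close> and edge set \<open>F\<close>.\<close>

definition model :: "'a set \<Rightarrow> ('a \<times> 'a) set \<Rightarrow> 'i set \<Rightarrow> ('i \<times> 'i) set \<Rightarrow> ('i \<Rightarrow> 'a set) \<Rightarrow> bool"
  where "model V E J F f \<longleftrightarrow>
    (\<forall>i\<in>J. conn E (f i) \<and> f i \<subseteq> V) \<and> (\<forall>i\<in>J. \<forall>j\<in>J. i \<noteq> j \<longrightarrow> f i \<inter> f j = {})
    \<and> (\<forall>(i, j)\<in>F. \<exists>u\<in>f i. \<exists>v\<in>f j. (u, v) \<in> E)"

lemma modelD:
  assumes "model V E J F f"
  shows "i \<in> J \<Longrightarrow> conn E (f i)" "i \<in> J \<Longrightarrow> f i \<subseteq> V"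
    "i \<in> J \<Longrightarrow> j \<in> J \<Longrightarrow> i \<noteq> j \<Longrightarrow> f i \<inter> f j = {}"
    "(i, j) \<in> F \<Longrightarrow> \<exists>u\<in>f i. \<exists>v\<in>f j. (u, v) \<in> E"
  using assms unfolding model_def by (simp_all add: case_prod_unfold Ball_def)

lemma modelI:
  assumes "\<And>i. i \<in> J \<Longrightarrow> conn E (f i)" "\<And>i. i \<in> J \<Longrightarrow> f i \<subseteq> V"
    "\<And>i j. i \<in> J \<Longrightarrow> j \<in> J \<Longrightarrow> i \<noteq> j \<Longrightarrow> f i \<inter> f j = {}"
    "\<And>i j. (i, j) \<in> F \<Longrightarrow> \<exists>u\<in>f i. \<exists>v\<in>f j. (u, v) \<in> E"
  shows "model V E J F f"
  unfolding model_def using assms by (simp add: case_prod_unfold Ball_def)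

lemma model_mono:
  assumes "model V E J F f" "V \<subseteq> V'" "E \<subseteq> E'" "F' \<subseteq> F"
  shows "model V' E' J F' f"
proof (rule modelI, goal_cases)
  case (1 i)
  show ?case by (rule conn_mono[OF modelD(1)[OF assms(1) 1]]) (use assms(3) in blast)
next
  case (2 i)
  show ?case using modelD(2)[OF assms(1) 2] assms(2) by blast
next
  case (3 i j)
  show ?case by (rule modelD(3)[OF assms(1) 3])
next
  case (4 i j)
  then have "(i, j) \<in> F" using assms(4) by blast
  show ?case using modelD(4)[OF assms(1) \<open>(i, j) \<in> F\<close>] assms(3) by blast
qed

section \<open>Edge contraction and its effect on branch sets\<close>

definition cmap :: "'a \<Rightarrow> 'a \<Rightarrow> 'a \<Rightarrow> 'a" where
  "cmap u v x = (if x = v then u else x)"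

definition contr :: "('a \<times> 'a) set \<Rightarrow> 'a \<Rightarrow> 'a \<Rightarrow> ('a \<times> 'a) set" where
  "contr E u v = {(cmap u v x, cmap u v y) | x y. (x, y) \<in> E \<and> cmap u v x \<noteq> cmap u v y}"

lemma contract_edge_simps:
  "pverts (contract_edge G u v) = pverts G - {v}"
  "parcs (contract_edge G u v) = contr (parcs G) u v"
  by (simp_all add: contract_edge_def contr_def cmap_def Let_def)

lemma ugraph_contr:
  assumes "ugraph V E" "(u, v) \<in> E"
  shows "ugraph (V - {v}) (contr E u v)"
proof -
  have "u \<noteq> v" using assms by (auto dest: ugraphD)
  then show ?thesis
    unfolding ugraph_def contr_def sym_def irrefl_def
    using assms by (auto simp: cmap_def dest: ugraphD)
qed

text \<open>A walk in the contracted graph is lifted arc by arc. Between consecutive lifts one may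
  have to move inside a fibre of \<open>cmap u v\<close>; a fibre with two points is
  \<open>{u, v}\<close>, and these two are adjacent.\<close>

lemma conn_preimage:
  assumes "(u, v) \<in> E" "(v, u) \<in> E" "conn (contr E u v) X" "v \<notin> X"
  shows "conn E (cmap u v -` X)"
proof -
  let ?g = "cmap u v" and ?E = "Restr (contr E u v) X"
  let ?P = "?g -` X"
  have fib: "(x, y) \<in> (Restr E ?P)\<^sup>*" if "x \<in> ?P" "y \<in> ?P" "?g x = ?g y" for x y
    using that assms(1,2) by (cases "x = y") (auto simp: cmap_def split: if_splits)
  have "\<forall>x\<in>?P. \<forall>y\<in>?P. ?g x = a \<and> ?g y = b \<longrightarrow> (x, y) \<in> (Restr E ?P)\<^sup>*"
    if "(a, b) \<in> ?E\<^sup>*" for a b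
    using that
  proof induction
    case base
    then show ?case using fib by auto
  next
    case (step b c)
    show ?case
    proof (intro ballI impI)
      fix x y assume xy: "x \<in> ?P" "y \<in> ?P" "?g x = a \<and> ?g y = c"
      obtain x' y' where *: "(x', y') \<in> E" "?g x' = b" "?g y' = c" "b \<in> X" "c \<in> X"
        using step(2) by (auto simp: contr_def)
      have "(x, x') \<in> (Restr E ?P)\<^sup>*" using step.IH xy * by auto
      moreover have "(x', y') \<in> Restr E ?P" using * by auto
      moreover have "(y', y) \<in> (Restr E ?P)\<^sup>*" using fib * xy by auto
      ultimately show "(x, y) \<in> (Restr E ?P)\<^sup>*" by (meson rtrancl.simps rtrancl_trans)
    qed
  qed
  moreover have "?P \<noteq> {}"
  proof -
    obtain x where "x \<in> X" using assms(3) by (auto simp: conn_def)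
    then have "x \<in> ?P" using assms(4) by (auto simp: cmap_def)
    then show ?thesis by auto
  qed
  ultimately show ?thesis using assms(3) unfolding conn_def by blast
qed

lemma model_contr:
  assumes "ugraph V E" "(u, v) \<in> E" "model (V - {v}) (contr E u v) J F f"
  shows "model V E J F (\<lambda>i. cmap u v -` f i \<inter> V)"
proof -
  let ?g = "cmap u v"
  have uv: "(v, u) \<in> E" "u \<in> V" "v \<in> V" using assms by (auto dest: ugraphD)
  have sub: "?g -` f i \<subseteq> V" "v \<notin> f i" if "i \<in> J" for i
  proof -
    have s: "f i \<subseteq> V - {v}" by (rule modelD(2)[OF assms(3) that])
    show "?g -` f i \<subseteq> V"
    proof
      fix x assume "x \<in> ?g -` f i"
      with s have "?g x \<in> V" by auto
      then show "x \<in> V" using uv by (auto simp: cmap_def split: if_splits)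
    qed
    show "v \<notin> f i" using s by auto
  qed
  have "conn E (?g -` f i)" if "i \<in> J" for i
  proof (rule conn_preimage[OF assms(2) uv(1)])
    show "conn (contr E u v) (f i)" by (rule modelD(1)[OF assms(3) that])
  qed (rule sub(2)[OF that])
  moreover have "\<exists>a\<in>?g -` f i \<inter> V. \<exists>b\<in>?g -` f j \<inter> V. (a, b) \<in> E" if ij: "(i, j) \<in> F" for i j
  proof -
    obtain a b where "a \<in> f i" "b \<in> f j" "(a, b) \<in> contr E u v"
      using modelD(4)[OF assms(3) ij] by blast
    then obtain x y where xy: "(x, y) \<in> E" "a = ?g x" "b = ?g y" unfolding contr_def by blast
    then have "x \<in> V" "y \<in> V" using ugraphD(6,7)[OF assms(1)] by blast+
    then show ?thesis using xy \<open>a \<in> f i\<close> \<open>b \<in> f j\<close> by (intro bexI[of _ x] bexI[of _ y]) auto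
  qed
  moreover have "?g -` f i \<inter> V = ?g -` f i" if "i \<in> J" for i using sub(1)[OF that] by blast
  moreover have "f i \<inter> f j = {}" if "i \<in> J" "j \<in> J" "i \<noteq> j" for i j
    by (rule modelD(3)[OF assms(3) that])
  ultimately have *: "\<And>i. i \<in> J \<Longrightarrow> conn E (?g -` f i)"
    "\<And>i j. (i, j) \<in> F \<Longrightarrow> \<exists>a\<in>?g -` f i \<inter> V. \<exists>b\<in>?g -` f j \<inter> V. (a, b) \<in> E"
    "\<And>i. i \<in> J \<Longrightarrow> ?g -` f i \<inter> V = ?g -` f i"
    "\<And>i j. i \<in> J \<Longrightarrow> j \<in> J \<Longrightarrow> i \<noteq> j \<Longrightarrow> f i \<inter> f j = {}" by blast+
  show ?thesis
  proof (rule modelI, goal_cases)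
    case (1 i)
    then show ?case using *(1,3) by simp
  next
    case (3 i j)
    then show ?case using *(4)[OF 3] by blast
  next
    case (4 i j)
    then show ?case using *(2) by blast
  qed blast
qed

lemma conn_contr:
  assumes "conn E X"
  shows "conn (contr E u v) (cmap u v ` X)"
proof -
  let ?g = "cmap u v"
  have "(?g x, ?g y) \<in> (Restr (contr E u v) (?g ` X))\<^sup>*" if "(x, y) \<in> (Restr E X)\<^sup>*" for x y
    using that
  proof induction
    case (step y z)
    have "?g y = ?g z \<or> (?g y, ?g z) \<in> Restr (contr E u v) (?g ` X)"
      using step(2) by (auto simp: contr_def)
    then show ?case using step.IH by (metis rtrancl.rtrancl_into_rtrancl)
  qed simp
  then show ?thesis using assms unfolding conn_def by auto
qed

abbreviation bip :: "nat \<Rightarrow> nat \<Rightarrow> (nat \<times> nat) set" where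
  "bip s t \<equiv> {..<s} \<times> {s..<s + t}"

text \<open>The last hypothesis says that nothing is left to delete: every arc runs inside a branch
  set or between the two sides. Contraction alone then suffices. A connected branch set with two
  vertices contains an arc to contract, and once all branch sets are singletons the graph is
  complete bipartite.\<close>

lemma contract_model:
  assumes "pair_graph G" "pverts G = (\<Union>i<s + t. f i)"
    "model (pverts G) (parcs G) {..<s + t} (bip s t) f"
    "\<And>x y. (x, y) \<in> parcs G \<Longrightarrow> \<exists>i j. i < s + t \<and> j < s + t \<and> x \<in> f i \<and> y \<in> f j \<and>
        (i = j \<or> i < s \<and> s \<le> j \<or> j < s \<and> s \<le> i)"
  shows "\<exists>M. contraction_step\<^sup>*\<^sup>* G M \<and> K\<^bsub>s,t\<^esub> (with_proj M)"
  using assms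
proof (induction "card (pverts G)" arbitrary: G f rule: less_induct)
  case less
  let ?V = "pverts G" and ?E = "parcs G"
  have ug: "ugraph ?V ?E" using less.prems(1) pair_graph_iff_ugraph by blast
  have mc: "conn ?E (f i)" and mV: "f i \<subseteq> ?V" if "i < s + t" for i
    using modelD(1,2)[OF less.prems(3), of i] that by auto
  have md: "f i \<inter> f j = {}" if "i < s + t" "j < s + t" "i \<noteq> j" for i j
    using modelD(3)[OF less.prems(3), of i j] that by auto
  have me: "\<exists>u\<in>f i. \<exists>v\<in>f j. (u, v) \<in> ?E" if "i < s" "s \<le> j" "j < s + t" for i j
    using modelD(4)[OF less.prems(3), of i j] that by auto
  show ?case
  proof (cases "\<forall>i<s+t. \<exists>m. f i = {m}")
    case True
    then obtain m where m: "\<And>i. i < s + t \<Longrightarrow> f i = {m i}" by metis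
    have inj: "inj_on m {..<s + t}"
      by (rule inj_onI) (use md m in \<open>force\<close>)
    let ?U = "m ` {..<s}" and ?W = "m ` {s..<s + t}"
    have "?V = ?U \<union> ?W"
    proof -
      have "?V = m ` {..<s + t}" unfolding less.prems(2) using m by auto
      also have "{..<s + t} = {..<s} \<union> {s..<s + t}" by auto
      finally show ?thesis by (simp add: image_Un)
    qed
    moreover have "?U \<inter> ?W = {}"
      using inj_on_image_Int[OF inj, of "{..<s}" "{s..<s + t}"] by (simp add: ivl_disj_int subset_eq)
    moreover have "card ?U = s" "card ?W = t"
      using inj by (subst card_image; auto intro: inj_on_subset)+
    moreover have "?E = ?U \<times> ?W \<union> ?W \<times> ?U"
    proof
      show "?E \<subseteq> ?U \<times> ?W \<union> ?W \<times> ?U"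
      proof (rule subrelI)
        fix x y assume xy: "(x, y) \<in> ?E"
        then obtain i j where ij: "i < s + t" "j < s + t" "x \<in> f i" "y \<in> f j"
          "i = j \<or> i < s \<and> s \<le> j \<or> j < s \<and> s \<le> i" using less.prems(4) by blast
        have "i \<noteq> j" using ij m xy ug by (auto dest: ugraphD)
        then show "(x, y) \<in> ?U \<times> ?W \<union> ?W \<times> ?U" using ij m by auto
      qed
      have "(m i, m j) \<in> ?E" if "i < s" "s \<le> j" "j < s + t" for i j
        using me[OF that] m that by auto
      then show "?U \<times> ?W \<union> ?W \<times> ?U \<subseteq> ?E" using ugraphD(4)[OF ug] by auto
    qed
    ultimately have "K\<^bsub>s,t\<^esub> (with_proj G)"
      unfolding complete_bipartite_digraph_pair_def using ugraphD(1)[OF ug] by blast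
    then show ?thesis by blast
  next
    case False
    then obtain i where i: "i < s + t" "\<And>m. f i \<noteq> {m}" by blast
    have "f i \<noteq> {}" using mc[OF i(1)] by (auto simp: conn_def)
    then obtain a b where ab: "a \<in> f i" "b \<in> f i" "a \<noteq> b" using i(2) by blast
    then have "(a, b) \<in> (Restr ?E (f i))\<^sup>*" using mc[OF i(1)] by (auto simp: conn_def)
    then obtain v where v: "(a, v) \<in> Restr ?E (f i)" using ab(3) by (metis converse_rtranclE)
    let ?g = "cmap a v"
    let ?G = "contract_edge G a v" and ?f = "\<lambda>j. ?g ` f j"
    have av: "(a, v) \<in> ?E" "a \<in> f i" "v \<in> f i" "a \<noteq> v" "v \<in> ?V"
      using v ugraphD[OF ug] by auto
    \<comment> \<open>Both ends of the contracted arc lie in \<open>f i\<close>, so no other branch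
      set changes.\<close>
    have fj: "?f j = (if j = i then f i - {v} else f j)" if "j < s + t" for j
      using md[OF that i(1)] av by (auto simp: cmap_def)
    have ug': "ugraph (pverts ?G) (parcs ?G)"
      unfolding contract_edge_simps by (rule ugraph_contr) (use ug av in auto)
    have "\<exists>M. contraction_step\<^sup>*\<^sup>* ?G M \<and> K\<^bsub>s,t\<^esub> (with_proj M)"
    proof (rule less.hyps)
      show "card (pverts ?G) < card (pverts G)"
        unfolding contract_edge_simps using av ugraphD(1)[OF ug] by (simp add: card_Diff1_less del: card_Diff_insert card_Diff_singleton)
      show "pair_graph ?G" using ug' pair_graph_iff_ugraph by blast
      show "pverts ?G = (\<Union>i<s + t. ?f i)"
      proof -
        have "?g ` ?V = (\<Union>i<s + t. ?f i)" unfolding less.prems(2) by auto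
        moreover have "?g ` ?V = ?V - {v}"
        proof
          show "?g ` ?V \<subseteq> ?V - {v}"
            using av(4) ugraphD(6)[OF ug av(1)] by (auto simp: cmap_def)
          show "?V - {v} \<subseteq> ?g ` ?V"
          proof
            fix x assume "x \<in> ?V - {v}"
            then have "x = ?g x" "x \<in> ?V" by (auto simp: cmap_def)
            then show "x \<in> ?g ` ?V" by (rule image_eqI)
          qed
        qed
        ultimately show ?thesis unfolding contract_edge_simps by simp
      qed
      show "model (pverts ?G) (parcs ?G) {..<s + t} (bip s t) ?f"
        unfolding contract_edge_simps
      proof (rule modelI, goal_cases)
        case (1 j)
        then show ?case using conn_contr[OF mc[of j]] by simp
      next
        case (2 j)
        then have j: "j < s + t" by simp
        show ?case
        proof (cases "j = i")
          case True
          then show ?thesis using fj[OF j] mV[OF j] by auto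
        next
          case False
          then show ?thesis using fj[OF j] mV[OF j] md[OF j i(1) False] av(3) by auto
        qed
      next
        case (3 j k)
        then show ?case using md[of j k] fj[of j] fj[of k] by (simp, blast)
      next
        case (4 j k)
        then obtain x y where "x \<in> f j" "y \<in> f k" "(x, y) \<in> ?E" using me[of j k] by auto
        moreover have "?g x \<noteq> ?g y"
        proof
          assume "?g x = ?g y"
          moreover have "?g x \<in> ?f j" "?g y \<in> ?f k" using \<open>x \<in> f j\<close> \<open>y \<in> f k\<close> by auto
          moreover have "?f j \<inter> ?f k = {}" using md[of j k] fj[of j] fj[of k] 4 by (simp, blast)
          ultimately show False by auto
        qed
        ultimately have "?g x \<in> ?f j" "?g y \<in> ?f k" "(?g x, ?g y) \<in> contr ?E a v"
          by (auto simp: contr_def)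
        then show ?case by blast
      qed
      fix x y assume "(x, y) \<in> parcs ?G"
      then obtain x' y' where "(x', y') \<in> ?E" "x = ?g x'" "y = ?g y'"
        unfolding contract_edge_simps contr_def by auto
      then show "\<exists>i j. i < s + t \<and> j < s + t \<and> x \<in> ?f i \<and> y \<in> ?f j \<and>
        (i = j \<or> i < s \<and> s \<le> j \<or> j < s \<and> s \<le> i)"
        using less.prems(4)[of x' y'] by blast
    qed
    moreover have "contraction_step G ?G" unfolding contraction_step_def using av by blast
    ultimately show ?thesis by (meson converse_rtranclp_into_rtranclp)
  qed
qed

lemma digraph_iso_refl: "wf_digraph G \<Longrightarrow> digraph_iso G G"
  unfolding digraph_iso_def
  by (rule exI[of _ "\<lparr>iso_verts = id, iso_arcs = id, iso_head = head G, iso_tail = tail G\<rparr>"])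
    (auto simp: pre_digraph.digraph_isomorphism_def app_iso_def)

text \<open>All deletions are made first: \<open>G'\<close> keeps the branch sets, the arcs inside
  them and the arcs between the two sides. After that \<open>contract_model\<close> applies.\<close>

lemma model_imp_minor:
  fixes G :: "nat pair_pre_digraph"
  assumes "pair_graph G" "model (pverts G) (parcs G) {..<s + t} (bip s t) f"
  shows "\<exists>H :: nat pair_pre_digraph. K\<^bsub>s,t\<^esub> (with_proj H) \<and> is_minor H G"
proof -
  let ?E = "parcs G"
  have ug: "ugraph (pverts G) ?E" using assms(1) pair_graph_iff_ugraph by blast
  define G' where "G' = \<lparr>pverts = (\<Union>i<s + t. f i),
     parcs = {(x, y) \<in> ?E. \<exists>i j. i < s + t \<and> j < s + t \<and> x \<in> f i \<and> y \<in> f j \<and>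
        (i = j \<or> i < s \<and> s \<le> j \<or> j < s \<and> s \<le> i)}\<rparr>"
  have sub: "pverts G' \<subseteq> pverts G" "parcs G' \<subseteq> ?E"
    using modelD(2)[OF assms(2)] by (auto simp: G'_def)
  have pg: "pair_graph G'"
    unfolding pair_graph_iff_ugraph ugraph_def sym_def irrefl_def
    using ugraphD[OF ug] sub finite_subset[OF sub(1)]
    by (auto simp: G'_def)
  have "model (pverts G') (parcs G') {..<s + t} (bip s t) f"
  proof (rule modelI, goal_cases)
    case (1 i)
    then show ?case
      by (intro conn_mono[OF modelD(1)[OF assms(2)]]) (auto simp: G'_def)
  next
    case (2 i)
    then show ?case by (auto simp: G'_def)
  next
    case (3 i j)
    then show ?case using modelD(3)[OF assms(2)] by blast
  next
    case (4 i j)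
    then have p: "i < s" "s \<le> j" "j < s + t" by auto
    obtain u v where "u \<in> f i" "v \<in> f j" "(u, v) \<in> ?E"
      using modelD(4)[OF assms(2) 4] by blast
    then have "(u, v) \<in> parcs G'"
      using p unfolding G'_def by (simp, intro exI[of _ i] exI[of _ j]) auto
    then show ?case using \<open>u \<in> f i\<close> \<open>v \<in> f j\<close> by blast
  qed
  moreover have "pverts G' = (\<Union>i<s + t. f i)" by (simp add: G'_def)
  moreover have "\<exists>i j. i < s + t \<and> j < s + t \<and> x \<in> f i \<and> y \<in> f j \<and>
        (i = j \<or> i < s \<and> s \<le> j \<or> j < s \<and> s \<le> i)" if "(x, y) \<in> parcs G'" for x y
    using that by (simp add: G'_def)
  ultimately obtain M where M: "contraction_step\<^sup>*\<^sup>* G' M" "K\<^bsub>s,t\<^esub> (with_proj M)"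
    using contract_model[OF pg, where f = f and s = s and t = t] by blast
  have "wf_digraph (with_proj M)" "wf_digraph (with_proj G)" "wf_digraph (with_proj G')"
    using M(2) assms(1) pg
    by (auto simp: wf_digraph_wp_iff pair_graphI_complete_bipartite pair_graph_def pair_digraph_def pair_fin_digraph_def
        dest!: pair_graphI_complete_bipartite)
  then have "subgraph (with_proj G') (with_proj G)" "digraph_iso (with_proj M) (with_proj M)"
    using sub by (auto simp: subgraph_def compatible_def digraph_iso_refl)
  then show ?thesis unfolding is_minor_def using M pg by blast
qed

text \<open>In the fully contracted graph the branch sets are singletons, read off from the
  isomorphism. Undoing a contraction replaces branch sets by preimages, and passing from the
  subgraph to the whole graph keeps them.\<close>

lemma minor_imp_model:
  assumes "pair_graph G" "K\<^bsub>s,t\<^esub> (with_proj H)" "is_minor H G"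
  shows "\<exists>f. model (pverts G) (parcs G) {..<s + t} (bip s t) f"
proof -
  obtain G' M where G': "pair_graph G'" "subgraph (with_proj G') (with_proj G)"
    "contraction_step\<^sup>*\<^sup>* G' M" "digraph_iso (with_proj M) (with_proj H)"
    using assms(3) unfolding is_minor_def by blast
  obtain U W where UW: "pverts H = U \<union> W" "U \<inter> W = {}" "card U = s" "card W = t" 
    "parcs H = U \<times> W \<union> W \<times> U" "finite U" "finite W"
    using assms(2) unfolding complete_bipartite_digraph_pair_def by auto
  obtain h where h: "pre_digraph.digraph_isomorphism (with_proj M) h"
    "with_proj H = app_iso h (with_proj M)" using G'(4) unfolding digraph_iso_def by blast
  obtain bu where bu: "bij_betw bu {..<s} U"
    using UW by (metis bij_betw_from_nat_into_finite atLeast0LessThan finite_same_card_bij finite_lessThan card_lessThan)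
  obtain bw where bw: "bij_betw bw {..<t} W"
    using UW by (metis finite_same_card_bij finite_lessThan card_lessThan)
  define b where "b i = (if i < s then bu i else bw (i - s))" for i
  have bU: "b i \<in> U" if "i < s" for i using that bu by (auto simp: b_def bij_betw_def)
  have bW: "b i \<in> W" if "s \<le> i" "i < s + t" for i using that bw by (auto simp: b_def bij_betw_def)
  have binj: "i = j" if "b i = b j" "i < s + t" "j < s + t" for i j
  proof (cases "i < s"; cases "j < s")
    assume "i < s" "j < s"
    then show ?thesis using that bu by (auto simp: b_def bij_betw_def inj_on_def)
  next
    assume "\<not> i < s" "\<not> j < s"
    then have "i - s = j - s" using that bw by (auto simp: b_def bij_betw_def inj_on_def)
    then show ?thesis using \<open>\<not> i < s\<close> \<open>\<not> j < s\<close> by auto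
  next
    assume "i < s" "\<not> j < s"
    then show ?thesis using bU[of i] bW[of j] that UW(2) by auto
  next
    assume "\<not> i < s" "j < s"
    then show ?thesis using bU[of j] bW[of i] that UW(2) by auto
  qed
  have V: "iso_verts h ` pverts M = pverts H" "inj_on (iso_verts h) (pverts M)"
    using h by (auto simp: pre_digraph.digraph_isomorphism_def with_proj_def app_iso_def)
  have E: "\<exists>u v. (u, v) \<in> parcs M \<and> iso_verts h u = x \<and> iso_verts h v = y" if "(x, y) \<in> parcs H" for x y
  proof -
    have "parcs H = iso_arcs h ` parcs M" "iso_tail h = fst" "iso_head h = snd"
      using h(2) by (auto simp: with_proj_def app_iso_def)
    then obtain u v where "(u, v) \<in> parcs M" "iso_arcs h (u, v) = (x, y)"
      using \<open>(x, y) \<in> parcs H\<close> by auto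
    moreover have "iso_verts h u = iso_tail h (iso_arcs h (u, v))"
      "iso_verts h v = iso_head h (iso_arcs h (u, v))"
      using h(1) calculation(1) unfolding pre_digraph.digraph_isomorphism_def by auto
    ultimately show ?thesis using \<open>iso_tail h = fst\<close> \<open>iso_head h = snd\<close> by auto
  qed
  have MV: "(u, v) \<in> parcs M \<Longrightarrow> u \<in> pverts M \<and> v \<in> pverts M" for u v
    using h(1) unfolding pre_digraph.digraph_isomorphism_def wf_digraph_def by auto
  define iv where "iv = the_inv_into (pverts M) (iso_verts h)"
  have iv: "iv (iso_verts h u) = u" if "u \<in> pverts M" for u
    unfolding iv_def using V that by (simp add: the_inv_into_f_f)
  have bV: "b i \<in> pverts H" if "i < s + t" for i using bU bW UW(1) that by (metis UnI1 UnI2 not_le)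
  have "model (pverts M) (parcs M) {..<s + t} (bip s t) (\<lambda>i. {iv (b i)})"
  proof (rule modelI, goal_cases)
    case (1 i)
    then show ?case by (rule_tac conn_singleton)
  next
    case (2 i)
    then have "b i \<in> iso_verts h ` pverts M" using V bV by auto
    then show ?case using iv by auto
  next
    case (3 i j)
    then have "b i \<in> iso_verts h ` pverts M" "b j \<in> iso_verts h ` pverts M" using V bV by auto
    then have "iv (b i) = iv (b j) \<Longrightarrow> b i = b j" using iv by auto
    then show ?case using binj 3 by auto
  next
    case (4 i j)
    then have p: "i < s" "s \<le> j" "j < s + t" by auto
    then have "(b i, b j) \<in> parcs H" using bU bW UW by auto
    then obtain u v where uv: "(u, v) \<in> parcs M" "iso_verts h u = b i" "iso_verts h v = b j" using E by blast
    then have "iv (b i) = u" "iv (b j) = v" using iv MV by metis+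
    then show ?case using p uv by auto
  qed
  then have "\<exists>f. model (pverts M) (parcs M) {..<s + t} (bip s t) f" by blast
  \<comment> \<open>The induction runs backwards along the contraction sequence, from
    \<open>M\<close> to \<open>G'\<close>.\<close>
  with G'(3,1) have "\<exists>f. model (pverts G') (parcs G') {..<s + t} (bip s t) f"
  proof (induction rule: converse_rtranclp_induct)
    case (step G1 G2)
    then obtain u v where uv: "(u, v) \<in> parcs G1" "G2 = contract_edge G1 u v"
      unfolding contraction_step_def by blast
    have ug: "ugraph (pverts G1) (parcs G1)" using step pair_graph_iff_ugraph by blast
    have "pair_graph G2" unfolding pair_graph_iff_ugraph uv contract_edge_simps
      by (rule ugraph_contr[OF ug uv(1)])
    with step obtain f where "model (pverts G2) (parcs G2) {..<s + t} (bip s t) f" by auto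
    then show ?case using model_contr[OF ug uv(1)] unfolding uv contract_edge_simps by blast
  qed
  then obtain f where f: "model (pverts G') (parcs G') {..<s + t} (bip s t) f" by blast
  have "pverts G' \<subseteq> pverts G" "parcs G' \<subseteq> parcs G" using G'(2) by (auto simp: subgraph_def)
  then show ?thesis using model_mono[OF f] by blast
qed

definition Kst_free :: "nat \<Rightarrow> nat \<Rightarrow> nat set \<Rightarrow> (nat \<times> nat) set \<Rightarrow> bool" where
  "Kst_free s t V E \<longleftrightarrow> \<not> (\<exists>f. model V E {..<s + t} (bip s t) f)"

lemma Kst_minor_free_graphs_iff:
  "G \<in> Kst_minor_free_graphs s t n \<longleftrightarrow>
     pverts G = {..<n} \<and> ugraph {..<n} (parcs G) \<and> Kst_free s t {..<n} (parcs G)"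
  unfolding Kst_minor_free_graphs_def graphs_on_def Kst_free_def
  using minor_imp_model[of G s t] model_imp_minor[of G s t] pair_graph_iff_ugraph[of G]
  by (auto; blast)

section \<open>Sparsity of minor-free graphs\<close>

lemma card_arcs_restrict:
  assumes "finite E" "finite N"
  shows "card (E \<inter> N \<times> N) = (\<Sum>w\<in>N. card (E `` {w} \<inter> N))"
proof -
  have "E \<inter> N \<times> N = Sigma N (\<lambda>w. E `` {w} \<inter> N)" by auto
  then show ?thesis using assms by (simp add: finite_Image)
qed

text \<open>Contraction destroys the edge \<open>uv\<close> and merges two edges into one for every
  common neighbour. Arcs are counted here, hence the factors two.\<close>

lemma card_contr:
  assumes ug: "ugraph V E" and uv: "(u, v) \<in> E"
  shows "card E \<le> card (contr E u v) + 2 + 2 * card (E `` {u} \<inter> E `` {v})"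
proof -
  define P where "P = {(x, y) \<in> E. x \<noteq> v \<and> y \<noteq> v}"
  define Q where "Q = E `` {v} - E `` {u} - {u}"
  note ug' = ugraphD[OF ug]
  have fE: "finite E" "finite (E `` {v})" using ug' by auto
  have "u \<noteq> v" using uv ug' by auto
  have cE: "card E = card P + 2 * card (E `` {v})"
  proof -
    have "E = P \<union> ({v} \<times> E `` {v} \<union> E `` {v} \<times> {v})" using ug' by (auto simp: P_def)
    moreover have "P \<inter> ({v} \<times> E `` {v} \<union> E `` {v} \<times> {v}) = {}" by (auto simp: P_def)
    moreover have "{v} \<times> E `` {v} \<inter> E `` {v} \<times> {v} = {}" using ug' by auto
    moreover have "finite P" using fE by (auto simp: P_def intro: finite_subset)
    ultimately have "card E = card P + (card ({v} \<times> E `` {v}) + card (E `` {v} \<times> {v}))"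
      using fE by (metis card_Un_disjoint finite.emptyI finite.insertI finite_UnI finite_cartesian_product)
    then show ?thesis by (simp add: card_cartesian_product)
  qed
  have "P \<union> ({u} \<times> Q \<union> Q \<times> {u}) \<subseteq> contr E u v"
  proof -
    have "(x, y) \<in> contr E u v" if "(x, y) \<in> P" for x y
    proof -
      have "x \<noteq> y" using that ug' by (auto simp: P_def)
      then have "(x, y) \<in> E" "cmap u v x = x" "cmap u v y = y" "x \<noteq> y"
        using that by (auto simp: P_def cmap_def)
      then show ?thesis unfolding contr_def by (metis (mono_tags, lifting) mem_Collect_eq)
    qed
    moreover have "(u, w) \<in> contr E u v" "(w, u) \<in> contr E u v" if "w \<in> Q" for w
    proof -
      have w: "(v, w) \<in> E" "(w, v) \<in> E" "w \<noteq> u" "w \<noteq> v" using that ug' by (auto simp: Q_def)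
      then have c: "cmap u v v = u" "cmap u v w = w" by (auto simp: cmap_def)
      show "(u, w) \<in> contr E u v" "(w, u) \<in> contr E u v"
        using w c unfolding contr_def by (metis (mono_tags, lifting) mem_Collect_eq)+
    qed
    ultimately show ?thesis by auto
  qed
  moreover have "finite (contr E u v)"
    using ugraph_contr[OF ug uv] ugraphD(2) by blast
  ultimately have "card (P \<union> ({u} \<times> Q \<union> Q \<times> {u})) \<le> card (contr E u v)" by (rule card_mono[rotated])
  moreover have "card (P \<union> ({u} \<times> Q \<union> Q \<times> {u})) = card P + 2 * card Q"
  proof -
    have f: "finite P" "finite Q" using fE by (auto simp: P_def Q_def intro: finite_subset)
    have "card ({u} \<times> Q \<union> Q \<times> {u}) = 2 * card Q"
      by (subst card_Un_disjoint) (use f in \<open>auto simp: Q_def card_cartesian_product\<close>)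
    moreover have "P \<inter> ({u} \<times> Q \<union> Q \<times> {u}) = {}" using ug'(4) by (auto simp: P_def Q_def)
    ultimately show ?thesis using f by (subst card_Un_disjoint) auto
  qed
  moreover have "card (E `` {v}) \<le> card Q + card (E `` {u} \<inter> E `` {v}) + 1"
  proof -
    have "E `` {v} \<subseteq> (Q \<union> (E `` {u} \<inter> E `` {v})) \<union> {u}" by (auto simp: Q_def)
    then have "card (E `` {v}) \<le> card ((Q \<union> (E `` {u} \<inter> E `` {v})) \<union> {u})"
      using fE by (intro card_mono) (auto simp: Q_def)
    also have "\<dots> \<le> card (Q \<union> (E `` {u} \<inter> E `` {v})) + card {u}" by (rule card_Un_le)
    also have "card (Q \<union> (E `` {u} \<inter> E `` {v})) \<le> card Q + card (E `` {u} \<inter> E `` {v})" by (rule card_Un_le)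
    finally show ?thesis by simp
  qed
  ultimately show ?thesis using cE by linarith
qed

text \<open>Mader's argument: contract edges lying in few triangles; when none is left, every
  neighbourhood is dense enough to contain a clique minor of order one less.\<close>

lemma clique_model:
  "\<exists>c::nat. \<forall>(V::'a set) E. ugraph V E \<longrightarrow> c * card V < card E \<longrightarrow>
     (\<exists>f::nat \<Rightarrow> 'a set. model V E {..<p} {(i, j). i < p \<and> j < p \<and> i \<noteq> j} f)"
proof (induction p)
  case 0
  show ?case by (auto simp: model_def)
next
  case (Suc p)
  then obtain c :: nat where c: "\<And>(V::'a set) E. ugraph V E \<Longrightarrow> c * card V < card E \<Longrightarrow>
     (\<exists>f::nat \<Rightarrow> 'a set. model V E {..<p} {(i, j). i < p \<and> j < p \<and> i \<noteq> j} f)" by blast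
  let ?K = "{(i, j). i < Suc p \<and> j < Suc p \<and> i \<noteq> j}"
  \<comment> \<open>The factor \<open>2 * c + 2\<close> is the loss in \<open>card_contr\<close> for
    an edge with at most \<open>c\<close> common neighbours. Such a contraction also removes one
    vertex, so the density hypothesis survives it.\<close>
  have "\<exists>f::nat \<Rightarrow> 'a set. model V E {..<Suc p} ?K f"
    if "ugraph V E" "(2 * c + 2) * card V < card E" for V :: "'a set" and E
    using that
  proof (induction "card V" arbitrary: V E rule: less_induct)
    case less
    note ug' = ugraphD[OF less.prems(1)]
    show ?case
    proof (cases "\<exists>u v. (u, v) \<in> E \<and> card (E `` {u} \<inter> E `` {v}) \<le> c")
      case True
      then obtain u v where uv: "(u, v) \<in> E" "card (E `` {u} \<inter> E `` {v}) \<le> c" by blast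
      have v: "v \<in> V" using uv ug' by auto
      then have cV: "card V = card (V - {v}) + 1" using ug'(1)
        by (metis Suc_eq_plus1 card_Suc_Diff1)
      have "(2 * c + 2) * card (V - {v}) < card (contr E u v)"
        using card_contr[OF less.prems(1) uv(1)] less.prems(2) uv(2) unfolding cV by simp
      then obtain f :: "nat \<Rightarrow> 'a set" where "model (V - {v}) (contr E u v) {..<Suc p} ?K f"
        using less.hyps[OF _ ugraph_contr[OF less.prems(1) uv(1)]] cV by auto
      from model_contr[OF less.prems(1) uv(1) this] show ?thesis by blast
    next
      case False
      have "E \<noteq> {}" using less.prems(2) by auto
      then obtain v w0 where v: "(v, w0) \<in> E" by (metis prod.exhaust equals0I)
      \<comment> \<open>Every edge at \<open>v\<close> now lies in more than \<open>c\<close>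
        triangles, so all degrees inside \<open>N\<close> exceed \<open>c\<close>. A clique minor of
        order \<open>p\<close> in \<open>N\<close> is completed by the branch set
        \<open>{v}\<close>, which sees all of \<open>N\<close>.\<close>
      define N where "N = E `` {v}"
      have fN: "finite N" "N \<noteq> {}" "N \<subseteq> V" "v \<notin> N" using ug' v by (auto simp: N_def)
      have ugN: "ugraph N (E \<inter> N \<times> N)"
        using fN ug' by (auto simp: ugraph_def sym_def irrefl_def)
      have "c * card N < card (E \<inter> N \<times> N)"
      proof -
        have "c * card N < (c + 1) * card N" using fN by (simp add: card_gt_0_iff)
        also have "\<dots> = (\<Sum>w\<in>N. c + 1)" by simp
        also have "\<dots> \<le> (\<Sum>w\<in>N. card (E `` {w} \<inter> N))"
        proof (rule sum_mono)
          fix w assume "w \<in> N"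
          then have "(v, w) \<in> E" by (simp add: N_def)
          then have "c < card (E `` {v} \<inter> E `` {w})" using False not_le by blast
          then show "c + 1 \<le> card (E `` {w} \<inter> N)" by (simp add: N_def Int_commute)
        qed
        finally show ?thesis using card_arcs_restrict[OF ug'(2) fN(1)] by simp
      qed
      then obtain f :: "nat \<Rightarrow> 'a set" where f:
        "model N (E \<inter> N \<times> N) {..<p} {(i, j). i < p \<and> j < p \<and> i \<noteq> j} f"
        using c[OF ugN] by blast
      have fE: "conn E (f i)" "f i \<subseteq> N" if "i < p" for i
        using modelD(1,2)[OF f] that conn_mono[of "E \<inter> N \<times> N" "f i" E] by auto
      have ne: "\<exists>w\<in>f i. (v, w) \<in> E \<and> (w, v) \<in> E" if i: "i < p" for i
      proof -
        obtain w where w: "w \<in> f i" using fE(1)[OF i] by (auto simp: conn_def)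
        then have "(v, w) \<in> E" using fE(2)[OF i] by (auto simp: N_def)
        then show ?thesis using w ug'(4) by blast
      qed
      have "model V E {..<Suc p} ?K (f(p := {v}))"
      proof (rule modelI, goal_cases)
        case (1 i)
        then show ?case using fE(1)[of i] conn_singleton[of E v] by auto
      next
        case (2 i)
        then show ?case using fE(2)[of i] fN(3) ug'(6)[OF v] by (cases "i = p") auto
      next
        case (3 i j)
        then show ?case using fE(2)[of i] fE(2)[of j] fN(4) modelD(3)[OF f, of i j] by auto
      next
        case (4 i j)
        then consider "i < p" "j < p" "i \<noteq> j" | "i = p" "j < p" | "i < p" "j = p" by fastforce
        then show ?case
        proof cases
          case 1
          then show ?thesis using modelD(4)[OF f, of i j] by auto
        qed (use ne in auto)
      qed
      then show ?thesis by blast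
    qed
  qed
  then show ?case by blast
qed

text \<open>A clique minor of order \<open>s + t\<close> contains the complete bipartite one. The
  bound covers every \<open>W\<close> because an orientation with small out-degrees needs all
  induced subgraphs to be sparse.\<close>

lemma Kst_free_sparse:
  "\<exists>c::nat. \<forall>V E W. Kst_free s t V E \<longrightarrow> ugraph V E \<longrightarrow> W \<subseteq> V \<longrightarrow> card (E \<inter> W \<times> W) \<le> c * card W"
proof -
  obtain c :: nat where c: "\<And>(V::nat set) E. ugraph V E \<Longrightarrow> c * card V < card E \<Longrightarrow>
     (\<exists>f::nat \<Rightarrow> nat set. model V E {..<s+t} {(i, j). i < s+t \<and> j < s+t \<and> i \<noteq> j} f)"
    using clique_model[where 'a = nat and p = "s + t"] by blast
  have "card (E \<inter> W \<times> W) \<le> c * card W" if "Kst_free s t V E" "ugraph V E" "W \<subseteq> V" for V E W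
  proof (rule ccontr)
    assume "\<not> ?thesis"
    moreover have "ugraph W (E \<inter> W \<times> W)"
      using ugraphD[OF that(2)] finite_subset[OF that(3)] by (auto simp: ugraph_def sym_def irrefl_def)
    ultimately obtain f where f: "model W (E \<inter> W \<times> W) {..<s+t} {(i, j). i < s+t \<and> j < s+t \<and> i \<noteq> j} f"
      using c by (meson not_le)
    have "model V E {..<s+t} (bip s t) f" by (rule model_mono[OF f]) (use that(3) in auto)
    then show False using that(1) by (auto simp: Kst_free_def)
  qed
  then show ?thesis by blast
qed

text \<open>The average degree in every induced subgraph is at most \<open>c\<close>, so some vertex
  has degree at most \<open>c\<close>. Orient its edges away from it, remove it and repeat.\<close>

lemma orientation:
  assumes "ugraph V E" "\<And>W. W \<subseteq> V \<Longrightarrow> card (E \<inter> W \<times> W) \<le> c * card W"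
  shows "\<exists>F. E = F \<union> F\<inverse> \<and> (\<forall>v. card (F `` {v}) \<le> c)"
  using assms
proof (induction "card V" arbitrary: V E)
  case 0
  then have "V = {}" "E \<subseteq> V \<times> V" by (auto simp: ugraph_def)
  then have "E = {}" by auto
  then show ?case by (intro exI[of _ "{}"]) auto
next
  case (Suc m)
  note ug' = ugraphD[OF Suc.prems(1)]
  have ex: "\<exists>v\<in>V. card (E `` {v}) \<le> c"
  proof (rule ccontr)
    assume *: "\<not> ?thesis"
    have "V \<noteq> {}" using Suc.hyps(2) by auto
    have "c * card V < (c + 1) * card V" using Suc.hyps(2)[symmetric] by simp
    also have "\<dots> = (\<Sum>w\<in>V. c + 1)" by simp
    also have "\<dots> \<le> (\<Sum>w\<in>V. card (E `` {w} \<inter> V))"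
    proof (rule sum_mono)
      fix w assume "w \<in> V"
      moreover have "E `` {w} \<inter> V = E `` {w}" using ug' by auto
      ultimately show "c + 1 \<le> card (E `` {w} \<inter> V)" using * by force
    qed
    also have "\<dots> = card (E \<inter> V \<times> V)" using card_arcs_restrict[OF ug'(2,1)] by simp
    finally show False using Suc.prems(2)[of V] by simp
  qed
  then obtain v where v: "v \<in> V" "card (E `` {v}) \<le> c" by blast
  define W where "W = V - {v}"
  have W: "W \<subseteq> V" "v \<notin> W" "finite W" "card W = m" using v Suc.hyps(2) ug' by (auto simp: W_def)
  have "ugraph W (E \<inter> W \<times> W)" using ug' W by (auto simp: ugraph_def sym_def irrefl_def)
  moreover have "card (E \<inter> W \<times> W \<inter> U \<times> U) \<le> c * card U" if "U \<subseteq> W" for U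
  proof -
    have "E \<inter> W \<times> W \<inter> U \<times> U = E \<inter> U \<times> U" using that by auto
    then show ?thesis using Suc.prems(2)[of U] that W by auto
  qed
  ultimately obtain F where F: "E \<inter> W \<times> W = F \<union> F\<inverse>" "\<And>v. card (F `` {v}) \<le> c"
    using Suc.hyps(1)[of W "E \<inter> W \<times> W"] W(4) by blast
  define F' where "F' = F \<union> {v} \<times> E `` {v}"
  have FW: "F \<subseteq> W \<times> W" using F(1) by auto
  have "E = F' \<union> F'\<inverse>"
  proof -
    have "E = (E \<inter> W \<times> W) \<union> {v} \<times> E `` {v} \<union> E `` {v} \<times> {v}" using ug' by (auto simp: W_def)
    then show ?thesis unfolding F(1) F'_def by auto
  qed
  moreover have "card (F' `` {x}) \<le> c" for x
  proof (cases "x = v")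
    case True
    then have "F' `` {x} = E `` {v}" using FW W by (auto simp: F'_def)
    then show ?thesis using v by simp
  next
    case False
    then have "F' `` {x} = F `` {x}" by (auto simp: F'_def)
    then show ?thesis using F by simp
  qed
  ultimately show ?case by blast
qed

section \<open>Adjacency operator and its quadratic form\<close>

definition ad :: "('a \<times> 'a) set \<Rightarrow> ('a \<Rightarrow> real) \<Rightarrow> 'a \<Rightarrow> real" where
  "ad E x v = (\<Sum>w\<in>E `` {v}. x w)"

text \<open>For a symmetric relation each edge enters through both of its arcs, so this is the
  quadratic form of the adjacency matrix without a factor two.\<close>

definition qf :: "('a \<times> 'a) set \<Rightarrow> ('a \<Rightarrow> real) \<Rightarrow> real" where
  "qf E x = (\<Sum>(u, v)\<in>E. x u * x v)"

abbreviation nrm2 :: "'a set \<Rightarrow> ('a \<Rightarrow> real) \<Rightarrow> real" where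
  "nrm2 V x \<equiv> (\<Sum>v\<in>V. (x v)\<^sup>2)"

lemma qf_ad:
  assumes "finite V" "E \<subseteq> V \<times> V"
  shows "qf E x = (\<Sum>v\<in>V. x v * ad E x v)"
proof -
  have "E = Sigma V (\<lambda>v. E `` {v})" using assms by auto
  moreover have "finite (E `` {v})" for v using assms by (meson finite_Image finite_SigmaI finite_subset)
  ultimately have "qf E x = (\<Sum>v\<in>V. \<Sum>w\<in>E `` {v}. x v * x w)"
    unfolding qf_def using assms(1) by (metis (no_types, lifting) sum.Sigma sum.cong)
  then show ?thesis by (simp add: ad_def sum_distrib_left)
qed

lemma ad_eq_indicator:
  assumes "finite V" "E \<subseteq> V \<times> V"
  shows "ad E x v = (\<Sum>w\<in>V. (if (v, w) \<in> E then 1 else 0) * x w)"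
proof -
  have "E `` {v} = {w \<in> V. (v, w) \<in> E}" using assms by auto
  then show ?thesis unfolding ad_def using assms(1)
    by (simp add: sum.inter_filter[symmetric] if_distrib[of "\<lambda>a. a * _"] cong: if_cong)
qed

section \<open>Extremal eigenvalues\<close>

text \<open>Vectors are functions on the whole type, so compactness is meant in the product
  topology. Being zero outside \<open>V\<close> turns the sphere into a closed subset of a product
  of compact sets.\<close>

lemma compact_sphere_fun:
  assumes "finite V"
  shows "compact {x :: 'a \<Rightarrow> real. (\<forall>v. v \<notin> V \<longrightarrow> x v = 0) \<and> nrm2 V x = 1}" (is "compact ?S")
proof -
  define B :: "'a \<Rightarrow> real set" where "B v = (if v \<in> V then {-1..1} else {0})" for v
  have "compactin (product_topology (\<lambda>i::'a. euclidean :: real topology) UNIV) (PiE UNIV B)"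
    by (subst compactin_PiE) (auto simp: B_def)
  then have "compact (PiE UNIV B)" by (simp add: euclidean_product_topology)
  moreover have "closed {x :: 'a \<Rightarrow> real. nrm2 V x = 1}"
    by (intro closed_Collect_eq continuous_intros continuous_on_product_coordinates)
  ultimately have "compact (PiE UNIV B \<inter> {x. nrm2 V x = 1})" by (rule compact_Int_closed)
  also have "PiE UNIV B \<inter> {x. nrm2 V x = 1} = ?S"
  proof
    show "PiE UNIV B \<inter> {x. nrm2 V x = 1} \<subseteq> ?S"
      by (auto simp: B_def PiE_def Pi_def split: if_splits)
    show "?S \<subseteq> PiE UNIV B \<inter> {x. nrm2 V x = 1}"
    proof
      fix x assume x: "x \<in> ?S"
      have "\<bar>x v\<bar> \<le> 1" if "v \<in> V" for v
      proof -
        have "(x v)\<^sup>2 \<le> nrm2 V x" using that assms by (intro member_le_sum) auto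
        then show ?thesis using x by (simp add: abs_square_le_1)
      qed
      then show "x \<in> PiE UNIV B \<inter> {x. nrm2 V x = 1}" using x by (auto simp: B_def abs_le_iff)
    qed
  qed
  finally show ?thesis .
qed

text \<open>The maximum of the Rayleigh quotient is attained by compactness, and the first order
  condition at a maximiser is the eigenvalue equation.\<close>

lemma rayleigh_max:
  fixes a :: "'a \<Rightarrow> 'a \<Rightarrow> real"
  assumes "finite V" "V \<noteq> {}" and sym: "\<And>u v. a u v = a v u"
  shows "\<exists>p x. nrm2 V x = 1 \<and> (\<forall>u\<in>V. (\<Sum>v\<in>V. a u v * x v) = p * x u) \<and>
    (\<forall>y. (\<Sum>u\<in>V. y u * (\<Sum>v\<in>V. a u v * y v)) \<le> p * nrm2 V y)"
proof -
  define q where "q x = (\<Sum>u\<in>V. x u * (\<Sum>v\<in>V. a u v * x v))" for x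
  let ?S = "{x :: 'a \<Rightarrow> real. (\<forall>v. v \<notin> V \<longrightarrow> x v = 0) \<and> nrm2 V x = 1}"
  have "?S \<noteq> {}"
  proof -
    obtain v where "v \<in> V" using assms(2) by auto
    define e :: "'a \<Rightarrow> real" where "e u = (if u = v then 1 else 0)" for u
    have "nrm2 V e = (\<Sum>u\<in>V. if u = v then 1 else 0)"
      by (rule sum.cong) (simp_all add: e_def)
    also have "\<dots> = 1" using assms(1) \<open>v \<in> V\<close> by simp
    finally have "e \<in> ?S" using \<open>v \<in> V\<close> by (auto simp: e_def)
    then show ?thesis by blast
  qed
  moreover have "continuous_on UNIV q"
    unfolding q_def by (intro continuous_intros continuous_on_product_coordinates)
  then have "continuous_on ?S q" by (rule continuous_on_subset) simp
  ultimately have "\<exists>x\<in>?S. \<forall>y\<in>?S. q y \<le> q x"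
    by (intro continuous_attains_sup compact_sphere_fun assms(1))
  then obtain x where x: "x \<in> ?S" "\<And>y. y \<in> ?S \<Longrightarrow> q y \<le> q x" by blast
  define p where "p = q x"
  have le: "q y \<le> p * nrm2 V y" for y
  proof (cases "nrm2 V y = 0")
    case True
    then have "y v = 0" if "v \<in> V" for v using that assms(1) by (simp add: sum_nonneg_eq_0_iff)
    then have "q y = 0" by (simp add: q_def)
    then show ?thesis using True by simp
  next
    case False
    define N where "N = sqrt (nrm2 V y)"
    have N: "N\<^sup>2 = nrm2 V y" "N > 0" using False
      by (simp_all add: N_def sum_nonneg less_le)
    define z where "z v = (if v \<in> V then y v / N else 0)" for v
    have "nrm2 V z = nrm2 V y / N\<^sup>2"
      by (simp add: z_def power_divide sum_divide_distrib)
    then have "z \<in> ?S" using N False by (simp add: z_def)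
    then have "q z \<le> p" using x(2) p_def by blast
    moreover have "q z = q y / N\<^sup>2"
      unfolding q_def z_def by (simp add: sum_divide_distrib sum_distrib_left power2_eq_square)
    ultimately have "q y / N\<^sup>2 \<le> p" by simp
    moreover have "N\<^sup>2 > 0" using N(2) by simp
    ultimately show ?thesis unfolding N(1)[symmetric] by (simp add: divide_le_eq)
  qed
  have eig: "(\<Sum>v\<in>V. a u v * x v) = p * x u" if u: "u \<in> V" for u
  proof (rule ccontr)
    define g where "g = (\<Sum>v\<in>V. a u v * x v) - p * x u"
    assume "\<not> ?thesis"
    then have g: "g \<noteq> 0" by (simp add: g_def)
    define h where "h = a u u - p"
    \<comment> \<open>Maximality is tested against moving the single coordinate \<open>u\<close> by
      \<open>e\<close>; \<open>g\<close> is the residual of the eigenvalue equation at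
      \<open>u\<close>.\<close>
    have main: "2 * e * g + e\<^sup>2 * h \<le> 0" for e :: real
    proof -
      define y where "y v = x v + (if v = u then e else 0)" for v
      have ay: "(\<Sum>v\<in>V. a w v * y v) = (\<Sum>v\<in>V. a w v * x v) + a w u * e" for w
        using u assms(1) by (simp add: y_def algebra_simps sum.distrib if_distrib[of "\<lambda>b. _ * b"] cong: if_cong)
      have "q y = (\<Sum>w\<in>V. x w * ((\<Sum>v\<in>V. a w v * x v) + a w u * e)) + e * ((\<Sum>v\<in>V. a u v * x v) + a u u * e)"
        unfolding q_def ay using u assms(1)
        by (simp add: y_def distrib_right sum.distrib if_distrib[of "\<lambda>b. b * _"] cong: if_cong)
      also have "\<dots> = q x + 2 * e * (\<Sum>v\<in>V. a u v * x v) + a u u * e\<^sup>2"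
      proof -
        have "(\<Sum>w\<in>V. x w * (a w u * e)) = e * (\<Sum>v\<in>V. a u v * x v)"
          unfolding sum_distrib_left
        proof (rule sum.cong)
          fix w
          show "x w * (a w u * e) = e * (a u w * x w)" unfolding sym[of w u] by simp
        qed simp
        then show ?thesis unfolding q_def distrib_left sum.distrib by (simp add: power2_eq_square)
      qed
      finally have 1: "q y = p + 2 * e * (\<Sum>v\<in>V. a u v * x v) + a u u * e\<^sup>2" by (simp add: p_def)
      have "nrm2 V y = nrm2 V x + (\<Sum>v\<in>V. if v = u then 2 * e * x u + e\<^sup>2 else 0)"
        unfolding sum.distrib[symmetric] by (rule sum.cong) (auto simp: y_def power2_eq_square algebra_simps)
      then have 2: "nrm2 V y = 1 + 2 * e * x u + e\<^sup>2" using x(1) u assms(1) by simp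
      show ?thesis using le[of y] unfolding 1 2 g_def h_def by (simp add: algebra_simps)
    qed
    \<comment> \<open>This step has the sign of \<open>g\<close> and is so short that the linear
      term beats the quadratic one.\<close>
    define e where "e = g / (\<bar>h\<bar> + 1)"
    have h1: "\<bar>h\<bar> + 1 > 0" by simp
    then have e: "e * (\<bar>h\<bar> + 1) = g" by (simp add: e_def)
    have "e \<noteq> 0" using g h1 by (simp add: e_def)
    have "2 * e * g + e\<^sup>2 * h = e\<^sup>2 * (2 * (\<bar>h\<bar> + 1) + h)"
      unfolding e[symmetric] by (simp add: power2_eq_square algebra_simps)
    moreover have "2 * (\<bar>h\<bar> + 1) + h > 0" by (cases "0 \<le> h") (auto simp: abs_if)
    ultimately have "2 * e * g + e\<^sup>2 * h > 0" using \<open>e \<noteq> 0\<close> by simp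
    then show False using main[of e] by simp
  qed
  show ?thesis using x(1) eig le unfolding q_def by blast
qed

definition eigvec :: "'a set \<Rightarrow> ('a \<times> 'a) set \<Rightarrow> real \<Rightarrow> ('a \<Rightarrow> real) \<Rightarrow> bool" where
  "eigvec V E p x \<longleftrightarrow> (\<exists>v\<in>V. x v \<noteq> 0) \<and> (\<forall>v\<in>V. ad E x v = p * x v)"

text \<open>The Rayleigh bounds force \<open>p\<close> and \<open>q\<close> to be the largest and the smallest eigenvalue.\<close>

definition extremal_eig :: "'a set \<Rightarrow> ('a \<times> 'a) set \<Rightarrow> real \<Rightarrow> real \<Rightarrow> bool" where
  "extremal_eig V E p q \<longleftrightarrow> (\<exists>x. eigvec V E p x) \<and> (\<exists>x. eigvec V E q x) \<and>
     (\<forall>y. qf E y \<le> p * nrm2 V y) \<and> (\<forall>y. q * nrm2 V y \<le> qf E y)"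

lemma eigvec_qf:
  assumes "eigvec V E p x" "finite V" "E \<subseteq> V \<times> V"
  shows "qf E x = p * nrm2 V x" "nrm2 V x > 0"
proof -
  have "qf E x = (\<Sum>v\<in>V. x v * (p * x v))"
    unfolding qf_ad[OF assms(2,3)] using assms(1) by (intro sum.cong) (auto simp: eigvec_def)
  then show "qf E x = p * nrm2 V x" by (simp add: sum_distrib_left power2_eq_square algebra_simps)
  obtain v where "v \<in> V" "x v \<noteq> 0" using assms(1) by (auto simp: eigvec_def)
  then show "nrm2 V x > 0" using assms(2) by (intro sum_pos2[of V v]) auto
qed

lemma extremal_eig_exists:
  assumes "ugraph V E" "V \<noteq> {}"
  obtains p q where "extremal_eig V E p q"
proof -
  note ug = ugraphD[OF assms(1)]
  let ?a = "\<lambda>u v. if (u, v) \<in> E then 1 else 0 :: real"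
  have ad: "ad E x v = (\<Sum>w\<in>V. ?a v w * x w)" for x v
    by (rule ad_eq_indicator) (use ug in auto)
  have qfe: "qf E y = (\<Sum>v\<in>V. y v * (\<Sum>w\<in>V. ?a v w * y w))" for y
    unfolding qf_ad[OF ug(1,3)] ad ..
  have sym: "?a u v = ?a v u" for u v using ug(4) by auto
  obtain p x where p: "nrm2 V x = 1" "\<And>u. u \<in> V \<Longrightarrow> (\<Sum>v\<in>V. ?a u v * x v) = p * x u"
    "\<And>y. (\<Sum>u\<in>V. y u * (\<Sum>v\<in>V. ?a u v * y v)) \<le> p * nrm2 V y"
    using rayleigh_max[of V ?a, OF ug(1) assms(2) sym] by blast
  \<comment> \<open>The smallest eigenvalue is obtained as minus the largest one of the negated
    matrix.\<close>
  have "- ?a u v = - ?a v u" for u v using sym[of u v] by (simp only:)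
  then obtain q z where q: "nrm2 V z = 1" "\<And>u. u \<in> V \<Longrightarrow> (\<Sum>v\<in>V. - ?a u v * z v) = q * z u"
    "\<And>y. (\<Sum>u\<in>V. y u * (\<Sum>v\<in>V. - ?a u v * y v)) \<le> q * nrm2 V y"
    using rayleigh_max[of V "\<lambda>u v. - ?a u v", OF ug(1) assms(2)] by blast
  have nz: "\<exists>v\<in>V. x v \<noteq> 0" if "nrm2 V x = 1" for x :: "'a \<Rightarrow> real"
    using that by (metis (mono_tags, lifting) sum.neutral zero_neq_one zero_power2)
  have "eigvec V E p x" unfolding eigvec_def ad using p nz by auto
  moreover have "eigvec V E (- q) z" unfolding eigvec_def ad using q(1,2) nz
    by (auto simp: sum_negf minus_equation_iff)
  moreover have "qf E y \<le> p * nrm2 V y" "- q * nrm2 V y \<le> qf E y" for y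
    using p(3)[of y] q(3)[of y] unfolding qfe by (simp_all add: sum_negf)
  ultimately show ?thesis using that unfolding extremal_eig_def by blast
qed

text \<open>The bridge from the matrix spectrum to functions on vertices; from here on the spread is
  handled through \<open>extremal_eig\<close> alone.\<close>

lemma spread_eq:
  assumes "ugraph {..<n} (parcs G)" "pverts G = {..<n}" "n > 0"
  shows "\<exists>p q. extremal_eig {..<n} (parcs G) p q \<and> spread G = p - q"
proof -
  let ?A = "adjacency_mat G" and ?E = "parcs G" and ?V = "{..<n}"
  note ug = ugraphD[OF assms(1)]
  have A: "?A = mat n n (\<lambda>(i, j). if (i, j) \<in> ?E then 1 else 0)"
    unfolding adjacency_mat_def assms(2) by (simp add: Let_def)
  have Ac: "?A \<in> carrier_mat n n" by (simp add: A)
  have mult: "(?A *\<^sub>v v) $ i = ad ?E (\<lambda>j. v $ j) i" if "i < n" "v \<in> carrier_vec n" for v i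
  proof -
    have "(?A *\<^sub>v v) $ i = (\<Sum>j = 0..<n. (if (i, j) \<in> ?E then 1 else 0) * v $ j)"
      using that by (simp add: A scalar_prod_def)
    also have "\<dots> = ad ?E (\<lambda>j. v $ j) i"
      unfolding atLeast0LessThan using ad_eq_indicator[OF ug(1,3)] by simp
    finally show ?thesis .
  qed
  have spec: "k \<in> spectrum ?A \<longleftrightarrow> (\<exists>x. eigvec ?V ?E k x)" for k
  proof
    assume "k \<in> spectrum ?A"
    then obtain v where v: "v \<in> carrier_vec n" "v \<noteq> 0\<^sub>v n" "?A *\<^sub>v v = k \<cdot>\<^sub>v v"
      using Ac by (auto simp: spectrum_def eigenvalue_def eigenvector_def A)
    have "\<exists>i<n. v $ i \<noteq> 0"
    proof (rule ccontr)
      assume "\<not> ?thesis"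
      then have "v = 0\<^sub>v n" using v(1) by (intro eq_vecI) auto
      then show False using v by simp
    qed
    moreover have "ad ?E (\<lambda>j. v $ j) i = k * v $ i" if "i < n" for i
      using mult[OF that v(1)] v that by simp
    ultimately show "\<exists>x. eigvec ?V ?E k x"
      unfolding eigvec_def by (intro exI[of _ "\<lambda>j. v $ j"]) auto
  next
    assume "\<exists>x. eigvec ?V ?E k x"
    then obtain x where x: "\<exists>v<n. x v \<noteq> 0" "\<And>v. v < n \<Longrightarrow> ad ?E x v = k * x v"
      by (auto simp: eigvec_def)
    define v where "v = vec n x"
    have v: "v \<in> carrier_vec n" by (simp add: v_def)
    have cong: "ad ?E (\<lambda>j. v $ j) i = ad ?E x i" for i
      unfolding ad_def using ug(7) by (intro sum.cong) (auto simp: v_def)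
    have "?A *\<^sub>v v = k \<cdot>\<^sub>v v"
      by (rule eq_vecI) (use mult[OF _ v] cong x(2) in \<open>auto simp: v_def A\<close>)
    moreover have "v \<noteq> 0\<^sub>v n" using x(1) by (auto simp: v_def vec_eq_iff)
    ultimately show "k \<in> spectrum ?A"
      using v Ac by (auto simp: spectrum_def eigenvalue_def eigenvector_def A)
  qed
  obtain p q where pq: "extremal_eig ?V ?E p q"
    using extremal_eig_exists[OF assms(1)] assms(3) by auto
  have fin: "finite (spectrum ?A)" by (rule card_finite_spectrum[OF Ac])
  have bd: "q \<le> k \<and> k \<le> p" if k: "k \<in> spectrum ?A" for k
  proof -
    obtain x where x: "eigvec ?V ?E k x" using k spec by blast
    note e = eigvec_qf[OF x ug(1,3)]
    have "qf ?E x \<le> p * nrm2 ?V x" "q * nrm2 ?V x \<le> qf ?E x"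
      using pq unfolding extremal_eig_def by blast+
    then have "k * nrm2 ?V x \<le> p * nrm2 ?V x" "q * nrm2 ?V x \<le> k * nrm2 ?V x"
      unfolding e(1) .
    from mult_right_le_imp_le[OF this(1) e(2)] mult_right_le_imp_le[OF this(2) e(2)]
    show ?thesis by simp
  qed
  have "p \<in> spectrum ?A" "q \<in> spectrum ?A" using pq spec by (auto simp: extremal_eig_def)
  then have "Max (spectrum ?A) = p" "Min (spectrum ?A) = q"
    using fin bd by (auto intro!: Max_eqI Min_eqI)
  then show ?thesis using pq by (auto simp: spread_def)
qed

section \<open>Estimates for quadratic forms\<close>

lemma cauchy_schwarz_sum:
  fixes f g :: "'a \<Rightarrow> real"
  shows "(\<Sum>i\<in>A. f i * g i)\<^sup>2 \<le> (\<Sum>i\<in>A. (f i)\<^sup>2) * (\<Sum>i\<in>A. (g i)\<^sup>2)"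
proof -
  have "\<bar>\<Sum>i\<in>A. f i * g i\<bar> \<le> (\<Sum>i\<in>A. \<bar>f i\<bar> * \<bar>g i\<bar>)"
    using sum_abs[of "\<lambda>i. f i * g i" A] by (simp add: abs_mult)
  also have "\<dots> \<le> L2_set f A * L2_set g A" by (rule L2_set_mult_ineq)
  finally have "\<bar>\<Sum>i\<in>A. f i * g i\<bar>\<^sup>2 \<le> (L2_set f A * L2_set g A)\<^sup>2"
    by (rule power_mono) simp
  then show ?thesis by (simp add: power_mult_distrib L2_set_def sum_nonneg)
qed

lemma sum_squared_le_card:
  fixes f :: "'a \<Rightarrow> real"
  shows "(\<Sum>i\<in>A. f i)\<^sup>2 \<le> card A * (\<Sum>i\<in>A. (f i)\<^sup>2)"
  using cauchy_schwarz_sum[of "\<lambda>_. 1" f A] by simp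

lemma abs_sum_le_sqrt:
  fixes f :: "'a \<Rightarrow> real"
  assumes "finite V" "A \<subseteq> V" "real (card A) \<le> m"
  shows "\<bar>\<Sum>i\<in>A. f i\<bar> \<le> sqrt m * sqrt (nrm2 V f)"
proof -
  have "(\<Sum>i\<in>A. f i)\<^sup>2 \<le> card A * nrm2 A f" by (rule sum_squared_le_card)
  also have "\<dots> \<le> m * nrm2 V f"
    using assms by (intro mult_mono sum_mono2) (auto intro: sum_nonneg order_trans[OF _ assms(3)])
  finally have "sqrt ((\<Sum>i\<in>A. f i)\<^sup>2) \<le> sqrt (m * nrm2 V f)" by (rule real_sqrt_le_mono)
  then show ?thesis by (simp add: real_sqrt_mult)
qed

lemma sum_arcs_fst:
  fixes g :: "'a \<Rightarrow> real"
  assumes "finite V" "F \<subseteq> V \<times> W" "finite W"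
  shows "(\<Sum>(u, v)\<in>F. g u) = (\<Sum>u\<in>V. card (F `` {u}) * g u)"
proof -
  have "F = Sigma V (\<lambda>u. F `` {u})" using assms by auto
  moreover have "finite (F `` {v})" for v using assms by (meson finite_Image finite_SigmaI finite_subset)
  ultimately have "(\<Sum>(u, v)\<in>F. g u) = (\<Sum>u\<in>V. \<Sum>v\<in>F `` {u}. g u)"
    using assms(1) by (metis (no_types, lifting) sum.Sigma sum.cong)
  then show ?thesis by simp
qed

lemma sum_arcs_snd:
  fixes g :: "'a \<Rightarrow> real"
  assumes "finite V" "F \<subseteq> V \<times> W" "finite W"
  shows "(\<Sum>(u, v)\<in>F. g v) = (\<Sum>v\<in>W. card (F\<inverse> `` {v}) * g v)"
proof -
  have "(\<Sum>(u, v)\<in>F. g v) = (\<Sum>(v, u)\<in>F\<inverse>. g v)"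
    by (rule sum.reindex_bij_witness[of _ prod.swap prod.swap]) auto
  also have "\<dots> = (\<Sum>v\<in>W. card (F\<inverse> `` {v}) * g v)"
    by (rule sum_arcs_fst[of W "F\<inverse>" V]) (use assms in auto)
  finally show ?thesis .
qed

lemma two_mult_le_weighted:
  fixes a b \<beta> :: real
  assumes "\<beta> > 0"
  shows "2 * \<bar>a\<bar> * \<bar>b\<bar> \<le> \<beta> * a\<^sup>2 + b\<^sup>2 / \<beta>"
proof -
  have "0 \<le> (\<beta> * \<bar>a\<bar> - \<bar>b\<bar>)\<^sup>2" by simp
  also have "\<dots> = \<beta> * (\<beta> * a\<^sup>2 + b\<^sup>2 / \<beta> - 2 * \<bar>a\<bar> * \<bar>b\<bar>)"
    using assms by (simp add: power2_eq_square algebra_simps)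
  finally show ?thesis using assms by (simp add: zero_le_mult_iff)
qed

text \<open>A Schur test. The weight \<open>\<beta>\<close> balances out-degrees against in-degrees
  when the two bounds are of very different size.\<close>

lemma sum_arcs_le_deg:
  fixes x :: "'a \<Rightarrow> real"
  assumes "finite V" "F \<subseteq> V \<times> V" "\<beta> > 0"
    "\<And>v. v \<in> V \<Longrightarrow> real (card (F `` {v})) \<le> D1" "\<And>v. v \<in> V \<Longrightarrow> real (card (F\<inverse> `` {v})) \<le> D2"
  shows "2 * (\<Sum>(u, v)\<in>F. \<bar>x u\<bar> * \<bar>x v\<bar>) \<le> (\<beta> * D1 + D2 / \<beta>) * nrm2 V x"
proof -
  have "2 * (\<Sum>(u, v)\<in>F. \<bar>x u\<bar> * \<bar>x v\<bar>) = (\<Sum>(u, v)\<in>F. 2 * \<bar>x u\<bar> * \<bar>x v\<bar>)"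
    by (simp add: sum_distrib_left case_prod_unfold mult.assoc)
  also have "\<dots> \<le> (\<Sum>(u, v)\<in>F. \<beta> * (x u)\<^sup>2 + (x v)\<^sup>2 / \<beta>)"
    using two_mult_le_weighted[OF assms(3)] by (intro sum_mono) auto
  also have "\<dots> = \<beta> * (\<Sum>(u, v)\<in>F. (x u)\<^sup>2) + (\<Sum>(u, v)\<in>F. (x v)\<^sup>2) / \<beta>"
    by (simp add: sum.distrib sum_distrib_left sum_divide_distrib case_prod_unfold)
  also have "(\<Sum>(u, v)\<in>F. (x u)\<^sup>2) = (\<Sum>u\<in>V. card (F `` {u}) * (x u)\<^sup>2)"
    by (rule sum_arcs_fst[OF assms(1,2,1)])
  also have "(\<Sum>(u, v)\<in>F. (x v)\<^sup>2) = (\<Sum>u\<in>V. card (F\<inverse> `` {u}) * (x u)\<^sup>2)"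
    by (rule sum_arcs_snd[OF assms(1,2,1)])
  also have "\<beta> * (\<Sum>u\<in>V. card (F `` {u}) * (x u)\<^sup>2) + (\<Sum>u\<in>V. card (F\<inverse> `` {u}) * (x u)\<^sup>2) / \<beta>
      \<le> \<beta> * (\<Sum>u\<in>V. D1 * (x u)\<^sup>2) + (\<Sum>u\<in>V. D2 * (x u)\<^sup>2) / \<beta>"
    using assms(3-5)
    by (intro add_mono mult_left_mono divide_right_mono sum_mono mult_right_mono) auto
  also have "\<dots> = (\<beta> * D1 + D2 / \<beta>) * nrm2 V x"
    by (simp add: sum_distrib_left[symmetric] algebra_simps)
  finally show ?thesis .
qed

text \<open>The operator norm is at most the Frobenius norm, which for a 0-1 matrix is the square
  root of the number of ones.\<close>

lemma abs_qf_le_card: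
  assumes "finite V" "F \<subseteq> V \<times> V"
  shows "\<bar>qf F x\<bar> \<le> sqrt (card F) * nrm2 V x"
proof -
  have N: "nrm2 V x \<ge> 0" by (simp add: sum_nonneg)
  have "(qf F x)\<^sup>2 \<le> card F * (\<Sum>p\<in>F. (case p of (u, v) \<Rightarrow> x u * x v)\<^sup>2)"
    unfolding qf_def by (rule sum_squared_le_card)
  also have "(\<Sum>p\<in>F. (case p of (u, v) \<Rightarrow> x u * x v)\<^sup>2) \<le> (\<Sum>p\<in>V \<times> V. (case p of (u, v) \<Rightarrow> x u * x v)\<^sup>2)"
    using assms by (intro sum_mono2) auto
  also have "\<dots> = (nrm2 V x)\<^sup>2"
    by (simp add: power2_eq_square[of "sum _ _"] sum_product sum.cartesian_product case_prod_unfold power_mult_distrib)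
  finally have "sqrt ((qf F x)\<^sup>2) \<le> sqrt (card F * (nrm2 V x)\<^sup>2)"
    by (intro real_sqrt_le_mono) (simp add: mult_left_mono)
  then show ?thesis using N by (simp add: real_sqrt_mult)
qed

lemma qf_Un:
  assumes "finite E" "E = F \<union> G" "F \<inter> G = {}"
  shows "qf E x = qf F x + qf G x"
  unfolding qf_def assms(2) using assms by (intro sum.union_disjoint) auto

lemma qf_converse: "qf (F\<inverse>) x = qf F x"
  unfolding qf_def by (rule sum.reindex_bij_witness[of _ prod.swap prod.swap]) auto

lemma abs_qf_le: "\<bar>qf F x\<bar> \<le> (\<Sum>(u, v)\<in>F. \<bar>x u\<bar> * \<bar>x v\<bar>)"
  unfolding qf_def by (rule order_trans[OF sum_abs]) (simp add: case_prod_unfold abs_mult)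

text \<open>A complete bipartite subgraph is already a minor, with singletons as branch
  sets.\<close>

lemma Kst_free_common_nbrs:
  assumes "Kst_free s t V E" "Y \<subseteq> V" "Z \<subseteq> V" "Y \<inter> Z = {}" "Y \<times> Z \<subseteq> E"
    "finite Y" "card Y \<ge> s" "finite Z"
  shows "card Z < t"
proof (rule ccontr)
  assume "\<not> card Z < t"
  then obtain Z' where Z': "Z' \<subseteq> Z" "card Z' = t" by (metis obtain_subset_with_card_n not_less)
  obtain Y' where Y': "Y' \<subseteq> Y" "card Y' = s" using assms(7) by (metis obtain_subset_with_card_n)
  have fin: "finite Z'" "finite Y'" using Z' Y' assms(6,8) finite_subset by blast+
  obtain g where g: "bij_betw g {..<s} Y'"
    using finite_same_card_bij[of "{..<s}" Y'] fin Y' by auto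
  obtain h where h: "bij_betw h {..<t} Z'"
    using finite_same_card_bij[of "{..<t}" Z'] fin Z' by auto
  define f where "f i = (if i < s then g i else h (i - s))" for i
  have gY: "g i \<in> Y'" if "i < s" for i using g that by (auto simp: bij_betw_def)
  have hZ: "h i \<in> Z'" if "i < t" for i using h that by (auto simp: bij_betw_def)
  have inj: "f i \<noteq> f j" if "i < s + t" "j < s + t" "i < j" for i j
  proof (cases "j < s")
    case True
    then show ?thesis using that g by (auto simp: f_def bij_betw_def inj_on_def)
  next
    case j: False
    show ?thesis
    proof (cases "i < s")
      case True
      then have "f i \<in> Y" "f j \<in> Z" using j that gY hZ Y' Z' by (auto simp: f_def)
      then show ?thesis using assms(4) by auto
    next
      case False
      then have "i - s \<noteq> j - s" "i - s < t" "j - s < t" using j that by auto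
      then show ?thesis using False j h by (auto simp: f_def bij_betw_def inj_on_def)
    qed
  qed
  have "model V E {..<s + t} (bip s t) (\<lambda>i. {f i})"
  proof (rule modelI, goal_cases)
    case (1 i)
    show ?case by (rule conn_singleton)
  next
    case (2 i)
    show ?case
    proof (cases "i < s")
      case True
      then show ?thesis using gY[of i] Y'(1) assms(2) by (auto simp: f_def)
    next
      case False
      then have "i - s < t" using 2 by auto
      then show ?thesis using False hZ[of "i - s"] Z'(1) assms(3) by (auto simp: f_def)
    qed
  next
    case (3 i j)
    then show ?case using inj[of i j] inj[of j i] by (cases "i < j") auto
  next
    case (4 i j)
    then have "f i \<in> Y" "f j \<in> Z" using gY[of i] hZ[of "j - s"] Y' Z' by (auto simp: f_def)
    then show ?case using assms(5) by auto
  qed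
  then show False using assms(1) by (auto simp: Kst_free_def)
qed

text \<open>Every such vertex is a common neighbour of some \<open>s\<close>-subset of
  \<open>A\<close>. There are at most \<open>2 ^ card A\<close> of these subsets, and each has fewer
  than \<open>t\<close> common neighbours outside \<open>A\<close>.\<close>

lemma card_many_nbrs:
  assumes ug: "ugraph V E" and free: "Kst_free s t V E" and "A \<subseteq> V"
  shows "card {b \<in> V - A. s \<le> card (E `` {b} \<inter> A)} \<le> 2 ^ card A * t"
proof -
  note u = ugraphD[OF ug]
  have fA: "finite A" using assms(3) u(1) finite_subset by blast
  let ?P = "{Y. Y \<subseteq> A \<and> card Y = s}"
  let ?C = "\<lambda>Y. {b \<in> V - A. Y \<subseteq> E `` {b}}"
  have fP: "finite ?P" using fA by auto
  have "{b \<in> V - A. s \<le> card (E `` {b} \<inter> A)} \<subseteq> (\<Union>Y\<in>?P. ?C Y)"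
  proof
    fix b assume b: "b \<in> {b \<in> V - A. s \<le> card (E `` {b} \<inter> A)}"
    then obtain Y where "Y \<subseteq> E `` {b} \<inter> A" "card Y = s" by (metis (mono_tags, lifting) mem_Collect_eq obtain_subset_with_card_n)
    then show "b \<in> (\<Union>Y\<in>?P. ?C Y)" using b by auto
  qed
  then have "card {b \<in> V - A. s \<le> card (E `` {b} \<inter> A)} \<le> card (\<Union>Y\<in>?P. ?C Y)"
    using fP u(1) by (intro card_mono) auto
  also have "\<dots> \<le> (\<Sum>Y\<in>?P. card (?C Y))" by (rule card_UN_le[OF fP])
  also have "\<dots> \<le> (\<Sum>Y\<in>?P. t)"
  proof (rule sum_mono)
    fix Y assume Y: "Y \<in> ?P"
    have "card (?C Y) < t"
    proof (rule Kst_free_common_nbrs[OF free, of Y])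
      show "Y \<times> ?C Y \<subseteq> E" using u(4) by auto
      show "finite Y" using Y fA finite_subset by auto
    qed (use Y assms(3) u(1) in auto)
    then show "card (?C Y) \<le> t" by simp
  qed
  also have "\<dots> = card ?P * t" by simp
  also have "card ?P \<le> card (Pow A)" using fA by (intro card_mono) auto
  also have "card (Pow A) = 2 ^ card A" using fA by (rule card_Pow)
  finally show ?thesis by simp
qed

text \<open>Cauchy-Schwarz over the at most \<open>j\<close> neighbours of \<open>b\<close> in
  \<open>A\<close>, followed by double counting: each \<open>a\<close> occurs at most as often as
  its degree.\<close>

lemma sum_nbr_sums_squared:
  fixes x :: "'a \<Rightarrow> real"
  assumes ug: "ugraph V E" and AB: "A \<subseteq> V" "B \<subseteq> V"
    and "\<And>b. b \<in> B \<Longrightarrow> real (card (E `` {b} \<inter> A)) \<le> j" and j: "j \<ge> 0"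
  shows "(\<Sum>b\<in>B. (\<Sum>a\<in>E `` {b} \<inter> A. x a)\<^sup>2) \<le> j * (\<Sum>a\<in>A. card (E `` {a}) * (x a)\<^sup>2)"
proof -
  note u = ugraphD[OF ug]
  have fin: "finite A" "finite B" using AB u(1) finite_subset by blast+
  have "(\<Sum>b\<in>B. (\<Sum>a\<in>E `` {b} \<inter> A. x a)\<^sup>2) \<le> (\<Sum>b\<in>B. j * (\<Sum>a\<in>E `` {b} \<inter> A. (x a)\<^sup>2))"
  proof (rule sum_mono)
    fix b assume "b \<in> B"
    have "(\<Sum>a\<in>E `` {b} \<inter> A. x a)\<^sup>2 \<le> card (E `` {b} \<inter> A) * (\<Sum>a\<in>E `` {b} \<inter> A. (x a)\<^sup>2)"
      by (rule sum_squared_le_card)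
    also have "\<dots> \<le> j * (\<Sum>a\<in>E `` {b} \<inter> A. (x a)\<^sup>2)"
      using assms(4)[OF \<open>b \<in> B\<close>] by (intro mult_right_mono sum_nonneg) auto
    finally show "(\<Sum>a\<in>E `` {b} \<inter> A. x a)\<^sup>2 \<le> j * (\<Sum>a\<in>E `` {b} \<inter> A. (x a)\<^sup>2)" .
  qed
  also have "\<dots> = j * (\<Sum>b\<in>B. \<Sum>a\<in>E `` {b} \<inter> A. (x a)\<^sup>2)" by (simp add: sum_distrib_left)
  also have "(\<Sum>b\<in>B. \<Sum>a\<in>E `` {b} \<inter> A. (x a)\<^sup>2) = (\<Sum>(b, a)\<in>E \<inter> B \<times> A. (x a)\<^sup>2)"
  proof -
    have "E \<inter> B \<times> A = Sigma B (\<lambda>b. E `` {b} \<inter> A)" by auto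
    then show ?thesis using fin by (simp add: sum.Sigma)
  qed
  also have "\<dots> = (\<Sum>a\<in>A. card ((E \<inter> B \<times> A)\<inverse> `` {a}) * (x a)\<^sup>2)"
    by (rule sum_arcs_snd[OF fin(2) _ fin(1)]) auto
  also have "\<dots> \<le> (\<Sum>a\<in>A. card (E `` {a}) * (x a)\<^sup>2)"
  proof (intro sum_mono mult_right_mono)
    fix a assume "a \<in> A"
    have "(E \<inter> B \<times> A)\<inverse> `` {a} \<subseteq> E `` {a}" using u(4) by auto
    then show "real (card ((E \<inter> B \<times> A)\<inverse> `` {a})) \<le> real (card (E `` {a}))"
      using u(2) by (simp add: card_mono finite_Image)
  qed simp
  finally show ?thesis using j by (simp add: mult_left_mono)
qed

section \<open>Existence of hubs\<close>

text \<open>\<open>A\<close> is meant to be the boundedly many vertices of large degree. The form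
  splits into arcs inside \<open>A\<close>, arcs outside \<open>A\<close>, arcs from
  \<open>A\<close> to the few vertices with at least \<open>s\<close> neighbours in
  \<open>A\<close>, and the main term, in which each vertex of \<open>G\<close> sees fewer than
  \<open>s\<close> vertices of \<open>A\<close>. All parts but the last are small against
  \<open>sqrt n\<close> for suitable \<open>\<beta>\<close> and \<open>D\<close>.\<close>

lemma qf_split_hubs:
  fixes x :: "nat \<Rightarrow> real" and c :: nat and \<beta> D :: real
  assumes ug: "ugraph V E" and free: "Kst_free s t V E"
    and sparse: "\<And>W. W \<subseteq> V \<Longrightarrow> card (E \<inter> W \<times> W) \<le> c * card W"
    and A: "A \<subseteq> V" and deg: "\<And>v. v \<in> V - A \<Longrightarrow> real (card (E `` {v})) \<le> D"
    and "\<beta> > 0" "D \<ge> 0"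
  defines "G \<equiv> {b \<in> V - A. card (E `` {b} \<inter> A) < s}"
  shows "qf E x \<le> (\<beta> * c + D / \<beta> + 2 * card A + 2 ^ card A * t) * nrm2 V x
      + (\<Sum>b\<in>G. 2 * (x b * (\<Sum>a\<in>E `` {b} \<inter> A. x a)))"
proof -
  note u = ugraphD[OF ug]
  define B where "B = V - A"
  define Bb where "Bb = {b \<in> V - A. s \<le> card (E `` {b} \<inter> A)}"
  have fin: "finite A" "finite B" "finite G" "finite Bb"
    using A u(1) by (auto simp: B_def G_def Bb_def intro: finite_subset)
  have B: "B = G \<union> Bb" "G \<inter> Bb = {}" "A \<inter> B = {}" "V = A \<union> B" using A by (auto simp: B_def G_def Bb_def)
  define N where "N = nrm2 V x"
  have finE: "finite (E \<inter> X)" "finite ((E \<inter> X) `` {v})" "finite ((E \<inter> X)\<inverse> `` {v})" for X v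
    using u(2) by (auto intro: finite_Image)
  have AA: "qf (E \<inter> A \<times> A) x \<le> card A * N"
  proof -
    have "(E \<inter> A \<times> A) `` {v} \<subseteq> A" "(E \<inter> A \<times> A)\<inverse> `` {v} \<subseteq> A" for v by auto
    then have "2 * (\<Sum>(u, v)\<in>E \<inter> A \<times> A. \<bar>x u\<bar> * \<bar>x v\<bar>) \<le> (1 * real (card A) + real (card A) / 1) * N"
      unfolding N_def using fin u by (intro sum_arcs_le_deg) (auto simp: card_mono)
    then show ?thesis using abs_qf_le[of "E \<inter> A \<times> A" x] by simp
  qed
  have BB: "qf (E \<inter> B \<times> B) x \<le> (\<beta> * c + D / \<beta>) * N"
  proof -
    have "ugraph B (E \<inter> B \<times> B)" using u fin by (auto simp: ugraph_def sym_def irrefl_def)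
    moreover have "card ((E \<inter> B \<times> B) \<inter> W \<times> W) \<le> c * card W" if "W \<subseteq> B" for W
    proof -
      have "(E \<inter> B \<times> B) \<inter> W \<times> W = E \<inter> W \<times> W" using that by auto
      then show ?thesis using sparse[of W] that B(4) by auto
    qed
    \<comment> \<open>The orientation has out-degrees at most \<open>c\<close> but in-degrees only
      bounded by \<open>D\<close>, the unbalanced situation for which the weight
      \<open>\<beta>\<close> is there.\<close>
    ultimately obtain F where F: "E \<inter> B \<times> B = F \<union> F\<inverse>" "\<And>v. card (F `` {v}) \<le> c"
      using orientation[of B "E \<inter> B \<times> B" c] by blast
    have FE: "F \<subseteq> E" "F \<subseteq> B \<times> B" "F\<inverse> \<subseteq> E" using F(1) by auto
    have fF: "finite F" using FE(1) u(2) finite_subset by blast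
    have "qf (E \<inter> B \<times> B) x \<le> (\<Sum>(u, v)\<in>F \<union> F\<inverse>. \<bar>x u\<bar> * \<bar>x v\<bar>)"
      using abs_qf_le[of "E \<inter> B \<times> B" x] unfolding F(1) by linarith
    also have "\<dots> \<le> (\<Sum>(u, v)\<in>F. \<bar>x u\<bar> * \<bar>x v\<bar>) + (\<Sum>(u, v)\<in>F\<inverse>. \<bar>x u\<bar> * \<bar>x v\<bar>)"
      using sum.union_inter[of F "F\<inverse>" "\<lambda>(u, v). \<bar>x u\<bar> * \<bar>x v\<bar>"] fF
        sum_nonneg[of "F \<inter> F\<inverse>" "\<lambda>(u, v). \<bar>x u\<bar> * \<bar>x v\<bar>"] by (simp add: case_prod_unfold)
    also have "(\<Sum>(u, v)\<in>F\<inverse>. \<bar>x u\<bar> * \<bar>x v\<bar>) = (\<Sum>(u, v)\<in>F. \<bar>x u\<bar> * \<bar>x v\<bar>)"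
      by (rule sum.reindex_bij_witness[of _ prod.swap prod.swap]) auto
    also have "(\<Sum>(u, v)\<in>F. \<bar>x u\<bar> * \<bar>x v\<bar>) + (\<Sum>(u, v)\<in>F. \<bar>x u\<bar> * \<bar>x v\<bar>) = 2 * (\<Sum>(u, v)\<in>F. \<bar>x u\<bar> * \<bar>x v\<bar>)" by simp
    also have "\<dots> \<le> (\<beta> * real c + D / \<beta>) * nrm2 V x"
    proof -
      have "F \<subseteq> V \<times> V" using FE u(3) by blast
      moreover have "real (card (F\<inverse> `` {v})) \<le> D" for v
      proof (cases "v \<in> B")
        case True
        have "card (F\<inverse> `` {v}) \<le> card (E `` {v})"
          using FE(3) u(2) by (intro card_mono finite_Image) auto
        then show ?thesis using deg[of v] True by (auto simp: B_def)
      next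
        case False
        then have "F\<inverse> `` {v} = {}" using FE(2) by auto
        then show ?thesis using \<open>D \<ge> 0\<close> by simp
      qed
      moreover have "real (card (F `` {v})) \<le> real c" for v using F(2) by simp
      ultimately show ?thesis using sum_arcs_le_deg[of V F \<beta> "real c" D x] u(1) \<open>\<beta> > 0\<close> by blast
    qed
    finally show ?thesis by (simp add: N_def)
  qed
  have BbA: "2 * qf (E \<inter> Bb \<times> A) x \<le> (card A + 2 ^ card A * t) * N"
  proof -
    have "card ((E \<inter> Bb \<times> A) `` {v}) \<le> card A" "card ((E \<inter> Bb \<times> A)\<inverse> `` {v}) \<le> card Bb" for v
      using fin by (auto intro!: card_mono)
    moreover have "card Bb \<le> 2 ^ card A * t" unfolding Bb_def by (rule card_many_nbrs[OF ug free A])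
    ultimately have "2 * (\<Sum>(u, v)\<in>E \<inter> Bb \<times> A. \<bar>x u\<bar> * \<bar>x v\<bar>) \<le> (1 * real (card A) + real (2 ^ card A * t) / 1) * N"
      unfolding N_def using u(1,3) by (intro sum_arcs_le_deg) (auto simp del: of_nat_mult of_nat_power intro: order_trans)
    then show ?thesis using abs_qf_le[of "E \<inter> Bb \<times> A" x] by simp
  qed
  have GA: "2 * qf (E \<inter> G \<times> A) x = (\<Sum>b\<in>G. 2 * (x b * (\<Sum>a\<in>E `` {b} \<inter> A. x a)))"
  proof -
    have "E \<inter> G \<times> A = Sigma G (\<lambda>b. E `` {b} \<inter> A)" by auto
    then have "qf (E \<inter> G \<times> A) x = (\<Sum>b\<in>G. \<Sum>a\<in>E `` {b} \<inter> A. x b * x a)"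
      unfolding qf_def using fin by (simp add: sum.Sigma)
    then show ?thesis by (simp add: sum_distrib_left)
  qed
  have "qf E x = qf (E \<inter> A \<times> A) x + qf (E \<inter> B \<times> B \<union> (E \<inter> B \<times> A \<union> E \<inter> A \<times> B)) x"
    by (rule qf_Un) (use u B in auto)
  also have "qf (E \<inter> B \<times> B \<union> (E \<inter> B \<times> A \<union> E \<inter> A \<times> B)) x = qf (E \<inter> B \<times> B) x + qf (E \<inter> B \<times> A \<union> E \<inter> A \<times> B) x"
    by (rule qf_Un) (use u B in auto)
  also have "qf (E \<inter> B \<times> A \<union> E \<inter> A \<times> B) x = qf (E \<inter> B \<times> A) x + qf (E \<inter> A \<times> B) x"
    by (rule qf_Un) (use u B in auto)
  also have "qf (E \<inter> A \<times> B) x = qf (E \<inter> B \<times> A) x"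
  proof -
    have "E \<inter> A \<times> B = (E \<inter> B \<times> A)\<inverse>" using u(4) by auto
    then show ?thesis by (simp add: qf_converse)
  qed
  also have "qf (E \<inter> B \<times> A) x = qf (E \<inter> G \<times> A) x + qf (E \<inter> Bb \<times> A) x"
    by (rule qf_Un) (use u B in auto)
  finally have "qf E x = qf (E \<inter> A \<times> A) x + qf (E \<inter> B \<times> B) x + 2 * qf (E \<inter> Bb \<times> A) x + 2 * qf (E \<inter> G \<times> A) x"
    by simp
  also have "\<dots> \<le> card A * N + (\<beta> * c + D / \<beta>) * N + (card A + 2 ^ card A * t) * N
      + (\<Sum>b\<in>G. 2 * (x b * (\<Sum>a\<in>E `` {b} \<inter> A. x a)))"
    using AA BB BbA GA by linarith
  finally show ?thesis unfolding N_def by (simp add: algebra_simps)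
qed

text \<open>With \<open>T\<close> the sum of the squared neighbour sums, \<open>T\<close> is at most
  \<open>k * n\<close> times the mass on \<open>A\<close>, because each vertex of \<open>G\<close>
  has at most \<open>k\<close> neighbours in \<open>A\<close>; the inequality between arithmetic and
  geometric mean gives the first claim. The second is its stability. Near equality puts almost all
  mass of \<open>A\<close> on vertices of almost full degree, and with fewer than \<open>k\<close>
  of those each neighbour sum would essentially have only \<open>k - 1\<close> terms, making
  \<open>T\<close> too small.\<close>

lemma hub_inequality:
  fixes x :: "nat \<Rightarrow> real" and s n :: nat and V E A
  assumes ug: "ugraph V E" and A: "A \<subseteq> V" and cV: "card V = n" and s: "s \<ge> 2"
  defines "k \<equiv> real s - 1" and "N \<equiv> nrm2 V x" 
    and "G \<equiv> {b \<in> V - A. card (E `` {b} \<inter> A) < s}"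
  defines "m \<equiv> (\<Sum>b\<in>G. 2 * (x b * (\<Sum>a\<in>E `` {b} \<inter> A. x a)))" and "Q \<equiv> sqrt (k * n)"
  shows "m \<le> Q * N"
    and "\<lbrakk>(1 - \<delta>) * Q * N \<le> m; N > 0; n > 0; 0 < \<epsilon>; \<epsilon> < 1; 0 < \<delta>; \<delta> \<le> 1 / 10; \<delta> * (k + 3 * k\<^sup>2 / \<epsilon>) < 1 / 10\<rbrakk>
      \<Longrightarrow> s - 1 \<le> card {a \<in> A. (1 - \<epsilon>) * n \<le> card (E `` {a})}"
proof -
  note u = ugraphD[OF ug]
  define B where "B = V - A"
  define r where "r b = (\<Sum>a\<in>E `` {b} \<inter> A. x a)" for b
  define T where "T = (\<Sum>b\<in>G. (r b)\<^sup>2)"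
  define w where "w = nrm2 A x"
  define d where "d a = real (card (E `` {a}))" for a
  have k: "k \<ge> 1" using s by (simp add: k_def)
  have fin: "finite A" "finite B" "finite G" "G \<subseteq> B" "G \<subseteq> V"
    using A u(1) by (auto simp: B_def G_def intro: finite_subset)
  have dn: "d a \<le> n" for a
  proof -
    have "card (E `` {a}) \<le> card V" using u by (intro card_mono) auto
    then show ?thesis by (simp add: d_def cV)
  qed
  have N: "N = w + nrm2 B x" unfolding N_def w_def B_def
    using A u(1) by (metis add.commute sum.subset_diff)
  have nB: "nrm2 G x \<le> nrm2 B x" using fin by (intro sum_mono2) auto
  have nB0: "nrm2 B x \<ge> 0" and w0: "w \<ge> 0" by (simp_all add: sum_nonneg w_def)
  have Td: "T \<le> k * (\<Sum>a\<in>A. d a * (x a)\<^sup>2)"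
    unfolding T_def r_def d_def
  proof (rule sum_nbr_sums_squared[OF ug A fin(5)])
    fix b assume "b \<in> G"
    then show "real (card (E `` {b} \<inter> A)) \<le> k" by (auto simp: G_def k_def)
  qed (use k in auto)
  have Tw: "T \<le> k * n * w"
  proof -
    have "(\<Sum>a\<in>A. d a * (x a)\<^sup>2) \<le> (\<Sum>a\<in>A. n * (x a)\<^sup>2)" using dn by (intro sum_mono mult_right_mono) auto
    then have "k * (\<Sum>a\<in>A. d a * (x a)\<^sup>2) \<le> k * (n * w)"
      using k by (simp add: w_def sum_distrib_left[symmetric] mult_left_mono)
    then show ?thesis using Td by simp
  qed
  have m_le: "m \<le> \<beta> * nrm2 B x + T / \<beta>" if b: "\<beta> > 0" for \<beta>
  proof -
    have "m \<le> (\<Sum>b\<in>G. \<beta> * (x b)\<^sup>2 + (r b)\<^sup>2 / \<beta>)" unfolding m_def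
    proof (rule sum_mono)
      fix b
      have "2 * (x b * r b) \<le> 2 * \<bar>x b\<bar> * \<bar>r b\<bar>" by (simp add: abs_mult[symmetric] mult.assoc)
      also have "\<dots> \<le> \<beta> * (x b)\<^sup>2 + (r b)\<^sup>2 / \<beta>" by (rule two_mult_le_weighted[OF b])
      finally show "2 * (x b * (\<Sum>a\<in>E `` {b} \<inter> A. x a)) \<le> \<beta> * (x b)\<^sup>2 + (r b)\<^sup>2 / \<beta>" by (simp add: r_def)
    qed
    also have "\<dots> = \<beta> * nrm2 G x + T / \<beta>" by (simp add: sum.distrib sum_distrib_left sum_divide_distrib T_def)
    also have "\<dots> \<le> \<beta> * nrm2 B x + T / \<beta>" using nB b by simp
    finally show ?thesis .
  qed
  have Q2: "Q\<^sup>2 = k * n" using k by (simp add: Q_def)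
  show "m \<le> Q * N"
  proof (cases "n = 0")
    case True
    then have "V = {}" using cV u(1) by simp
    then show ?thesis by (simp add: m_def G_def N_def)
  next
    case False
    then have Q: "Q > 0" using k by (simp add: Q_def)
    have "T / Q \<le> Q\<^sup>2 * w / Q" using Tw Q unfolding Q2 by (intro divide_right_mono) auto
    also have "\<dots> = Q * w" using Q by (simp add: power2_eq_square)
    finally show ?thesis using m_le[OF Q] N by (simp add: algebra_simps)
  qed
  assume m: "(1 - \<delta>) * Q * N \<le> m" and N0: "N > 0" and n0: "n > 0" and ep: "0 < \<epsilon>" "\<epsilon> < 1"
    and de: "0 < \<delta>" "\<delta> \<le> 1 / 10" "\<delta> * (k + 3 * k\<^sup>2 / \<epsilon>) < 1 / 10"
  have Q: "Q > 0" using k n0 by (simp add: Q_def)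
  have kn: "k * n > 0" using k n0 by simp
  \<comment> \<open>Read together with \<open>Tw\<close>: the neighbour sums are almost as large as
    they can be.\<close>
  have T1: "k * n * (w - \<delta> * N) \<le> T"
  proof -
    have "(1 - \<delta>) * Q * N \<le> Q * (N - w) + T / Q" using m m_le[OF Q] N by simp
    then have "Q * ((1 - \<delta>) * Q * N) \<le> Q * (Q * (N - w) + T / Q)" using Q by (intro mult_left_mono) auto
    also have "\<dots> = Q\<^sup>2 * (N - w) + T" using Q by (simp add: power2_eq_square algebra_simps)
    finally have "Q\<^sup>2 * ((1 - \<delta>) * N) \<le> Q\<^sup>2 * (N - w) + T" by (simp add: power2_eq_square algebra_simps)
    then show ?thesis unfolding Q2 by (simp add: algebra_simps)
  qed
  \<comment> \<open>With weight \<open>Q / 2\<close> in place of \<open>Q\<close>, the mass outside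
    \<open>A\<close> contributes at most half of what is needed, so \<open>A\<close> must carry a
    fixed share.\<close>
  have wN: "N / 5 \<le> w"
  proof -
    have "(1 - \<delta>) * Q * N \<le> Q / 2 * nrm2 B x + T / (Q / 2)" using m m_le[of "Q / 2"] Q by simp
    also have "Q / 2 * nrm2 B x \<le> Q / 2 * N" using N w0 Q by simp
    finally have "Q * ((1 - \<delta>) * Q * N) \<le> Q * (Q / 2 * N + T / (Q / 2))" using Q by (intro mult_left_mono) auto
    also have "\<dots> = Q\<^sup>2 / 2 * N + 2 * T" using Q by (simp add: power2_eq_square algebra_simps)
    finally have "Q\<^sup>2 * ((1 - \<delta>) * N) \<le> Q\<^sup>2 / 2 * N + 2 * T" by (simp add: power2_eq_square algebra_simps)
    also have "\<dots> \<le> Q\<^sup>2 / 2 * N + 2 * (Q\<^sup>2 * w)" using Tw Q2 by simp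
    finally have "Q\<^sup>2 * ((1 - \<delta>) * N) \<le> Q\<^sup>2 * (N / 2 + 2 * w)" by (simp add: algebra_simps)
    then have "(1 - \<delta>) * N \<le> N / 2 + 2 * w" using Q by simp
    moreover have "\<delta> * N \<le> 1 / 10 * N" using de N0 by (intro mult_right_mono) auto
    ultimately show ?thesis by (simp add: algebra_simps)
  qed
  define H where "H = {a \<in> A. (1 - \<epsilon>) * n \<le> card (E `` {a})}"
  show "s - 1 \<le> card H"
  proof (rule ccontr)
    assume cH: "\<not> s - 1 \<le> card H"
    then have cH': "real (card H) \<le> k - 1" by (simp add: k_def)
    define w' where "w' = nrm2 (A - H) x"
    have HA: "H \<subseteq> A" "H \<subseteq> V" "A - H \<subseteq> V" "finite H" using A fin by (auto simp: H_def)
    have w': "w = nrm2 H x + w'" "w' \<ge> 0" "nrm2 H x \<ge> 0" unfolding w_def w'_def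
      using fin HA by (simp_all add: sum.subset_diff[of H A] sum_nonneg)
    have "(\<Sum>a\<in>A. d a * (x a)\<^sup>2) = (\<Sum>a\<in>A - H. d a * (x a)\<^sup>2) + (\<Sum>a\<in>H. d a * (x a)\<^sup>2)"
      using fin HA by (simp add: sum.subset_diff[of H A])
    also have "\<dots> \<le> (\<Sum>a\<in>A - H. (1 - \<epsilon>) * n * (x a)\<^sup>2) + (\<Sum>a\<in>H. n * (x a)\<^sup>2)"
      using dn by (intro add_mono sum_mono mult_right_mono) (auto simp: H_def d_def)
    also have "\<dots> = (1 - \<epsilon>) * n * w' + n * nrm2 H x"
      unfolding sum_distrib_left[symmetric] w'_def ..
    also have "\<dots> = n * (w - \<epsilon> * w')" unfolding w'(1) by (simp add: algebra_simps)
    finally have "k * (\<Sum>a\<in>A. d a * (x a)\<^sup>2) \<le> k * (n * (w - \<epsilon> * w'))"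
      using k by (intro mult_left_mono) auto
    then have "k * n * (w - \<delta> * N) \<le> k * n * (w - \<epsilon> * w')" using T1 Td by (simp add: mult.assoc)
    from mult_left_le_imp_le[OF this kn] have ew: "\<epsilon> * w' \<le> \<delta> * N" by simp
    have w'N: "w' \<le> \<delta> * N / \<epsilon>" using ew ep by (simp add: field_simps)
    \<comment> \<open>Small enough that \<open>(1 + \<theta>) * (k - 1)\<close> stays below
      \<open>k - 1 / 2\<close>; the price is the factor \<open>1 + 1 / \<theta>\<close>, at most
      \<open>3 * k\<close>, on the small part.\<close>
    define \<theta> where "\<theta> = 1 / (2 * k)"
    have th: "\<theta> > 0" using k by (simp add: \<theta>_def)
    define rH where "rH b = (\<Sum>a\<in>E `` {b} \<inter> H. x a)" for b
    define rA where "rA b = (\<Sum>a\<in>E `` {b} \<inter> (A - H). x a)" for b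
    have r: "r b = rH b + rA b" for b
    proof -
      have "E `` {b} \<inter> A = (E `` {b} \<inter> H) \<union> (E `` {b} \<inter> (A - H))" using HA by auto
      then show ?thesis unfolding r_def rH_def rA_def using fin HA by (simp only:, subst sum.union_disjoint) auto
    qed
    have sq: "(r b)\<^sup>2 \<le> (1 + \<theta>) * (rH b)\<^sup>2 + (1 + 1 / \<theta>) * (rA b)\<^sup>2" for b
    proof -
      have "2 * (rH b * rA b) \<le> 2 * \<bar>rH b\<bar> * \<bar>rA b\<bar>" by (simp add: abs_mult[symmetric] mult.assoc)
      also have "\<dots> \<le> \<theta> * (rH b)\<^sup>2 + (rA b)\<^sup>2 / \<theta>" by (rule two_mult_le_weighted[OF th])
      finally show ?thesis unfolding r by (simp add: power2_sum algebra_simps)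
    qed
    have P: "(\<Sum>b\<in>G. (rH b)\<^sup>2) \<le> (k - 1) * n * w"
    proof -
      have "(\<Sum>b\<in>G. (rH b)\<^sup>2) \<le> (k - 1) * (\<Sum>a\<in>H. card (E `` {a}) * (x a)\<^sup>2)"
        unfolding rH_def
      proof (rule sum_nbr_sums_squared[OF ug HA(2) fin(5)])
        fix b
        have "card (E `` {b} \<inter> H) \<le> card H" using HA by (intro card_mono) auto
        then show "real (card (E `` {b} \<inter> H)) \<le> k - 1" using cH' by simp
      qed (use k in auto)
      also have "\<dots> \<le> (k - 1) * (\<Sum>a\<in>H. n * (x a)\<^sup>2)"
        using dn k by (intro mult_left_mono sum_mono mult_right_mono) (auto simp: d_def)
      also have "\<dots> = (k - 1) * n * nrm2 H x" by (simp add: sum_distrib_left[symmetric])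
      also have "\<dots> \<le> (k - 1) * n * w" using w' k by (intro mult_left_mono) auto
      finally show ?thesis .
    qed
    have P': "(\<Sum>b\<in>G. (rA b)\<^sup>2) \<le> k * n * w'"
    proof -
      have "(\<Sum>b\<in>G. (rA b)\<^sup>2) \<le> k * (\<Sum>a\<in>A - H. card (E `` {a}) * (x a)\<^sup>2)"
        unfolding rA_def
      proof (rule sum_nbr_sums_squared[OF ug HA(3) fin(5)])
        fix b assume b: "b \<in> G"
        have "card (E `` {b} \<inter> (A - H)) \<le> card (E `` {b} \<inter> A)" using fin by (intro card_mono) auto
        then show "real (card (E `` {b} \<inter> (A - H))) \<le> k" using b by (auto simp: G_def k_def)
      qed (use k in auto)
      also have "\<dots> \<le> k * (\<Sum>a\<in>A - H. n * (x a)\<^sup>2)"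
        using dn k by (intro mult_left_mono sum_mono mult_right_mono) (auto simp: d_def)
      also have "\<dots> = k * n * w'" by (simp add: sum_distrib_left[symmetric] w'_def)
      finally show ?thesis .
    qed
    have "T \<le> (1 + \<theta>) * (\<Sum>b\<in>G. (rH b)\<^sup>2) + (1 + 1 / \<theta>) * (\<Sum>b\<in>G. (rA b)\<^sup>2)"
      unfolding T_def sum_distrib_left sum.distrib[symmetric] by (intro sum_mono sq)
    also have "\<dots> \<le> (1 + \<theta>) * ((k - 1) * n * w) + (1 + 1 / \<theta>) * (k * n * w')"
      using P P' th by (intro add_mono mult_left_mono) auto
    also have "(1 + \<theta>) * ((k - 1) * n * w) \<le> (k - 1 / 2) * (n * w)"
    proof -
      have "(1 + \<theta>) * (k - 1) \<le> k - 1 / 2" using k by (simp add: \<theta>_def field_simps)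
      then have "(1 + \<theta>) * (k - 1) * (n * w) \<le> (k - 1 / 2) * (n * w)" using w0 by (intro mult_right_mono) auto
      then show ?thesis by (simp add: mult.assoc)
    qed
    also have "(1 + 1 / \<theta>) * (k * n * w') \<le> 3 * k * (k * n * w')"
    proof -
      have "1 + 1 / \<theta> \<le> 3 * k" using k by (simp add: \<theta>_def)
      then show ?thesis using w' k by (intro mult_right_mono) auto
    qed
    also have "3 * k * (k * n * w') \<le> 3 * k * (k * n * (\<delta> * N / \<epsilon>))"
      using w'N k by (intro mult_left_mono) auto
    finally have "T \<le> (k - 1 / 2) * (n * w) + 3 * k * (k * n * (\<delta> * N / \<epsilon>))" by simp
    moreover have "(k - 1 / 2) * (n * w) + 3 * k * (k * n * (\<delta> * N / \<epsilon>))
        = n * ((k - 1 / 2) * w + 3 * k\<^sup>2 * (\<delta> * N / \<epsilon>))"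
      by (simp add: power2_eq_square algebra_simps)
    moreover have "n * (k * (w - \<delta> * N)) = k * n * (w - \<delta> * N)" by simp
    ultimately have "n * (k * (w - \<delta> * N)) \<le> n * ((k - 1 / 2) * w + 3 * k\<^sup>2 * (\<delta> * N / \<epsilon>))"
      using T1 by linarith
    then have "k * (w - \<delta> * N) \<le> (k - 1 / 2) * w + 3 * k\<^sup>2 * (\<delta> * N / \<epsilon>)" using n0 by simp
    then have "w / 2 \<le> N * (\<delta> * (k + 3 * k\<^sup>2 / \<epsilon>))" by (simp add: algebra_simps)
    also have "\<dots> < N * (1 / 10)" using de(3) N0 by (intro mult_strict_left_mono)
    finally show False using wN by simp
  qed
qed


text \<open>Large degree means above \<open>n / M\<close>. By sparsity at most \<open>a0\<close>
  vertices qualify, a number independent of \<open>n\<close>, and the remaining parts of the form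
  cost at most a small multiple of \<open>sqrt n\<close>. So \<open>hub_inequality\<close> applies
  with any prescribed precision. The constant \<open>C0\<close> leaves room for a bounded loss in
  the Rayleigh quotient, which is all that is known about an extremal graph at this stage.\<close>

theorem hubs_exist:
  fixes s t :: nat and \<epsilon> C0 :: real
  assumes s: "2 \<le> s" and ep: "0 < \<epsilon>" "\<epsilon> < 1"
  shows "\<exists>N. \<forall>n\<ge>N. \<forall>E. ugraph {..<n} E \<longrightarrow> Kst_free s t {..<n} E \<longrightarrow>
    (\<forall>x. qf E x \<le> (1 + \<epsilon>) * sqrt ((real s - 1) * n) * nrm2 {..<n} x) \<and>
    (\<forall>x. 0 < nrm2 {..<n} x \<longrightarrow> (sqrt ((real s - 1) * n) - C0) * nrm2 {..<n} x \<le> qf E x \<longrightarrow>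
      (\<exists>H\<subseteq>{..<n}. card H = s - 1 \<and> (\<forall>h\<in>H. (1 - \<epsilon>) * n \<le> card (E `` {h}))))"
proof -
  obtain c0 :: nat where c0: "\<And>V E W. Kst_free s t V E \<Longrightarrow> ugraph V E \<Longrightarrow> W \<subseteq> V \<Longrightarrow> card (E \<inter> W \<times> W) \<le> c0 * card W"
    using Kst_free_sparse[of s t] by blast
  define c where "c = Suc c0"
  have c: "card (E \<inter> W \<times> W) \<le> c * card W" if "Kst_free s t V E" "ugraph V E" "W \<subseteq> V" for V E W
    using c0[OF that] by (simp add: c_def)
  have c1: "real c \<ge> 1" by (simp add: c_def)
  define k where "k = real s - 1"
  have k: "k \<ge> 1" using s by (simp add: k_def)
  define P where "P = k + 3 * k\<^sup>2 / \<epsilon>"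
  have P: "P > 0" using k ep by (simp add: P_def add_pos_pos)
  define \<delta> where "\<delta> = min (min (1 / 10) \<epsilon>) (1 / (20 * P))"
  have de: "0 < \<delta>" "\<delta> \<le> 1 / 10" "\<delta> \<le> \<epsilon>" using ep P by (auto simp: \<delta>_def)
  have deP: "\<delta> * P < 1 / 10"
  proof -
    have "\<delta> * P \<le> 1 / (20 * P) * P" using P by (intro mult_right_mono) (auto simp: \<delta>_def)
    then show ?thesis using P by simp
  qed
  define \<eta> where "\<eta> = \<delta> / 4"
  have eta: "\<eta> > 0" using de by (simp add: \<eta>_def)
  \<comment> \<open>Chosen so that, for the \<open>\<beta>\<close> used below,
    \<open>\<beta> * c\<close> and \<open>D / \<beta>\<close> both equal
    \<open>\<eta> * q / 2\<close>.\<close>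
  define M where "M = 4 * real c / \<eta>\<^sup>2"
  have M: "M > 0" using c1 eta by (simp add: M_def)
  define a0 where "a0 = nat \<lceil>real c * M\<rceil>"
  define K1 where "K1 = 2 * real a0 + 2 ^ a0 * real t + \<bar>C0\<bar>"
  have K1: "K1 \<ge> 0" by (simp add: K1_def)
  define N where "N = max 1 (nat \<lceil>(2 * K1 / \<delta>)\<^sup>2\<rceil>)"
  have main: "(\<forall>x. qf E x \<le> (1 + \<epsilon>) * sqrt (k * n) * nrm2 {..<n} x) \<and>
    (\<forall>x. 0 < nrm2 {..<n} x \<longrightarrow> (sqrt (k * n) - C0) * nrm2 {..<n} x \<le> qf E x \<longrightarrow>
      (\<exists>H\<subseteq>{..<n}. card H = s - 1 \<and> (\<forall>h\<in>H. (1 - \<epsilon>) * n \<le> card (E `` {h}))))"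
    if n: "n \<ge> N" and ug: "ugraph {..<n} E" and free: "Kst_free s t {..<n} E" for n E
  proof -
    let ?V = "{..<n}"
    note u = ugraphD[OF ug]
    have n1: "n \<ge> 1" using n by (simp add: N_def)
    have n2: "(2 * K1 / \<delta>)\<^sup>2 \<le> n" using n unfolding N_def by linarith
    define q where "q = sqrt (real n)"
    have q: "q > 0" "q * q = n" using n1 by (simp_all add: q_def)
    have K1q: "K1 \<le> \<delta> / 2 * q"
    proof -
      have "2 * K1 / \<delta> \<le> q" unfolding q_def by (rule real_le_rsqrt[OF n2])
      then show ?thesis using de by (simp add: field_simps)
    qed
    define Q where "Q = sqrt (k * n)"
    have qQ: "q \<le> Q" unfolding q_def Q_def using mult_right_mono[OF k, of "real n"] by simp
    define D where "D = n / M"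
    have D: "D > 0" using n1 M by (simp add: D_def)
    define A where "A = {v \<in> ?V. D < card (E `` {v})}"
    have A: "A \<subseteq> ?V" "finite A" by (auto simp: A_def)
    have cA: "card A \<le> a0"
    proof -
      have "card A * D = (\<Sum>a\<in>A. D)" by simp
      also have "\<dots> \<le> (\<Sum>a\<in>A. real (card (E `` {a})))" by (intro sum_mono) (auto simp: A_def)
      also have "\<dots> \<le> (\<Sum>a\<in>?V. real (card (E `` {a})))" using A by (intro sum_mono2) auto
      also have "\<dots> = (\<Sum>a\<in>?V. real (card (E `` {a} \<inter> ?V)))"
        using u(3) by (intro sum.cong arg_cong[of _ _ "\<lambda>X. real (card X)"]) auto
      also have "\<dots> = real (card (E \<inter> ?V \<times> ?V))"
        using card_arcs_restrict[OF u(2,1)] by simp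
      also have "\<dots> \<le> real c * n" using c[OF free ug, of ?V] by (metis card_lessThan of_nat_le_iff of_nat_mult order_refl)
      also have "\<dots> = real c * M * D" using M by (simp add: D_def)
      finally have "real (card A) \<le> real c * M" using D by simp
      then show ?thesis unfolding a0_def by linarith
    qed
    define \<beta> where "\<beta> = \<eta> * q / (2 * c)"
    have be: "\<beta> > 0" using eta q c1 by (simp add: \<beta>_def)
    have "\<beta> * c = \<eta> * q / 2" using c1 by (simp add: \<beta>_def)
    moreover have "D / \<beta> = \<eta> * q / 2"
    proof -
      have "D = \<eta>\<^sup>2 * (q * q) / (4 * c)" using q c1 by (simp add: D_def M_def)
      then show ?thesis using q eta c1 by (simp add: \<beta>_def power2_eq_square field_simps)
    qed
    ultimately have coef: "\<beta> * c + D / \<beta> = \<eta> * q" by linarith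
    define C1 where "C1 = \<beta> * c + D / \<beta> + 2 * card A + 2 ^ card A * t"
    have C1: "C1 + \<bar>C0\<bar> \<le> \<delta> * Q"
    proof -
      have "2 ^ card A * t \<le> 2 ^ a0 * t" using cA by (intro mult_right_mono power_increasing) auto
      then have "real (2 ^ card A * t) \<le> real (2 ^ a0 * t)" by (rule of_nat_mono)
      then have "C1 + \<bar>C0\<bar> \<le> \<eta> * q + K1" unfolding C1_def coef K1_def using cA by simp
      also have "\<dots> \<le> \<delta> * q"
      proof -
        have "\<delta> * q > 0" "\<eta> * q = \<delta> * q / 4" "\<delta> / 2 * q = \<delta> * q / 2" using q de by (simp_all add: \<eta>_def)
        then show ?thesis using K1q by linarith
      qed
      also have "\<dots> \<le> \<delta> * Q" using qQ de by simp
      finally show ?thesis .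
    qed
    define m where "m x = (\<Sum>b\<in>{b \<in> ?V - A. card (E `` {b} \<inter> A) < s}. 2 * (x b * (\<Sum>a\<in>E `` {b} \<inter> A. x a)))"
      for x :: "nat \<Rightarrow> real"
    have split: "qf E x \<le> C1 * nrm2 ?V x + m x" for x
      unfolding C1_def m_def
    proof (rule qf_split_hubs[OF ug free _ A(1) _ be])
      show "card (E \<inter> W \<times> W) \<le> c * card W" if "W \<subseteq> ?V" for W by (rule c[OF free ug that])
      show "real (card (E `` {v})) \<le> D" if "v \<in> ?V - A" for v using that by (auto simp: A_def)
    qed (use D in simp)
    have N0: "nrm2 ?V x \<ge> 0" for x by (simp add: sum_nonneg)
    have up: "qf E x \<le> (1 + \<epsilon>) * Q * nrm2 ?V x" for x
    proof -
      have "m x \<le> Q * nrm2 ?V x"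
        unfolding m_def Q_def k_def by (rule hub_inequality(1)[OF ug A(1) _ s]) simp
      then have "qf E x \<le> (C1 + Q) * nrm2 ?V x" using split[of x] by (simp add: algebra_simps)
      also have "\<dots> \<le> ((1 + \<epsilon>) * Q) * nrm2 ?V x"
      proof (rule mult_right_mono[OF _ N0])
        have "\<delta> * Q \<le> \<epsilon> * Q" using de qQ q by (intro mult_right_mono) auto
        then show "C1 + Q \<le> (1 + \<epsilon>) * Q" using C1 by (simp add: algebra_simps)
      qed
      finally show ?thesis .
    qed
    have "\<exists>H\<subseteq>?V. card H = s - 1 \<and> (\<forall>h\<in>H. (1 - \<epsilon>) * n \<le> card (E `` {h}))"
      if x: "0 < nrm2 ?V x" "(Q - C0) * nrm2 ?V x \<le> qf E x" for x
    proof -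
      have "(Q - C0 - C1) * nrm2 ?V x \<le> m x" using split[of x] x(2) by (simp add: algebra_simps)
      moreover have "((1 - \<delta>) * Q) * nrm2 ?V x \<le> (Q - C0 - C1) * nrm2 ?V x"
        using C1 by (intro mult_right_mono[OF _ N0]) (simp add: algebra_simps)
      ultimately have mx: "(1 - \<delta>) * Q * nrm2 ?V x \<le> m x" by simp
      have "s - 1 \<le> card {a \<in> A. (1 - \<epsilon>) * n \<le> card (E `` {a})}"
      proof (rule hub_inequality(2)[OF ug A(1) _ s mx[unfolded m_def Q_def k_def]])
        show "card ?V = n" by simp
        show "0 < nrm2 ?V x" by (rule x(1))
        show "0 < n" using n1 by simp
        show "\<delta> * (real s - 1 + 3 * (real s - 1)\<^sup>2 / \<epsilon>) < 1 / 10" using deP unfolding P_def k_def .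
      qed (rule ep de)+
      then obtain H where "H \<subseteq> {a \<in> A. (1 - \<epsilon>) * n \<le> card (E `` {a})}" "card H = s - 1"
        by (rule obtain_subset_with_card_n)
      then show ?thesis using A(1) by (intro exI[of _ H] conjI ballI) auto
    qed
    then have "\<forall>x. 0 < nrm2 ?V x \<longrightarrow> (Q - C0) * nrm2 ?V x \<le> qf E x \<longrightarrow>
      (\<exists>H\<subseteq>?V. card H = s - 1 \<and> (\<forall>h\<in>H. (1 - \<epsilon>) * n \<le> card (E `` {h})))" by simp
    with up show ?thesis unfolding Q_def by simp
  qed
  show ?thesis using main unfolding k_def by blast
qed

section \<open>Joining the hubs to all other vertices\<close>

lemma qf_block:
  assumes "finite U" "finite W"
  shows "qf (E \<inter> U \<times> W) x = (\<Sum>v\<in>U. x v * (\<Sum>w\<in>E `` {v} \<inter> W. x w))"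
proof -
  have "E \<inter> U \<times> W = Sigma U (\<lambda>v. E `` {v} \<inter> W)" by auto
  then have "qf (E \<inter> U \<times> W) x = (\<Sum>v\<in>U. \<Sum>w\<in>E `` {v} \<inter> W. x v * x w)"
    unfolding qf_def using assms by (simp add: sum.Sigma)
  then show ?thesis by (simp add: sum_distrib_left)
qed

lemma ad_split:
  assumes "ugraph V E" "U \<subseteq> V"
  shows "ad E x v = (\<Sum>w\<in>E `` {v} \<inter> U. x w) + (\<Sum>w\<in>E `` {v} \<inter> (V - U). x w)"
proof -
  note u = ugraphD[OF assms(1)]
  have "E `` {v} = (E `` {v} \<inter> U) \<union> (E `` {v} \<inter> (V - U))" using u(3) by auto
  then have "sum x (E `` {v}) = sum x ((E `` {v} \<inter> U) \<union> (E `` {v} \<inter> (V - U)))" by simp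
  then show ?thesis unfolding ad_def using u(2)
    by (simp add: sum.union_disjoint finite_Image disjoint_iff)
qed

lemma eigvec_restrict:
  assumes ug: "ugraph V E" and x: "eigvec V E \<mu> x" and U: "U \<subseteq> V"
  shows "\<mu> * nrm2 U x = qf (E \<inter> U \<times> U) x + qf (E \<inter> U \<times> (V - U)) x"
proof -
  note u = ugraphD[OF ug]
  have f: "finite U" "finite (V - U)" using U u(1) finite_subset by auto
  have "\<mu> * nrm2 U x = (\<Sum>v\<in>U. x v * (\<mu> * x v))" by (simp add: sum_distrib_left power2_eq_square algebra_simps)
  also have "\<dots> = (\<Sum>v\<in>U. x v * ad E x v)" using x U by (intro sum.cong) (auto simp: eigvec_def)
  also have "\<dots> = qf (E \<inter> U \<times> U) x + qf (E \<inter> U \<times> (V - U)) x"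
    unfolding qf_block[OF f(1) f(1)] qf_block[OF f(1) f(2)] ad_split[OF ug U]
    by (simp add: distrib_left sum.distrib)
  finally show ?thesis .
qed

text \<open>\<open>E'\<close> rewires \<open>R1\<close> so that each of its vertices sees exactly \<open>K\<close>; the new entries \<open>sum x K / \<mu>\<close>
  are what the eigenvalue equation prescribes at such vertices.\<close>

lemma rank_one_test_vector:
  fixes \<mu> \<sigma> :: real and x :: "'a \<Rightarrow> real" and K R1 :: "'a set"
  assumes ug: "ugraph V E" and x: "eigvec V E \<mu> x" and KR: "K \<subseteq> V" "R1 \<subseteq> V" "K \<inter> R1 = {}" and l: "\<mu> \<noteq> 0"
  defines "\<sigma> \<equiv> sum x K" and "E' \<equiv> (E \<inter> (V - R1) \<times> (V - R1)) \<union> K \<times> R1 \<union> R1 \<times> K"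
    and "x' \<equiv> (\<lambda>v. if v \<in> R1 then sum x K / \<mu> else x v)"
  shows "qf E' x' - \<mu> * nrm2 V x' = card R1 * \<sigma>\<^sup>2 / \<mu> - qf (E \<inter> R1 \<times> (V - R1)) x"
proof -
  note u = ugraphD[OF ug]
  have f: "finite K" "finite R1" "finite (V - R1)" using KR u(1) finite_subset by auto
  have "qf E' x' = qf (E \<inter> (V - R1) \<times> (V - R1)) x' + qf (K \<times> R1 \<union> R1 \<times> K) x'"
    by (rule qf_Un) (use u f KR in \<open>auto simp: E'_def\<close>)
  also have "qf (K \<times> R1 \<union> R1 \<times> K) x' = qf (K \<times> R1) x' + qf (R1 \<times> K) x'"
    by (rule qf_Un) (use u f KR in auto)
  also have "qf (R1 \<times> K) x' = qf (K \<times> R1) x'"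
    using qf_converse[of "K \<times> R1" x'] by (simp add: converse_Times)
  also have "qf (K \<times> R1) x' = sum x' K * sum x' R1"
    unfolding qf_def by (simp add: sum_product sum.cartesian_product)
  also have "sum x' K = \<sigma>" unfolding \<sigma>_def x'_def using KR by (intro sum.cong) auto
  also have "sum x' R1 = card R1 * (\<sigma> / \<mu>)" by (simp add: x'_def \<sigma>_def)
  also have "qf (E \<inter> (V - R1) \<times> (V - R1)) x' = qf (E \<inter> (V - R1) \<times> (V - R1)) x"
    unfolding qf_def by (rule sum.cong) (auto simp: x'_def)
  finally have 1: "qf E' x' = qf (E \<inter> (V - R1) \<times> (V - R1)) x + 2 * (card R1 * \<sigma>\<^sup>2 / \<mu>)"
    by (simp add: power2_eq_square)
  have "nrm2 V x' = nrm2 (V - R1) x' + nrm2 R1 x'" by (rule sum.subset_diff[OF KR(2) u(1)])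
  also have "nrm2 (V - R1) x' = nrm2 (V - R1) x" by (rule sum.cong) (auto simp: x'_def)
  also have "nrm2 R1 x' = card R1 * (\<sigma> / \<mu>)\<^sup>2" by (simp add: x'_def \<sigma>_def)
  finally have 2: "\<mu> * nrm2 V x' = \<mu> * nrm2 (V - R1) x + card R1 * \<sigma>\<^sup>2 / \<mu>"
    using l by (simp add: power2_eq_square distrib_left)
  have "V - (V - R1) = R1" using KR by auto
  then have 3: "\<mu> * nrm2 (V - R1) x = qf (E \<inter> (V - R1) \<times> (V - R1)) x + qf (E \<inter> (V - R1) \<times> R1) x"
    using eigvec_restrict[OF ug x, of "V - R1"] by simp
  have "E \<inter> (V - R1) \<times> R1 = (E \<inter> R1 \<times> (V - R1))\<inverse>" using u(4) by auto
  then have 4: "qf (E \<inter> (V - R1) \<times> R1) x = qf (E \<inter> R1 \<times> (V - R1)) x" by (simp add: qf_converse)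
  show ?thesis unfolding 1 2 3 4 by simp
qed

text \<open>Arcs inside \<open>R0\<close> are handled by the degree bound. All others number at most
  a constant times \<open>card R1\<close>, and the Frobenius bound turns this count into a square
  root, which is small against the eigenvalue.\<close>

lemma abs_qf_rest:
  assumes ug: "ugraph V E" and R: "R0 \<subseteq> V" "R1 \<subseteq> V" "R0 \<inter> R1 = {}"
    and deg: "\<And>v. v \<in> R0 \<union> R1 \<Longrightarrow> card (E `` {v} \<inter> R0) \<le> \<tau>"
    and sparse: "card (E \<inter> R1 \<times> R1) \<le> c * card R1"
  shows "\<bar>qf (E \<inter> (R0 \<union> R1) \<times> (R0 \<union> R1)) y\<bar> \<le> (\<tau> + sqrt ((2 * \<tau> + c) * card R1)) * nrm2 (R0 \<union> R1) y"
proof -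
  note u = ugraphD[OF ug]
  let ?R = "R0 \<union> R1"
  have f: "finite R0" "finite R1" "finite ?R" using R u(1) finite_subset by auto
  define F where "F = E \<inter> R1 \<times> R0 \<union> E \<inter> R0 \<times> R1 \<union> E \<inter> R1 \<times> R1"
  have split: "qf (E \<inter> ?R \<times> ?R) y = qf (E \<inter> R0 \<times> R0) y + qf F y"
    by (rule qf_Un) (use u R in \<open>auto simp: F_def\<close>)
  have "2 * (\<Sum>(u, v)\<in>E \<inter> R0 \<times> R0. \<bar>y u\<bar> * \<bar>y v\<bar>) \<le> (1 * real \<tau> + real \<tau> / 1) * nrm2 ?R y"
  proof (rule sum_arcs_le_deg)
    fix v
    have eq: "(E \<inter> R0 \<times> R0)\<inverse> = E \<inter> R0 \<times> R0" using u(4) by auto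
    show c1: "real (card ((E \<inter> R0 \<times> R0) `` {v})) \<le> real \<tau>"
    proof (cases "v \<in> R0")
      case True
      then have "(E \<inter> R0 \<times> R0) `` {v} = E `` {v} \<inter> R0" by auto
      then show ?thesis using deg[of v] True by simp
    next
      case False
      then have "(E \<inter> R0 \<times> R0) `` {v} = {}" by auto
      then show ?thesis by simp
    qed
    show "real (card ((E \<inter> R0 \<times> R0)\<inverse> `` {v})) \<le> real \<tau>" unfolding eq by (rule c1)
  qed (use f in auto)
  then have 1: "\<bar>qf (E \<inter> R0 \<times> R0) y\<bar> \<le> \<tau> * nrm2 ?R y"
    using abs_qf_le[of "E \<inter> R0 \<times> R0" y] by simp
  have c10: "card (E \<inter> R1 \<times> R0) \<le> \<tau> * card R1"
  proof -
    have "E \<inter> R1 \<times> R0 = Sigma R1 (\<lambda>v. E `` {v} \<inter> R0)" by auto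
    then have "card (E \<inter> R1 \<times> R0) = (\<Sum>v\<in>R1. card (E `` {v} \<inter> R0))" using f by simp
    also have "\<dots> \<le> (\<Sum>v\<in>R1. \<tau>)" using deg by (intro sum_mono) auto
    finally show ?thesis by (simp add: mult.commute)
  qed
  have "E \<inter> R0 \<times> R1 = (E \<inter> R1 \<times> R0)\<inverse>" using u(4) by auto
  then have "card (E \<inter> R0 \<times> R1) = card (E \<inter> R1 \<times> R0)" by simp
  then have "card F \<le> (2 * \<tau> + c) * card R1"
    unfolding F_def using c10 sparse card_Un_le[of "E \<inter> R1 \<times> R0 \<union> E \<inter> R0 \<times> R1" "E \<inter> R1 \<times> R1"]
      card_Un_le[of "E \<inter> R1 \<times> R0" "E \<inter> R0 \<times> R1"] by (simp add: algebra_simps)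
  then have "real (card F) \<le> real ((2 * \<tau> + c) * card R1)" by (rule of_nat_mono)
  then have "sqrt (card F) \<le> sqrt ((2 * \<tau> + c) * card R1)" by (rule real_sqrt_le_mono)
  then have "sqrt (card F) * nrm2 ?R y \<le> sqrt ((2 * \<tau> + c) * card R1) * nrm2 ?R y"
    by (intro mult_right_mono) (auto simp: sum_nonneg)
  moreover have "\<bar>qf F y\<bar> \<le> sqrt (card F) * nrm2 ?R y"
    by (rule abs_qf_le_card) (use f in \<open>auto simp: F_def\<close>)
  ultimately show ?thesis using 1 split by (simp add: algebra_simps)
qed

text \<open>By \<open>rank_one_test_vector\<close> it has to be shown that \<open>\<mu>\<close>
  times the form on \<open>R1 \<times> (V - R1)\<close> is less than
  \<open>card R1 * \<sigma>\<^sup>2\<close>. The hub entries are nearly equal, hence close to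
  \<open>\<sigma> / k\<close>, and a vertex of \<open>R1\<close> misses at least one hub, so its
  neighbour sum outside \<open>R1\<close> falls short of \<open>\<sigma>\<close> by a fixed
  proportion. The conclusion carries the factor \<open>\<mu>\<close> so that it covers both ends of
  the spectrum: the form exceeds the Rayleigh level at a positive eigenvalue and falls below it at a
  negative one.\<close>

lemma hub_completion_increases:
  fixes V :: "nat set" and \<mu> e \<rho> :: real and \<tau> c k :: nat
  assumes ug: "ugraph V E" and x: "eigvec V E \<mu> x" and K: "K \<subseteq> V" "card K = k" "k \<ge> 1" "card V = n" "n \<ge> 1"
  defines "R0 \<equiv> {v \<in> V - K. \<forall>h\<in>K. (h, v) \<in> E}" defines "R1 \<equiv> V - K - R0"
  assumes deg: "\<And>v. v \<in> V - K \<Longrightarrow> card (E `` {v} \<inter> R0) \<le> \<tau>"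
    and sparse: "card (E \<inter> R1 \<times> R1) \<le> c * card R1"
    and ne: "R1 \<noteq> {}"
    and e: "e > 0" "4 * real k * real (k + \<tau>) * e \<le> 1"
    and rho: "sqrt (card R1) \<le> \<rho>"
    and L0: "sqrt (real k * real n) \<le> 2 * \<bar>\<mu>\<bar>"
    and L1: "2 * sqrt k + 8 * \<rho> \<le> e * \<bar>\<mu>\<bar>" and L2: "sqrt k + 4 * sqrt \<tau> + 4 * \<rho> \<le> e * \<bar>\<mu>\<bar>"
    and L3: "\<tau> + sqrt ((2 * \<tau> + c) * card R1) \<le> \<bar>\<mu>\<bar> / (4 * k)"
  defines "E' \<equiv> (E \<inter> (V - R1) \<times> (V - R1)) \<union> K \<times> R1 \<union> R1 \<times> K"
  shows "\<exists>x'. 0 < \<mu> * (qf E' x' - \<mu> * nrm2 V x')"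
proof -
  note u = ugraphD[OF ug]
  let ?L = "\<bar>\<mu>\<bar>" and ?R = "R0 \<union> R1"
  have R: "?R = V - K" "R0 \<inter> R1 = {}" "R0 \<subseteq> V" "R1 \<subseteq> V" "K \<inter> R1 = {}" "K \<inter> R0 = {}"
    by (auto simp: R0_def R1_def)
  have VR: "V - ?R = K" using K R by auto
  have f: "finite K" "finite R0" "finite R1" "finite ?R" using K R u(1) finite_subset by auto
  have k1: "real k \<ge> 1" using K by simp
  define Q where "Q = sqrt (k * n)"
  have Q: "Q > 0" using K by (simp add: Q_def)
  have L: "?L > 0" "\<mu> \<noteq> 0" using L0 Q by (auto simp: Q_def)
  define X where "X = sqrt (nrm2 K x)"
  define Y where "Y = sqrt (nrm2 ?R x)"
  have X0: "X \<ge> 0" "X\<^sup>2 = nrm2 K x" and Y0: "Y \<ge> 0" "Y\<^sup>2 = nrm2 ?R x" by (auto simp: X_def Y_def sum_nonneg)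
  define r where "r = card R1"
  have r1: "r \<ge> 1" using ne f by (simp add: r_def Suc_le_eq card_gt_0_iff)
  have rho0: "\<rho> \<ge> 0" using rho by (meson order_trans real_sqrt_ge_zero of_nat_0_le_iff)
  have sumK: "\<bar>sum x A\<bar> \<le> sqrt k * X" if "A \<subseteq> K" for A
    unfolding X_def using that f K card_mono[OF f(1) that] by (intro abs_sum_le_sqrt) auto
  \<comment> \<open>The hubs carry a fixed share of the mass: outside them the form is small against
    \<open>\<mu>\<close>, so the eigenvalue equation must be fed by the hub entries.\<close>
  have YX: "Y \<le> 4 * X"
  proof (cases "Y = 0")
    case False
    then have Yp: "Y > 0" using Y0 by simp
    have a: "\<bar>qf (E \<inter> ?R \<times> K) x\<bar> \<le> Y * (Q * X)"
    proof -
      define g where "g v = (\<Sum>w\<in>E `` {v} \<inter> K. x w)" for v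
      have "nrm2 ?R g \<le> (\<Sum>v\<in>?R. k * X\<^sup>2)"
      proof (rule sum_mono)
        fix v
        have "\<bar>g v\<bar> \<le> sqrt k * X" unfolding g_def by (rule sumK) auto
        then have "\<bar>g v\<bar>\<^sup>2 \<le> (sqrt k * X)\<^sup>2" by (intro power_mono) auto
        then show "(g v)\<^sup>2 \<le> k * X\<^sup>2" by (simp add: power_mult_distrib)
      qed
      also have "\<dots> \<le> n * (k * X\<^sup>2)"
      proof -
        have "card ?R \<le> n" unfolding K(4)[symmetric] using R u(1) by (intro card_mono) auto
        then show ?thesis by (simp add: mult_right_mono)
      qed
      finally have g2: "nrm2 ?R g \<le> (Q * X)\<^sup>2" by (simp add: Q_def power_mult_distrib ac_simps)
      have "(qf (E \<inter> ?R \<times> K) x)\<^sup>2 = (\<Sum>v\<in>?R. x v * g v)\<^sup>2" unfolding qf_block[OF f(4,1)] g_def ..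
      also have "\<dots> \<le> nrm2 ?R x * nrm2 ?R g" by (rule cauchy_schwarz_sum)
      also have "\<dots> \<le> Y\<^sup>2 * (Q * X)\<^sup>2" unfolding Y0(2) by (intro mult_left_mono g2) (simp add: sum_nonneg)
      finally have "\<bar>qf (E \<inter> ?R \<times> K) x\<bar>\<^sup>2 \<le> (Y * (Q * X))\<^sup>2" by (simp add: power_mult_distrib)
      then show ?thesis by (rule power2_le_imp_le) (use Y0 X0 Q in simp)
    qed
    have "?L * Y\<^sup>2 = \<bar>qf (E \<inter> ?R \<times> ?R) x + qf (E \<inter> ?R \<times> K) x\<bar>"
          proof -
      have "?R \<subseteq> V" using R(3,4) by blast
      from eigvec_restrict[OF ug x this] have "\<mu> * Y\<^sup>2 = qf (E \<inter> ?R \<times> ?R) x + qf (E \<inter> ?R \<times> K) x"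
        unfolding VR Y0(2) .
      from this[symmetric] show ?thesis by (simp add: abs_mult)
    qed
    also have "\<dots> \<le> ?L / (4 * k) * Y\<^sup>2 + Y * (Q * X)"
    proof -
      have "\<bar>qf (E \<inter> ?R \<times> ?R) x\<bar> \<le> (\<tau> + sqrt ((2 * \<tau> + c) * card R1)) * Y\<^sup>2" unfolding Y0(2)
        by (rule abs_qf_rest[OF ug R(3,4,2)]) (use deg sparse R in auto)
      also have "\<dots> \<le> ?L / (4 * k) * Y\<^sup>2" using L3 by (intro mult_right_mono) auto
      finally show ?thesis using a by linarith
    qed
    also have "?L / (4 * k) * Y\<^sup>2 \<le> ?L / 4 * Y\<^sup>2" using k1 L by (intro mult_right_mono) (auto simp: field_simps)
    finally have "Y * (3 / 4 * ?L * Y) \<le> Y * (Q * X)" by (simp add: power2_eq_square algebra_simps)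
    then have "3 / 4 * ?L * Y \<le> Q * X" using Yp by simp
    moreover have "3 / 4 * (Q / 2) * Y \<le> 3 / 4 * ?L * Y" using L0 Y0 by (intro mult_right_mono) (auto simp: Q_def)
    ultimately have "Q * (3 / 8 * Y) \<le> Q * X" by (simp add: algebra_simps)
    then have "3 / 8 * Y \<le> X" using Q by simp
    then show ?thesis using X0 by simp
  qed (use X0 in simp)
  have Xp: "X > 0"
  proof (rule ccontr)
    assume "\<not> X > 0"
    then have "X = 0" "Y = 0" using X0 Y0 YX by auto
    then have "\<forall>v\<in>K. x v = 0" "\<forall>v\<in>?R. x v = 0" using f unfolding X_def Y_def
      by (simp_all add: sum_nonneg_eq_0_iff)
    then show False using x K R(1) by (auto simp: eigvec_def)
  qed
  have sumR1: "\<bar>sum x A\<bar> \<le> 4 * \<rho> * X" if "A \<subseteq> R1" for A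
  proof -
    have "\<bar>sum x A\<bar> \<le> sqrt r * Y" unfolding Y_def r_def
      using that f card_mono[OF f(3) that] by (intro abs_sum_le_sqrt) auto
    also have "\<dots> \<le> \<rho> * (4 * X)" using rho YX Y0 rho0 by (intro mult_mono) (auto simp: r_def)
    finally show ?thesis by simp
  qed
  define \<sigma> where "\<sigma> = sum x K"
  have adR: "ad E x v = (\<Sum>w\<in>E `` {v} \<inter> K. x w) + (\<Sum>w\<in>E `` {v} \<inter> R0. x w) + (\<Sum>w\<in>E `` {v} \<inter> R1. x w)" for v
  proof -
    have "E `` {v} \<inter> ?R = (E `` {v} \<inter> R0) \<union> (E `` {v} \<inter> R1)" by auto
    then have "sum x (E `` {v} \<inter> ?R) = sum x (E `` {v} \<inter> R0) + sum x (E `` {v} \<inter> R1)"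
      using f R by (simp only:, subst sum.union_disjoint) auto
    then show ?thesis using ad_split[OF ug K(1), of x v] R(1) by simp
  qed
  \<comment> \<open>All hubs see the whole of \<open>R0\<close>, so their equations differ only in
    sums over \<open>K\<close> and \<open>R1\<close>.\<close>
  have diff: "\<bar>x h - x h'\<bar> \<le> X * e" if h: "h \<in> K" "h' \<in> K" for h h'
  proof -
    have eq: "E `` {h} \<inter> R0 = R0" if "h \<in> K" for h using that by (auto simp: R0_def)
    have "\<mu> * x h = ad E x h" "\<mu> * x h' = ad E x h'" using x h K by (auto simp: eigvec_def)
    then have "\<mu> * (x h - x h') = (\<Sum>w\<in>E `` {h} \<inter> K. x w) - (\<Sum>w\<in>E `` {h'} \<inter> K. x w)
       + ((\<Sum>w\<in>E `` {h} \<inter> R1. x w) - (\<Sum>w\<in>E `` {h'} \<inter> R1. x w))"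
      unfolding adR eq[OF h(1)] eq[OF h(2)] by (simp add: algebra_simps)
    also have "\<bar>\<dots>\<bar> \<le> 2 * (sqrt k * X) + 2 * (4 * \<rho> * X)"
      using sumK[of "E `` {h} \<inter> K"] sumK[of "E `` {h'} \<inter> K"] sumR1[of "E `` {h} \<inter> R1"] sumR1[of "E `` {h'} \<inter> R1"]
      by auto
    also have "\<dots> = (2 * sqrt k + 8 * \<rho>) * X" by (simp add: algebra_simps)
    also have "\<dots> \<le> e * ?L * X" using L1 Xp by (intro mult_right_mono) auto
    finally have "?L * \<bar>x h - x h'\<bar> \<le> ?L * (X * e)" unfolding abs_mult by (simp add: ac_simps)
    then show ?thesis using L by simp
  qed
  have entR0: "\<bar>x w\<bar> \<le> X * e" if w: "w \<in> R0" for w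
  proof -
    have "w \<in> V" using w R by auto
    then have "\<mu> * x w = ad E x w" using x by (auto simp: eigvec_def)
    also have "\<bar>\<dots>\<bar> \<le> sqrt k * X + sqrt \<tau> * (4 * X) + 4 * \<rho> * X"
    proof -
      have "\<bar>\<Sum>v\<in>E `` {w} \<inter> R0. x v\<bar> \<le> sqrt \<tau> * Y" unfolding Y_def
        using f deg[of w] w R by (intro abs_sum_le_sqrt) auto
      also have "\<dots> \<le> sqrt \<tau> * (4 * X)" using YX by (intro mult_left_mono) auto
      finally show ?thesis unfolding adR using sumK[of "E `` {w} \<inter> K"] sumR1[of "E `` {w} \<inter> R1"] by auto
    qed
    also have "\<dots> = (sqrt k + 4 * sqrt \<tau> + 4 * \<rho>) * X" by (simp add: algebra_simps)
    also have "\<dots> \<le> e * ?L * X" using L2 Xp by (intro mult_right_mono) auto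
    finally have "?L * \<bar>x w\<bar> \<le> ?L * (X * e)" unfolding abs_mult by (simp add: ac_simps)
    then show ?thesis using L by simp
  qed
  have hub: "\<bar>x h\<bar> \<le> \<bar>\<sigma>\<bar> / k + X * e" if h: "h \<in> K" for h
  proof -
    have "k * x h - \<sigma> = (\<Sum>h'\<in>K. x h - x h')" by (simp add: sum_subtractf K(2) \<sigma>_def)
    also have "\<bar>\<dots>\<bar> \<le> (\<Sum>h'\<in>K. X * e)" by (rule order_trans[OF sum_abs], rule sum_mono) (use diff h in auto)
    finally have "\<bar>k * x h - \<sigma>\<bar> \<le> k * (X * e)" by (simp add: K(2))
    then have "\<bar>k * x h\<bar> \<le> \<bar>\<sigma>\<bar> + k * (X * e)" by linarith
    then have "k * \<bar>x h\<bar> \<le> k * (\<bar>\<sigma>\<bar> / k + X * e)" using k1 by (simp add: abs_mult distrib_left)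
    then show ?thesis using k1 by simp
  qed
  have ke: "k * e \<le> 1 / 4" "2 * (k + \<tau>) * e \<le> 1 / (2 * k)"
  proof -
    show *: "2 * (k + \<tau>) * e \<le> 1 / (2 * k)" using e k1 by (simp add: field_simps)
    have "2 * k * e \<le> 2 * (k + \<tau>) * e" using e by (intro mult_right_mono) auto
    also have "\<dots> \<le> 1 / (2 * k)" by (rule *)
    also have "\<dots> \<le> 1 / 2" using k1 by simp
    finally show "k * e \<le> 1 / 4" by simp
  qed
  \<comment> \<open>Nearly equal entries cannot cancel, so the hub sum is comparable to the norm on
    the hubs.\<close>
  have sig: "X \<le> 2 * \<bar>\<sigma>\<bar>"
  proof -
    define b where "b = \<bar>\<sigma>\<bar> / k + X * e"
    have b0: "b \<ge> 0" using e X0 by (simp add: b_def)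
    have "X\<^sup>2 \<le> (\<Sum>h\<in>K. b\<^sup>2)" unfolding X0(2)
    proof (rule sum_mono)
      fix h assume "h \<in> K"
      then have "\<bar>x h\<bar>\<^sup>2 \<le> b\<^sup>2" using hub by (intro power_mono) (auto simp: b_def)
      then show "(x h)\<^sup>2 \<le> b\<^sup>2" by simp
    qed
    also have "\<dots> = k * b\<^sup>2" by (simp add: K(2))
    also have "\<dots> \<le> (k * b)\<^sup>2"
    proof -
      have "1 * (k * b\<^sup>2) \<le> k * (k * b\<^sup>2)" using k1 by (intro mult_right_mono) auto
      then show ?thesis by (simp only: mult_1 power2_eq_square ac_simps)
    qed
    finally have "X \<le> k * b" by (rule power2_le_imp_le) (use b0 in simp)
    also have "\<dots> = \<bar>\<sigma>\<bar> + k * e * X" using k1 by (simp add: b_def field_simps)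
    also have "\<dots> \<le> \<bar>\<sigma>\<bar> + 1 / 4 * X" using ke X0 by (intro add_left_mono mult_right_mono) auto
    finally show ?thesis using abs_ge_zero[of \<sigma>] by linarith
  qed
  define W where "W = qf (E \<inter> R1 \<times> (V - R1)) x"
  define M where "M v = (\<Sum>w\<in>E `` {v} \<inter> (V - R1). x w)" for v
  have fVR: "finite (V - R1)" using u(1) by simp
  have W: "W = (\<Sum>v\<in>R1. x v * M v)" unfolding W_def M_def by (rule qf_block[OF f(3) fVR])
  define q where "q = 1 - 1 / (2 * real k)"
  have q0: "q \<ge> 0" using k1 by (simp add: q_def)
  \<comment> \<open>At most \<open>k - 1\<close> hubs contribute \<open>\<sigma> / k\<close> each.
    Half of the missing share \<open>1 / k\<close> is spent on the error terms, which leaves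
    \<open>q\<close>.\<close>
  have Mv: "\<bar>M v\<bar> \<le> \<bar>\<sigma>\<bar> * q" if v: "v \<in> R1" for v
  proof -
    have vV: "v \<in> V - K" "v \<notin> R0" using v by (auto simp: R1_def)
    have "E `` {v} \<inter> (V - R1) = (E `` {v} \<inter> K) \<union> (E `` {v} \<inter> R0)" using u(3) by (auto simp: R1_def R0_def)
    then have "M v = (\<Sum>w\<in>E `` {v} \<inter> K. x w) + (\<Sum>w\<in>E `` {v} \<inter> R0. x w)"
      unfolding M_def using f R by (simp only:, subst sum.union_disjoint) auto
    moreover have "\<bar>\<Sum>w\<in>E `` {v} \<inter> K. x w\<bar> \<le> (real k - 1) * (\<bar>\<sigma>\<bar> / k + X * e)"
    proof -
      obtain h where "h \<in> K" "(h, v) \<notin> E" using vV by (auto simp: R0_def)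
      then have "E `` {v} \<inter> K \<subset> K" using u(4) by auto
      then have "card (E `` {v} \<inter> K) < k" using psubset_card_mono[OF f(1)] K(2) by auto
      then have ck: "real (card (E `` {v} \<inter> K)) \<le> real k - 1" by linarith
      have "\<bar>\<Sum>w\<in>E `` {v} \<inter> K. x w\<bar> \<le> (\<Sum>w\<in>E `` {v} \<inter> K. \<bar>\<sigma>\<bar> / k + X * e)"
        by (rule order_trans[OF sum_abs], rule sum_mono) (use hub in auto)
      also have "\<dots> = card (E `` {v} \<inter> K) * (\<bar>\<sigma>\<bar> / k + X * e)" by simp
      also have "\<dots> \<le> (real k - 1) * (\<bar>\<sigma>\<bar> / k + X * e)" using ck e X0 by (intro mult_right_mono) auto
      finally show ?thesis .
    qed
    moreover have "\<bar>\<Sum>w\<in>E `` {v} \<inter> R0. x w\<bar> \<le> \<tau> * (X * e)"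
    proof -
      have "\<bar>\<Sum>w\<in>E `` {v} \<inter> R0. x w\<bar> \<le> (\<Sum>w\<in>E `` {v} \<inter> R0. X * e)"
        by (rule order_trans[OF sum_abs], rule sum_mono) (use entR0 in auto)
      also have "\<dots> = card (E `` {v} \<inter> R0) * (X * e)" by simp
      also have "\<dots> \<le> \<tau> * (X * e)" using deg[OF vV(1)] e X0 by (intro mult_right_mono) auto
      finally show ?thesis .
    qed
    ultimately have "\<bar>M v\<bar> \<le> (real k - 1) * (\<bar>\<sigma>\<bar> / k + X * e) + \<tau> * (X * e)" by linarith
    also have "\<dots> = \<bar>\<sigma>\<bar> * (1 - 1 / k) + X * ((real k - 1 + \<tau>) * e)" using k1 by (simp add: field_simps)
    also have "X * ((real k - 1 + \<tau>) * e) \<le> (2 * \<bar>\<sigma>\<bar>) * ((k + \<tau>) * e)"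
    proof (rule mult_mono)
      show "(real k - 1 + \<tau>) * e \<le> (k + \<tau>) * e" using e by (intro mult_right_mono) auto
      show "0 \<le> (real k - 1 + \<tau>) * e" using e k1 by (intro mult_nonneg_nonneg) auto
    qed (use sig in auto)
    also have "\<dots> = \<bar>\<sigma>\<bar> * (2 * (k + \<tau>) * e)" by simp
    also have "\<dots> \<le> \<bar>\<sigma>\<bar> * (1 / (2 * k))" using ke(2) by (intro mult_left_mono) auto
    finally show ?thesis by (simp add: q_def algebra_simps)
  qed
  have WL: "?L * \<bar>W\<bar> < r * \<sigma>\<^sup>2"
  proof -
    define y where "y = nrm2 R1 x"
    have y0: "y \<ge> 0" by (simp add: y_def sum_nonneg)
    define B where "B = r * \<sigma>\<^sup>2 * q\<^sup>2"
    have sp: "\<sigma>\<^sup>2 > 0" using sig Xp by auto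
    have W2: "W\<^sup>2 \<le> y * nrm2 R1 M" unfolding W y_def by (rule cauchy_schwarz_sum)
    have "nrm2 R1 M \<le> (\<Sum>v\<in>R1. \<sigma>\<^sup>2 * q\<^sup>2)"
    proof (rule sum_mono)
      fix v assume "v \<in> R1"
      then have "\<bar>M v\<bar>\<^sup>2 \<le> (\<bar>\<sigma>\<bar> * q)\<^sup>2" using Mv by (intro power_mono) auto
      then show "(M v)\<^sup>2 \<le> \<sigma>\<^sup>2 * q\<^sup>2" by (simp add: power_mult_distrib)
    qed
    also have "\<dots> = B" by (simp add: B_def r_def)
    finally have "y * nrm2 R1 M \<le> y * B" using y0 by (rule mult_left_mono)
    with W2 have W2: "W\<^sup>2 \<le> y * B" by linarith
    have "?L * y = \<bar>qf (E \<inter> R1 \<times> R1) x + W\<bar>"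
      unfolding W_def eigvec_restrict[OF ug x R(4), symmetric] y_def[symmetric] using y0 by (simp add: abs_mult)
    moreover have "\<bar>qf (E \<inter> R1 \<times> R1) x\<bar> \<le> ?L / (4 * k) * y"
    proof -
      have "\<bar>qf (E \<inter> R1 \<times> R1) x\<bar> \<le> sqrt (card (E \<inter> R1 \<times> R1)) * y" unfolding y_def
        by (rule abs_qf_le_card) (use f in auto)
      also have "\<dots> \<le> ?L / (4 * k) * y"
      proof (rule mult_right_mono[OF _ y0])
        have "card (E \<inter> R1 \<times> R1) \<le> (2 * \<tau> + c) * card R1" using sparse by (simp add: algebra_simps)
        then have "real (card (E \<inter> R1 \<times> R1)) \<le> real ((2 * \<tau> + c) * card R1)" by (rule of_nat_mono)
        then have "sqrt (card (E \<inter> R1 \<times> R1)) \<le> sqrt ((2 * \<tau> + c) * card R1)" by (rule real_sqrt_le_mono)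
        then show "sqrt (card (E \<inter> R1 \<times> R1)) \<le> ?L / (4 * k)" using L3 by linarith
      qed
      finally show ?thesis .
    qed
    ultimately have "?L * y - ?L / (4 * k) * y \<le> \<bar>W\<bar>" by linarith
    then have yW: "?L * (1 - 1 / (4 * k)) * y \<le> \<bar>W\<bar>" by (simp add: algebra_simps)
    \<comment> \<open>The form inside \<open>R1\<close> costs the factor \<open>p\<close>.
      Strictness of the final estimate rests on \<open>q\<^sup>2 < p\<close>.\<close>
    define p where "p = 1 - 1 / (4 * real k)"
    have p: "p > 0" "q\<^sup>2 < p"
    proof -
      define z where "z = 1 / (4 * real k)"
      have z: "0 < z" "z \<le> 1 / 4" using k1 by (auto simp: z_def field_simps)
      have qz: "q = 1 - 2 * z" "p = 1 - z" by (simp_all add: q_def p_def z_def)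
      have "z * z \<le> 1 / 4 * z" using z by (intro mult_right_mono) auto
      moreover have "(1 - 2 * z)\<^sup>2 = 1 - 4 * z + 4 * (z * z)" by (simp add: power2_eq_square algebra_simps)
      ultimately show "p > 0" "q\<^sup>2 < p" unfolding qz using z by linarith+
    qed
    have B0: "B \<ge> 0" by (simp add: B_def)
    have "?L * p * \<bar>W\<bar> \<le> B"
    proof (cases "W = 0")
      case False
      have "?L * p * \<bar>W\<bar> * \<bar>W\<bar> = ?L * p * W\<^sup>2" by (simp add: power2_eq_square)
      also have "\<dots> \<le> ?L * p * (y * B)" using W2 L p by (intro mult_left_mono) auto
      also have "\<dots> = (?L * p * y) * B" by simp
      also have "\<dots> \<le> \<bar>W\<bar> * B" using yW B0 by (intro mult_right_mono) (auto simp: p_def)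
      finally have "(?L * p * \<bar>W\<bar>) * \<bar>W\<bar> \<le> B * \<bar>W\<bar>" by (simp add: mult.commute)
      then show ?thesis using False by simp
    qed (use B0 in simp)
    also have "B < r * \<sigma>\<^sup>2 * p" unfolding B_def using p(2) r1 sp by (intro mult_strict_left_mono) auto
    finally have "p * (?L * \<bar>W\<bar>) < p * (r * \<sigma>\<^sup>2)" by (simp add: algebra_simps)
    then show ?thesis using p by simp
  qed
  have "\<mu> * W \<le> ?L * \<bar>W\<bar>" using abs_ge_self[of "\<mu> * W"] by (simp only: abs_mult)
  moreover have "\<mu> * (r * \<sigma>\<^sup>2 / \<mu> - W) = r * \<sigma>\<^sup>2 - \<mu> * W" using L by (simp add: algebra_simps)
  ultimately have pos: "0 < \<mu> * (r * \<sigma>\<^sup>2 / \<mu> - W)" using WL by linarith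
  show ?thesis
    using pos rank_one_test_vector[OF ug x K(1) R(4,5) L(2)] unfolding E'_def W_def r_def \<sigma>_def
    by (intro exI[of _ "\<lambda>v. if v \<in> R1 then sum x K / \<mu> else x v"]) simp
qed

text \<open>If no vertex misses a hub, the graph already has the required form. Otherwise at most
  \<open>k * \<epsilon> * n\<close> vertices do, and \<open>hub_completion_increases\<close>, used
  at \<open>p\<close> and at \<open>q\<close>, moves both eigenvalues strictly outwards. The bound
  \<open>12 * card R1 \<le> n\<close> is recorded for a later count of isolated vertices.\<close>

theorem hub_join_dominates:
  fixes s t :: nat
  assumes s: "2 \<le> s" and t: "1 \<le> t"
  shows "\<exists>\<epsilon> N. 0 < \<epsilon> \<and> \<epsilon> < (1::real) \<and> (\<forall>n\<ge>N. \<forall>E K p q. ugraph {..<n} E \<longrightarrow> Kst_free s t {..<n} E \<longrightarrow>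
    K \<subseteq> {..<n} \<longrightarrow> card K = s - 1 \<longrightarrow> (\<forall>h\<in>K. (1 - \<epsilon>) * n \<le> card (E `` {h})) \<longrightarrow>
    extremal_eig {..<n} E p q \<longrightarrow> sqrt ((real s - 1) * n) \<le> 2 * p \<longrightarrow> sqrt ((real s - 1) * n) \<le> - 2 * q \<longrightarrow>
    (\<exists>E' p' q'. ugraph {..<n} E' \<and> K \<times> ({..<n} - K) \<subseteq> E' \<and>
       (\<forall>v\<in>{..<n} - K. card (E' `` {v} \<inter> ({..<n} - K)) \<le> t - 1) \<and> extremal_eig {..<n} E' p' q' \<and>
       (\<exists>R1\<subseteq>{..<n} - K. 12 * card R1 \<le> n \<and>
         E' = E \<inter> ({..<n} - R1) \<times> ({..<n} - R1) \<union> K \<times> R1 \<union> R1 \<times> K) \<and>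
       (E' = E \<and> p' = p \<and> q' = q \<or> p - q < p' - q')))"
proof -
  obtain c :: nat where c: "\<And>V E W. Kst_free s t V E \<Longrightarrow> ugraph V E \<Longrightarrow> W \<subseteq> V \<Longrightarrow> card (E \<inter> W \<times> W) \<le> c * card W"
    using Kst_free_sparse[of s t] by blast
  define k where "k = s - 1"
  define \<tau> where "\<tau> = t - 1"
  have k: "k \<ge> 1" "real k \<ge> 1" and ks: "real s - 1 = real k" using s by (auto simp: k_def)
  define e where "e = 1 / (4 * real k * (k + \<tau> + 1))"
  have e0: "e > 0" using k by (simp add: e_def)
  have e1: "4 * k * (k + \<tau>) * e \<le> 1"
  proof -
    define b where "b = 4 * real k * (k + \<tau> + 1)"
    have "b > 0" unfolding b_def using k(2) by (intro mult_pos_pos) auto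
    moreover have "4 * k * (k + \<tau>) \<le> b" unfolding b_def by (simp add: algebra_simps)
    ultimately have "4 * k * (k + \<tau>) * (1 / b) \<le> 1" by simp
    then show ?thesis by (simp add: e_def b_def)
  qed
  define C where "C = sqrt (2 * \<tau> + c + 1)"
  have C: "C > 0" by (simp add: C_def)
  \<comment> \<open>\<open>g\<close> is the size allowed for \<open>sqrt (card R1)\<close> relative
    to \<open>Q\<close>: the first bound serves the estimates of single entries, the second the form
    outside the hubs. Since \<open>card R1\<close> is at most \<open>k * \<epsilon> * n\<close>,
    this dictates \<open>\<epsilon> = g\<^sup>2\<close>.\<close>
  define g where "g = min (min (e / 64) (1 / (32 * k * C))) (1 / 2)"
  have g: "g > 0" "g \<le> e / 64" "g \<le> 1 / (32 * k * C)" "g \<le> 1 / 2" using e0 C k by (auto simp: g_def)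
  define \<epsilon> where "\<epsilon> = g\<^sup>2"
  have ep: "0 < \<epsilon>" "\<epsilon> < 1" "sqrt \<epsilon> = g"
  proof -
    show "0 < \<epsilon>" "sqrt \<epsilon> = g" using g by (auto simp: \<epsilon>_def)
    have "g * g \<le> 1 / 2 * g" using g by (intro mult_right_mono) auto
    then show "\<epsilon> < 1" using g(4) unfolding \<epsilon>_def power2_eq_square by linarith
  qed
  define L0 where "L0 = 16 * (sqrt k + 4 * sqrt \<tau>) / e + 16 * real k * real \<tau>"
  define N where "N = max 1 (nat \<lceil>L0\<^sup>2\<rceil>)"
  have main: "\<exists>E' p' q'. ugraph {..<n} E' \<and> K \<times> ({..<n} - K) \<subseteq> E' \<and>
       (\<forall>v\<in>{..<n} - K. card (E' `` {v} \<inter> ({..<n} - K)) \<le> t - 1) \<and> extremal_eig {..<n} E' p' q' \<and>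
       (\<exists>R1\<subseteq>{..<n} - K. 12 * card R1 \<le> n \<and>
         E' = E \<inter> ({..<n} - R1) \<times> ({..<n} - R1) \<union> K \<times> R1 \<union> R1 \<times> K) \<and>
       (E' = E \<and> p' = p \<and> q' = q \<or> p - q < p' - q')"
    if n: "n \<ge> N" and ug: "ugraph {..<n} E" and free: "Kst_free s t {..<n} E" and KV: "K \<subseteq> {..<n}"
      and cK: "card K = s - 1" and hd: "\<forall>h\<in>K. (1 - \<epsilon>) * n \<le> card (E `` {h})" and ex: "extremal_eig {..<n} E p q"
      and p: "sqrt ((real s - 1) * n) \<le> 2 * p" and q: "sqrt ((real s - 1) * n) \<le> - 2 * q"
    for n E K p q
  proof -
    let ?V = "{..<n}"
    note u = ugraphD[OF ug]
    have fK: "finite K" using KV finite_subset by blast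
    have n1: "n \<ge> 1" and n2: "L0\<^sup>2 \<le> n" using n unfolding N_def by linarith+
    define R0 where "R0 = {v \<in> ?V - K. \<forall>h\<in>K. (h, v) \<in> E}"
    define R1 where "R1 = ?V - K - R0"
    have deg: "card (E `` {v} \<inter> R0) \<le> \<tau>" if v: "v \<in> ?V - K" for v
    proof -
      have "card (E `` {v} \<inter> R0) < t"
      \<comment> \<open>The hubs together with \<open>v\<close> are \<open>s\<close> vertices, all
        adjacent to every neighbour of \<open>v\<close> in \<open>R0\<close>.\<close>
      proof (rule Kst_free_common_nbrs[OF free, of "insert v K"])
        show "insert v K \<inter> (E `` {v} \<inter> R0) = {}" using u(5) by (auto simp: R0_def)
        show "insert v K \<times> (E `` {v} \<inter> R0) \<subseteq> E" by (auto simp: R0_def)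
        show "s \<le> card (insert v K)" using v fK cK s by auto
      qed (use v KV fK u in \<open>auto simp: R0_def\<close>)
      then show ?thesis by (simp add: \<tau>_def)
    qed
    show ?thesis
    proof (cases "R1 = {}")
      case True
      then have R: "R0 = ?V - K" by (auto simp: R1_def R0_def)
      then have "K \<times> (?V - K) \<subseteq> E" by (auto simp: R0_def)
      moreover have "\<exists>R1\<subseteq>?V - K. 12 * card R1 \<le> n \<and> E = E \<inter> (?V - R1) \<times> (?V - R1) \<union> K \<times> R1 \<union> R1 \<times> K"
        using u(3) by (intro exI[of _ "{}"]) auto
      ultimately show ?thesis using ug ex deg unfolding R \<tau>_def
        by (intro exI[of _ E] exI[of _ p] exI[of _ q]) (intro conjI ballI disjI1; (assumption | simp))
    next
      case False
      define E' where "E' = (E \<inter> (?V - R1) \<times> (?V - R1)) \<union> K \<times> R1 \<union> R1 \<times> K"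
      define Q where "Q = sqrt (real k * real n)"
      have Qk: "sqrt ((real s - 1) * n) = Q" by (simp add: Q_def ks)
      have QL: "Q \<ge> L0"
      proof -
        have "L0\<^sup>2 \<le> k * real n" using n2 k(2) mult_right_mono[OF k(2), of "real n"] by simp
        then show ?thesis unfolding Q_def by (rule real_le_rsqrt)
      qed
      have L00: "0 \<le> 16 * (sqrt k + 4 * sqrt \<tau>) / e" "0 \<le> 16 * real k * \<tau>" using e0 by auto
      have Q1: "sqrt k + 4 * sqrt \<tau> \<le> e * Q / 16"
      proof -
        have "16 * (sqrt k + 4 * sqrt \<tau>) / e \<le> Q" using QL L00 unfolding L0_def by linarith
        then show ?thesis using e0 by (simp add: field_simps)
      qed
      have Q2: "\<tau> \<le> Q / (16 * k)"
      proof -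
        have "16 * real k * \<tau> \<le> Q" using QL L00 unfolding L0_def by linarith
        then show ?thesis using k by (simp add: field_simps)
      qed
      have Qp: "Q > 0" using k n1 by (simp add: Q_def)
      define \<rho> where "\<rho> = Q * g"
      have cR1: "real (card R1) \<le> k * (\<epsilon> * n)"
      proof -
        have "R1 \<subseteq> (\<Union>h\<in>K. ?V - E `` {h})" by (auto simp: R1_def R0_def)
        then have "card R1 \<le> card (\<Union>h\<in>K. ?V - E `` {h})" using fK by (intro card_mono) auto
        also have "\<dots> \<le> (\<Sum>h\<in>K. card (?V - E `` {h}))" by (rule card_UN_le[OF fK])
        finally have "real (card R1) \<le> (\<Sum>h\<in>K. real (card (?V - E `` {h})))"
          unfolding of_nat_sum[symmetric] by (rule of_nat_mono)
        also have "\<dots> \<le> (\<Sum>h\<in>K. \<epsilon> * n)"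
        proof (rule sum_mono)
          fix h assume h: "h \<in> K"
          have "E `` {h} \<subseteq> ?V" using u(3) by auto
          then have "card (?V - E `` {h}) = n - card (E `` {h})" "card (E `` {h}) \<le> n"
            using card_Diff_subset[of "E `` {h}" ?V] card_mono[of ?V "E `` {h}"] finite_subset[of "E `` {h}" ?V] by auto
          then have "real (card (?V - E `` {h})) = n - real (card (E `` {h}))" by simp
          also have "\<dots> \<le> \<epsilon> * n" using hd h by (auto simp: algebra_simps)
          finally show "real (card (?V - E `` {h})) \<le> \<epsilon> * n" .
        qed
        also have "\<dots> = k * (\<epsilon> * n)" by (simp add: cK k_def)
        finally show ?thesis .
      qed
      have R1n: "12 * card R1 \<le> n"
      proof -
        have C1: "C \<ge> 1" by (simp add: C_def)
        have "g * g \<le> 1 / 2 * (1 / (32 * k * C))" using g by (intro mult_mono) auto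
        then have "k * \<epsilon> \<le> k * (1 / 2 * (1 / (32 * k * C)))" unfolding \<epsilon>_def power2_eq_square
          using k by (intro mult_left_mono) auto
        also have "\<dots> = 1 / (64 * C)" using k by (simp add: field_simps)
        also have "\<dots> \<le> 1 / 12" using C1 by (simp add: divide_le_eq)
        finally have "k * \<epsilon> * n \<le> 1 / 12 * n" by (intro mult_right_mono) auto
        then have "12 * real (card R1) \<le> n" using cR1 by (simp add: mult.assoc)
        then have "real (12 * card R1) \<le> real n" by simp
        then show ?thesis by (simp only: of_nat_le_iff)
      qed
      have rho: "sqrt (card R1) \<le> \<rho>"
      proof -
        have "sqrt (card R1) \<le> sqrt (k * (\<epsilon> * n))" using cR1 by simp
        also have "\<dots> = \<rho>" using ep by (simp add: \<rho>_def Q_def real_sqrt_mult)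
        finally show ?thesis .
      qed
      have ugE': "ugraph ?V E'" unfolding ugraph_def
      proof (intro conjI)
        have "R1 \<subseteq> ?V" by (auto simp: R1_def)
        then show "E' \<subseteq> ?V \<times> ?V" unfolding E'_def using KV by blast
        show "sym E'" using u(4) by (auto simp: E'_def intro!: symI)
        show "irrefl E'" using u(5) by (auto simp: E'_def R1_def irrefl_def)
      qed simp
      have KE': "K \<times> (?V - K) \<subseteq> E'"
      proof -
        have "(h, v) \<in> E'" if hv: "h \<in> K" "v \<in> ?V" "v \<notin> K" for h v
        proof -
          have "h \<in> ?V - R1" using KV hv by (auto simp: R1_def)
          then show ?thesis using hv by (cases "v \<in> R1") (auto simp: E'_def R1_def R0_def)
        qed
        then show ?thesis by blast
      qed
      have degE': "card (E' `` {v} \<inter> (?V - K)) \<le> t - 1" if v: "v \<in> ?V - K" for v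
      proof (cases "v \<in> R1")
        case True
        then have "E' `` {v} \<inter> (?V - K) = {}" using KV by (auto simp: E'_def R1_def)
        then show ?thesis by simp
      next
        case False
        then have "E' `` {v} \<inter> (?V - K) \<subseteq> E `` {v} \<inter> R0" using v by (auto simp: E'_def R1_def)
        then have "card (E' `` {v} \<inter> (?V - K)) \<le> card (E `` {v} \<inter> R0)" using u(2) by (intro card_mono) auto
        then show ?thesis using deg[OF v] by (simp add: \<tau>_def)
      qed
      have imp: "\<exists>x'. 0 < \<mu> * (qf E' x' - \<mu> * nrm2 ?V x')" if x: "eigvec ?V E \<mu> x" and mu: "Q \<le> 2 * \<bar>\<mu>\<bar>" for \<mu> x
      proof -
        have h1: "card K = k" by (simp add: cK k_def)
        have h2: "card ?V = n" by simp
        have h3: "card (E `` {v} \<inter> R0) \<le> \<tau>" if "v \<in> ?V - K" for v by (rule deg[OF that])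
        have h4: "card (E \<inter> R1 \<times> R1) \<le> c * card R1" by (rule c[OF free ug]) (auto simp: R1_def)
        have h5: "R1 \<noteq> {}" by (rule False)
        have h6: "4 * real k * real (k + \<tau>) * e \<le> 1" using e1 by simp
        have h7: "sqrt (real (card R1)) \<le> \<rho>" by (rule rho)
        have h8: "sqrt (real k * real n) \<le> 2 * \<bar>\<mu>\<bar>" using mu by (simp add: Q_def)
        have "e * (Q / 2) \<le> e * \<bar>\<mu>\<bar>" using mu e0 by (intro mult_left_mono) auto
        then have eL: "e * Q / 2 \<le> e * \<bar>\<mu>\<bar>" by simp
        have rho_e: "\<rho> \<le> e * Q / 64" using mult_left_mono[OF g(2), of Q] Qp by (simp add: \<rho>_def mult.commute)
        have s0: "sqrt (real k) \<ge> 0" "sqrt (real \<tau>) \<ge> 0" "e * Q > 0" using e0 Qp by auto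
        have h9: "2 * sqrt (real k) + 8 * \<rho> \<le> e * \<bar>\<mu>\<bar>" using eL rho_e Q1 s0 by linarith
        have h10: "sqrt (real k) + 4 * sqrt (real \<tau>) + 4 * \<rho> \<le> e * \<bar>\<mu>\<bar>" using eL rho_e Q1 s0 by linarith
        have "sqrt (real ((2 * \<tau> + c) * card R1)) \<le> C * \<rho>"
        proof -
          have "sqrt (real ((2 * \<tau> + c) * card R1)) = sqrt (2 * \<tau> + c) * sqrt (card R1)"
            by (simp add: real_sqrt_mult)
          also have "\<dots> \<le> C * \<rho>" using rho by (intro mult_mono) (auto simp: C_def)
          finally show ?thesis .
        qed
        also have "\<dots> \<le> Q / (32 * k)"
        proof -
          have "C * Q * g \<le> C * Q * (1 / (32 * k * C))" using g(3) C Qp by (intro mult_left_mono) auto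
          then show ?thesis using C by (simp add: \<rho>_def field_simps)
        qed
        finally have "\<tau> + sqrt (real ((2 * \<tau> + c) * card R1)) \<le> Q / (16 * k) + Q / (32 * k)" using Q2 by linarith
        also have "\<dots> \<le> (Q / 2) / (4 * k)" using Qp k by (simp add: field_simps)
        also have "\<dots> \<le> \<bar>\<mu>\<bar> / (4 * k)" using mu by (intro divide_right_mono) auto
        finally have hl: "real \<tau> + sqrt (real ((2 * \<tau> + c) * card R1)) \<le> \<bar>\<mu>\<bar> / real (4 * k)" by simp
        note hc = hub_completion_increases[where V = ?V and E = E and \<mu> = \<mu> and x = x and K = K and k = k
            and n = n and \<tau> = \<tau> and c = c and e = e and \<rho> = \<rho>, folded R0_def, folded R1_def, folded E'_def]
        show ?thesis
          by (rule hc[OF ug x KV h1 k(1) h2 n1 h3 h4 h5 e0 h6 h7 h8 h9 h10 hl])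
      qed
      obtain p' q' where ex': "extremal_eig ?V E' p' q'"
      proof (rule extremal_eig_exists[OF ugE'])
        show "?V \<noteq> {}" using n1 by (auto simp: lessThan_empty_iff)
      qed
      have nn: "nrm2 ?V y \<ge> 0" for y :: "nat \<Rightarrow> real" by (simp add: sum_nonneg)
      have "p < p'"
      proof -
        obtain x where "eigvec ?V E p x" using ex by (auto simp: extremal_eig_def)
        then obtain x' where x': "0 < p * (qf E' x' - p * nrm2 ?V x')" using imp[of p x] p Qk Qp by auto
        have "p > 0" using p Qk Qp by simp
        then have "p * nrm2 ?V x' < qf E' x'" using x' by (simp add: zero_less_mult_iff)
        also have "\<dots> \<le> p' * nrm2 ?V x'" using ex' by (simp add: extremal_eig_def)
        finally show "p < p'" using nn[of x'] mult_less_cancel_right_disj[of p "nrm2 ?V x'" p'] by linarith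
      qed
      moreover have "q' < q"
      proof -
        obtain x where "eigvec ?V E q x" using ex by (auto simp: extremal_eig_def)
        then obtain x' where x': "0 < q * (qf E' x' - q * nrm2 ?V x')" using imp[of q x] q Qk Qp by auto
        have "q < 0" using q Qk Qp by simp
        then have "qf E' x' < q * nrm2 ?V x'" using x' by (simp add: zero_less_mult_iff)
        moreover have "q' * nrm2 ?V x' \<le> qf E' x'" using ex' by (simp add: extremal_eig_def)
        ultimately have "q' * nrm2 ?V x' < q * nrm2 ?V x'" by linarith
        then show "q' < q" using nn[of x'] mult_less_cancel_right_disj[of q' "nrm2 ?V x'" q] by linarith
      qed
      ultimately have "p - q < p' - q'" by simp
      moreover have "\<exists>R1\<subseteq>?V - K. 12 * card R1 \<le> n \<and> E' = E \<inter> (?V - R1) \<times> (?V - R1) \<union> K \<times> R1 \<union> R1 \<times> K"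
        using R1n unfolding E'_def by (intro exI[of _ R1] conjI) (auto simp: R1_def)
      ultimately show ?thesis using ugE' KE' degE' ex'
        by (intro exI[of _ E'] exI[of _ p'] exI[of _ q']) (intro conjI ballI disjI2; (assumption | simp))
    qed
  qed
  show ?thesis
    by (intro exI[of _ \<epsilon>] exI[of _ N] conjI ep(1,2) allI impI) (rule main)
qed

section \<open>Eigenvalue equations of hub joins\<close>

definition nsum :: "('a \<times> 'a) set \<Rightarrow> 'a set \<Rightarrow> ('a \<Rightarrow> real) \<Rightarrow> 'a \<Rightarrow> real" where
  "nsum E U x u = (\<Sum>w\<in>E `` {u} \<inter> U. x w)"

definition ldeg :: "('a \<times> 'a) set \<Rightarrow> 'a set \<Rightarrow> 'a \<Rightarrow> real" where
  "ldeg E U u = card (E `` {u} \<inter> U)"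

lemma nsum_one: "nsum E U (\<lambda>_. c) u = c * ldeg E U u"
  by (simp add: nsum_def ldeg_def)

lemma nsum_adjoint:
  assumes "finite U" "sym E"
  shows "(\<Sum>u\<in>U. f u * nsum E U g u) = (\<Sum>u\<in>U. nsum E U f u * g u)"
proof -
  have S: "E \<inter> U \<times> U = Sigma U (\<lambda>u. E `` {u} \<inter> U)" by auto
  have "(\<Sum>u\<in>U. f u * nsum E U g u) = (\<Sum>(u, w)\<in>E \<inter> U \<times> U. f u * g w)"
    unfolding S nsum_def using assms(1) by (simp add: sum.Sigma sum_distrib_left)
  also have "\<dots> = (\<Sum>(u, w)\<in>E \<inter> U \<times> U. f w * g u)"
    by (rule sum.reindex_bij_witness[of _ prod.swap prod.swap]) (use assms(2) in \<open>auto dest: symD\<close>)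
  also have "\<dots> = (\<Sum>u\<in>U. nsum E U f u * g u)"
    unfolding S nsum_def using assms(1) by (simp add: sum.Sigma sum_distrib_right)
  finally show ?thesis .
qed

lemma abs_nsum_le:
  assumes "\<And>u. u \<in> U \<Longrightarrow> \<bar>x u\<bar> \<le> M"
  shows "\<bar>nsum E U x u\<bar> \<le> ldeg E U u * M"
proof -
  have "\<bar>nsum E U x u\<bar> \<le> (\<Sum>w\<in>E `` {u} \<inter> U. M)"
    unfolding nsum_def by (rule order_trans[OF sum_abs], rule sum_mono) (use assms in auto)
  then show ?thesis by (simp add: ldeg_def)
qed

text \<open>Evaluating the equation at an entry of largest modulus replaces the Neumann series for
  the inverse of \<open>1 - z A\<close>. It gives \<open>4 / 3\<close>, rounded up to
  \<open>2\<close>.\<close>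

lemma resolvent_bound:
  fixes z D G :: real
  assumes fin: "finite U" and deg: "\<And>u. u \<in> U \<Longrightarrow> ldeg E U u \<le> D" and z: "\<bar>z\<bar> * D \<le> 1 / 4"
    and eq: "\<And>u. u \<in> U \<Longrightarrow> x u = g u + z * nsum E U x u" and g: "\<And>u. u \<in> U \<Longrightarrow> \<bar>g u\<bar> \<le> G"
    and u: "u \<in> U"
  shows "\<bar>x u\<bar> \<le> 2 * G"
proof -
  define M where "M = Max ((\<lambda>u. \<bar>x u\<bar>) ` U)"
  have fi: "finite ((\<lambda>u. \<bar>x u\<bar>) ` U)" "(\<lambda>u. \<bar>x u\<bar>) ` U \<noteq> {}" using fin u by auto
  have le: "\<bar>x v\<bar> \<le> M" if "v \<in> U" for v unfolding M_def using fi that by (intro Max_ge) auto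
  have M0: "M \<ge> 0" using le[OF u] by simp
  have "M \<in> (\<lambda>u. \<bar>x u\<bar>) ` U" unfolding M_def using fi by (rule Max_in)
  then obtain v where v: "v \<in> U" "M = \<bar>x v\<bar>" by auto
  have "\<bar>z * nsum E U x v\<bar> \<le> \<bar>z\<bar> * (D * M)"
  proof -
    have "\<bar>nsum E U x v\<bar> \<le> ldeg E U v * M" by (rule abs_nsum_le) (rule le)
    also have "\<dots> \<le> D * M" using deg[OF v(1)] M0 by (rule mult_right_mono)
    finally show ?thesis unfolding abs_mult by (rule mult_left_mono) simp
  qed
  also have "\<dots> \<le> 1 / 4 * M" using mult_right_mono[OF z M0] by (simp add: mult.assoc)
  finally have "M \<le> G + 1 / 4 * M" using eq[OF v(1)] g[OF v(1)] v(2) by linarith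
  then show ?thesis using le[OF u] M0 by linarith
qed

text \<open>On \<open>K\<close>, \<open>y\<close> is the resolvent of the hub graph applied to the
  all-ones vector. Up to scaling this is the hub part of an eigenvector of a hub join, with
  \<open>z\<close> the reciprocal eigenvalue.\<close>

definition hub_sol :: "('a \<times> 'a) set \<Rightarrow> 'a set \<Rightarrow> real \<Rightarrow> ('a \<Rightarrow> real) \<Rightarrow> bool" where
  "hub_sol E K z y \<longleftrightarrow> (\<forall>h\<in>K. y h = 1 + z * nsum E K y h)"

definition hb1 :: "('a \<times> 'a) set \<Rightarrow> 'a set \<Rightarrow> real" where
  "hb1 E K = (\<Sum>h\<in>K. ldeg E K h) / card K"

definition hb2 :: "('a \<times> 'a) set \<Rightarrow> 'a set \<Rightarrow> real" where
  "hb2 E K = (\<Sum>h\<in>K. (ldeg E K h)\<^sup>2) / card K"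

text \<open>\<open>hb1\<close> and \<open>hb2\<close> are the normalised numbers of walks of length
  one and two in the hub graph. \<open>hb3\<close> is the exact tail of the walk series, starting
  with walks of length three.\<close>

definition hb3 :: "('a \<times> 'a) set \<Rightarrow> 'a set \<Rightarrow> ('a \<Rightarrow> real) \<Rightarrow> real" where
  "hb3 E K y = (\<Sum>h\<in>K. nsum E K (nsum E K (ldeg E K)) h * y h) / card K"

lemma ldeg_le_card: "finite K \<Longrightarrow> ldeg E K h \<le> card K" "0 \<le> ldeg E K h"
  by (auto simp: ldeg_def card_mono)

text \<open>The resolvent equation is substituted three times, each time moving the adjacency
  operator to the other factor by symmetry. Nothing is truncated.\<close>

lemma hub_sol_sum:
  assumes fin: "finite K" "K \<noteq> {}" and sym: "sym E" and y: "hub_sol E K z y"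
  shows "sum y K = card K * (1 + hb1 E K * z + hb2 E K * z\<^sup>2 + hb3 E K y * z ^ 3)"
proof -
  have k: "real (card K) \<noteq> 0" using fin by simp
  have step: "(\<Sum>h\<in>K. c h * y h) = sum c K + z * (\<Sum>h\<in>K. nsum E K c h * y h)" for c
  proof -
    have "(\<Sum>h\<in>K. c h * y h) = (\<Sum>h\<in>K. c h + z * (c h * nsum E K y h))"
      using y by (intro sum.cong) (auto simp: hub_sol_def algebra_simps)
    then show ?thesis using nsum_adjoint[OF fin(1) sym, of c y]
      by (simp add: sum.distrib sum_distrib_left[symmetric])
  qed
  have c1: "nsum E K (\<lambda>_. 1) = ldeg E K" by (rule ext) (simp add: nsum_one)
  have c2: "sum (nsum E K (ldeg E K)) K = (\<Sum>h\<in>K. (ldeg E K h)\<^sup>2)"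
    using nsum_adjoint[OF fin(1) sym, of "\<lambda>_. 1" "ldeg E K"] by (simp add: nsum_one power2_eq_square)
  have "sum y K = card K + z * (\<Sum>h\<in>K. ldeg E K h * y h)" using step[of "\<lambda>_. 1"] by (simp add: c1)
  also have "(\<Sum>h\<in>K. ldeg E K h * y h) = sum (ldeg E K) K + z * (\<Sum>h\<in>K. nsum E K (ldeg E K) h * y h)"
    by (rule step)
  also have "(\<Sum>h\<in>K. nsum E K (ldeg E K) h * y h)
     = (\<Sum>h\<in>K. (ldeg E K h)\<^sup>2) + z * (\<Sum>h\<in>K. nsum E K (nsum E K (ldeg E K)) h * y h)"
    unfolding c2[symmetric] by (rule step)
  finally show ?thesis using k
    by (simp add: hb1_def hb2_def hb3_def distrib_left power2_eq_square power3_eq_cube)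
qed

text \<open>The bounded term left over in \<open>hubR_expansion\<close>, as a function of the
  reciprocal eigenvalue. It is written with sums, negations, products and \<open>inverse\<close>
  only, so that the closure rules for \<open>bdlip\<close> can follow its syntax.\<close>

definition hubR :: "real \<Rightarrow> real \<Rightarrow> real \<Rightarrow> real \<Rightarrow> real \<Rightarrow> real" where
  "hubR \<tau> b1 b2 b3 z = (1 + - \<tau> * z) *
     (- (b1 * (b1 * b1 + - b2) + - (b1 * b2) + b3 + z * (b2 * (b1 * b1 + - b2) + - (b1 * b3)) + z * z * (b3 * (b1 * b1 + - b2)))
      * inverse (1 + b1 * z + b2 * (z * z) + b3 * (z * z * z)))"

text \<open>\<open>1 - b1 z + (b1^2 - b2) z^2\<close> inverts \<open>B\<close> up to a multiple of
  \<open>z ^ 3\<close>. Multiplication by \<open>\<mu>\<^sup>2\<close> leaves one factor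
  \<open>z\<close>, which the factor \<open>\<mu> - \<tau>\<close> absorbs, so the remainder is
  bounded.\<close>

lemma hubR_expansion:
  fixes \<mu> \<tau> b1 b2 b3 :: real
  assumes "\<mu> \<noteq> 0" "z = 1 / \<mu>" "B = 1 + b1 * z + b2 * z\<^sup>2 + b3 * z ^ 3" "B \<noteq> 0"
  shows "(\<mu> - \<tau>) * (\<mu>\<^sup>2 / B) = (\<mu> - \<tau>) * (\<mu>\<^sup>2 - b1 * \<mu> + (b1\<^sup>2 - b2)) + hubR \<tau> b1 b2 b3 z"
proof -
  define w where "w = b1\<^sup>2 - b2"
  define F where "F = b1 * w - b1 * b2 + b3 + z * (b2 * w - b1 * b3) + z\<^sup>2 * (b3 * w)"
  have B: "1 + b1 * z + b2 * (z * z) + b3 * (z * z * z) = B"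
    unfolding assms(3) by (simp add: power2_eq_square power3_eq_cube mult.assoc)
  have R: "hubR \<tau> b1 b2 b3 z = (1 - \<tau> * z) * (- F / B)"
    unfolding hubR_def B by (simp add: F_def w_def power2_eq_square divide_inverse algebra_simps)
  have zm: "z * \<mu> = 1" using assms(1,2) by simp
  have "B * (1 - b1 * z + w * z\<^sup>2) = 1 + z ^ 3 * F"
    unfolding assms(3) F_def w_def by (simp add: algebra_simps power2_eq_square power3_eq_cube)
  then have "B * (1 - b1 * z + w * z\<^sup>2) * \<mu>\<^sup>2 = (1 + z ^ 3 * F) * \<mu>\<^sup>2" by simp
  moreover have "(1 - b1 * z + w * z\<^sup>2) * \<mu>\<^sup>2 = \<mu>\<^sup>2 - b1 * (z * \<mu>) * \<mu> + w * (z * \<mu>)\<^sup>2"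
    by (simp add: algebra_simps power2_eq_square)
  moreover have "(1 + z ^ 3 * F) * \<mu>\<^sup>2 = \<mu>\<^sup>2 + (z * \<mu>)\<^sup>2 * z * F"
    by (simp add: algebra_simps power2_eq_square power3_eq_cube)
  ultimately have "B * (\<mu>\<^sup>2 - b1 * \<mu> + w) = \<mu>\<^sup>2 + z * F" unfolding zm by (simp add: mult.assoc)
  then have X: "\<mu>\<^sup>2 / B = \<mu>\<^sup>2 - b1 * \<mu> + w - z * F / B" using assms(4) by (simp add: field_simps)
  have "(\<mu> - \<tau>) * (\<mu>\<^sup>2 / B) = (\<mu> - \<tau>) * (\<mu>\<^sup>2 - b1 * \<mu> + w) + (\<mu> * z - \<tau> * z) * (- F / B)"
    unfolding X by (simp add: algebra_simps diff_divide_distrib)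
  also have "\<mu> * z = 1" using zm by (simp add: mult.commute)
  finally show ?thesis unfolding R w_def .
qed

section \<open>Lipschitz dependence of the remainder on the reciprocal eigenvalue\<close>

text \<open>Bounded and Lipschitz along a pair of points at distance \<open>\<Delta>\<close>; closed under ring operations.\<close>

definition bdlip :: "real \<Rightarrow> real \<Rightarrow> real \<Rightarrow> real \<Rightarrow> bool" where
  "bdlip C \<Delta> a b \<longleftrightarrow> \<bar>a\<bar> \<le> C \<and> \<bar>b\<bar> \<le> C \<and> \<bar>a - b\<bar> \<le> C * \<Delta> \<and> 0 \<le> \<Delta>"

lemma bdlip_const: "0 \<le> \<Delta> \<Longrightarrow> \<bar>a\<bar> \<le> C \<Longrightarrow> bdlip C \<Delta> a a"
  by (auto simp: bdlip_def)

lemma bdlip_add: "bdlip C \<Delta> a b \<Longrightarrow> bdlip D \<Delta> a' b' \<Longrightarrow> bdlip (C + D) \<Delta> (a + a') (b + b')"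
  unfolding bdlip_def distrib_right by linarith

lemma bdlip_minus: "bdlip C \<Delta> a b \<Longrightarrow> bdlip C \<Delta> (- a) (- b)"
  unfolding bdlip_def by linarith

lemma bdlip_mult:
  assumes "bdlip C \<Delta> a b" "bdlip D \<Delta> a' b'"
  shows "bdlip (2 * (C * D)) \<Delta> (a * a') (b * b')"
proof -
  have C: "\<bar>a\<bar> \<le> C" "\<bar>b\<bar> \<le> C" "\<bar>a - b\<bar> \<le> C * \<Delta>" "0 \<le> \<Delta>" "0 \<le> C"
    and D: "\<bar>a'\<bar> \<le> D" "\<bar>b'\<bar> \<le> D" "\<bar>a' - b'\<bar> \<le> D * \<Delta>" "0 \<le> D"
    using assms unfolding bdlip_def by auto
  have "\<bar>a\<bar> * \<bar>a'\<bar> \<le> C * D" "\<bar>b\<bar> * \<bar>b'\<bar> \<le> C * D" using C D by (auto intro: mult_mono)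
  moreover have "0 \<le> C * D" using C D by simp
  moreover have "\<bar>a * a' - b * b'\<bar> \<le> 2 * (C * D) * \<Delta>"
  proof -
    have "a * a' - b * b' = a * (a' - b') + (a - b) * b'" by (simp add: algebra_simps)
    also have "\<bar>\<dots>\<bar> \<le> \<bar>a\<bar> * \<bar>a' - b'\<bar> + \<bar>a - b\<bar> * \<bar>b'\<bar>" by (metis abs_mult abs_triangle_ineq)
    also have "\<dots> \<le> C * (D * \<Delta>) + (C * \<Delta>) * D" using C D by (intro add_mono mult_mono) auto
    finally show ?thesis by (simp add: algebra_simps)
  qed
  ultimately show ?thesis using C(4) unfolding bdlip_def abs_mult by auto
qed

lemma bdlip_inverse:
  assumes "bdlip C \<Delta> a b" "1 / 2 \<le> a" "1 / 2 \<le> b"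
  shows "bdlip (2 + 4 * C) \<Delta> (inverse a) (inverse b)"
proof -
  have C: "\<bar>a - b\<bar> \<le> C * \<Delta>" "0 \<le> \<Delta>" "0 \<le> C" using assms unfolding bdlip_def by auto
  have ab: "inverse a \<le> 2" "inverse b \<le> 2" "0 < inverse a" "0 < inverse b"
    using assms(2,3) le_imp_inverse_le[of "1 / 2" a] le_imp_inverse_le[of "1 / 2" b] by auto
  have "inverse a - inverse b = inverse a * inverse b * (b - a)" using assms(2,3) by (simp add: field_simps)
  also have "\<bar>\<dots>\<bar> = inverse a * inverse b * \<bar>a - b\<bar>" using ab by (simp add: abs_mult)
  also have "\<dots> \<le> (2 * 2) * (C * \<Delta>)" using ab C by (intro mult_mono) auto
  also have "\<dots> \<le> (2 + 4 * C) * \<Delta>" using C by (simp add: algebra_simps)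
  finally show ?thesis using ab C unfolding bdlip_def by auto
qed

lemma hubR_bdlip:
  fixes \<tau> :: real
  shows "\<exists>C. \<forall>\<Delta> b1 b2 b3 b3' z z'. 0 \<le> \<Delta> \<longrightarrow> \<bar>b1\<bar> \<le> D \<longrightarrow> \<bar>b2\<bar> \<le> D \<longrightarrow> bdlip D \<Delta> b3 b3' \<longrightarrow> bdlip D \<Delta> z z' \<longrightarrow>
     1 / 2 \<le> 1 + b1 * z + b2 * (z * z) + b3 * (z * z * z) \<longrightarrow> 1 / 2 \<le> 1 + b1 * z' + b2 * (z' * z') + b3' * (z' * z' * z') \<longrightarrow>
     bdlip C \<Delta> (hubR \<tau> b1 b2 b3 z) (hubR \<tau> b1 b2 b3' z')"
  unfolding hubR_def
  \<comment> \<open>The witness stays schematic and is assembled by the closure rules. It may depend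
    on \<open>D\<close> and \<open>\<tau>\<close> only, so \<open>1\<close> and
    \<open>\<tau>\<close> are bounded by their own modulus, whereas \<open>b1\<close> and
    \<open>b2\<close> are bounded by \<open>D\<close>.\<close>
  apply (rule exI)
  apply (intro allI impI)
  apply (rule bdlip_mult)
   apply (rule bdlip_add)
    apply (rule bdlip_const, assumption, rule order_refl)
   apply (rule bdlip_mult)
    apply (rule bdlip_const, assumption, rule order_refl)
   apply assumption
  apply (rule bdlip_mult)
   apply ((rule bdlip_minus bdlip_add bdlip_mult | (rule bdlip_const, assumption, assumption) | assumption)+)[1]
  apply (rule bdlip_inverse)
    apply ((rule bdlip_add bdlip_mult | (rule bdlip_const, assumption, assumption) | (rule bdlip_const, assumption, rule order_refl) | assumption)+)[1]
   apply assumption+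
  done


text \<open>One constant serves all hub graphs with \<open>k\<close> vertices: the moments are
  bounded by powers of \<open>k\<close>, and the entries of the resolvent vector lie between
  \<open>1 / 2\<close> and \<open>2\<close>.\<close>

lemma hub_sol_hubR_bdlip:
  fixes k :: nat and \<tau> :: real
  shows "\<exists>C\<ge>1. \<forall>(E :: (nat \<times> nat) set) K (z::real) (z'::real) y y'. finite K \<longrightarrow> card K = k \<longrightarrow> k \<ge> 1 \<longrightarrow> sym E \<longrightarrow> \<bar>z\<bar> * k \<le> 1 / 4 \<longrightarrow> \<bar>z'\<bar> * k \<le> 1 / 4 \<longrightarrow>
    hub_sol E K z y \<longrightarrow> hub_sol E K z' y' \<longrightarrow>
    bdlip C \<bar>z - z'\<bar> (hubR \<tau> (hb1 E K) (hb2 E K) (hb3 E K y) z) (hubR \<tau> (hb1 E K) (hb2 E K) (hb3 E K y') z')"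
proof -
  define D where "D = 4 * (real k + 1) ^ 4"
  obtain C where C: "\<And>\<Delta> b1 b2 b3 b3' z z'. 0 \<le> \<Delta> \<Longrightarrow> \<bar>b1\<bar> \<le> D \<Longrightarrow> \<bar>b2\<bar> \<le> D \<Longrightarrow> bdlip D \<Delta> b3 b3' \<Longrightarrow> bdlip D \<Delta> z z' \<Longrightarrow>
     1 / 2 \<le> 1 + b1 * z + b2 * (z * z) + b3 * (z * z * z) \<Longrightarrow> 1 / 2 \<le> 1 + b1 * z' + b2 * (z' * z') + b3' * (z' * z' * z') \<Longrightarrow>
     bdlip C \<Delta> (hubR \<tau> b1 b2 b3 z) (hubR \<tau> b1 b2 b3' z')" using hubR_bdlip[of D \<tau>] by blast
  have main: "bdlip (max 1 C) \<bar>z - z'\<bar> (hubR \<tau> (hb1 E K) (hb2 E K) (hb3 E K y) z) (hubR \<tau> (hb1 E K) (hb2 E K) (hb3 E K y') z')"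
    if fin: "finite K" and cK: "card K = k" and k1: "k \<ge> 1" and sym: "sym E"
      and z: "\<bar>z\<bar> * k \<le> 1 / 4" "\<bar>z'\<bar> * k \<le> 1 / 4" and y: "hub_sol E K z y" "hub_sol E K z' y'"
    for E :: "(nat \<times> nat) set" and K and z z' :: real and y y'
  proof -
    have ne: "K \<noteq> {}" using cK k1 by auto
    have kr: "real k \<ge> 1" using k1 by simp
    have dk: "ldeg E K h \<le> k" "0 \<le> ldeg E K h" for h using ldeg_le_card(1)[OF fin] ldeg_le_card(2) cK by auto
    have D1: "real k ^ i \<le> (real k + 1) ^ i" for i by (intro power_mono) auto
    have Dk: "k \<le> D" "(real k)\<^sup>2 \<le> D" "2 * real k ^ 3 \<le> D" "4 * real k ^ 4 \<le> D" "1 \<le> D"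
    proof -
      have m: "real k ^ i \<le> (real k + 1) ^ 4" if "i \<le> 4" for i
      proof -
        have "real k ^ i \<le> (real k + 1) ^ i" by (rule D1)
        also have "\<dots> \<le> (real k + 1) ^ 4" using that by (intro power_increasing) auto
        finally show ?thesis .
      qed
      define X where "X = (real k + 1) ^ 4"
      have "real k ^ 1 \<le> X" "real k ^ 2 \<le> X" "real k ^ 3 \<le> X" "real k ^ 4 \<le> X" "real k ^ 0 \<le> X"
        unfolding X_def by (rule m, simp)+
      moreover have "real k ^ 1 = k" "real k ^ 0 = 1" "D = 4 * X" by (simp_all add: D_def X_def)
      ultimately show "k \<le> D" "(real k)\<^sup>2 \<le> D" "2 * real k ^ 3 \<le> D" "4 * real k ^ 4 \<le> D" "1 \<le> D"
        by linarith+
    qed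
    have b1: "\<bar>hb1 E K\<bar> \<le> D"
    proof -
      have "(\<Sum>h\<in>K. ldeg E K h) \<le> (\<Sum>h\<in>K. real k)" by (intro sum_mono dk)
      then have "hb1 E K \<le> k" using kr by (simp add: hb1_def cK field_simps)
      moreover have "0 \<le> hb1 E K" unfolding hb1_def by (simp add: sum_nonneg dk)
      ultimately show ?thesis using Dk by linarith
    qed
    have b2: "\<bar>hb2 E K\<bar> \<le> D"
    proof -
      have "(\<Sum>h\<in>K. (ldeg E K h)\<^sup>2) \<le> (\<Sum>h\<in>K. (real k)\<^sup>2)" by (intro sum_mono power_mono dk)
      then have "hb2 E K \<le> (real k)\<^sup>2" using kr by (simp add: hb2_def cK field_simps)
      moreover have "0 \<le> hb2 E K" unfolding hb2_def by (simp add: sum_nonneg)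
      ultimately show ?thesis using Dk by linarith
    qed
    have y2: "\<bar>y h\<bar> \<le> 2 * 1" if "hub_sol E K z y" "\<bar>z\<bar> * k \<le> 1 / 4" "h \<in> K" for z y h
      by (rule resolvent_bound[of K E k z y "\<lambda>_. 1" 1 h]) (use fin dk that in \<open>auto simp: hub_sol_def\<close>)
    \<comment> \<open>By \<open>hub_sol_sum\<close> the right-hand side is the mean of the entries
      of \<open>y\<close>, and each of these is at least \<open>1 / 2\<close>. This keeps the
      denominator in \<open>hubR\<close> away from zero.\<close>
    have B: "1 / 2 \<le> 1 + hb1 E K * z + hb2 E K * (z * z) + hb3 E K y * (z * z * z)"
      if s: "hub_sol E K z y" and zz: "\<bar>z\<bar> * k \<le> 1 / 4" for z y
    proof -
      have "1 / 2 \<le> y h" if h: "h \<in> K" for h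
      proof -
        have "\<bar>nsum E K y h\<bar> \<le> ldeg E K h * 2" by (rule abs_nsum_le) (use y2[OF s zz] in auto)
        also have "\<dots> \<le> k * 2" using dk by simp
        finally have "\<bar>z * nsum E K y h\<bar> \<le> \<bar>z\<bar> * (k * 2)" unfolding abs_mult by (rule mult_left_mono) simp
        then show ?thesis using s h zz by (auto simp: hub_sol_def)
      qed
      then have "(\<Sum>h\<in>K. 1 / 2) \<le> sum y K" by (intro sum_mono)
      then have "k * (1 / 2) \<le> k * (1 + hb1 E K * z + hb2 E K * z\<^sup>2 + hb3 E K y * z ^ 3)"
        unfolding hub_sol_sum[OF fin ne sym s] by (simp add: cK)
      then have "1 / 2 \<le> 1 + hb1 E K * z + hb2 E K * z\<^sup>2 + hb3 E K y * z ^ 3"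
        by (rule mult_left_le_imp_le) (use kr in simp)
      then show ?thesis by (simp add: power2_eq_square power3_eq_cube mult.assoc)
    qed
    have c3: "\<bar>nsum E K (nsum E K (ldeg E K)) h\<bar> \<le> real k ^ 3" for h
    proof -
      have 1: "\<bar>nsum E K (ldeg E K) h\<bar> \<le> real k * real k" for h
      proof -
        have "\<bar>nsum E K (ldeg E K) h\<bar> \<le> ldeg E K h * real k" by (rule abs_nsum_le) (use dk in auto)
        also have "\<dots> \<le> real k * real k" using dk by (intro mult_right_mono) auto
        finally show ?thesis by simp
      qed
      have "\<bar>nsum E K (nsum E K (ldeg E K)) h\<bar> \<le> ldeg E K h * (real k * real k)" by (rule abs_nsum_le) (use 1 in auto)
      also have "\<dots> \<le> real k * (real k * real k)" using dk by (intro mult_right_mono) auto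
      finally show ?thesis by (simp add: power3_eq_cube)
    qed
    have b3: "\<bar>(\<Sum>h\<in>K. nsum E K (nsum E K (ldeg E K)) h * g h) / k\<bar> \<le> real k ^ 3 * G"
      if g: "\<And>h. h \<in> K \<Longrightarrow> \<bar>g h\<bar> \<le> G" for g G
    proof -
      have "\<bar>\<Sum>h\<in>K. nsum E K (nsum E K (ldeg E K)) h * g h\<bar> \<le> (\<Sum>h\<in>K. real k ^ 3 * G)"
        by (rule order_trans[OF sum_abs], rule sum_mono)
          (use c3 g in \<open>auto simp: abs_mult intro!: mult_mono simp del: of_nat_power\<close>)
      also have "\<dots> = k * (real k ^ 3 * G)" by (simp add: cK)
      finally show ?thesis using kr by (simp add: abs_divide divide_le_eq mult.commute)
    qed
    have lip3: "bdlip D \<bar>z - z'\<bar> (hb3 E K y) (hb3 E K y')"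
    proof -
      have "\<bar>hb3 E K y\<bar> \<le> real k ^ 3 * (2 * 1)" "\<bar>hb3 E K y'\<bar> \<le> real k ^ 3 * (2 * 1)"
        unfolding hb3_def cK by (rule b3, erule y2[OF y(1) z(1)] y2[OF y(2) z(2)])+
      moreover have "\<bar>hb3 E K y - hb3 E K y'\<bar> \<le> real k ^ 3 * (2 * (\<bar>z - z'\<bar> * (k * 2)))"
      proof -
        \<comment> \<open>The difference of two solutions again satisfies a resolvent equation, with
          a right-hand side of size \<open>z - z'\<close>.\<close>
        have "\<bar>y h - y' h\<bar> \<le> 2 * (\<bar>z - z'\<bar> * (k * 2))" if h: "h \<in> K" for h
        proof (rule resolvent_bound[of K E k z "\<lambda>h. y h - y' h" "\<lambda>h. (z - z') * nsum E K y' h", OF fin dk(1) z(1) _ _ h])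
          fix u assume u: "u \<in> K"
          have e: "nsum E K (\<lambda>h. y h - y' h) u = nsum E K y u - nsum E K y' u" by (simp add: nsum_def sum_subtractf)
          have "y u = 1 + z * nsum E K y u" "y' u = 1 + z' * nsum E K y' u" using y u by (auto simp: hub_sol_def)
          then show "y u - y' u = (z - z') * nsum E K y' u + z * nsum E K (\<lambda>h. y h - y' h) u"
            unfolding e right_diff_distrib left_diff_distrib by linarith
          have "\<bar>nsum E K y' u\<bar> \<le> ldeg E K u * 2" by (rule abs_nsum_le) (use y2[OF y(2) z(2)] in auto)
          also have "\<dots> \<le> k * 2" using dk by simp
          finally show "\<bar>(z - z') * nsum E K y' u\<bar> \<le> \<bar>z - z'\<bar> * (k * 2)" unfolding abs_mult by (rule mult_left_mono) simp
        qed
        then have "\<bar>(\<Sum>h\<in>K. nsum E K (nsum E K (ldeg E K)) h * (y h - y' h)) / k\<bar> \<le> real k ^ 3 * (2 * (\<bar>z - z'\<bar> * (k * 2)))"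
          by (rule b3)
        then show ?thesis by (simp add: hb3_def cK right_diff_distrib sum_subtractf diff_divide_distrib)
      qed
      moreover have "real k ^ 3 * (2 * (\<bar>z - z'\<bar> * (k * 2))) = 4 * real k ^ 4 * \<bar>z - z'\<bar>"
        by (simp add: power3_eq_cube power4_eq_xxxx)
      moreover have "4 * real k ^ 4 * \<bar>z - z'\<bar> \<le> D * \<bar>z - z'\<bar>" using Dk by (intro mult_right_mono) auto
      ultimately show ?thesis using Dk(3) abs_ge_zero[of "z - z'"] unfolding bdlip_def by linarith
    qed
    have zb: "\<bar>z\<bar> \<le> 1" if "\<bar>z\<bar> * k \<le> 1 / 4" for z :: real
      using mult_left_mono[OF kr, of "\<bar>z\<bar>"] that by simp
    have lipz: "bdlip D \<bar>z - z'\<bar> z z'"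
      using zb[OF z(1)] zb[OF z(2)] Dk(5) mult_right_mono[OF Dk(5), of "\<bar>z - z'\<bar>"] unfolding bdlip_def by auto
    have "bdlip C \<bar>z - z'\<bar> (hubR \<tau> (hb1 E K) (hb2 E K) (hb3 E K y) z) (hubR \<tau> (hb1 E K) (hb2 E K) (hb3 E K y') z')"
      by (rule C[OF _ b1 b2 lip3 lipz B[OF y(1) z(1)] B[OF y(2) z(2)]]) simp
    then show ?thesis using mult_right_mono[of C "max 1 C" "\<bar>z - z'\<bar>"] unfolding bdlip_def by auto
  qed
  show ?thesis by (rule exI[of _ "max 1 C"]) (use main in auto)
qed


section \<open>Hub joins and the cubic equation for their eigenvalues\<close>

definition hub_join :: "'a set \<Rightarrow> 'a set \<Rightarrow> ('a \<times> 'a) set \<Rightarrow> nat \<Rightarrow> bool" where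
  "hub_join V K E \<tau> \<longleftrightarrow> ugraph V E \<and> K \<subseteq> V \<and> K \<noteq> {} \<and> K \<times> (V - K) \<subseteq> E \<and>
     (\<forall>v\<in>V - K. card (E `` {v} \<inter> (V - K)) \<le> \<tau>)"

definition degsum :: "('a \<times> 'a) set \<Rightarrow> 'a set \<Rightarrow> real" where
  "degsum E R = (\<Sum>u\<in>R. ldeg E R u)"

text \<open>When all degrees are at most \<open>\<tau>\<close>, this vanishes exactly if each degree
  is \<open>0\<close> or \<open>\<tau>\<close>.\<close>

definition defect :: "('a \<times> 'a) set \<Rightarrow> 'a set \<Rightarrow> real \<Rightarrow> real" where
  "defect E R \<tau> = (\<Sum>u\<in>R. ldeg E R u * (\<tau> - ldeg E R u))"

text \<open>Let \<open>\<sigma>\<close> and \<open>T\<close> be the sums of the eigenvector over the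
  hubs and over \<open>R\<close>. On the hubs the vector is \<open>T / \<mu>\<close> times the
  resolvent vector, which expresses \<open>\<sigma>\<close> through \<open>T\<close>. On
  \<open>R\<close> it is close to the constant \<open>\<sigma> / \<mu>\<close>, and summing the
  equations over \<open>R\<close>, with and without the degrees as weights, expresses
  \<open>T\<close> through \<open>\<sigma>\<close>. The ratio of the two is then eliminated.\<close>

lemma hub_join_eigen:
  fixes \<mu> :: real and \<tau> :: nat
  assumes hj: "hub_join V K E \<tau>" and x: "eigvec V E \<mu> x" and mu: "4 * (card K + \<tau>) \<le> \<bar>\<mu>\<bar>"
  defines "R \<equiv> V - K"
  shows "\<exists>y (dl::real). hub_sol E K (1 / \<mu>) y \<and> \<bar>dl - defect E R \<tau> / \<mu>\<bar> \<le> 2 * real \<tau> * defect E R \<tau> / \<mu>\<^sup>2 \<and>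
    (\<mu> - \<tau>) * (\<mu>\<^sup>2 - hb1 E K * \<mu> + ((hb1 E K)\<^sup>2 - hb2 E K) - real (card K) * real (card R))
      + hubR \<tau> (hb1 E K) (hb2 E K) (hb3 E K y) (1 / \<mu>) = card K * degsum E R - card K * dl"
proof -
  have ug: "ugraph V E" and KV: "K \<subseteq> V" "K \<noteq> {}" and join: "K \<times> R \<subseteq> E"
    and deg: "\<And>v. v \<in> R \<Longrightarrow> ldeg E R v \<le> \<tau>"
    using hj by (auto simp: hub_join_def R_def ldeg_def)
  note u = ugraphD[OF ug]
  have symE: "sym E" using ug by (simp add: ugraph_def)
  have fin: "finite K" "finite R" using u(1) KV finite_subset by (auto simp: R_def)
  have k1: "real (card K) \<ge> 1" using fin KV by (simp add: Suc_le_eq card_gt_0_iff)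
  have mu0: "\<bar>\<mu>\<bar> > 0" "\<mu> \<noteq> 0" using mu k1 by auto
  define z where "z = 1 / \<mu>"
  have zb: "\<bar>z\<bar> * D \<le> 1 / 4" if "4 * D \<le> \<bar>\<mu>\<bar>" for D :: real
    using that mu0 by (simp add: z_def field_simps)
  have zk: "\<bar>z\<bar> * card K \<le> 1 / 4" and zt: "\<bar>z\<bar> * \<tau> \<le> 1 / 4"
    by (rule zb, use mu in simp)+
  define \<sigma> where "\<sigma> = sum x K"
  define T where "T = sum x R"
  have eR: "\<mu> * x v = \<sigma> + nsum E R x v" if "v \<in> R" for v
  proof -
    have "E `` {v} \<inter> K = K" using that join u(4) by auto
    then show ?thesis using x that ad_split[OF ug KV(1), of x v]
      by (auto simp: eigvec_def R_def \<sigma>_def nsum_def)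
  qed
  have eK: "\<mu> * x h = T + nsum E K x h" if "h \<in> K" for h
  proof -
    have "E `` {h} \<inter> R = R" using that join by auto
    then show ?thesis using x that KV ad_split[OF ug KV(1), of x h]
      by (auto simp: eigvec_def R_def T_def nsum_def)
  qed
  have eR': "x v = \<sigma> / \<mu> + z * nsum E R x v" if "v \<in> R" for v
    using eR[OF that] mu0 by (simp add: z_def field_simps)
  have eK': "x h = T / \<mu> + z * nsum E K x h" if "h \<in> K" for h
    using eK[OF that] mu0 by (simp add: z_def field_simps)
  have bR: "\<bar>x v\<bar> \<le> 2 * \<bar>\<sigma> / \<mu>\<bar>" if "v \<in> R" for v
    by (rule resolvent_bound[OF fin(2) deg zt eR' _ that]) auto
  have bK: "\<bar>x h\<bar> \<le> 2 * \<bar>T / \<mu>\<bar>" if "h \<in> K" for h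
    by (rule resolvent_bound[OF fin(1) ldeg_le_card(1)[OF fin(1)] zk eK' _ that]) auto
  have nz: "\<exists>v\<in>V. x v \<noteq> 0" using x by (simp add: eigvec_def)
  \<comment> \<open>If \<open>\<sigma>\<close> vanished, \<open>resolvent_bound\<close> would
    annihilate the vector first on \<open>R\<close> and then on the hubs.\<close>
  have s0: "\<sigma> \<noteq> 0"
  proof
    assume s: "\<sigma> = 0"
    then have R0: "x v = 0" if "v \<in> R" for v using bR[OF that] by simp
    then have "T = 0" by (simp add: T_def)
    then have "x h = 0" if "h \<in> K" for h using bK[OF that] by simp
    then show False using R0 nz by (auto simp: R_def)
  qed
  have T0: "T \<noteq> 0"
  proof
    assume "T = 0"
    then have "x h = 0" if "h \<in> K" for h using bK[OF that] by simp
    then show False using s0 by (simp add: \<sigma>_def)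
  qed
  define y where "y h = \<mu> * x h / T" for h
  have y: "hub_sol E K z y"
    unfolding hub_sol_def
  proof
    fix h assume h: "h \<in> K"
    have "nsum E K y h = \<mu> / T * nsum E K x h" by (simp add: nsum_def y_def sum_distrib_left)
    then show "y h = 1 + z * nsum E K y h"
      using eK[OF h] T0 mu0 by (simp add: y_def z_def field_simps)
  qed
  define B where "B = 1 + hb1 E K * z + hb2 E K * z\<^sup>2 + hb3 E K y * z ^ 3"
  have sy: "\<mu> * \<sigma> / T = card K * B"
  proof -
    have "sum y K = \<mu> * \<sigma> / T" by (simp add: y_def \<sigma>_def sum_divide_distrib sum_distrib_left)
    then show ?thesis using hub_sol_sum[OF fin(1) KV(2) symE y] by (simp add: B_def)
  qed
  have B0: "B \<noteq> 0" using sy mu0 s0 T0 by auto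
  \<comment> \<open>Multiplying by \<open>\<mu> - \<tau>\<close> instead of \<open>\<mu>\<close>
    cancels the contribution of vertices of degree \<open>\<tau>\<close>, so \<open>P\<close> only
    sees vertices of other degrees. With \<open>x\<close> replaced by
    \<open>\<sigma> / \<mu>\<close> it becomes \<open>\<sigma> / \<mu>\<close> times the
    defect.\<close>
  define P where "P = (\<Sum>v\<in>R. (\<tau> - ldeg E R v) * nsum E R x v)"
  have main: "(\<mu> - \<tau>) * (\<mu> * T - card R * \<sigma>) = \<sigma> * degsum E R - P"
  proof -
    have D1: "(\<Sum>v\<in>R. nsum E R x v) = (\<Sum>v\<in>R. ldeg E R v * x v)"
      using nsum_adjoint[OF fin(2) symE, of "\<lambda>_. 1" x] by (simp add: nsum_one)
    have "\<mu> * T = (\<Sum>v\<in>R. \<sigma> + nsum E R x v)"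
      unfolding T_def sum_distrib_left using eR by (intro sum.cong) auto
    then have 1: "\<mu> * T - card R * \<sigma> = (\<Sum>v\<in>R. nsum E R x v)" by (simp add: sum.distrib)
    have "\<mu> * (\<Sum>v\<in>R. nsum E R x v) = (\<Sum>v\<in>R. ldeg E R v * (\<sigma> + nsum E R x v))"
      unfolding D1 sum_distrib_left
    proof (rule sum.cong)
      fix v assume "v \<in> R"
      have "\<mu> * (ldeg E R v * x v) = ldeg E R v * (\<mu> * x v)" by simp
      also have "\<dots> = ldeg E R v * (\<sigma> + nsum E R x v)" unfolding eR[OF \<open>v \<in> R\<close>] ..
      finally show "\<mu> * (ldeg E R v * x v) = ldeg E R v * (\<sigma> + nsum E R x v)" .
    qed simp
    also have "\<dots> = \<sigma> * degsum E R + (\<Sum>v\<in>R. ldeg E R v * nsum E R x v)"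
      by (simp add: distrib_left sum.distrib degsum_def sum_distrib_left mult.commute)
    finally show ?thesis unfolding 1 P_def
      by (simp add: left_diff_distrib sum_subtractf sum_distrib_left[symmetric])
  qed
  define dl where "dl = P / \<sigma>"
  have dl: "\<bar>dl - defect E R \<tau> / \<mu>\<bar> \<le> 2 * real \<tau> * defect E R \<tau> / \<mu>\<^sup>2"
  proof -
    have "P - defect E R \<tau> * (\<sigma> / \<mu>) = (\<Sum>v\<in>R. (\<tau> - ldeg E R v) * nsum E R (\<lambda>w. x w - \<sigma> / \<mu>) v)"
      unfolding P_def defect_def sum_distrib_right sum_subtractf[symmetric]
      by (intro sum.cong) (auto simp: nsum_def sum_subtractf ldeg_def algebra_simps diff_divide_distrib)
    also have "\<bar>\<dots>\<bar> \<le> (\<Sum>v\<in>R. (\<tau> - ldeg E R v) * (ldeg E R v * (2 * real \<tau> * \<bar>\<sigma>\<bar> / \<mu>\<^sup>2)))"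
    proof (rule order_trans[OF sum_abs], rule sum_mono)
      fix v assume v: "v \<in> R"
      have "\<bar>x w - \<sigma> / \<mu>\<bar> \<le> 2 * real \<tau> * \<bar>\<sigma>\<bar> / \<mu>\<^sup>2" if w: "w \<in> R" for w
      proof -
        have xw: "x w - \<sigma> / \<mu> = z * nsum E R x w" using eR'[OF w] by simp
        have "\<bar>nsum E R x w\<bar> \<le> ldeg E R w * (2 * \<bar>\<sigma> / \<mu>\<bar>)" by (rule abs_nsum_le) (rule bR)
        also have "\<dots> \<le> \<tau> * (2 * \<bar>\<sigma> / \<mu>\<bar>)" using deg[OF w] by (intro mult_right_mono) auto
        finally have "\<bar>x w - \<sigma> / \<mu>\<bar> \<le> \<bar>z\<bar> * (\<tau> * (2 * \<bar>\<sigma> / \<mu>\<bar>))"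
          unfolding xw abs_mult by (rule mult_left_mono) simp
        also have "\<dots> = 2 * real \<tau> * \<bar>\<sigma>\<bar> / \<mu>\<^sup>2" using mu0 by (simp add: z_def abs_divide power2_eq_square)
        finally show ?thesis .
      qed
      then have "\<bar>nsum E R (\<lambda>w. x w - \<sigma> / \<mu>) v\<bar> \<le> ldeg E R v * (2 * real \<tau> * \<bar>\<sigma>\<bar> / \<mu>\<^sup>2)" by (rule abs_nsum_le)
      then show "\<bar>(\<tau> - ldeg E R v) * nsum E R (\<lambda>w. x w - \<sigma> / \<mu>) v\<bar> \<le> (\<tau> - ldeg E R v) * (ldeg E R v * (2 * real \<tau> * \<bar>\<sigma>\<bar> / \<mu>\<^sup>2))"
        using deg[OF v] unfolding abs_mult by (intro mult_mono) auto
    qed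
    also have "\<dots> = \<bar>\<sigma>\<bar> * (2 * real \<tau> * defect E R \<tau> / \<mu>\<^sup>2)"
      unfolding defect_def by (simp add: sum_distrib_left sum_divide_distrib algebra_simps)
    finally have "\<bar>P - defect E R \<tau> * (\<sigma> / \<mu>)\<bar> \<le> \<bar>\<sigma>\<bar> * (2 * real \<tau> * defect E R \<tau> / \<mu>\<^sup>2)" .
    moreover have "P - defect E R \<tau> * (\<sigma> / \<mu>) = \<sigma> * (dl - defect E R \<tau> / \<mu>)" using s0 by (simp add: dl_def field_simps)
    ultimately have "\<bar>\<sigma>\<bar> * \<bar>dl - defect E R \<tau> / \<mu>\<bar> \<le> \<bar>\<sigma>\<bar> * (2 * real \<tau> * defect E R \<tau> / \<mu>\<^sup>2)" by (simp only: abs_mult)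
    then show ?thesis by (rule mult_left_le_imp_le) (use s0 in simp)
  qed
  have TB: "card K * (\<mu> * T / \<sigma>) = \<mu>\<^sup>2 / B"
    using sy s0 T0 B0 mu0 k1 by (simp add: field_simps power2_eq_square)
  have "(\<mu> - \<tau>) * (\<mu>\<^sup>2 / B - real (card K) * real (card R)) = card K * ((\<mu> - \<tau>) * (\<mu> * T - card R * \<sigma>) / \<sigma>)"
    unfolding TB[symmetric] using s0 by (simp add: field_simps)
  also have "\<dots> = card K * degsum E R - card K * dl"
    unfolding main dl_def using s0 by (simp add: field_simps)
  finally have "(\<mu> - \<tau>) * (\<mu>\<^sup>2 / B) - (\<mu> - \<tau>) * (real (card K) * real (card R)) = card K * degsum E R - card K * dl"
    by (simp add: right_diff_distrib)
  then have "(\<mu> - \<tau>) * (\<mu>\<^sup>2 - hb1 E K * \<mu> + ((hb1 E K)\<^sup>2 - hb2 E K) - real (card K) * real (card R))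
      + hubR \<tau> (hb1 E K) (hb2 E K) (hb3 E K y) z = card K * degsum E R - card K * dl"
    unfolding hubR_expansion[OF mu0(2) z_def B_def B0] by (simp add: right_diff_distrib)
  then show ?thesis using y dl unfolding z_def by blast
qed

section \<open>Comparing spreads through the cubic equations\<close>

text \<open>\<open>q\<close> is minus the smallest eigenvalue. Subtracting the two cubics removes
  \<open>A\<close> and leaves a multiple of \<open>p + q\<close>; completing the square in the
  cofactor isolates the deviation of \<open>p - q\<close> from its optimal value.\<close>

lemma spread_square_identity:
  fixes p q t b1 b2 M A R1 R2 e1 e2 :: real
  assumes S: "p + q \<noteq> 0"
    and 1: "(p - t) * (p\<^sup>2 - b1 * p + (b1\<^sup>2 - b2) - M) + R1 = A - e1"
    and 2: "(- q - t) * (q\<^sup>2 + b1 * q + (b1\<^sup>2 - b2) - M) + R2 = A - e2"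
  shows "(p + q)\<^sup>2 = 4 * M + 4 / 3 * (t\<^sup>2 - t * b1 - 2 * b1\<^sup>2 + 3 * b2) - 3 * ((p - q) - 2 * (b1 + t) / 3)\<^sup>2
      - 4 * ((R1 - R2) / (p + q)) - 4 * ((e1 - e2) / (p + q))"
proof -
  define F where "F = 4 * M + 4 / 3 * (t\<^sup>2 - t * b1 - 2 * b1\<^sup>2 + 3 * b2) - 3 * ((p - q) - 2 * (b1 + t) / 3)\<^sup>2 - (p + q)\<^sup>2"
  define F3 where "F3 = 12 * M + 4 * (t\<^sup>2 - t * b1 - 2 * b1\<^sup>2 + 3 * b2) - (3 * (p - q) - 2 * (b1 + t))\<^sup>2 - 3 * (p + q)\<^sup>2"
  have "(p + q) * F3 = - 12 * ((p - t) * (p\<^sup>2 - b1 * p + (b1\<^sup>2 - b2) - M) - (- q - t) * (q\<^sup>2 + b1 * q + (b1\<^sup>2 - b2) - M))"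
    unfolding F3_def by (simp add: algebra_simps power2_eq_square power3_eq_cube)
  moreover have "F3 = 3 * F" unfolding F_def F3_def by (simp add: field_simps power2_eq_square)
  ultimately have "(p + q) * F = - 4 * ((p - t) * (p\<^sup>2 - b1 * p + (b1\<^sup>2 - b2) - M) - (- q - t) * (q\<^sup>2 + b1 * q + (b1\<^sup>2 - b2) - M))"
    by simp
  also have "\<dots> = 4 * ((R1 - R2) + (e1 - e2))" using 1 2 by (simp add: algebra_simps)
  finally have "F = (4 * ((R1 - R2) + (e1 - e2))) / (p + q)" using S by (simp add: nonzero_eq_divide_eq mult.commute)
  then have "F = 4 * ((R1 - R2) / (p + q)) + 4 * ((e1 - e2) / (p + q))" by (simp only: distrib_left add_divide_distrib times_divide_eq_right)
  then show ?thesis unfolding F_def by simp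
qed

text \<open>Each cubic is divided by its linear factor before the two are subtracted, so
  \<open>A\<close> survives. This converts knowledge about \<open>p - q\<close> into knowledge about
  the degree sum and back.\<close>

lemma eig_difference_identity:
  fixes p q t b1 b2 M A R1 R2 :: real
  assumes nz: "p + q \<noteq> 0" "p - t \<noteq> 0" "q + t \<noteq> 0"
    and 1: "(p - t) * (p\<^sup>2 - b1 * p + (b1\<^sup>2 - b2) - M) + R1 = A"
    and 2: "(- q - t) * (q\<^sup>2 + b1 * q + (b1\<^sup>2 - b2) - M) + R2 = A"
  shows "(p - q) - b1 = A / ((p - t) * (q + t)) - (R1 / (p - t) + R2 / (q + t)) / (p + q)"
proof -
  have X1: "p\<^sup>2 - b1 * p + (b1\<^sup>2 - b2) - M = (A - R1) / (p - t)" using 1 nz by (simp add: field_simps)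
  have X2: "q\<^sup>2 + b1 * q + (b1\<^sup>2 - b2) - M = - ((A - R2) / (q + t))" using 2 nz by (simp add: field_simps)
  have "(p + q) * ((p - q) - b1) = (p\<^sup>2 - b1 * p + (b1\<^sup>2 - b2) - M) - (q\<^sup>2 + b1 * q + (b1\<^sup>2 - b2) - M)"
    by (simp add: algebra_simps power2_eq_square)
  also have "\<dots> = A * (1 / (p - t) + 1 / (q + t)) - (R1 / (p - t) + R2 / (q + t))"
    unfolding X1 X2 by (simp add: algebra_simps diff_divide_distrib)
  also have "1 / (p - t) + 1 / (q + t) = (p + q) / ((p - t) * (q + t))"
    using nz by (simp add: field_simps)
  finally have "(p + q) * ((p - q) - b1) = (p + q) * (A / ((p - t) * (q + t)) - (R1 / (p - t) + R2 / (q + t)) / (p + q))"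
    using nz(1) by (simp add: right_diff_distrib)
  then show ?thesis using nz(1) by simp
qed

text \<open>\<open>p\<close> and \<open>- q\<close> are the extremal eigenvalues, \<open>L = sqrt (k m)\<close>, and \<open>A = k a\<close> with \<open>a\<close> the degree
  sum of the part outside the hubs.\<close>

definition eig_pair :: "real \<Rightarrow> real \<Rightarrow> real \<Rightarrow> real \<Rightarrow> real \<Rightarrow> real \<Rightarrow> real \<Rightarrow> real \<Rightarrow> real \<Rightarrow> real \<Rightarrow> real \<Rightarrow> real \<Rightarrow> bool" where
  "eig_pair c L t b1 b2 A p q R1 R2 e1 e2 \<longleftrightarrow>
     (p - t) * (p\<^sup>2 - b1 * p + (b1\<^sup>2 - b2) - L\<^sup>2) + R1 = A - e1 \<and>
     (- q - t) * (q\<^sup>2 + b1 * q + (b1\<^sup>2 - b2) - L\<^sup>2) + R2 = A - e2 \<and>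
     \<bar>p - L\<bar> \<le> c \<and> \<bar>q - L\<bar> \<le> c \<and> \<bar>R1\<bar> \<le> c \<and> \<bar>R2\<bar> \<le> c \<and> \<bar>R1 - R2\<bar> \<le> c * (1 / p + 1 / q) \<and> e2 \<le> e1 \<and> \<bar>A\<bar> \<le> c * L\<^sup>2"

text \<open>The constant term of the spread identity. With \<open>t\<close> standing for the degree
  bound outside the hubs it is \<open>t\<^sup>2\<close> plus \<open>psi\<close> divided by the
  number of hubs, see \<open>hub_graph_quantities\<close>.\<close>

definition psival :: "real \<Rightarrow> real \<Rightarrow> real \<Rightarrow> real" where
  "psival t b1 b2 = t\<^sup>2 - t * b1 - 2 * b1\<^sup>2 + 3 * b2"

text \<open>Here \<open>t\<close> is the degree bound outside the hubs, one less than the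
  \<open>t\<close> of the forbidden minor. The condition \<open>4 * c \<le> L\<close> keeps
  \<open>p\<close>, \<open>q\<close> and their shifts by \<open>t\<close> between fixed multiples of
  \<open>L\<close>.\<close>

locale eig_params =
  fixes c L t b1 b2 :: real
  assumes c: "1 \<le> c" and L: "4 * c \<le> L" and t: "0 \<le> t" "t \<le> c" and b1: "\<bar>b1\<bar> \<le> c"
    and psi: "\<bar>psival t b1 b2\<bar> \<le> c"
begin

lemma L0: "L > 0" "L \<ge> 1" "c \<le> c\<^sup>2" "1 \<le> L\<^sup>2"
proof -
  show "L > 0" "L \<ge> 1" using c L by auto
  then show "1 \<le> L\<^sup>2" by simp
  show "c \<le> c\<^sup>2" using mult_right_mono[of 1 c c] c by (simp add: power2_eq_square)
qed

context
  fixes A p q R1 R2 e1 e2 :: real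
  assumes ep: "eig_pair c L t b1 b2 A p q R1 R2 e1 e2"
begin

lemma pq: "L / 2 \<le> p" "L / 2 \<le> q" "p \<le> 2 * L" "q \<le> 2 * L" "0 < p" "0 < q" "L \<le> p + q" "p + q \<le> 4 * L"
    "L / 2 \<le> p - t" "L / 2 \<le> q + t" "\<bar>p - q\<bar> \<le> 2 * c"
  using ep c L t unfolding eig_pair_def by auto

lemma x_bound: "\<bar>(p - q) - 2 * (b1 + t) / 3\<bar> \<le> 4 * c"
  using pq(11) b1 t c unfolding distrib_left add_divide_distrib by linarith

lemma ident: "(p + q)\<^sup>2 = 4 * L\<^sup>2 + 4 / 3 * psival t b1 b2 - 3 * ((p - q) - 2 * (b1 + t) / 3)\<^sup>2
      - 4 * ((R1 - R2) / (p + q)) - 4 * ((e1 - e2) / (p + q))"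
  unfolding psival_def
proof (rule spread_square_identity)
  show "p + q \<noteq> 0" using pq(5,6) by linarith
  show "(p - t) * (p\<^sup>2 - b1 * p + (b1\<^sup>2 - b2) - L\<^sup>2) + R1 = A - e1"
    "(- q - t) * (q\<^sup>2 + b1 * q + (b1\<^sup>2 - b2) - L\<^sup>2) + R2 = A - e2"
    using ep unfolding eig_pair_def by blast+
qed

lemma inv_sum: "(1 / p + 1 / q) / (p + q) = 1 / (p * q)"
proof -
  have "1 / p + 1 / q = (p + q) / (p * q)" using pq(5,6) by (simp add: add_frac_eq add.commute)
  then show ?thesis using pq(7) L0 by simp
qed

lemma pq_prod: "L\<^sup>2 / 4 \<le> p * q" "p * q \<le> 4 * L\<^sup>2"
proof -
  have "(L / 2) * (L / 2) \<le> p * q" using pq L0 by (intro mult_mono) auto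
  then show "L\<^sup>2 / 4 \<le> p * q" by (simp add: power2_eq_square)
  have "p * q \<le> (2 * L) * (2 * L)" using pq L0 by (intro mult_mono) auto
  then show "p * q \<le> 4 * L\<^sup>2" by (simp add: power2_eq_square)
qed

text \<open>Boundedness of the remainders alone would give order \<open>1 / L\<close>. The Lipschitz
  estimate between the reciprocals of the two eigenvalues gains the second factor.\<close>

lemma rho_bound: "\<bar>(R1 - R2) / (p + q)\<bar> \<le> 4 * c / L\<^sup>2"
proof -
  have "\<bar>(R1 - R2) / (p + q)\<bar> \<le> c * (1 / p + 1 / q) / (p + q)"
    using ep pq by (simp add: eig_pair_def abs_divide divide_right_mono)
  also have "\<dots> = c * (1 / (p * q))" unfolding inv_sum[symmetric] by simp
  also have "\<dots> \<le> c * (1 / (L\<^sup>2 / 4))"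
    using pq_prod(1) L0 c by (intro mult_left_mono frac_le) auto
  finally show ?thesis by (simp add: mult.commute)
qed

lemma e_term: "0 \<le> (e1 - e2) / (p + q)"
  using ep pq by (simp add: eig_pair_def)

lemma spread_upper: "(p + q)\<^sup>2 \<le> 4 * L\<^sup>2 + 4 / 3 * psival t b1 b2 + 16 * c / L\<^sup>2"
  using ident rho_bound e_term zero_le_power2[of "(p - q) - 2 * (b1 + t) / 3"] by linarith

lemma spread_upper_const: "(p + q)\<^sup>2 \<le> 4 * L\<^sup>2 + 66 * c\<^sup>2"
proof -
  have "16 * c / L\<^sup>2 \<le> 16 * c" using L0 c by (simp add: divide_le_eq)
  then show ?thesis using spread_upper psi L0 by linarith
qed

context
  assumes e0: "e1 = 0" "e2 = 0"
begin

lemma spread_const: "\<bar>(p + q)\<^sup>2 - 4 * L\<^sup>2\<bar> \<le> 66 * c\<^sup>2"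
proof -
  have "\<bar>(p - q) - 2 * (b1 + t) / 3\<bar>\<^sup>2 \<le> (4 * c)\<^sup>2" using x_bound by (intro power_mono) auto
  then have "((p - q) - 2 * (b1 + t) / 3)\<^sup>2 \<le> 16 * c\<^sup>2" by (simp add: power_mult_distrib)
  moreover have "16 * c / L\<^sup>2 \<le> 16 * c" using L0 c by (simp add: divide_le_eq)
  moreover have "(e1 - e2) / (p + q) = 0" using e0 by simp
  ultimately have "4 * L\<^sup>2 - 66 * c\<^sup>2 \<le> (p + q)\<^sup>2"
    using ident rho_bound psi L0 by linarith
  then show ?thesis using spread_upper_const by linarith
qed

text \<open>The denominator \<open>(p - t) * (q + t)\<close> differs from \<open>L\<^sup>2\<close>
  by a bounded amount, because \<open>(p + q)\<^sup>2\<close> is \<open>4 * L\<^sup>2\<close> up to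
  a constant and \<open>p - q\<close> is bounded.\<close>

lemma d_approx: "\<bar>(p - q) - b1 - A / L\<^sup>2\<bar> \<le> 88 * c ^ 3 / L\<^sup>2"
proof -
  define D where "D = (p - t) * (q + t)"
  define d where "d = p - q"
  have "(L / 2) * (L / 2) \<le> D" unfolding D_def using pq L0 by (intro mult_mono) auto
  then have D: "L\<^sup>2 / 4 \<le> D" by (simp add: power2_eq_square)
  have D0: "D > 0" using D L0 by (smt (verit) divide_pos_pos zero_less_power)
  have "\<bar>d\<bar> \<le> 2 * c" using pq by (simp add: d_def)
  then have d2: "d\<^sup>2 \<le> 4 * c\<^sup>2" using power_mono[of "\<bar>d\<bar>" "2 * c" 2] by (simp add: power_mult_distrib)
  have td: "\<bar>t * d\<bar> \<le> 2 * c\<^sup>2"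
    using mult_mono[of t c "\<bar>d\<bar>" "2 * c"] t c \<open>\<bar>d\<bar> \<le> 2 * c\<close> by (simp add: abs_mult power2_eq_square)
  have t2: "t\<^sup>2 \<le> c\<^sup>2" using t by (intro power_mono)
  have "4 * D - 4 * L\<^sup>2 = ((p + q)\<^sup>2 - 4 * L\<^sup>2) - d\<^sup>2 + 4 * (t * d) - 4 * t\<^sup>2"
    unfolding D_def d_def by (simp add: algebra_simps power2_eq_square)
  moreover have "(p + q)\<^sup>2 - 4 * L\<^sup>2 \<le> 66 * c\<^sup>2" "- (66 * c\<^sup>2) \<le> (p + q)\<^sup>2 - 4 * L\<^sup>2"
    "t * d \<le> 2 * c\<^sup>2" "- (2 * c\<^sup>2) \<le> t * d" using spread_const td by (auto simp: abs_le_iff)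
  ultimately have "D - L\<^sup>2 \<le> 21 * c\<^sup>2" "- (D - L\<^sup>2) \<le> 21 * c\<^sup>2"
    using d2 t2 zero_le_power2[of d] zero_le_power2[of t] zero_le_power2[of c] by linarith+
  then have DL: "\<bar>D - L\<^sup>2\<bar> \<le> 21 * c\<^sup>2" by (rule abs_leI)
  have "\<bar>A / D - A / L\<^sup>2\<bar> = \<bar>A\<bar> / L\<^sup>2 * (\<bar>D - L\<^sup>2\<bar> / D)"
  proof -
    have "A / D - A / L\<^sup>2 = A / L\<^sup>2 * ((L\<^sup>2 - D) / D)" using D0 L0 by (simp add: field_simps)
    then show ?thesis using D0 by (simp add: abs_mult abs_divide abs_minus_commute)
  qed
  also have "\<dots> \<le> c * ((21 * c\<^sup>2) / (L\<^sup>2 / 4))"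
  proof (rule mult_mono)
    show "\<bar>A\<bar> / L\<^sup>2 \<le> c" using ep L0 by (simp add: eig_pair_def divide_le_eq)
    show "\<bar>D - L\<^sup>2\<bar> / D \<le> (21 * c\<^sup>2) / (L\<^sup>2 / 4)" using DL D D0 L0 by (intro frac_le) auto
  qed (use c D0 in auto)
  also have "\<dots> = 84 * c ^ 3 / L\<^sup>2" by (simp add: power2_eq_square power3_eq_cube)
  finally have 1: "\<bar>A / D - A / L\<^sup>2\<bar> \<le> 84 * c ^ 3 / L\<^sup>2" .
  have "\<bar>R1 / (p - t)\<bar> \<le> c / (L / 2)" "\<bar>R2 / (q + t)\<bar> \<le> c / (L / 2)"
    using ep pq L0 c unfolding abs_divide by (intro frac_le; auto simp: eig_pair_def)+
  then have "\<bar>R1 / (p - t) + R2 / (q + t)\<bar> \<le> c / (L / 2) + c / (L / 2)"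
    by (rule order_trans[OF abs_triangle_ineq add_mono])
  also have "\<dots> = 4 * c / L" by simp
  finally have "\<bar>R1 / (p - t) + R2 / (q + t)\<bar> \<le> 4 * c / L" .
  then have "\<bar>(R1 / (p - t) + R2 / (q + t)) / (p + q)\<bar> \<le> (4 * c / L) / L"
    unfolding abs_divide using pq L0 c by (intro frac_le) auto
  also have "\<dots> \<le> 4 * c ^ 3 / L\<^sup>2"
  proof -
    have "c * 1 \<le> c * c\<^sup>2" using c L0 by (intro mult_left_mono) auto
    then show ?thesis using L0 by (simp add: power2_eq_square power3_eq_cube divide_right_mono)
  qed
  finally have 2: "\<bar>(R1 / (p - t) + R2 / (q + t)) / (p + q)\<bar> \<le> 4 * c ^ 3 / L\<^sup>2" .
  have "(p - q) - b1 = A / D - (R1 / (p - t) + R2 / (q + t)) / (p + q)"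
    unfolding D_def by (rule eig_difference_identity) (use ep e0 pq L0 in \<open>auto simp: eig_pair_def\<close>)
  moreover have "84 * c ^ 3 / L\<^sup>2 + 4 * c ^ 3 / L\<^sup>2 = 88 * c ^ 3 / L\<^sup>2" by (simp add: add_divide_distrib[symmetric])
  ultimately show ?thesis using 1 2 by linarith
qed

lemma x_approx:
  assumes "\<bar>A / L\<^sup>2 - (2 * t - b1) / 3\<bar> \<le> c / L\<^sup>2"
  shows "\<bar>(p - q) - 2 * (b1 + t) / 3\<bar> \<le> 89 * c ^ 3 / L\<^sup>2"
proof -
  have "c * 1 \<le> c * c\<^sup>2" using c L0 by (intro mult_left_mono) auto
  then have "c / L\<^sup>2 \<le> c ^ 3 / L\<^sup>2" by (intro divide_right_mono) (auto simp: power2_eq_square power3_eq_cube)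
  moreover have "88 * c ^ 3 / L\<^sup>2 + c ^ 3 / L\<^sup>2 = 89 * c ^ 3 / L\<^sup>2" by (simp add: add_divide_distrib[symmetric])
  moreover have "(p - q) - 2 * (b1 + t) / 3 = ((p - q) - b1 - A / L\<^sup>2) + (A / L\<^sup>2 - (2 * t - b1) / 3)"
    by (simp add: field_simps)
  ultimately show ?thesis using d_approx assms by linarith
qed

text \<open>A degree sum within a constant of the optimum makes the square in the identity of order
  \<open>L ^ -4\<close>, so only the remainder term limits the precision.\<close>

lemma spread_lower:
  assumes "\<bar>A / L\<^sup>2 - (2 * t - b1) / 3\<bar> \<le> c / L\<^sup>2"
  shows "4 * L\<^sup>2 + 4 / 3 * psival t b1 b2 - (16 * c + 3 * (89 * c ^ 3)\<^sup>2) / L\<^sup>2 \<le> (p + q)\<^sup>2"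
proof -
  have "((p - q) - 2 * (b1 + t) / 3)\<^sup>2 \<le> (89 * c ^ 3 / L\<^sup>2)\<^sup>2"
    using power_mono[OF x_approx[OF assms], of 2] by simp
  also have "\<dots> = (89 * c ^ 3)\<^sup>2 / L\<^sup>2 / L\<^sup>2" by (simp add: power2_eq_square)
  also have "\<dots> \<le> (89 * c ^ 3)\<^sup>2 / L\<^sup>2 / 1" using L0 by (intro divide_left_mono) auto
  finally have "((p - q) - 2 * (b1 + t) / 3)\<^sup>2 \<le> (89 * c ^ 3)\<^sup>2 / L\<^sup>2" by simp
  moreover have "(e1 - e2) / (p + q) = 0" using e0 by simp
  moreover have "(16 * c + 3 * (89 * c ^ 3)\<^sup>2) / L\<^sup>2 = 4 * (4 * c / L\<^sup>2) + 3 * ((89 * c ^ 3)\<^sup>2 / L\<^sup>2)"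
    by (simp add: add_divide_distrib)
  ultimately show ?thesis using ident rho_bound by linarith
qed

end

end

text \<open>The constant terms of the final quadratic inequality in \<open>compare\<close>.\<close>

definition "Gc = 3 * (89 * c ^ 3)\<^sup>2 + 2112 * c ^ 3 + 16 * c * (89 * c ^ 3)"

text \<open>Both graphs share \<open>L\<close>, \<open>b1\<close> and \<open>b2\<close>, so
  subtracting their spread identities leaves the squares, the defect term and the difference of the
  remainders. The latter is controlled by how far the eigenvalues of the two graphs are apart, which
  in turn is controlled by the deviations \<open>x\<close> and \<open>x'\<close>. The result is an
  inequality bounding a quadratic in the deviation by a linear one, and it closes at precision
  \<open>1 / L\<^sup>2\<close> for the deviation as well as for \<open>f\<close>.\<close>

lemma compare:
  assumes ep: "eig_pair c L t b1 b2 A p q R1 R2 e1 e2"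
    and ep': "eig_pair c L t b1 b2 A' p' q' R1' R2' 0 0"
    and opt: "\<bar>A' / L\<^sup>2 - (2 * t - b1) / 3\<bar> \<le> c / L\<^sup>2"
    and le: "p' + q' \<le> p + q"
    and lip: "\<bar>R1 - R1'\<bar> \<le> c * \<bar>1 / p - 1 / p'\<bar>" "\<bar>R2 - R2'\<bar> \<le> c * \<bar>1 / q - 1 / q'\<bar>"
    and f: "f \<ge> 0" "f * (1 / p + 1 / q) / 2 \<le> e1 - e2"
  shows "\<bar>(p - q) - 2 * (b1 + t) / 3\<bar> \<le> (Gc + 16 * c) / L\<^sup>2"
    and "f \<le> 2 * (Gc + 16 * c * (Gc + 16 * c)) / L\<^sup>2"
proof -
  note P = pq[OF ep] and P' = pq[OF ep']
  define x where "x = (p - q) - 2 * (b1 + t) / 3"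
  define x' where "x' = (p' - q') - 2 * (b1 + t) / 3"
  define S where "S = p + q"
  define S' where "S' = p' + q'"
  define Y where "Y = 89 * c ^ 3"
  have Y0: "Y \<ge> 0" using c by (simp add: Y_def)
  have S0: "L \<le> S" "L \<le> S'" "0 < S" "0 < S'" using P P' L0 by (auto simp: S_def S'_def)
  have x': "\<bar>x'\<bar> \<le> Y / L\<^sup>2" unfolding x'_def Y_def by (rule x_approx[OF ep' _ _ opt]) auto
  have SS: "\<bar>S\<^sup>2 - S'\<^sup>2\<bar> \<le> 132 * c\<^sup>2"
  proof -
    have "S'\<^sup>2 \<le> S\<^sup>2" using le S0 by (intro power_mono) (auto simp: S_def S'_def)
    then show ?thesis using spread_upper_const[OF ep] spread_const[OF ep'] unfolding S_def S'_def by auto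
  qed
  have dS: "\<bar>S - S'\<bar> \<le> 66 * c\<^sup>2 / L"
  proof -
    have "S\<^sup>2 - S'\<^sup>2 = (S + S') * (S - S')" by (simp add: power2_eq_square algebra_simps)
    then have "(S + S') * \<bar>S - S'\<bar> \<le> 132 * c\<^sup>2" using SS S0 by (simp add: abs_mult)
    moreover have "(2 * L) * \<bar>S - S'\<bar> \<le> (S + S') * \<bar>S - S'\<bar>" using S0 by (intro mult_right_mono) auto
    ultimately show ?thesis using L0 by (simp add: field_simps)
  qed
  define g where "g = \<bar>x\<bar> + \<bar>x'\<bar>"
  \<comment> \<open>\<open>h / 2\<close> bounds the displacement of both eigenvalues:
    \<open>2 * (p - p')\<close> and \<open>2 * (q - q')\<close> are the difference of the spreads
    plus or minus the difference of the deviations.\<close>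
  define h where "h = 66 * c\<^sup>2 / L + g"
  have g0: "g \<ge> 0" by (simp add: g_def)
  have h0: "h \<ge> 0" using g0 L0 by (simp add: h_def)
  have dd: "\<bar>p - p'\<bar> \<le> h / 2" "\<bar>q - q'\<bar> \<le> h / 2"
  proof -
    have "2 * (p - p') = (S - S') + (x - x')" "2 * (q - q') = (S - S') - (x - x')"
      by (simp_all add: S_def S'_def x_def x'_def)
    then have "2 * \<bar>p - p'\<bar> \<le> \<bar>S - S'\<bar> + (\<bar>x\<bar> + \<bar>x'\<bar>)" "2 * \<bar>q - q'\<bar> \<le> \<bar>S - S'\<bar> + (\<bar>x\<bar> + \<bar>x'\<bar>)" by linarith+
    moreover have "\<bar>S - S'\<bar> + (\<bar>x\<bar> + \<bar>x'\<bar>) \<le> h" unfolding h_def g_def using dS by simp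
    ultimately have "2 * \<bar>p - p'\<bar> \<le> h" "2 * \<bar>q - q'\<bar> \<le> h" by (blast intro: order_trans)+
    then show "\<bar>p - p'\<bar> \<le> h / 2" "\<bar>q - q'\<bar> \<le> h / 2" by simp_all
  qed
  have inv: "\<bar>1 / a - 1 / b\<bar> \<le> 2 * h / L\<^sup>2" if "L / 2 \<le> a" "L / 2 \<le> b" "\<bar>a - b\<bar> \<le> h / 2" for a b
  proof -
    have ab: "a > 0" "b > 0" using that L0 by auto
    have "(L / 2) * (L / 2) \<le> a * b" using that L0 by (intro mult_mono) auto
    then have m: "L\<^sup>2 / 4 \<le> a * b" by (simp add: power2_eq_square)
    have "\<bar>1 / a - 1 / b\<bar> = \<bar>a - b\<bar> / (a * b)"
    proof -
      have "1 / a - 1 / b = (b - a) / (a * b)" using ab by (simp add: field_simps)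
      then show ?thesis using ab by (simp add: abs_divide abs_mult abs_minus_commute)
    qed
    also have "\<dots> \<le> (h / 2) / (L\<^sup>2 / 4)" using m that L0 h0 by (intro frac_le) auto
    finally show ?thesis by simp
  qed
  have dR: "\<bar>R1 - R1'\<bar> \<le> c * (2 * h / L\<^sup>2)" "\<bar>R2 - R2'\<bar> \<le> c * (2 * h / L\<^sup>2)"
    using order_trans[OF lip(1) mult_left_mono[OF inv[of p p']]] order_trans[OF lip(2) mult_left_mono[OF inv[of q q']]] P P' dd c by auto
  define \<rho> where "\<rho> = (R1 - R2) / S"
  define \<rho>' where "\<rho>' = (R1' - R2') / S'"
  have drho: "\<bar>\<rho> - \<rho>'\<bar> \<le> 4 * c * h / L ^ 3 + 264 * c ^ 3 / L ^ 4"
  proof -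
    have eq: "\<rho> - \<rho>' = ((R1 - R1') - (R2 - R2')) / S + (R1' - R2') / S' * ((S' - S) / S)"
      unfolding \<rho>_def \<rho>'_def using S0 by (simp add: field_simps)
    have u: "\<bar>((R1 - R1') - (R2 - R2')) / S\<bar> \<le> (c * (4 * h / L\<^sup>2)) / L"
      unfolding abs_divide
    proof (rule frac_le)
      have "\<bar>(R1 - R1') - (R2 - R2')\<bar> \<le> c * (2 * h / L\<^sup>2) + c * (2 * h / L\<^sup>2)"
        by (rule order_trans[OF abs_triangle_ineq4 add_mono[OF dR]])
      also have "\<dots> = c * (4 * h / L\<^sup>2)" by simp
      finally show "\<bar>(R1 - R1') - (R2 - R2')\<bar> \<le> c * (4 * h / L\<^sup>2)" .
    qed (use S0 L0 c h0 in auto)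
    have w: "\<bar>(R1' - R2') / S' * ((S' - S) / S)\<bar> \<le> (4 * c / L\<^sup>2) * ((66 * c\<^sup>2 / L) / L)"
      unfolding abs_mult
    proof (rule mult_mono)
      show "\<bar>(R1' - R2') / S'\<bar> \<le> 4 * c / L\<^sup>2" using rho_bound[OF ep'] by (simp add: S'_def)
      show "\<bar>(S' - S) / S\<bar> \<le> (66 * c\<^sup>2 / L) / L"
        unfolding abs_divide using dS S0 L0 by (intro frac_le) auto
    qed (use c in auto)
    have w': "(4 * c / L\<^sup>2) * ((66 * c\<^sup>2 / L) / L) = 264 * c ^ 3 / L ^ 4"
      by (simp add: power2_eq_square power3_eq_cube power4_eq_xxxx)
    have u': "(c * (4 * h / L\<^sup>2)) / L = 4 * c * h / L ^ 3" by (simp add: power2_eq_square power3_eq_cube)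
    show ?thesis unfolding eq u'[symmetric] w'[symmetric]
      by (rule order_trans[OF abs_triangle_ineq add_mono[OF u w]])
  qed
  have e: "f / (8 * L\<^sup>2) \<le> (e1 - e2) / S"
  proof -
    have "f / (8 * L\<^sup>2) \<le> f / (2 * (p * q))"
      using pq_prod[OF ep] P L0 f by (intro divide_left_mono) auto
    also have "\<dots> = f * ((1 / p + 1 / q) / (p + q)) / 2" unfolding inv_sum[OF ep] by simp
    also have "\<dots> = (f * (1 / p + 1 / q) / 2) / S" by (simp add: S_def)
    also have "\<dots> \<le> (e1 - e2) / S" using f S0 by (intro divide_right_mono) auto
    finally show ?thesis .
  qed
  define W where "W = 4 * c * h / L ^ 3 + 264 * c ^ 3 / L ^ 4"
  define ff where "ff = f / (8 * L\<^sup>2)"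
  define es where "es = (e1 - e2) / S"
  define base where "base = 4 * L\<^sup>2 + 4 / 3 * psival t b1 b2"
  have I: "S\<^sup>2 = base - 3 * x\<^sup>2 - 4 * \<rho> - 4 * es"
    unfolding S_def x_def \<rho>_def es_def base_def by (rule ident[OF ep])
  have I': "S'\<^sup>2 = base - 3 * x'\<^sup>2 - 4 * \<rho>'"
    unfolding S'_def x'_def \<rho>'_def base_def using ident[OF ep'] by simp
  have "S'\<^sup>2 \<le> S\<^sup>2" using le S0 by (intro power_mono) (auto simp: S_def S'_def)
  moreover have "\<rho>' - \<rho> \<le> W" using drho by (auto simp: W_def abs_le_iff)
  moreover have "ff \<le> es" using e by (simp add: ff_def es_def)
  ultimately have "3 * x\<^sup>2 + 4 * ff \<le> 3 * x'\<^sup>2 + 4 * W"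
    using I I' by linarith
  then have main: "(3 * x\<^sup>2 + 4 * (f / (8 * L\<^sup>2))) * L ^ 4 \<le> (3 * x'\<^sup>2 + 4 * (4 * c * h / L ^ 3 + 264 * c ^ 3 / L ^ 4)) * L ^ 4"
    unfolding W_def ff_def using L0 by (intro mult_right_mono) auto
  \<comment> \<open>After scaling by \<open>L ^ 4\<close> the inequality is quadratic in
    \<open>X\<close>, with bounds independent of \<open>L\<close> apart from the term
    \<open>f * L\<^sup>2\<close> that is to be estimated.\<close>
  define X where "X = \<bar>x\<bar> * L\<^sup>2"
  define X' where "X' = \<bar>x'\<bar> * L\<^sup>2"
  have X0: "X \<ge> 0" "X' \<ge> 0" by (auto simp: X_def X'_def)
  have X'Y: "X' \<le> Y" using x' L0 by (simp add: X'_def field_simps)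
  have l4: "(3 * x\<^sup>2 + 4 * (f / (8 * L\<^sup>2))) * L ^ 4 = 3 * X\<^sup>2 + f * L\<^sup>2 / 2"
    using L0 by (simp add: X_def power_mult_distrib distrib_right power2_eq_square power4_eq_xxxx)
  have r4: "(3 * x'\<^sup>2 + 4 * (4 * c * h / L ^ 3 + 264 * c ^ 3 / L ^ 4)) * L ^ 4 = 3 * X'\<^sup>2 + 16 * c * (h * L) + 1056 * c ^ 3"
    using L0 by (simp add: X'_def power_mult_distrib distrib_right power2_eq_square power3_eq_cube power4_eq_xxxx)
  \<comment> \<open>The deviations occur with one factor \<open>L\<close>; since \<open>L\<close> is
    at least one they are dominated by \<open>X\<close> and \<open>X'\<close>.\<close>
  have hL: "h * L \<le> 66 * c\<^sup>2 + X + X'"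
  proof -
    have "h * L = 66 * c\<^sup>2 + (\<bar>x\<bar> * L + \<bar>x'\<bar> * L)" using L0 by (simp add: h_def g_def distrib_right)
    moreover have "\<bar>x\<bar> * L * 1 \<le> \<bar>x\<bar> * L * L" "\<bar>x'\<bar> * L * 1 \<le> \<bar>x'\<bar> * L * L"
      by (rule mult_left_mono, use L0 in simp, use L0 in simp)+
    ultimately show ?thesis by (simp add: X_def X'_def power2_eq_square mult.assoc)
  qed
  have "16 * c * (h * L) \<le> 16 * c * (66 * c\<^sup>2 + X + X')" using hL c by (intro mult_left_mono) auto
  also have "\<dots> = 1056 * c ^ 3 + 16 * c * X + 16 * c * X'" by (simp add: algebra_simps power2_eq_square power3_eq_cube)
  also have "16 * c * X' \<le> 16 * c * Y" using X'Y c by (intro mult_left_mono) auto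
  finally have hh: "16 * c * (h * L) \<le> 1056 * c ^ 3 + 16 * c * X + 16 * c * Y" by simp
  have "X'\<^sup>2 \<le> Y\<^sup>2" using X'Y X0 by (intro power_mono)
  then have fin: "3 * X\<^sup>2 + f * L\<^sup>2 / 2 \<le> Gc + 16 * c * X"
  proof -
    have lin: "a \<le> 3 * b + u + 1056 * d \<Longrightarrow> u \<le> 1056 * d + v + w \<Longrightarrow> b \<le> e \<Longrightarrow> a \<le> (3 * e + 2112 * d + w) + v"
      for a b d e u v w :: real by linarith
    show ?thesis unfolding Gc_def Y_def[symmetric]
      by (rule lin[OF main[unfolded l4 r4] hh \<open>X'\<^sup>2 \<le> Y\<^sup>2\<close>])
  qed
  have G0: "Gc \<ge> 0" using c by (simp add: Gc_def)
  have fL: "f * L\<^sup>2 \<ge> 0" using f by simp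
  have XG: "X \<le> Gc + 16 * c"
  proof (rule ccontr)
    assume "\<not> ?thesis"
    then have big: "Gc + 16 * c < X" "1 \<le> X" using G0 c by auto
    have "(Gc + 16 * c) * X \<le> X * X" using big X0 by (intro mult_right_mono) auto
    moreover have "Gc * 1 \<le> Gc * X" using big G0 by (intro mult_left_mono) auto
    moreover have "0 < X * X" using big by simp
    moreover have lin: "3 * a + F / 2 \<le> g + v \<Longrightarrow> w + v \<le> a \<Longrightarrow> g \<le> w \<Longrightarrow> 0 < a \<Longrightarrow> 0 \<le> F \<Longrightarrow> False"
      for a F g v w :: real by linarith
    ultimately show False
      using lin[OF fin[unfolded power2_eq_square[of X]] _ _ _ fL, of "Gc * X"] by (simp add: distrib_right)
  qed
  then show "\<bar>(p - q) - 2 * (b1 + t) / 3\<bar> \<le> (Gc + 16 * c) / L\<^sup>2"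
    using L0 by (simp add: X_def x_def field_simps)
  have m: "16 * c * X \<le> 16 * c * (Gc + 16 * c)" using XG c by (intro mult_left_mono) auto
  have lin: "3 * a + F / 2 \<le> g + v \<Longrightarrow> v \<le> w \<Longrightarrow> 0 \<le> a \<Longrightarrow> F \<le> 2 * (g + w)"
    for a F g v w :: real by (simp add: distrib_left)
  have "f * L\<^sup>2 \<le> 2 * (Gc + 16 * c * (Gc + 16 * c))" by (rule lin[OF fin m zero_le_power2])
  then show "f \<le> 2 * (Gc + 16 * c * (Gc + 16 * c)) / L\<^sup>2" using L0 by (simp add: field_simps)
qed

end

section \<open>Spectral asymptotics of hub joins\<close>

lemma hub_joinD:
  assumes "hub_join V K E \<tau>"
  shows "ugraph V E" "K \<subseteq> V" "K \<noteq> {}" "K \<times> (V - K) \<subseteq> E" "(V - K) \<times> K \<subseteq> E"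
    "v \<in> V - K \<Longrightarrow> ldeg E (V - K) v \<le> \<tau>" "finite K" "finite (V - K)" "sym E"
proof -
  show ug: "ugraph V E" and "K \<subseteq> V" "K \<noteq> {}" and j: "K \<times> (V - K) \<subseteq> E" using assms by (auto simp: hub_join_def)
  then show "(V - K) \<times> K \<subseteq> E" using ugraphD(4)[OF ug] by auto
  show "v \<in> V - K \<Longrightarrow> ldeg E (V - K) v \<le> \<tau>" using assms by (auto simp: hub_join_def ldeg_def)
  show "finite K" "finite (V - K)" using ugraphD(1)[OF ug] \<open>K \<subseteq> V\<close> finite_subset by auto
  show "sym E" using ug by (simp add: ugraph_def)
qed

lemma hub_join_qf:
  assumes hj: "hub_join V K E \<tau>"
  shows "qf E x = qf (E \<inter> K \<times> K) x + qf (E \<inter> (V - K) \<times> (V - K)) x + 2 * (sum x K * sum x (V - K))"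
proof -
  note h = hub_joinD[OF hj]
  let ?R = "V - K"
  have "qf E x = qf (E \<inter> K \<times> K) x + qf (E \<inter> ?R \<times> ?R \<union> (K \<times> ?R \<union> ?R \<times> K)) x"
    by (rule qf_Un) (use h ugraphD(2,3)[OF h(1)] in auto)
  also have "qf (E \<inter> ?R \<times> ?R \<union> (K \<times> ?R \<union> ?R \<times> K)) x = qf (E \<inter> ?R \<times> ?R) x + qf (K \<times> ?R \<union> ?R \<times> K) x"
    by (rule qf_Un) (use h in auto)
  also have "qf (K \<times> ?R \<union> ?R \<times> K) x = qf (K \<times> ?R) x + qf (?R \<times> K) x"
    by (rule qf_Un) (use h in auto)
  also have "qf (?R \<times> K) x = qf (K \<times> ?R) x"
    using qf_converse[of "K \<times> ?R" x] by (simp add: converse_Times)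
  also have "qf (K \<times> ?R) x = sum x K * sum x ?R"
    unfolding qf_def by (simp add: sum_product sum.cartesian_product)
  finally show ?thesis by simp
qed

lemma abs_qf_ldeg:
  assumes "finite U" "sym E" "\<And>u. u \<in> U \<Longrightarrow> ldeg E U u \<le> D"
  shows "\<bar>qf (E \<inter> U \<times> U) x\<bar> \<le> D * nrm2 U x"
proof -
  have eq: "(E \<inter> U \<times> U)\<inverse> = E \<inter> U \<times> U" using assms(2) by (auto dest: symD)
  have d: "real (card ((E \<inter> U \<times> U) `` {v})) \<le> D" if "v \<in> U" for v
  proof -
    have "(E \<inter> U \<times> U) `` {v} = E `` {v} \<inter> U" using that by auto
    then show ?thesis using assms(3)[OF that] by (simp add: ldeg_def)
  qed
  have "2 * (\<Sum>(u, v)\<in>E \<inter> U \<times> U. \<bar>x u\<bar> * \<bar>x v\<bar>) \<le> (1 * D + D / 1) * nrm2 U x"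
    by (rule sum_arcs_le_deg) (use d assms(1) in \<open>simp_all add: eq\<close>)
  then show ?thesis using abs_qf_le[of "E \<inter> U \<times> U" x] by simp
qed

text \<open>The complete bipartite part has extremal eigenvalues \<open>L\<close> and
  \<open>- L\<close>, and the remaining arcs perturb them by at most \<open>card K + \<tau>\<close>.
  The lower bound for \<open>p\<close> has no loss because its test vector is nonnegative.\<close>

lemma hub_join_extremal_bounds:
  assumes hj: "hub_join V K E \<tau>" and ex: "extremal_eig V E p q" and ne: "V - K \<noteq> {}"
  defines "L \<equiv> sqrt (real (card K) * real (card (V - K)))"
  shows "L \<le> p" "p \<le> L + (card K + \<tau>)" "L - (card K + \<tau>) \<le> - q" "- q \<le> L + (card K + \<tau>)"
proof -
  note h = hub_joinD[OF hj]
  let ?R = "V - K"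
  define k where "k = real (card K)"
  define m where "m = real (card ?R)"
  have km: "k \<ge> 1" "m \<ge> 1" using h ne by (simp_all add: k_def m_def Suc_le_eq card_gt_0_iff)
  have L: "L > 0" "L\<^sup>2 = k * m" using km by (simp_all add: L_def k_def m_def)
  have nV: "nrm2 V x = nrm2 K x + nrm2 ?R x" for x :: "'a \<Rightarrow> real"
    using sum.subset_diff[OF h(2) ugraphD(1)[OF h(1)], of "\<lambda>v. (x v)\<^sup>2"] by simp
  have bK: "\<bar>qf (E \<inter> K \<times> K) x\<bar> \<le> k * nrm2 K x" for x
    by (rule abs_qf_ldeg[OF h(7,9)]) (simp add: k_def ldeg_le_card(1)[OF h(7)])
  have bR: "\<bar>qf (E \<inter> ?R \<times> ?R) x\<bar> \<le> \<tau> * nrm2 ?R x" for x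
    by (rule abs_qf_ldeg[OF h(8,9,6)])
  have up: "\<bar>qf E x\<bar> \<le> (L + (card K + \<tau>)) * nrm2 V x" for x
  proof -
    have n0: "nrm2 K x \<ge> 0" "nrm2 ?R x \<ge> 0" by (simp_all add: sum_nonneg)
    have "\<bar>sum x K\<bar> * \<bar>sum x ?R\<bar> \<le> (sqrt k * sqrt (nrm2 K x)) * (sqrt m * sqrt (nrm2 ?R x))"
      using h by (intro mult_mono abs_sum_le_sqrt) (auto simp: k_def m_def n0)
    also have "\<dots> = L * (sqrt (nrm2 K x) * sqrt (nrm2 ?R x))" by (simp add: L_def k_def m_def real_sqrt_mult)
    finally have 1: "2 * (\<bar>sum x K\<bar> * \<bar>sum x ?R\<bar>) \<le> L * (2 * (sqrt (nrm2 K x) * sqrt (nrm2 ?R x)))" by simp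
    have "2 * (sqrt (nrm2 K x) * sqrt (nrm2 ?R x)) \<le> nrm2 K x + nrm2 ?R x"
      using two_mult_le_weighted[of 1 "sqrt (nrm2 K x)" "sqrt (nrm2 ?R x)"] n0 by simp
    then have "L * (2 * (sqrt (nrm2 K x) * sqrt (nrm2 ?R x))) \<le> L * (nrm2 K x + nrm2 ?R x)"
      using L by (intro mult_left_mono) auto
    with 1 have 2: "\<bar>2 * (sum x K * sum x ?R)\<bar> \<le> L * (nrm2 K x + nrm2 ?R x)" by (simp add: abs_mult)
    have "k * nrm2 K x \<le> (k + \<tau>) * nrm2 K x" "\<tau> * nrm2 ?R x \<le> (k + \<tau>) * nrm2 ?R x"
      using n0 km by (auto intro!: mult_right_mono)
    then have "\<bar>qf E x\<bar> \<le> (k + \<tau>) * nrm2 K x + (k + \<tau>) * nrm2 ?R x + L * (nrm2 K x + nrm2 ?R x)"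
      unfolding hub_join_qf[OF hj] using bK[of x] bR[of x] 2 by linarith
    then show ?thesis unfolding nV k_def by (simp add: algebra_simps)
  qed
  have eig: "\<bar>a\<bar> \<le> L + (card K + \<tau>)" if a: "eigvec V E a x" for a x
  proof -
    note e = eigvec_qf[OF a ugraphD(1,3)[OF h(1)]]
    have "\<bar>a\<bar> * nrm2 V x \<le> (L + (card K + \<tau>)) * nrm2 V x"
      using up[of x] e by (simp add: abs_mult)
    then show ?thesis using e(2) by simp
  qed
  obtain x where "eigvec V E p x" using ex by (auto simp: extremal_eig_def)
  from eig[OF this] show "p \<le> L + (card K + \<tau>)" by linarith
  obtain x where "eigvec V E q x" using ex by (auto simp: extremal_eig_def)
  from eig[OF this] show "- q \<le> L + (card K + \<tau>)" by linarith
  \<comment> \<open>For \<open>c = 1\<close> and \<open>c = -1\<close> these are the extremal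
    eigenvectors of the complete bipartite part.\<close>
  define f where "f c v = (if v \<in> K then sqrt m else c * sqrt k)" for c :: real and v
  have sf: "sum (f c) K = k * sqrt m" "sum (f c) ?R = c * (m * sqrt k)" "nrm2 K (f c) = k * m" "nrm2 ?R (f c) = c\<^sup>2 * (m * k)" for c
    using km by (simp_all add: f_def k_def m_def power_mult_distrib)
  have prod: "(k * sqrt m) * (m * sqrt k) = k * m * L"
    by (simp add: L_def k_def m_def real_sqrt_mult)
  have kmp: "0 < k * m" using km by simp
  have pr: "sum (f 1) K * sum (f 1) ?R = k * m * L" "sum (f (- 1)) K * sum (f (- 1)) ?R = - (k * m * L)"
    unfolding sf prod[symmetric] by simp_all
  have "0 \<le> qf (E \<inter> K \<times> K) (f 1)" "0 \<le> qf (E \<inter> ?R \<times> ?R) (f 1)"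
    unfolding qf_def using km by (auto intro!: sum_nonneg simp: f_def)
  then have "2 * (k * m * L) \<le> qf E (f 1)" unfolding hub_join_qf[OF hj] pr by linarith
  also have "\<dots> \<le> p * nrm2 V (f 1)" using ex by (simp add: extremal_eig_def)
  finally have "(2 * (k * m)) * L \<le> (2 * (k * m)) * p" unfolding nV sf by (simp add: algebra_simps)
  then show "L \<le> p" by (rule mult_left_le_imp_le) (use kmp in simp)
  have "q * nrm2 V (f (-1)) \<le> qf E (f (-1))" using ex by (simp add: extremal_eig_def)
  also have "\<dots> \<le> k * (k * m) + \<tau> * (m * k) - 2 * (k * m * L)"
  proof -
    have "qf (E \<inter> K \<times> K) (f (-1)) \<le> k * (k * m)" "qf (E \<inter> ?R \<times> ?R) (f (-1)) \<le> \<tau> * (m * k)"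
      using bK[of "f (-1)"] bR[of "f (-1)"] unfolding sf by auto
    then show ?thesis unfolding hub_join_qf[OF hj] pr by linarith
  qed
  finally have "(k * m) * (2 * q) \<le> (k * m) * (k + \<tau> - 2 * L)" unfolding nV sf by (simp add: algebra_simps)
  then have "2 * q \<le> k + \<tau> - 2 * L" by (rule mult_left_le_imp_le) (use kmp in simp)
  then show "L - (card K + \<tau>) \<le> - q" using km by (simp add: k_def)
qed

text \<open>Everything in the remainder except the eigenvalue is determined by the hub graph. This
  lets the remainders of a graph and of its competitor be compared through one Lipschitz
  bound.\<close>

lemma hub_quantities_cong:
  assumes "E \<inter> K \<times> K = E' \<inter> K \<times> K"
  shows "hb1 E K = hb1 E' K" "hb2 E K = hb2 E' K" "hb3 E K y = hb3 E' K y" "hub_sol E K z y = hub_sol E' K z y"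
proof -
  have i: "E `` {h} \<inter> K = E' `` {h} \<inter> K" if "h \<in> K" for h using assms that by auto
  have n: "nsum E K f h = nsum E' K f h" if "h \<in> K" for f h using i[OF that] by (simp add: nsum_def)
  have c: "nsum F K f h = nsum F K g h" if "\<And>w. w \<in> K \<Longrightarrow> f w = g w" for F f g h
    unfolding nsum_def using that by (intro sum.cong) auto
  have l: "ldeg E K h = ldeg E' K h" if "h \<in> K" for h using i[OF that] by (simp add: ldeg_def)
  show "hb1 E K = hb1 E' K" "hb2 E K = hb2 E' K" using l by (simp_all add: hb1_def hb2_def)
  have "nsum E K (nsum E K (ldeg E K)) h = nsum E' K (nsum E' K (ldeg E' K)) h" if h: "h \<in> K" for h
  proof -
    have "nsum E K (nsum E K (ldeg E K)) h = nsum E' K (nsum E K (ldeg E K)) h" by (rule n[OF h])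
    also have "\<dots> = nsum E' K (nsum E' K (ldeg E' K)) h"
    proof (rule c)
      fix w assume w: "w \<in> K"
      have "nsum E K (ldeg E K) w = nsum E' K (ldeg E K) w" by (rule n[OF w])
      also have "\<dots> = nsum E' K (ldeg E' K) w" by (rule c[OF l])
      finally show "nsum E K (ldeg E K) w = nsum E' K (ldeg E' K) w" .
    qed
    finally show ?thesis .
  qed
  then show "hb3 E K y = hb3 E' K y" by (simp add: hb3_def)
  show "hub_sol E K z y = hub_sol E' K z y" using n by (simp add: hub_sol_def)
qed

lemma defect_nonneg: "(\<And>u. u \<in> R \<Longrightarrow> ldeg E R u \<le> \<tau>) \<Longrightarrow> 0 \<le> defect E R \<tau>"
  unfolding defect_def by (intro sum_nonneg mult_nonneg_nonneg) (auto simp: ldeg_def)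

definition hubR_lip :: "real \<Rightarrow> nat \<Rightarrow> real \<Rightarrow> bool" where
  "hubR_lip C k \<tau> \<longleftrightarrow> (\<forall>(E :: (nat \<times> nat) set) K (z::real) (z'::real) y y'. finite K \<longrightarrow> card K = k \<longrightarrow> k \<ge> 1 \<longrightarrow> sym E \<longrightarrow> \<bar>z\<bar> * k \<le> 1 / 4 \<longrightarrow> \<bar>z'\<bar> * k \<le> 1 / 4 \<longrightarrow>
    hub_sol E K z y \<longrightarrow> hub_sol E K z' y' \<longrightarrow>
    bdlip C \<bar>z - z'\<bar> (hubR \<tau> (hb1 E K) (hb2 E K) (hb3 E K y) z) (hubR \<tau> (hb1 E K) (hb2 E K) (hb3 E K y') z'))"

lemma hubR_lip_exists: "\<exists>C\<ge>1. hubR_lip C k \<tau>"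
  unfolding hubR_lip_def by (rule hub_sol_hubR_bdlip)

text \<open>All data needed to compare two graphs. The resolvent vectors \<open>y1\<close> and
  \<open>y2\<close> are exposed, and the remainders named as values of \<open>hubR\<close>, because
  the Lipschitz bound has to be applied between different graphs. The second eigenvalue enters
  \<open>eig_pair\<close> with reversed sign.\<close>

definition hub_spectral :: "real \<Rightarrow> real \<Rightarrow> nat \<Rightarrow> nat \<Rightarrow> nat set \<Rightarrow> nat set \<Rightarrow> (nat \<times> nat) set \<Rightarrow> bool" where
  "hub_spectral c L k \<tau> V K E \<longleftrightarrow> eig_params c L \<tau> (hb1 E K) (hb2 E K) \<and>
    (\<forall>p q. extremal_eig V E p q \<longrightarrow> (\<exists>R1 R2 e1 e2 y1 y2.
      eig_pair c L \<tau> (hb1 E K) (hb2 E K) (k * degsum E (V - K)) p (- q) R1 R2 e1 e2 \<and>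
      k * defect E (V - K) \<tau> * (1 / p + 1 / (- q)) / 2 \<le> e1 - e2 \<and>
      (defect E (V - K) \<tau> = 0 \<longrightarrow> e1 = 0 \<and> e2 = 0) \<and>
      hub_sol E K (1 / p) y1 \<and> hub_sol E K (1 / q) y2 \<and>
      R1 = hubR \<tau> (hb1 E K) (hb2 E K) (hb3 E K y1) (1 / p) \<and> R2 = hubR \<tau> (hb1 E K) (hb2 E K) (hb3 E K y2) (1 / q) \<and>
      \<bar>1 / p\<bar> * k \<le> 1 / 4 \<and> \<bar>1 / q\<bar> * k \<le> 1 / 4))"

theorem hub_join_spectral:
  fixes k \<tau> :: nat
  assumes k: "k \<ge> 1"
  shows "\<exists>c\<ge>1. real k * ((real \<tau> + 1) * real \<tau>) \<le> c \<and> hubR_lip c k \<tau> \<and> (\<forall>(V :: nat set) K E. hub_join V K E \<tau> \<longrightarrow> card K = k \<longrightarrow>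
    4 * c \<le> sqrt (real k * real (card (V - K))) \<longrightarrow> hub_spectral c (sqrt (real k * real (card (V - K)))) k \<tau> V K E)"
proof -
  obtain C where C1: "C \<ge> 1" and C2: "hubR_lip C k \<tau>" using hubR_lip_exists by blast
  note CC = C2[unfolded hubR_lip_def, rule_format]
  \<comment> \<open>One constant for all requirements of \<open>eig_params\<close> and
    \<open>eig_pair\<close>; its last summand is \<open>k\<close> times the tolerance in
    \<open>near_opt\<close>.\<close>
  define c where "c = C + 4 * (real k + \<tau> + 1) + ((real \<tau>)\<^sup>2 + real \<tau> * real k + 2 * (real k)\<^sup>2 + 3 * (real k)\<^sup>2)
    + real k * ((real \<tau> + 1) * real \<tau>)"
  have c5: "real k * ((real \<tau> + 1) * real \<tau>) \<le> c" using C1 by (simp add: c_def add_nonneg_nonneg)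
  have c: "c \<ge> 1" "c \<ge> C" "c \<ge> 4 * (real k + \<tau>)" "c \<ge> (real \<tau>)\<^sup>2 + real \<tau> * real k + 2 * (real k)\<^sup>2 + 3 * (real k)\<^sup>2"
    using C1 by (simp_all add: c_def add_nonneg_nonneg)
  have lip: "hubR_lip c k \<tau>"
    unfolding hubR_lip_def
  proof (intro allI impI)
    fix E :: "(nat \<times> nat) set" and K and z z' :: real and y y'
    assume a: "finite K" "card K = k" "k \<ge> 1" "sym E" "\<bar>z\<bar> * k \<le> 1 / 4" "\<bar>z'\<bar> * k \<le> 1 / 4" "hub_sol E K z y" "hub_sol E K z' y'"
    show "bdlip c \<bar>z - z'\<bar> (hubR \<tau> (hb1 E K) (hb2 E K) (hb3 E K y) z) (hubR \<tau> (hb1 E K) (hb2 E K) (hb3 E K y') z')"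
      using CC[OF a] mult_right_mono[OF c(2), of "\<bar>z - z'\<bar>"] c(2) unfolding bdlip_def by auto
  qed
  have main: "hub_spectral c L k \<tau> V K E"
    if hj: "hub_join V K E \<tau>" and cK: "card K = k" and L4: "4 * c \<le> L" and Ld: "L = sqrt (real k * real (card (V - K)))"
    for V :: "nat set" and K E L
    unfolding hub_spectral_def
  proof (intro conjI allI impI)
    note h = hub_joinD[OF hj]
    let ?R = "V - K"
    have kr: "real k \<ge> 1" using k by simp
    have dk: "ldeg E K u \<le> k" "0 \<le> ldeg E K u" for u using ldeg_le_card(1)[OF h(7)] ldeg_le_card(2) cK by auto
    have b1: "0 \<le> hb1 E K" "hb1 E K \<le> k"
    proof -
      show "0 \<le> hb1 E K" unfolding hb1_def by (simp add: sum_nonneg dk)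
      have "(\<Sum>u\<in>K. ldeg E K u) \<le> (\<Sum>u\<in>K. real k)" by (intro sum_mono dk)
      then show "hb1 E K \<le> k" using kr by (simp add: hb1_def cK field_simps)
    qed
    have b2: "0 \<le> hb2 E K" "hb2 E K \<le> (real k)\<^sup>2"
    proof -
      show "0 \<le> hb2 E K" unfolding hb2_def by (simp add: sum_nonneg)
      have "(\<Sum>u\<in>K. (ldeg E K u)\<^sup>2) \<le> (\<Sum>u\<in>K. (real k)\<^sup>2)" by (intro sum_mono power_mono dk)
      then show "hb2 E K \<le> (real k)\<^sup>2" using kr by (simp add: hb2_def cK field_simps)
    qed
    show params: "eig_params c L \<tau> (hb1 E K) (hb2 E K)"
    proof
      show "1 \<le> c" "4 * c \<le> L" "0 \<le> real \<tau>" using c L4 by auto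
      show "real \<tau> \<le> c" using c(3) by simp
      show "\<bar>hb1 E K\<bar> \<le> c" using b1 c(3) by simp
      have "\<tau> * hb1 E K \<le> real \<tau> * real k" "0 \<le> \<tau> * hb1 E K" using b1 by (auto intro: mult_left_mono)
      moreover have "(hb1 E K)\<^sup>2 \<le> (real k)\<^sup>2" using b1 by (intro power_mono)
      moreover have "0 \<le> real \<tau> * real k" "0 \<le> (real \<tau>)\<^sup>2" "0 \<le> (hb1 E K)\<^sup>2" by auto
      ultimately show "\<bar>psival \<tau> (hb1 E K) (hb2 E K)\<bar> \<le> c"
        using b2 c(4) zero_le_power2[of "real k"] unfolding psival_def by (intro abs_leI) linarith+
    qed
    fix p q assume ex: "extremal_eig V E p q"
    have Lp: "L \<ge> 4" using L4 c by linarith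
    have ne: "?R \<noteq> {}" using Lp unfolding Ld by (metis card.empty mult_zero_right not_numeral_le_zero of_nat_0 real_sqrt_zero)
    have bd: "L \<le> p" "p \<le> L + (k + \<tau>)" "L - (k + \<tau>) \<le> - q" "- q \<le> L + (k + \<tau>)"
      using hub_join_extremal_bounds[OF hj ex ne] unfolding Ld cK by auto
    have kt: "real (k + \<tau>) \<le> c / 4" using c(3) by simp
    have lin: "4 * u \<le> a \<and> 0 < a" if "L - u \<le> a" "u \<le> c / 4" for u a using that L4 c(1) by linarith
    have "L - real (k + \<tau>) \<le> p" using bd(1) by (simp del: of_nat_add)
    then have big: "4 * real (k + \<tau>) \<le> p" "4 * real (k + \<tau>) \<le> - q" "0 < p" "0 < - q"
      using lin[OF _ kt] bd(3) by blast+
    obtain xp xq where x: "eigvec V E p xp" "eigvec V E q xq" using ex by (auto simp: extremal_eig_def)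
    have ap: "real (4 * (card K + \<tau>)) \<le> \<bar>p\<bar>" "real (4 * (card K + \<tau>)) \<le> \<bar>q\<bar>" using big cK by auto
    define D where "D = defect E ?R \<tau>"
    have D0: "D \<ge> 0" unfolding D_def by (rule defect_nonneg) (rule h(6))
    have L2: "L\<^sup>2 = real k * real (card ?R)" unfolding Ld by simp
    obtain y1 :: "nat \<Rightarrow> real" and d1 :: real where 1: "hub_sol E K (1 / p) y1" "\<bar>d1 - D / p\<bar> \<le> 2 * real \<tau> * D / p\<^sup>2"
      "(p - \<tau>) * (p\<^sup>2 - hb1 E K * p + ((hb1 E K)\<^sup>2 - hb2 E K) - L\<^sup>2) + hubR \<tau> (hb1 E K) (hb2 E K) (hb3 E K y1) (1 / p)
        = k * degsum E ?R - k * d1"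
      using hub_join_eigen[OF hj x(1) ap(1)] unfolding cK D_def[symmetric] L2 by blast
    obtain y2 :: "nat \<Rightarrow> real" and d2 :: real where 2: "hub_sol E K (1 / q) y2" "\<bar>d2 - D / q\<bar> \<le> 2 * real \<tau> * D / q\<^sup>2"
      "(q - \<tau>) * (q\<^sup>2 - hb1 E K * q + ((hb1 E K)\<^sup>2 - hb2 E K) - L\<^sup>2) + hubR \<tau> (hb1 E K) (hb2 E K) (hb3 E K y2) (1 / q)
        = k * degsum E ?R - k * d2"
      using hub_join_eigen[OF hj x(2) ap(2)] unfolding cK D_def[symmetric] L2 by blast
    define R1 where "R1 = hubR \<tau> (hb1 E K) (hb2 E K) (hb3 E K y1) (1 / p)"
    define R2 where "R2 = hubR \<tau> (hb1 E K) (hb2 E K) (hb3 E K y2) (1 / q)"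
    have zk: "\<bar>1 / a\<bar> * k \<le> 1 / 4" if "real (4 * (card K + \<tau>)) \<le> \<bar>a\<bar>" for a
    proof -
      have "4 * real k \<le> \<bar>a\<bar>" "\<bar>a\<bar> > 0" using that kr cK by auto
      then show ?thesis by (simp add: abs_divide field_simps)
    qed
    have bl: "bdlip C \<bar>1 / p - 1 / q\<bar> R1 R2"
      unfolding R1_def R2_def by (rule CC[OF h(7) cK k h(9) zk[OF ap(1)] zk[OF ap(2)] 1(1) 2(1)])
    have half: "2 * real \<tau> * D / a\<^sup>2 \<le> D / (2 * a)" if a: "4 * real (k + \<tau>) \<le> a" "0 < a" for a
    proof -
      have "2 * real \<tau> * D / a\<^sup>2 = (2 * real \<tau> / a) * (D / a)" by (simp add: power2_eq_square)
      also have "\<dots> \<le> (1 / 2) * (D / a)" using a D0 by (intro mult_right_mono) (auto simp: field_simps)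
      finally show ?thesis by simp
    qed
    \<comment> \<open>\<open>d1\<close> and \<open>d2\<close> equal \<open>D / p\<close> and
      \<open>D / q\<close> up to half their size. As \<open>q\<close> is negative, the two
      contributions add up instead of cancelling.\<close>
    have dd: "D * (1 / p + 1 / (- q)) / 2 \<le> d1 - d2"
    proof -
      have q2: "2 * real \<tau> * D / q\<^sup>2 \<le> D / (2 * - q)" using half[OF big(2,4)] by simp
      have "D / p - D / (2 * p) \<le> d1" using 1(2) half[OF big(1,3)] by (auto simp: abs_le_iff)
      then have a: "D / p / 2 \<le> d1" by simp
      have "d2 \<le> D / q + D / (2 * - q)" using 2(2) q2 by (auto simp: abs_le_iff)
      then have b: "d2 \<le> D / q / 2" by simp
      have "D * (1 / p + 1 / (- q)) / 2 = D / p / 2 - D / q / 2" by (simp add: algebra_simps diff_divide_distrib)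
      then show ?thesis using diff_mono[OF a b] by simp
    qed
    have e12: "k * D * (1 / p + 1 / (- q)) / 2 \<le> k * d1 - k * d2"
      using mult_left_mono[OF dd, of "real k"] by (simp add: right_diff_distrib mult.assoc)
    have "0 \<le> 1 / p + 1 / (- q)" using big by (intro add_nonneg_nonneg divide_nonneg_nonneg) auto
    then have e0: "0 \<le> k * D * (1 / p + 1 / (- q)) / 2" using D0 by (intro divide_nonneg_nonneg mult_nonneg_nonneg) auto
    have A: "\<bar>k * degsum E ?R\<bar> \<le> c * L\<^sup>2"
    proof -
      have "0 \<le> degsum E ?R" unfolding degsum_def by (intro sum_nonneg ldeg_le_card(2))
      moreover have "degsum E ?R \<le> (\<Sum>u\<in>?R. real \<tau>)" unfolding degsum_def by (intro sum_mono h(6))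
      ultimately have "\<bar>k * degsum E ?R\<bar> \<le> k * (card ?R * real \<tau>)" by (simp add: abs_mult mult_left_mono)
      also have "\<dots> = \<tau> * L\<^sup>2" unfolding L2 by simp
      also have "\<dots> \<le> c * L\<^sup>2" using c(3) by (intro mult_right_mono) auto
      finally show ?thesis .
    qed
    have ep: "eig_pair c L \<tau> (hb1 E K) (hb2 E K) (k * degsum E ?R) p (- q) R1 R2 (k * d1) (k * d2)"
      unfolding eig_pair_def
    proof (intro conjI)
      show "(p - \<tau>) * (p\<^sup>2 - hb1 E K * p + ((hb1 E K)\<^sup>2 - hb2 E K) - L\<^sup>2) + R1 = k * degsum E ?R - k * d1"
        unfolding R1_def by (rule 1(3))
      show "(- (- q) - \<tau>) * ((- q)\<^sup>2 + hb1 E K * (- q) + ((hb1 E K)\<^sup>2 - hb2 E K) - L\<^sup>2) + R2 = k * degsum E ?R - k * d2"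
        unfolding R2_def using 2(3) by simp
      show "\<bar>p - L\<bar> \<le> c" "\<bar>- q - L\<bar> \<le> c" using bd kt c(1) by linarith+
      show "\<bar>R1\<bar> \<le> c" "\<bar>R2\<bar> \<le> c" using bl c(2) by (auto simp: bdlip_def)
      have "1 / p - 1 / q = 1 / p + 1 / (- q)" by simp
      moreover have "0 \<le> 1 / p + 1 / (- q)" using big by (intro add_nonneg_nonneg divide_nonneg_nonneg) auto
      ultimately have "\<bar>1 / p - 1 / q\<bar> = 1 / p + 1 / (- q)" by simp
      then show "\<bar>R1 - R2\<bar> \<le> c * (1 / p + 1 / (- q))"
        using bl mult_right_mono[OF c(2), of "\<bar>1 / p - 1 / q\<bar>"] unfolding bdlip_def by auto
      show "k * d2 \<le> k * d1" using e12 e0 by linarith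
    qed (rule A)
    have z: "D = 0 \<longrightarrow> k * d1 = 0 \<and> k * d2 = 0" using 1(2) 2(2) by auto
    show "\<exists>R1 R2 e1 e2 y1 y2.
      eig_pair c L \<tau> (hb1 E K) (hb2 E K) (k * degsum E (V - K)) p (- q) R1 R2 e1 e2 \<and>
      k * defect E (V - K) \<tau> * (1 / p + 1 / (- q)) / 2 \<le> e1 - e2 \<and>
      (defect E (V - K) \<tau> = 0 \<longrightarrow> e1 = 0 \<and> e2 = 0) \<and>
      hub_sol E K (1 / p) y1 \<and> hub_sol E K (1 / q) y2 \<and>
      R1 = hubR \<tau> (hb1 E K) (hb2 E K) (hb3 E K y1) (1 / p) \<and> R2 = hubR \<tau> (hb1 E K) (hb2 E K) (hb3 E K y2) (1 / q) \<and>
      \<bar>1 / p\<bar> * k \<le> 1 / 4 \<and> \<bar>1 / q\<bar> * k \<le> 1 / 4"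
      by (intro exI conjI) (rule ep, rule e12[unfolded D_def], rule z[unfolded D_def], rule 1(1), rule 2(1),
         rule R1_def, rule R2_def, rule zk[OF ap(1)], rule zk[OF ap(2)])
  qed
  show ?thesis
  proof (intro exI[of _ c] conjI allI impI)
    fix V :: "nat set" and K E
    assume "hub_join V K E \<tau>" "card K = k" "4 * c \<le> sqrt (real k * real (card (V - K)))"
    then show "hub_spectral c (sqrt (real k * real (card (V - K)))) k \<tau> V K E" using main by blast
  qed (rule c(1), rule c5, rule lip)
qed

text \<open>The square term of the spread identity vanishes to leading order at the degree sum
  \<open>(2 \<tau> - hb1 E K) m / 3\<close>; the tolerance \<open>(\<tau> + 1) \<tau>\<close> is the degree sum of one \<open>K\<^sub>t\<close>, \<open>t = \<tau> + 1\<close>.\<close>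

definition near_opt :: "nat set \<Rightarrow> nat set \<Rightarrow> (nat \<times> nat) set \<Rightarrow> nat \<Rightarrow> bool" where
  "near_opt V K E \<tau> \<longleftrightarrow> defect E (V - K) \<tau> = 0 \<and>
     \<bar>degsum E (V - K) - (2 * real \<tau> - hb1 E K) / 3 * card (V - K)\<bar> \<le> (real \<tau> + 1) * real \<tau>"

text \<open>The defect is a nonnegative integer, so a bound below one already forces it to
  vanish.\<close>

lemma defect_nat:
  assumes "\<And>u. u \<in> R \<Longrightarrow> ldeg E R u \<le> real \<tau>" "defect E R \<tau> < 1"
  shows "defect E R \<tau> = 0"
proof -
  have "defect E R \<tau> = (\<Sum>u\<in>R. real (card (E `` {u} \<inter> R) * (\<tau> - card (E `` {u} \<inter> R))))"
    unfolding defect_def using assms(1) by (intro sum.cong) (auto simp: ldeg_def of_nat_diff)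
  also have "\<dots> = real (\<Sum>u\<in>R. card (E `` {u} \<inter> R) * (\<tau> - card (E `` {u} \<inter> R)))" (is "_ = real ?X")
    by (simp only: of_nat_sum)
  finally have eq: "defect E R \<tau> = real ?X" .
  then have "real ?X < real 1" using assms(2) by linarith
  then have "?X = 0" by (simp only: of_nat_less_iff less_one)
  then show ?thesis unfolding eq by (simp only: of_nat_0)
qed

text \<open>The upper bound holds for every hub join, the matching lower bound for those with nearly
  optimal degree sum. The last clause is the rigidity: a graph doing at least as well as a nearly
  optimal one with the same hub graph is nearly optimal itself.\<close>

theorem hub_join_asymptotics:
  fixes k \<tau> :: nat
  assumes k: "k \<ge> 1"
  shows "\<exists>C N. 0 \<le> C \<and> 1 \<le> N \<and> (\<forall>V K E p q. card K = k \<longrightarrow> N \<le> card (V - K) \<longrightarrow> hub_join V K E \<tau> \<longrightarrow> extremal_eig V E p q \<longrightarrow>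
     0 < p - q \<and> sqrt (real k * card (V - K)) \<le> p - q \<and>
     (p - q)\<^sup>2 \<le> 4 * (real k * card (V - K)) + 4 / 3 * psival \<tau> (hb1 E K) (hb2 E K) + C / card (V - K) \<and>
     (near_opt V K E \<tau> \<longrightarrow> 4 * (real k * card (V - K)) + 4 / 3 * psival \<tau> (hb1 E K) (hb2 E K) - C / card (V - K) \<le> (p - q)\<^sup>2) \<and>
     (\<forall>E' p' q'. hub_join V K E' \<tau> \<longrightarrow> extremal_eig V E' p' q' \<longrightarrow> E \<inter> K \<times> K = E' \<inter> K \<times> K \<longrightarrow> near_opt V K E' \<tau> \<longrightarrow>
        p' - q' \<le> p - q \<longrightarrow> defect E (V - K) \<tau> = 0 \<and> \<bar>degsum E (V - K) - (2 * real \<tau> - hb1 E K) / 3 * card (V - K)\<bar> \<le> C))"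
proof -
  obtain c where c: "c \<ge> 1" "real k * ((real \<tau> + 1) * real \<tau>) \<le> c" "hubR_lip c k \<tau>"
    and sp: "\<forall>(V :: nat set) K E. hub_join V K E \<tau> \<longrightarrow> card K = k \<longrightarrow>
      4 * c \<le> sqrt (real k * real (card (V - K))) \<longrightarrow> hub_spectral c (sqrt (real k * real (card (V - K)))) k \<tau> V K E"
    using hub_join_spectral[OF k, of \<tau>] by (elim exE conjE) (rule that; assumption)
  define G where "G = eig_params.Gc c"
  define C1 where "C1 = 16 * c + 3 * (89 * c ^ 3)\<^sup>2"
  define C2 where "C2 = 88 * c ^ 3 + (G + 16 * c)"
  define C3 where "C3 = 2 * (G + 16 * c * (G + 16 * c))"
  \<comment> \<open>The square makes \<open>L\<close> at least \<open>4 * c\<close>; the last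
    summand brings the defect bound \<open>C3 / L\<^sup>2\<close> below one.\<close>
  define N where "N = 1 + nat \<lceil>(4 * c)\<^sup>2\<rceil> + nat \<lceil>\<bar>C3\<bar>\<rceil>"
  define C where "C = \<bar>C1\<bar> + \<bar>C2\<bar>"
  have kr: "real k \<ge> 1" using k by simp
  have main: "0 < p - q \<and> sqrt (real k * card (V - K)) \<le> p - q \<and>
     (p - q)\<^sup>2 \<le> 4 * (real k * card (V - K)) + 4 / 3 * psival \<tau> (hb1 E K) (hb2 E K) + C / card (V - K) \<and>
     (near_opt V K E \<tau> \<longrightarrow> 4 * (real k * card (V - K)) + 4 / 3 * psival \<tau> (hb1 E K) (hb2 E K) - C / card (V - K) \<le> (p - q)\<^sup>2) \<and>
     (\<forall>E' p' q'. hub_join V K E' \<tau> \<longrightarrow> extremal_eig V E' p' q' \<longrightarrow> E \<inter> K \<times> K = E' \<inter> K \<times> K \<longrightarrow> near_opt V K E' \<tau> \<longrightarrow>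
        p' - q' \<le> p - q \<longrightarrow> defect E (V - K) \<tau> = 0 \<and> \<bar>degsum E (V - K) - (2 * real \<tau> - hb1 E K) / 3 * card (V - K)\<bar> \<le> C)"
    if cK: "card K = k" and mN: "N \<le> card (V - K)" and hj: "hub_join V K E \<tau>" and ex: "extremal_eig V E p q"
    for V K E p q
  proof -
    define m where "m = real (card (V - K))"
    define L where "L = sqrt (real k * m)"
    have m1: "m \<ge> 1" and m2: "(4 * c)\<^sup>2 \<le> m" and m3: "C3 < m"
    proof -
      have "1 + (4 * c)\<^sup>2 + \<bar>C3\<bar> \<le> real N" unfolding N_def using real_nat_ceiling_ge[of "(4 * c)\<^sup>2"] real_nat_ceiling_ge[of "\<bar>C3\<bar>"] by linarith
      also have "\<dots> \<le> m" using mN by (simp add: m_def)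
      finally have *: "1 + (4 * c)\<^sup>2 + \<bar>C3\<bar> \<le> m" .
      have "0 \<le> (4 * c)\<^sup>2" "C3 \<le> \<bar>C3\<bar>" "0 \<le> \<bar>C3\<bar>" by auto
      with * show "m \<ge> 1" "(4 * c)\<^sup>2 \<le> m" "C3 < m" by linarith+
    qed
    have L2: "L\<^sup>2 = real k * m" using m1 by (simp add: L_def)
    have mL: "m \<le> L\<^sup>2" unfolding L2 using mult_right_mono[OF kr, of m] m1 by simp
    have Lc: "4 * c \<le> L"
    proof -
      have "(4 * c)\<^sup>2 \<le> real k * m" using m2 mL L2 by linarith
      then show ?thesis unfolding L_def by (rule real_le_rsqrt)
    qed
    have L0: "L > 0" using Lc c(1) by linarith
    have hs: "hub_spectral c L k \<tau> V K E" if "hub_join V K E \<tau>" for E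
    proof -
      have Lc': "4 * c \<le> sqrt (real k * real (card (V - K)))" using Lc unfolding L_def m_def .
      show ?thesis using sp[rule_format, OF that cK Lc'] unfolding L_def m_def .
    qed
    note hs2 = hs[unfolded hub_spectral_def, THEN conjunct2, THEN spec, THEN spec, THEN mp]
    note P = hs[OF hj, unfolded hub_spectral_def, THEN conjunct1]
    obtain R1 R2 e1 e2 y1 y2 where
      ep: "eig_pair c L \<tau> (hb1 E K) (hb2 E K) (k * degsum E (V - K)) p (- q) R1 R2 e1 e2"
      and df: "k * defect E (V - K) \<tau> * (1 / p + 1 / (- q)) / 2 \<le> e1 - e2"
      and e0: "defect E (V - K) \<tau> = 0 \<longrightarrow> e1 = 0 \<and> e2 = 0"
      and y: "hub_sol E K (1 / p) y1" "hub_sol E K (1 / q) y2"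
      and R: "R1 = hubR \<tau> (hb1 E K) (hb2 E K) (hb3 E K y1) (1 / p)" "R2 = hubR \<tau> (hb1 E K) (hb2 E K) (hb3 E K y2) (1 / q)"
      and z: "\<bar>1 / p\<bar> * k \<le> 1 / 4" "\<bar>1 / q\<bar> * k \<le> 1 / 4"
      using hs2[OF hj ex] by (elim exE conjE) (rule that; assumption)
    have h: "finite K" "sym E" "\<And>u. u \<in> V - K \<Longrightarrow> ldeg E (V - K) u \<le> real \<tau>" using hub_joinD[OF hj] by auto
    have frac: "X / L\<^sup>2 \<le> C / m" if "X \<le> C" "0 \<le> C" for X
      using that mL m1 by (intro frac_le) auto
    have AL: "real k * a / L\<^sup>2 = a / m" for a :: real using kr m1 by (simp add: L2)
    have opt: "\<bar>k * degsum E (V - K) / L\<^sup>2 - (2 * real \<tau> - hb1 E K) / 3\<bar> \<le> c / L\<^sup>2" if "near_opt V K E \<tau>" for E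
    proof -
      have "degsum E (V - K) / m - (2 * real \<tau> - hb1 E K) / 3 = (degsum E (V - K) - (2 * real \<tau> - hb1 E K) / 3 * m) / m"
        using m1 by (simp add: field_simps)
      also have "\<bar>\<dots>\<bar> \<le> ((real \<tau> + 1) * real \<tau>) / m"
        using that m1 unfolding near_opt_def m_def[symmetric] by (simp add: abs_divide divide_right_mono)
      also have "\<dots> = (real k * ((real \<tau> + 1) * real \<tau>)) / L\<^sup>2" by (rule AL[symmetric])
      also have "\<dots> \<le> c / L\<^sup>2" using c(2) by (intro divide_right_mono) auto
      finally show ?thesis unfolding AL .
    qed
    have C0: "C \<ge> 0" "C1 \<le> C" "C2 \<le> C" by (auto simp: C_def)
    note pq = eig_params.pq[OF P ep]
    have up: "(p - q)\<^sup>2 \<le> 4 * L\<^sup>2 + 4 / 3 * psival \<tau> (hb1 E K) (hb2 E K) + C / m"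
    proof -
      have "16 * c \<le> C" using C0(2) zero_le_power2[of "89 * c ^ 3"] unfolding C1_def by linarith
      then have "16 * c / L\<^sup>2 \<le> C / m" by (rule frac) (rule C0)
      moreover have "(p - q)\<^sup>2 = (p + - q)\<^sup>2" by simp
      ultimately show ?thesis using eig_params.spread_upper[OF P ep] by linarith
    qed
    have low: "4 * L\<^sup>2 + 4 / 3 * psival \<tau> (hb1 E K) (hb2 E K) - C / m \<le> (p - q)\<^sup>2" if "near_opt V K E \<tau>"
    proof -
      have e: "e1 = 0" "e2 = 0" using e0 that by (auto simp: near_opt_def)
      have "C1 / L\<^sup>2 \<le> C / m" by (rule frac) (rule C0)+
      moreover have "(p - q)\<^sup>2 = (p + - q)\<^sup>2" by simp
      ultimately show ?thesis using eig_params.spread_lower[OF P ep e opt[OF that]] unfolding C1_def by linarith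
    qed
    have cmp: "defect E (V - K) \<tau> = 0 \<and> \<bar>degsum E (V - K) - (2 * real \<tau> - hb1 E K) / 3 * m\<bar> \<le> C"
      if hj': "hub_join V K E' \<tau>" and ex': "extremal_eig V E' p' q'" and EE: "E \<inter> K \<times> K = E' \<inter> K \<times> K"
        and no: "near_opt V K E' \<tau>" and le: "p' - q' \<le> p - q" for E' p' q'
    proof -
      obtain R1' R2' e1' e2' y1' y2' where
        ep': "eig_pair c L \<tau> (hb1 E' K) (hb2 E' K) (k * degsum E' (V - K)) p' (- q') R1' R2' e1' e2'"
        and e0': "defect E' (V - K) \<tau> = 0 \<longrightarrow> e1' = 0 \<and> e2' = 0"
        and y': "hub_sol E' K (1 / p') y1'" "hub_sol E' K (1 / q') y2'"
        and R': "R1' = hubR \<tau> (hb1 E' K) (hb2 E' K) (hb3 E' K y1') (1 / p')" "R2' = hubR \<tau> (hb1 E' K) (hb2 E' K) (hb3 E' K y2') (1 / q')"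
        and z': "\<bar>1 / p'\<bar> * k \<le> 1 / 4" "\<bar>1 / q'\<bar> * k \<le> 1 / 4"
        using hs2[OF hj' ex'] by (elim exE conjE) (rule that; assumption)
      note cg = hub_quantities_cong[OF EE]
      have e': "e1' = 0" "e2' = 0" using e0' no by (auto simp: near_opt_def)
      note ep'' = ep'[folded cg, unfolded e']
      note opt' = opt[OF no, folded cg]
      note lp = c(3)[unfolded hubR_lip_def, rule_format, OF h(1) cK k h(2)]
      have l1: "\<bar>R1 - R1'\<bar> \<le> c * \<bar>1 / p - 1 / p'\<bar>"
        using lp[OF z(1) z'(1) y(1) y'(1)[folded cg]] unfolding R R'[folded cg] bdlip_def by blast
      have "\<bar>R2 - R2'\<bar> \<le> c * \<bar>1 / q - 1 / q'\<bar>"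
        using lp[OF z(2) z'(2) y(2) y'(2)[folded cg]] unfolding R R'[folded cg] bdlip_def by blast
      moreover have "\<bar>1 / q - 1 / q'\<bar> = \<bar>1 / (- q) - 1 / (- q')\<bar>" by simp
      ultimately have l2: "\<bar>R2 - R2'\<bar> \<le> c * \<bar>1 / (- q) - 1 / (- q')\<bar>" by simp
      have le': "p' + - q' \<le> p + - q" using le by simp
      have D0: "0 \<le> defect E (V - K) \<tau>" by (rule defect_nonneg) (rule h(3))
      then have f0: "0 \<le> k * defect E (V - K) \<tau>" by simp
      note cm = eig_params.compare[OF P ep ep'' opt' le' l1 l2 f0 df, folded G_def]
      have dz: "defect E (V - K) \<tau> = 0"
      proof (rule defect_nat[OF h(3)])
        have "1 * defect E (V - K) \<tau> \<le> k * defect E (V - K) \<tau>" using kr D0 by (rule mult_right_mono)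
        also have "\<dots> \<le> C3 / L\<^sup>2" using cm(2) unfolding C3_def .
        also have "\<dots> < 1" using m3 mL L0 by simp
        finally show "defect E (V - K) \<tau> < 1" by simp
      qed
      then have e: "e1 = 0" "e2 = 0" using e0 by auto
      define x where "x = (p - - q) - 2 * (hb1 E K + \<tau>) / 3"
      define a where "a = degsum E (V - K)"
      have "\<bar>(p - - q) - hb1 E K - a / m\<bar> \<le> 88 * c ^ 3 / L\<^sup>2"
        using eig_params.d_approx[OF P ep e] unfolding AL a_def .
      moreover have "\<bar>x\<bar> \<le> (G + 16 * c) / L\<^sup>2" unfolding x_def by (rule cm(1))
      ultimately have "\<bar>x - ((p - - q) - hb1 E K - a / m)\<bar> \<le> (G + 16 * c) / L\<^sup>2 + 88 * c ^ 3 / L\<^sup>2"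
        by (intro order_trans[OF abs_triangle_ineq4 add_mono])
      also have "\<dots> = C2 / L\<^sup>2" by (simp add: C2_def add_divide_distrib)
      also have "\<dots> \<le> C / m" by (rule frac) (rule C0)+
      also have "x - ((p - - q) - hb1 E K - a / m) = (a - (2 * real \<tau> - hb1 E K) / 3 * m) / m"
        using m1 by (simp add: x_def field_simps)
      finally have "\<bar>a - (2 * real \<tau> - hb1 E K) / 3 * m\<bar> \<le> C" using m1 by (simp add: abs_divide divide_le_cancel)
      then show ?thesis using dz by (simp add: a_def)
    qed
    have pos: "0 < p - q" "L \<le> p - q" using pq(5,6,7) by auto
    note up' = up[unfolded L2, unfolded m_def] and low' = low[unfolded L2, unfolded m_def]
      and pos' = pos[unfolded L_def, unfolded m_def] and cmp' = cmp[unfolded m_def]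
    show ?thesis
      by (intro conjI allI impI)
        (rule pos' up' | (rule low', assumption) |
          (rule cmp'[THEN conjunct1]; assumption) | (rule cmp'[THEN conjunct2]; assumption))+
  qed
  show ?thesis
  proof (intro exI[of _ C] exI[of _ N] conjI)
    show "0 \<le> C" by (simp add: C_def)
    show "1 \<le> N" by (simp add: N_def)
  qed (intro allI impI, rule main)
qed

section \<open>Components outside the hubs\<close>

lemma Kst_free_model:
  assumes free: "Kst_free s t V E" and A: "finite A" "card A = s" and B: "finite B" "card B = t" and AB: "A \<inter> B = {}"
    and m: "model V E (A \<union> B) (A \<times> B) f"
  shows False
proof -
  obtain a where a: "bij_betw a {..<s} A" using A by (metis finite_same_card_bij finite_lessThan card_lessThan)
  obtain b where b: "bij_betw b {..<t} B" using B by (metis finite_same_card_bij finite_lessThan card_lessThan)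
  define c where "c i = (if i < s then a i else b (i - s))" for i
  have cA: "c i \<in> A" if "i < s" for i using a that by (auto simp: c_def bij_betw_def)
  have cB: "c i \<in> B" if "s \<le> i" "i < s + t" for i using b that by (auto simp: c_def bij_betw_def)
  have cAB: "c i \<in> A \<union> B" if "i < s + t" for i using cA[of i] cB[of i] that by (cases "i < s") auto
  have inj: "c i \<noteq> c j" if "i < s + t" "j < s + t" "i \<noteq> j" for i j
  proof (cases "i < s"; cases "j < s")
    assume "i < s" "j < s"
    then show ?thesis using a that by (auto simp: c_def bij_betw_def inj_on_def)
  next
    assume h: "\<not> i < s" "\<not> j < s"
    then have "i - s \<noteq> j - s" "i - s < t" "j - s < t" using that by auto
    then show ?thesis using b h by (auto simp: c_def bij_betw_def inj_on_def)
  next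
    assume "i < s" "\<not> j < s"
    then show ?thesis using cA[of i] cB[of j] that AB by auto
  next
    assume "\<not> i < s" "j < s"
    then show ?thesis using cA[of j] cB[of i] that AB by auto
  qed
  have "model V E {..<s + t} (bip s t) (\<lambda>i. f (c i))"
  proof (rule modelI)
    fix i assume i: "i \<in> {..<s + t}"
    then show "conn E (f (c i))" "f (c i) \<subseteq> V" using modelD(1,2)[OF m cAB[of i]] by auto
  next
    fix i j assume "i \<in> {..<s + t}" "j \<in> {..<s + t}" "i \<noteq> j"
    then show "f (c i) \<inter> f (c j) = {}" using modelD(3)[OF m cAB[of i] cAB[of j]] inj[of i j] by simp
  next
    fix i j assume "(i, j) \<in> bip s t"
    then have "(c i, c j) \<in> A \<times> B" using cA cB by auto
    then show "\<exists>u\<in>f (c i). \<exists>v\<in>f (c j). (u, v) \<in> E" by (rule modelD(4)[OF m])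
  qed
  then show False using free unfolding Kst_free_def by blast
qed

text \<open>\<open>X\<close> and the hubs form one side of the minor.\<close>

lemma Kst_free_boundary:
  assumes free: "Kst_free s t V E" and hj: "hub_join V K E \<tau>" and cK: "Suc (card K) = s"
    and X: "conn E X" "X \<subseteq> V - K" and B: "B \<subseteq> V - K - X" "\<And>b. b \<in> B \<Longrightarrow> \<exists>x\<in>X. (x, b) \<in> E"
  shows "card B < t"
proof (rule ccontr)
  note h = hub_joinD[OF hj]
  assume "\<not> card B < t"
  then obtain B' where B': "B' \<subseteq> B" "card B' = t" by (metis obtain_subset_with_card_n not_less)
  have "B' \<subseteq> V - K" using B' B by blast
  then have fB: "finite B'" using h(8) finite_subset by blast
  obtain x where x: "x \<in> X" using X(1) by (auto simp: conn_def)
  have xK: "x \<notin> K" using x X by auto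
  define f where "f i = (if i = x then X else {i})" for i
  have m: "model V E (insert x K \<union> B') (insert x K \<times> B') f"
  proof (rule modelI)
    fix i assume i: "i \<in> insert x K \<union> B'"
    show "conn E (f i)" by (simp add: f_def X(1) conn_singleton)
    show "f i \<subseteq> V" using i X(2) B(1) B'(1) h(2) by (auto simp: f_def)
  next
    fix i j assume "i \<in> insert x K \<union> B'" "j \<in> insert x K \<union> B'" "i \<noteq> j"
    then show "f i \<inter> f j = {}" using X(2) B(1) B'(1) by (auto simp: f_def)
  next
    fix i j assume "(i, j) \<in> insert x K \<times> B'"
    then have ij: "i \<in> insert x K" "j \<in> B'" by auto
    have j: "f j = {j}" "j \<in> V - K" using ij x B(1) B'(1) by (auto simp: f_def)
    show "\<exists>u\<in>f i. \<exists>v\<in>f j. (u, v) \<in> E"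
    proof (cases "i = x")
      case True
      then show ?thesis using B(2)[of j] B'(1) ij j(1) by (auto simp: f_def)
    next
      case False
      then show ?thesis using ij j h(4) by (auto simp: f_def)
    qed
  qed
  show False
    by (rule Kst_free_model[OF free _ _ fB B'(2) _ m]) (use h(7) cK xK x B(1) B'(1) in auto)
qed

text \<open>One side consists of \<open>u\<close>, \<open>w\<close> and all hubs but one; the remaining hub, \<open>C\<close> and \<open>Y\<close> form the other.
  Each hub on the first side borrows a vertex of \<open>I\<close> to reach the hub on the second.\<close>

lemma Kst_free_linked_pair:
  assumes free: "Kst_free s t V E" and hj: "hub_join V K E \<tau>" and cK: "Suc (card K) = s"
    and uw: "u \<in> V - K" "w \<in> V - K" "u \<noteq> w"
    and C: "C \<subseteq> V - K - {u, w}" "card C + 2 = t" "\<And>c. c \<in> C \<Longrightarrow> (u, c) \<in> E \<and> (w, c) \<in> E"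
    and Y: "conn E Y" "Y \<subseteq> V - K - {u, w} - C" "\<exists>y\<in>Y. (u, y) \<in> E" "\<exists>y\<in>Y. (w, y) \<in> E"
    and I: "I \<subseteq> V - K - {u, w} - C - Y" "card K \<le> Suc (card I)"
  shows False
proof -
  note h = hub_joinD[OF hj]
  obtain h0 where h0: "h0 \<in> K" using h(3) by auto
  have sub: "C \<subseteq> V - K" "I \<subseteq> V - K" using C(1) I(1) by auto
  have fin: "finite C" "finite I" using sub h(8) finite_subset by blast+
  have "card (K - {h0}) \<le> card I" using I(2) h(7) h0 by simp
  then obtain g where g: "g ` (K - {h0}) \<subseteq> I" "inj_on g (K - {h0})"
    using card_le_inj[of "K - {h0}" I] h(7) fin(2) by auto
  obtain y where y: "y \<in> Y" using Y(1) by (auto simp: conn_def)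
  define f where "f i = (if i \<in> K - {h0} then {i, g i} else if i = y then Y else {i})" for i
  \<comment> \<open>The sides have the right sizes: \<open>2 + (card K - 1) = s\<close> here, and
    \<open>2 + (t - 2) = t\<close> for \<open>B\<close>.\<close>
  define A where "A = {u, w} \<union> (K - {h0})"
  define B where "B = {h0, y} \<union> C"
  have gI: "g i \<in> I" if "i \<in> K - {h0}" for i using g(1) that by auto
  have gi: "g i \<in> V - K" "g i \<notin> {u, w}" "g i \<notin> C" "g i \<notin> Y" if "i \<in> K - {h0}" for i
    using gI[OF that] I(1) by auto
  have yR: "y \<in> V - K" "y \<notin> {u, w}" "y \<notin> C" using y Y(2) by auto
  have KR: "(a, b) \<in> E" "(b, a) \<in> E" if "a \<in> K" "b \<in> V - K" for a b using h(4,5) that by auto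
  have fY: "f y = Y" using yR by (simp add: f_def)
  have fK: "f i = {i, g i}" if "i \<in> K - {h0}" for i unfolding f_def using that by (rule if_P)
  have fo: "f i = {i}" if "i \<notin> K - {h0}" "i \<noteq> y" for i unfolding f_def by (simp only: that if_False)
  have m: "model V E (A \<union> B) (A \<times> B) f"
  proof (rule modelI)
    fix i assume i: "i \<in> A \<union> B"
    show "conn E (f i)"
    proof (cases "i \<in> K - {h0}")
      case True
      show ?thesis unfolding fK[OF True] by (rule conn_edge) (use KR[of i "g i"] gi[OF True] True in auto)
    next
      case False
      then show ?thesis using Y(1) conn_singleton[of E i] fY fo[OF False] by (cases "i = y") auto
    qed
    show "f i \<subseteq> V"
    proof (cases "i \<in> K - {h0}")
      case True
      then show ?thesis unfolding fK[OF True] using gi(1)[OF True] h(2) by auto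
    next
      case False
      have "i \<in> V" using i uw h(2) h0 yR(1) C(1) by (auto simp: A_def B_def)
      then show ?thesis using Y(2) fY fo[OF False] by (cases "i = y") auto
    qed
  next
    have sep: "f i \<inter> f j = {}" if "i \<in> K - {h0}" "j \<in> A \<union> B" "i \<noteq> j" for i j
    proof (cases "j \<in> K - {h0}")
      case True
      have "g i \<noteq> g j" using g(2) that True by (auto simp: inj_on_def)
      then show ?thesis unfolding fK[OF that(1)] fK[OF True] using gi(1)[OF that(1)] gi(1)[OF True] that True by auto
    next
      case False
      then have j: "j \<in> {u, w, h0, y} \<union> C" using that(2) by (auto simp: A_def B_def)
      show ?thesis
      proof (cases "j = y")
        case True
        then show ?thesis unfolding fK[OF that(1)] using fY gi(4)[OF that(1)] that(1) Y(2) by auto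
      next
        case F: False
        then show ?thesis unfolding fK[OF that(1)] fo[OF False F] using j gi[OF that(1)] that h0 by auto
      qed
    qed
    fix i j assume ij: "i \<in> A \<union> B" "j \<in> A \<union> B" "i \<noteq> j"
    consider "i \<in> K - {h0}" | "j \<in> K - {h0}" | "i \<notin> K - {h0}" "j \<notin> K - {h0}" by blast
    then show "f i \<inter> f j = {}"
    proof cases
      case 1
      then show ?thesis using sep ij by blast
    next
      case 2
      then show ?thesis using sep[of j i] ij by blast
    next
      case 3
      then have ij': "i \<in> {u, w, h0, y} \<union> C" "j \<in> {u, w, h0, y} \<union> C" using ij by (auto simp: A_def B_def)
      have "x \<notin> Y" if "x \<in> {u, w, h0} \<union> C" for x using that Y(2) h0 by auto
      then show ?thesis using fY fo 3 ij' ij(3) by (cases "i = y"; cases "j = y") auto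
    qed
  next
    fix i j assume "(i, j) \<in> A \<times> B"
    then have ij: "i \<in> A" "j \<in> B" by auto
    have jK: "j \<notin> K - {h0}" using ij C(1) yR by (auto simp: B_def)
    show "\<exists>a\<in>f i. \<exists>b\<in>f j. (a, b) \<in> E"
    proof (cases "i \<in> K - {h0}")
      case True
      consider "j = h0" | "j = y" | "j \<in> C" "j \<noteq> y" "j \<in> V - K" using ij C(1) yR by (auto simp: B_def)
      then show ?thesis
      proof cases
        case 1
        then have "f j = {h0}" using fo[OF jK] h0 yR by auto
        moreover have "(g i, h0) \<in> E" using KR(2)[OF h0 gi(1)[OF True]] .
        ultimately show ?thesis unfolding fK[OF True] by auto
      next
        case 2
        then have "f j = Y" using fY by simp
        moreover have "(i, y) \<in> E" using KR(1) True yR by auto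
        ultimately show ?thesis unfolding fK[OF True] using y by auto
      next
        case 3
        then have "f j = {j}" using fo[OF jK] by simp
        moreover have "(i, j) \<in> E" using KR(1) True 3 by auto
        ultimately show ?thesis unfolding fK[OF True] by auto
      qed
    next
      case False
      then have i: "i \<in> {u, w}" using ij by (auto simp: A_def)
      then have iR: "i \<in> V - K" "i \<noteq> y" using uw yR by auto
      have fi: "f i = {i}" using fo[OF False] iR by simp
      consider "j = h0" | "j = y" | "j \<in> C" "j \<noteq> y" using ij by (auto simp: B_def)
      then show ?thesis
      proof cases
        case 1
        then have "f j = {h0}" using fo[OF jK] h0 yR by auto
        then show ?thesis unfolding fi using KR(2)[OF h0 iR(1)] by auto
      next
        case 2
        then have "f j = Y" using fY by simp
        then show ?thesis unfolding fi using i Y(3,4) by auto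
      next
        case 3
        then have "f j = {j}" using fo[OF jK] by simp
        then show ?thesis unfolding fi using i C(3)[OF 3(1)] by auto
      qed
    qed
  qed
  have "card A = s"
  proof -
    have "card K \<ge> 1" using h0 h(7) by (simp add: Suc_le_eq card_gt_0_iff) blast
    moreover have "{u, w} \<inter> (K - {h0}) = {}" using uw by auto
    then have "card A = 2 + (card K - 1)" unfolding A_def using h(7) h0 uw(3) by (subst card_Un_disjoint) auto
    ultimately show ?thesis using cK by simp
  qed
  moreover have "card B = t"
  proof -
    have "{h0, y} \<inter> C = {}" "h0 \<noteq> y" using h0 yR sub by auto
    then have "card B = 2 + card C" unfolding B_def using fin by (subst card_Un_disjoint) auto
    then show ?thesis using C(2) by simp
  qed
  moreover have "finite A" "finite B" using h(7) fin by (auto simp: A_def B_def)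
  moreover have "A \<inter> B = {}" using h0 uw yR sub C(1) by (auto simp: A_def B_def)
  ultimately show False using Kst_free_model[OF free _ _ _ _ _ m] by blast
qed

section \<open>Components of positive degree outside the hubs are cliques\<close>

lemma conn_reachable:
  assumes "sym E"
  shows "conn E {x. (y, x) \<in> (Restr E U)\<^sup>*}" (is "conn E ?W")
proof -
  have 1: "(y, x) \<in> (Restr E ?W)\<^sup>*" if "(y, x) \<in> (Restr E U)\<^sup>*" for x
    using that
  proof induction
    case (step a b)
    have "b \<in> ?W" using step(1,2) by (auto intro: rtrancl_into_rtrancl)
    then have "(a, b) \<in> Restr E ?W" using step(1,2) by auto
    then show ?case using step(3) by (rule rtrancl_into_rtrancl[rotated])
  qed simp
  have "sym (Restr E ?W)" using assms by (auto simp: sym_def)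
  then have s: "sym ((Restr E ?W)\<^sup>*)" by (rule sym_rtrancl)
  have "(a, b) \<in> (Restr E ?W)\<^sup>*" if "a \<in> ?W" "b \<in> ?W" for a b
  proof -
    have "(a, y) \<in> (Restr E ?W)\<^sup>*" using symD[OF s 1[of a]] that by simp
    moreover have "(y, b) \<in> (Restr E ?W)\<^sup>*" using 1[of b] that by simp
    ultimately show ?thesis by (rule rtrancl_trans)
  qed
  then show ?thesis unfolding conn_def by auto
qed

lemma card_arcs_eq:
  fixes E :: "('a :: linorder \<times> 'a) set"
  assumes "finite E" "sym E" "irrefl E"
  shows "card E = 2 * card {(x, y) \<in> E. x < y}"
proof -
  define A where "A = {(x, y) \<in> E. x < y}"
  have E: "E = A \<union> A\<inverse>"
    using assms(2,3) by (auto simp: A_def sym_def irrefl_def) (metis linorder_neqE)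
  have fA: "finite A" using assms(1) by (rule finite_subset[rotated]) (auto simp: A_def)
  have "card E = card A + card (A\<inverse>)"
    by (subst E, rule card_Un_disjoint) (use fA in \<open>auto simp: A_def\<close>)
  then show ?thesis by (simp add: A_def[symmetric])
qed

text \<open>If \<open>u v w\<close> is an induced path, then \<open>v\<close> has a common neighbourhood \<open>D\<close> with \<open>u\<close> and \<open>w\<close>, each of which has
  one further neighbour \<open>y\<close>, \<open>z\<close>. If \<open>y\<close> and \<open>z\<close> are linked outside, \<open>u\<close> and \<open>w\<close> give a minor. Otherwise the
  boundary of \<open>{u, v, w, y}\<close> forces \<open>D\<close> to be adjacent to \<open>y\<close> and \<open>z\<close>, which is too many exits for an edge
  at \<open>v\<close>; if \<open>D\<close> is empty, the component of \<open>y\<close> violates the handshake lemma.\<close>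

theorem regular_components_transitive:
  fixes s t :: nat and V K :: "nat set"
  assumes st: "2 \<le> s" "s \<le> t" and free: "Kst_free s t V E" and hj: "hub_join V K E \<tau>" and cK: "Suc (card K) = s"
    and deg: "\<And>u. u \<in> V - K \<Longrightarrow> card (E `` {u} \<inter> (V - K)) \<in> {0, t - 1}"
    and iso: "card K \<le> card {u \<in> V - K. E `` {u} \<inter> (V - K) = {}}"
    and uvw: "(u, v) \<in> E" "(v, w) \<in> E" "u \<in> V - K" "v \<in> V - K" "w \<in> V - K" "u \<noteq> w"
  shows "(u, w) \<in> E"
proof (rule ccontr)
  assume uw: "(u, w) \<notin> E"
  note h = hub_joinD[OF hj]
  note ug = ugraphD[OF h(1)]
  define R where "R = V - K"
  define N where "N x = E `` {x} \<inter> R" for x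
  have fR: "finite R" using h(8) by (simp add: R_def)
  have fN: "finite (N x)" for x using fR by (simp add: N_def)
  have Nn: "x \<notin> N x" for x using ug(5) by (auto simp: N_def)
  have NE: "(x, y) \<in> E" "y \<in> R" if "y \<in> N x" for x y using that by (auto simp: N_def)
  have NI: "y \<in> N x" if "(x, y) \<in> E" "y \<in> R" for x y using that by (auto simp: N_def)
  have Ns: "x \<in> N y" if "y \<in> N x" "x \<in> R" for x y using that ug(4) by (auto simp: N_def)
  have cN: "card (N x) = t - 1" if "y \<in> N x" "x \<in> R" for x y
  proof -
    have "card (N x) \<noteq> 0" using that fN by auto
    then show ?thesis using deg[of x] that(2) by (auto simp: N_def R_def)
  qed
  have bd: "card B < t" if "conn E X" "X \<subseteq> R" "B \<subseteq> R - X" "\<And>b. b \<in> B \<Longrightarrow> \<exists>x\<in>X. (x, b) \<in> E" for X B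
    using Kst_free_boundary[OF free hj cK] that unfolding R_def by blast
  \<comment> \<open>The edge \<open>ab\<close> has \<open>t - 2\<close> exits through
    \<open>a\<close>. Two neighbours of \<open>b\<close> other than \<open>a\<close> and not
    adjacent to \<open>a\<close> would raise the number of exits to \<open>t\<close>.\<close>
  have i: "c = c'" if ab: "a \<in> R" "b \<in> N a" and c: "c \<in> N b" "c \<noteq> a" "c \<notin> N a" and c': "c' \<in> N b" "c' \<noteq> a" "c' \<notin> N a"
    for a b c c'
  proof (rule ccontr)
    assume ne: "c \<noteq> c'"
    define B where "B = insert c (insert c' (N a - {b}))"
    have bR: "b \<in> R" using NE ab by auto
    have "(b, a) \<in> E" using NE(1)[OF Ns[OF ab(2,1)]] .
    then have "conn E {a, b}" using NE(1)[OF ab(2)] by (intro conn_edge)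
    then have "card B < t"
    proof (rule bd)
      show "{a, b} \<subseteq> R" using ab(1) bR by simp
      show "B \<subseteq> R - {a, b}" using NE(2) c c' Nn[of a] Nn[of b] by (auto simp: B_def)
      show "\<exists>x\<in>{a, b}. (x, d) \<in> E" if "d \<in> B" for d using that NE(1) c c' by (auto simp: B_def)
    qed
    moreover have "card B = Suc (Suc (card (N a - {b})))" using c c' ne fN by (simp add: B_def)
    moreover have "card (N a - {b}) = t - 1 - 1" using cN[OF ab(2,1)] ab(2) fN by simp
    ultimately show False using st by simp
  qed
  define D where "D = N v - {u, w}"
  have R: "u \<in> R" "v \<in> R" "w \<in> R" using uvw by (auto simp: R_def)
  have nb: "v \<in> N u" "u \<in> N v" "w \<in> N v" "v \<in> N w" using uvw R ug(4) by (auto intro!: NI)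
  have unw: "w \<notin> N u" "u \<notin> N w" using uw ug(4) by (auto simp: N_def)
  have Nv: "N v = insert u (insert w D)" using nb by (auto simp: D_def)
  have vD: "u \<notin> D" "w \<notin> D" "v \<notin> D" using Nn[of v] by (auto simp: D_def)
  have fD: "finite D" using fN by (simp add: D_def)
  have DR: "D \<subseteq> R" using NE by (auto simp: D_def)
  have ne: "u \<noteq> v" "w \<noteq> v" using nb Nn by auto
  have cv: "card (N v) = t - 1" using cN nb R by blast
  have cD: "card D + 3 = t"
  proof -
    have "card (N v) = Suc (Suc (card D))" unfolding Nv using vD fD uvw(6) by simp
    then show ?thesis using cv st by simp
  qed
  have Du: "D \<subseteq> N u"
  proof
    fix d assume d: "d \<in> D"
    show "d \<in> N u"
    proof (rule ccontr)
      assume "d \<notin> N u"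
      then have "d = w" using i[of u v d w] R nb unw uvw(6) d by (auto simp: D_def)
      then show False using d vD by simp
    qed
  qed
  have Dw: "D \<subseteq> N w"
  proof
    fix d assume d: "d \<in> D"
    show "d \<in> N w"
    proof (rule ccontr)
      assume "d \<notin> N w"
      then have "d = u" using i[of w v d u] R nb unw uvw(6) d by (auto simp: D_def)
      then show False using d vD by simp
    qed
  qed
  have last: "\<exists>y. y \<notin> insert v D \<and> N a = insert y (insert v D)" if "a \<in> R" "v \<in> N a" "D \<subseteq> N a" for a
  proof -
    have sub: "insert v D \<subseteq> N a" using that by auto
    have "card (N a - insert v D) = t - 1 - (t - 2)" using card_Diff_subset[OF _ sub] fD vD cD cN[OF that(2,1)] by simp
    then have "card (N a - insert v D) = 1" using cD by simp
    then obtain y where "N a - insert v D = {y}" by (rule card_1_singletonE)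
    then show ?thesis using sub by (intro exI[of _ y]) auto
  qed
  obtain y where y: "y \<notin> insert v D" "N u = insert y (insert v D)" using last[OF R(1) nb(1) Du] by blast
  obtain z where z: "z \<notin> insert v D" "N w = insert z (insert v D)" using last[OF R(3) nb(4) Dw] by blast
  have yz: "y \<in> N u" "z \<in> N w" using y z by auto
  have yR: "y \<in> R" "z \<in> R" using NE(2) yz by auto
  have yn: "y \<noteq> u" "y \<noteq> w" "z \<noteq> u" "z \<noteq> w" using yz Nn unw by auto
  have ynv: "y \<notin> N v" "z \<notin> N v" using y z yn by (auto simp: Nv)
  \<comment> \<open>\<open>W\<close> will be the component of \<open>y\<close> after removing
    \<open>u\<close>, \<open>v\<close>, \<open>w\<close> and their common neighbours
    \<open>D\<close>. The main case distinction is whether the remaining neighbour \<open>z\<close>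
    of \<open>w\<close> lies in it.\<close>
  define U where "U = R - insert u (insert v (insert w D))"
  define W where "W = {x. (y, x) \<in> (Restr E U)\<^sup>*}"
  have yzU: "y \<in> U" "z \<in> U" using yR y(1) z(1) yn by (auto simp: U_def)
  have Wy: "y \<in> W" by (simp add: W_def)
  have WU: "W \<subseteq> U"
  proof
    fix x assume "x \<in> W"
    then have "(y, x) \<in> (Restr E U)\<^sup>*" by (simp add: W_def)
    then show "x \<in> U" by (cases rule: rtrancl.cases) (use yzU in auto)
  qed
  have Wstep: "x' \<in> W" if "x \<in> W" "(x, x') \<in> E" "x' \<in> U" for x x'
  proof -
    have "(x, x') \<in> Restr E U" using that WU by auto
    then show ?thesis using that(1) unfolding W_def by (auto intro: rtrancl_into_rtrancl)
  qed
  have Wne: "N x \<noteq> {}" if "x \<in> W" for x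
  proof -
    have "(y, x) \<in> (Restr E U)\<^sup>*" using that by (simp add: W_def)
    then show ?thesis
    proof (cases rule: rtrancl.cases)
      case rtrancl_refl
      then show ?thesis using Ns[OF yz(1) R(1)] by auto
    next
      case (rtrancl_into_rtrancl b)
      then have "b \<in> N x" using ug(4) by (intro NI) (auto simp: U_def)
      then show ?thesis by auto
    qed
  qed
  have cW: "conn E W" unfolding W_def by (rule conn_reachable) (rule h(9))
  have WR: "W \<subseteq> V - K" using WU by (auto simp: U_def R_def)
  show False
  proof (cases "z \<in> W")
    case True
    define I where "I = {u \<in> V - K. E `` {u} \<inter> (V - K) = {}}"
    have I: "x \<in> R" "N x = {}" if "x \<in> I" for x using that by (auto simp: I_def N_def R_def)
    show False
    proof (rule Kst_free_linked_pair[OF free hj cK uvw(3,5,6), of "insert v D" W I])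
      show "insert v D \<subseteq> V - K - {u, w}" using uvw(4) DR vD ne by (auto simp: R_def)
      show "card (insert v D) + 2 = t" using cD vD fD by simp
      show "(u, c) \<in> E \<and> (w, c) \<in> E" if "c \<in> insert v D" for c
        using that NE(1) nb Du Dw by blast
      show "conn E W" by (rule cW)
      show "W \<subseteq> V - K - {u, w} - insert v D" using WU by (auto simp: U_def R_def)
      show "\<exists>y\<in>W. (u, y) \<in> E" using Wy NE(1)[OF yz(1)] by blast
      show "\<exists>y\<in>W. (w, y) \<in> E" using True NE(1)[OF yz(2)] by blast
      have "N d \<noteq> {}" if "d \<in> D" for d
        using Ns[of d v] that R(2) by (auto simp: Nv)
      then show "I \<subseteq> V - K - {u, w} - insert v D - W"
        using I nb Wne by (fastforce simp: R_def)
      show "card K \<le> Suc (card I)" using iso unfolding I_def by simp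
    qed
  next
    case False
    have zNy: "z \<notin> N y" using Wstep[OF Wy _ yzU(2)] NE(1) False by blast
    have yNz: "y \<notin> N z" using zNy Ns yR by blast
    have yz': "y \<noteq> z" using Wy False by auto
    \<comment> \<open>Stated in primed names because it is used twice, with the roles of
      \<open>u\<close>, \<open>y\<close> and \<open>w\<close>, \<open>z\<close> exchanged. If
      \<open>d\<close> were not adjacent to \<open>y'\<close>, the connected set \<open>X\<close>
      would have \<open>t\<close> exits: \<open>d\<close>, \<open>z'\<close> and the
      \<open>t - 2\<close> neighbours of \<open>y'\<close> other than \<open>u'\<close>.\<close>
    have twin: "D \<subseteq> N y'" if u': "u' \<in> R" and w': "w' \<in> R" and yy: "N u' = insert y' (insert v D)" "N w' = insert z' (insert v D)"
      "N v = insert u' (insert w' D)" "y' \<notin> insert v D" "z' \<notin> insert v D" "y' \<in> R" "z' \<in> R" "z' \<notin> N y'" "y' \<noteq> z'"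
      "y' \<noteq> w'" "z' \<noteq> u'" "u' \<notin> D" "w' \<notin> D" "u' \<noteq> w'" for u' w' y' z'
    proof (rule ccontr)
      assume "\<not> D \<subseteq> N y'"
      then obtain d where d: "d \<in> D" "d \<notin> N y'" by auto
      define X where "X = {y', w', v, u'}"
      define B where "B = insert d (insert z' (N y' - {u'}))"
      have uy: "u' \<in> N y'" by (rule Ns) (use u' yy in auto)
      have n: "v \<notin> N u' \<Longrightarrow> False" "u' \<noteq> v" "w' \<noteq> v" "y' \<noteq> u'" "z' \<noteq> w'" using yy(1,2,3) Nn[of u'] Nn[of v] Nn[of w'] by auto
      have vy: "v \<notin> N y'" using Ns[of v y'] yy(3,4,6,10) n by auto
      have wy: "w' \<notin> N y'" using Ns[of w' y'] yy(2,4,6,9) by auto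
      have E1: "(u', v) \<in> E" "(v, u') \<in> E" "(v, w') \<in> E" "(w', v) \<in> E" "(u', y') \<in> E" "(y', u') \<in> E"
        using NE(1)[of v u'] NE(1)[of w' v] NE(1)[of y' u'] yy(1,3) ug(4) by auto
      have "conn E {u'}" by (rule conn_singleton)
      then have "conn E {v, u'}" by (rule conn_insert[of _ _ u']) (use E1 in auto)
      then have "conn E {w', v, u'}" by (rule conn_insert[of _ _ v]) (use E1 in auto)
      then have "conn E X" unfolding X_def by (rule conn_insert[of _ _ u']) (use E1 in auto)
      then have "card B < t"
      proof (rule bd)
        show "X \<subseteq> R" using u' w' R yy by (auto simp: X_def)
        have "d \<notin> X" using d vD(3) yy by (auto simp: X_def)
        moreover have "z' \<notin> X" using yy n by (auto simp: X_def)
        moreover have "N y' - {u'} \<subseteq> R - X" using NE(2) vy wy Nn[of y'] by (auto simp: X_def)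
        ultimately show "B \<subseteq> R - X" using d(1) DR yy(7) by (auto simp: B_def)
        have "(v, d) \<in> E" "(w', z') \<in> E" using NE(1)[of d v] NE(1)[of z' w'] yy(2,3) d(1) by auto
        then show "\<exists>x\<in>X. (x, b) \<in> E" if "b \<in> B" for b using that NE(1) by (auto simp: X_def B_def)
      qed
      moreover have "card B = Suc (Suc (card (N y' - {u'})))" 
      proof -
        have "d \<noteq> z'" "finite (N y' - {u'})" using d yy(5) fN by auto
        then show ?thesis using d yy(8) unfolding B_def by (simp add: card_insert_if)
      qed
      moreover have "card (N y' - {u'}) = t - 1 - 1" using cN[OF uy yy(6)] uy fN by simp
      ultimately show False using st by simp
    qed
    show False
    proof (cases "D = {}")
      case False
      then obtain d where d: "d \<in> D" by auto
      have Nv': "N v = insert w (insert u D)" unfolding Nv by (rule insert_commute)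
      have "D \<subseteq> N y" by (rule twin[OF R(1,3) y(2) z(2) Nv y(1) z(1) yR zNy yz' yn(2,3) vD(1,2) uvw(6)])
      moreover have "D \<subseteq> N z"
        by (rule twin[OF R(3,1) z(2) y(2) Nv' z(1) y(1) yR(2,1) yNz yz'[symmetric] yn(3,2) vD(2,1) uvw(6)[symmetric]])
      ultimately have "y \<in> N d" "z \<in> N d" using d Ns yR by auto
      moreover have "d \<in> N v" using d by (simp add: Nv)
      moreover have "y \<noteq> v" "z \<noteq> v" using y z by auto
      ultimately have "y = z" using i[OF R(2), of d y z] ynv by auto
      then show False using yz' by simp
    next
      case True
      \<comment> \<open>All positive degrees are now two. Inside \<open>W\<close> every vertex keeps
        both neighbours except \<open>y\<close>, which loses \<open>u\<close>, so the degree sum of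
        \<open>W\<close> is odd.\<close>
      then have t3: "t - 1 = 2" using cD by simp
      have fW: "finite W" using WR h(8) finite_subset by blast
      have Nd: "N x \<inter> W = (if x = y then N x - {u} else N x)" if x: "x \<in> W" for x
      proof -
        have xU: "x \<in> R" "x \<noteq> u" "x \<noteq> v" "x \<noteq> w" using x WU by (auto simp: U_def)
        have nv: "v \<notin> N x" using Ns[of v x] xU by (auto simp: Nv True)
        have nw: "w \<notin> N x" using Ns[of w x] xU z(2) True False x by auto
        have nu: "x = y" if "u \<in> N x" using Ns[of u x] that xU y(2) True by auto
        have uW: "u \<notin> W" using WU by (auto simp: U_def)
        have "a \<in> W" if "a \<in> N x" "a \<noteq> u" for a
          by (rule Wstep[OF x]) (use that NE[of a x] nv nw True in \<open>auto simp: U_def\<close>)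
        then show ?thesis using nu uW by auto
      qed
      have "E \<inter> W \<times> W = Sigma W (\<lambda>x. N x \<inter> W)" using WU by (auto simp: N_def U_def)
      then have "card (E \<inter> W \<times> W) = (\<Sum>x\<in>W. card (N x \<inter> W))" using fW by simp
      also have "\<dots> = card (N y \<inter> W) + (\<Sum>x\<in>W - {y}. card (N x \<inter> W))"
        by (rule sum.remove) (use fW Wy in auto)
      also have "card (N y \<inter> W) = 1"
      proof -
        have "u \<in> N y" by (rule Ns) (use yz R in auto)
        then show ?thesis using Nd[OF Wy] cN[of u y] yR t3 fN by simp
      qed
      also have "(\<Sum>x\<in>W - {y}. card (N x \<inter> W)) = (\<Sum>x\<in>W - {y}. 2)"
      proof (rule sum.cong)
        fix x assume x: "x \<in> W - {y}"
        then have "x \<in> R" using WU by (auto simp: U_def)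
        then show "card (N x \<inter> W) = 2" using x Nd[of x] Wne[of x] cN[of _ x] t3 by auto
      qed simp
      finally have "odd (card (E \<inter> W \<times> W))" by simp
      moreover have "even (card (E \<inter> W \<times> W))"
        using card_arcs_eq[of "E \<inter> W \<times> W"] ug(2,4,5) by (auto simp: sym_def irrefl_def)
      ultimately show False by simp
    qed
  qed
qed

text \<open>Transitivity of adjacency together with the degree condition says that the components
  outside the hubs are cliques on \<open>t\<close> vertices and isolated vertices, without having to
  name the components.\<close>

definition clique_join :: "nat set \<Rightarrow> nat set \<Rightarrow> (nat \<times> nat) set \<Rightarrow> nat \<Rightarrow> bool" where
  "clique_join V K E t \<longleftrightarrow> hub_join V K E (t - 1) \<and>
     (\<forall>u\<in>V - K. card (E `` {u} \<inter> (V - K)) \<in> {0, t - 1}) \<and>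
     (\<forall>u\<in>V - K. \<forall>v\<in>V - K. \<forall>w\<in>V - K. (u, v) \<in> E \<longrightarrow> (v, w) \<in> E \<longrightarrow> u \<noteq> w \<longrightarrow> (u, w) \<in> E)"

lemma clique_join_defect: "clique_join V K E t \<Longrightarrow> t \<ge> 1 \<Longrightarrow> defect E (V - K) (t - 1) = 0"
  unfolding defect_def clique_join_def by (rule sum.neutral) (auto simp: ldeg_def)

definition same_clique :: "nat set \<Rightarrow> (nat \<times> nat) set \<Rightarrow> (nat \<times> nat) set" where
  "same_clique R E = {(x, y) \<in> R \<times> R. x = y \<or> (x, y) \<in> E}"

lemma same_clique_equiv: "clique_join V K E t \<Longrightarrow> equiv (V - K) (same_clique (V - K) E)"
proof (rule equivI)
  assume cj: "clique_join V K E t"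
  then have hj: "hub_join V K E (t - 1)" by (simp add: clique_join_def)
  show "same_clique (V - K) E \<subseteq> (V - K) \<times> (V - K)" by (auto simp: same_clique_def)
  show "refl_on (V - K) (same_clique (V - K) E)" by (auto simp: same_clique_def refl_on_def)
  show "sym (same_clique (V - K) E)"
    using hub_joinD(9)[OF hj] by (auto simp: same_clique_def sym_def)
  show "trans (same_clique (V - K) E)"
  proof (rule transI)
    fix x y z assume "(x, y) \<in> same_clique (V - K) E" "(y, z) \<in> same_clique (V - K) E"
    then show "(x, z) \<in> same_clique (V - K) E"
      using cj unfolding clique_join_def same_clique_def by blast
  qed
qed

lemma same_clique_class:
  "x \<in> R \<Longrightarrow> same_clique R E `` {x} = insert x (E `` {x} \<inter> R)"
  by (auto simp: same_clique_def)

text \<open>Only \<open>s - 1\<close> branch sets can meet the hubs, so at least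
  \<open>t + 1\<close> avoid them. Neither side has that many vertices, so both sides are
  represented, and since opposite branch sets are adjacent all of these lie in one component outside
  the hubs. That component has at most \<open>t\<close> vertices.\<close>

theorem clique_join_Kst_free:
  assumes cj: "clique_join V K E t" and st: "2 \<le> s" "s \<le> t" and cK: "Suc (card K) = s"
  shows "Kst_free s t V E"
proof (rule ccontr)
  assume "\<not> Kst_free s t V E"
  then obtain f where m: "model V E {..<s + t} (bip s t) f" by (auto simp: Kst_free_def)
  have hj: "hub_join V K E (t - 1)" using cj by (simp add: clique_join_def)
  note h = hub_joinD[OF hj]
  let ?Q = "same_clique (V - K) E"
  note Q = same_clique_equiv[OF cj]
  have Qsym: "(b, a) \<in> ?Q" if "(a, b) \<in> ?Q" for a b using equivE[OF Q] that by (auto dest: symD)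
  have Qtr: "(a, c) \<in> ?Q" if "(a, b) \<in> ?Q" "(b, c) \<in> ?Q" for a b c using equivE[OF Q] that by (blast dest: transD)
  define J where "J = {i \<in> {..<s + t}. f i \<inter> K = {}}"
  have fc: "f i \<noteq> {}" if "i < s + t" for i using modelD(1)[OF m, of i] that by (auto simp: conn_def)
  \<comment> \<open>Disjoint branch sets that all meet \<open>C\<close> have distinct
    representatives there. Used once with the hubs and once with a component.\<close>
  have sdr: "card A \<le> card C" if "A \<subseteq> {..<s + t}" "\<And>i. i \<in> A \<Longrightarrow> f i \<inter> C \<noteq> {}" "finite C" for A C
  proof -
    define g where "g i = (SOME x. x \<in> f i \<inter> C)" for i
    have g: "g i \<in> f i \<inter> C" if "i \<in> A" for i unfolding g_def using that(1) \<open>\<And>i. i \<in> A \<Longrightarrow> f i \<inter> C \<noteq> {}\<close>[OF that] by (meson ex_in_conv someI_ex)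
    have "inj_on g A"
    proof (rule inj_onI)
      fix i j assume ij: "i \<in> A" "j \<in> A" "g i = g j"
      show "i = j"
      proof (rule ccontr)
        assume "i \<noteq> j"
        then have "f i \<inter> f j = {}" using modelD(3)[OF m, of i j] ij that(1) by auto
        then show False using g[OF ij(1)] g[OF ij(2)] ij(3) by auto
      qed
    qed
    then show ?thesis using g that(3) by (intro card_inj_on_le[of g]) auto
  qed
  have "card ({..<s + t} - J) \<le> card K" by (rule sdr) (use h(7) in \<open>auto simp: J_def\<close>)
  moreover have "card ({..<s + t} - J) = s + t - card J"
    by (subst card_Diff_subset) (auto simp: J_def)
  ultimately have cJ: "card J \<ge> t + 1" using cK by simp
  have "\<not> J \<subseteq> {..<s}" using card_mono[of "{..<s}" J] cJ st by auto
  then obtain j0 where j0: "j0 \<in> J" "s \<le> j0" by (metis subsetI lessThan_iff not_le)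
  have "\<not> J \<subseteq> {s..<s + t}" using card_mono[of "{s..<s + t}" J] cJ by auto
  then obtain i0 where i0: "i0 \<in> J" "i0 \<notin> {s..<s + t}" by blast
  then have i0: "i0 \<in> J" "i0 < s" by (auto simp: J_def)
  have JR: "f i \<subseteq> V - K" "i < s + t" if "i \<in> J" for i using modelD(2)[OF m, of i] that by (auto simp: J_def)
  have inQ: "(a, b) \<in> ?Q" if "i \<in> J" "a \<in> f i" "b \<in> f i" for i a b
  proof -
    have "(a, b) \<in> (Restr E (f i))\<^sup>*" using modelD(1)[OF m, of i] JR(2)[OF that(1)] that(2,3) by (simp add: conn_def)
    then show ?thesis
    proof induction
      case base
      then show ?case using that JR by (auto simp: same_clique_def)
    next
      case (step c d)
      then have "(c, d) \<in> ?Q" using JR(1)[OF that(1)] by (auto simp: same_clique_def)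
      with step(3) show ?case by (rule Qtr)
    qed
  qed
  have cross: "(a, b) \<in> ?Q" if i: "i \<in> J" "i < s" "a \<in> f i" and j: "j \<in> J" "s \<le> j" "b \<in> f j" for i j a b
  proof -
    obtain a' b' where ab: "a' \<in> f i" "b' \<in> f j" "(a', b') \<in> E" using modelD(4)[OF m, of i j] i j JR(2)[OF j(1)] by auto
    have "(a', b') \<in> ?Q" using ab JR(1)[OF i(1)] JR(1)[OF j(1)] by (auto simp: same_clique_def)
    then show ?thesis using Qtr[OF Qtr[OF inQ[OF i(1,3) ab(1)]] inQ[OF j(1) ab(2) j(3)]] by blast
  qed
  obtain x0 where x0: "x0 \<in> f i0" using fc[of i0] JR(2)[OF i0(1)] by auto
  obtain z0 where z0: "z0 \<in> f j0" using fc[of j0] JR(2)[OF j0(1)] by auto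
  have x0R: "x0 \<in> V - K" using JR(1)[OF i0(1)] x0 by auto
  have all: "(x0, b) \<in> ?Q" if "i \<in> J" "b \<in> f i" for i b
  proof (cases "i < s")
    case True
    have "(x0, z0) \<in> ?Q" using cross[OF i0 x0 j0 z0] .
    moreover have "(z0, b) \<in> ?Q" using Qsym[OF cross[OF that(1) True that(2) j0 z0]] .
    ultimately show ?thesis by (rule Qtr)
  next
    case False
    then show ?thesis using cross[OF i0 x0 that(1) _ that(2)] by simp
  qed
  have "card J \<le> card (insert x0 (E `` {x0} \<inter> (V - K)))"
  proof (rule sdr)
    show "J \<subseteq> {..<s + t}" by (auto simp: J_def)
    show "finite (insert x0 (E `` {x0} \<inter> (V - K)))" using h(8) by simp
    fix i assume i: "i \<in> J"
    obtain b where "b \<in> f i" using fc[of i] JR(2)[OF i] by auto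
    then show "f i \<inter> insert x0 (E `` {x0} \<inter> (V - K)) \<noteq> {}"
      using all[OF i] same_clique_class[OF x0R, of E] by blast
  qed
  also have "\<dots> \<le> Suc (card (E `` {x0} \<inter> (V - K)))" by (rule card_insert_le_m1[OF _ ]) auto
  also have "\<dots> \<le> t"
  proof -
    have "card (E `` {x0} \<inter> (V - K)) \<in> {0, t - 1}" using cj x0R unfolding clique_join_def by (elim conjE) (drule bspec)
    then show ?thesis using st by auto
  qed
  finally show False using cJ by simp
qed

text \<open>Number the outside vertices and cut the numbers into blocks of length \<open>t\<close>;
  the first \<open>l\<close> blocks become cliques. Quotients by \<open>t\<close> thus serve as
  names of the blocks.\<close>

lemma clique_join_exists:
  fixes V K :: "nat set"
  assumes V: "finite V" "K \<subseteq> V" "K \<noteq> {}" and F: "F \<subseteq> K \<times> K" "sym F" "irrefl F" and t: "t \<ge> 1" and l: "t * l \<le> card (V - K)"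
  shows "\<exists>E. clique_join V K E t \<and> E \<inter> K \<times> K = F \<and> degsum E (V - K) = real (t * l * (t - 1))"
proof -
  define R where "R = V - K"
  define M where "M = card R"
  have fR: "finite R" using V by (simp add: R_def)
  obtain g where g: "bij_betw g R {..<M}" unfolding M_def using fR by (metis finite_same_card_bij finite_lessThan card_lessThan)
  have ginj: "x = y" if "x \<in> R" "y \<in> R" "g x = g y" for x y using g that by (auto simp: bij_betw_def inj_on_def)
  define Q where "Q = {(x, y) \<in> R \<times> R. x \<noteq> y \<and> g x div t = g y div t \<and> g x div t < l}"
  define E where "E = F \<union> K \<times> R \<union> R \<times> K \<union> Q"
  have ug: "ugraph V E" unfolding ugraph_def
    using V F by (auto simp: E_def Q_def R_def sym_def irrefl_def)
  have NR: "E `` {x} \<inter> R = {y \<in> R. x \<noteq> y \<and> g x div t = g y div t \<and> g x div t < l}" if "x \<in> R" for x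
    using that F(1) by (auto simp: E_def Q_def R_def)
  have blk: "card {y \<in> R. g y div t = c} = t" if "c < l" for c
  proof -
    have "g ` {y \<in> R. g y div t = c} = {c * t..<c * t + t}"
    proof
      show "g ` {y \<in> R. g y div t = c} \<subseteq> {c * t..<c * t + t}"
      proof
        fix a assume "a \<in> g ` {y \<in> R. g y div t = c}"
        then have "a div t = c" by auto
        then have "a = c * t + a mod t" "a mod t < t" using t div_mult_mod_eq[of a t] by auto
        then show "a \<in> {c * t..<c * t + t}" by simp
      qed
      show "{c * t..<c * t + t} \<subseteq> g ` {y \<in> R. g y div t = c}"
      proof
        fix a assume a: "a \<in> {c * t..<c * t + t}"
        have "c * t + t \<le> t * l" using mult_le_mono2[of "Suc c" l t] that by (simp add: mult.commute add.commute)
        then have "a < M" using a l by (simp add: M_def R_def)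
        then obtain y where y: "y \<in> R" "a = g y" using g by (metis bij_betw_def imageE lessThan_iff)
        have "a div t = c" using a by (intro div_nat_eqI) (auto simp: mult.commute)
        then show "a \<in> g ` {y \<in> R. g y div t = c}" using y by auto
      qed
    qed
    moreover have "card (g ` {y \<in> R. g y div t = c}) = card {y \<in> R. g y div t = c}"
      by (rule card_image) (use ginj in \<open>auto simp: inj_on_def\<close>)
    ultimately show ?thesis by simp
  qed
  have cN: "card (E `` {x} \<inter> R) = (if g x div t < l then t - 1 else 0)" if "x \<in> R" for x
  proof (cases "g x div t < l")
    case True
    then have "E `` {x} \<inter> R = {y \<in> R. g y div t = g x div t} - {x}" unfolding NR[OF that] by (safe; simp)
    moreover have "card ({y \<in> R. g y div t = g x div t} - {x}) = t - 1"
      by (subst card_Diff_singleton) (use blk[OF True] that in simp_all)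
    ultimately show ?thesis using True by simp
  next
    case False
    then show ?thesis using NR[OF that] by simp
  qed
  have c01: "card (E `` {u} \<inter> (V - K)) \<in> {0, t - 1}" if "u \<in> V - K" for u
    using cN[of u] that unfolding R_def by (cases "g u div t < l") simp_all
  have "card (E `` {u} \<inter> (V - K)) \<le> t - 1" if "u \<in> V - K" for u using c01[OF that] by auto
  moreover have "K \<times> (V - K) \<subseteq> E" by (auto simp: E_def R_def)
  ultimately have "hub_join V K E (t - 1)" unfolding hub_join_def using ug V(2,3) by blast
  moreover have "\<forall>u\<in>V - K. card (E `` {u} \<inter> (V - K)) \<in> {0, t - 1}" using c01 by blast
  moreover have "(u, w) \<in> E" if "u \<in> V - K" "v \<in> V - K" "w \<in> V - K" "(u, v) \<in> E" "(v, w) \<in> E" "u \<noteq> w" for u v w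
  proof -
    have "(u, v) \<in> Q" "(v, w) \<in> Q" using that(1-5) F(1) by (auto simp: E_def R_def)
    then have "u \<in> R" "w \<in> R" "g u div t = g w div t" "g u div t < l" by (simp_all add: Q_def)
    then have "(u, w) \<in> Q" using that(6) by (simp add: Q_def)
    then show ?thesis by (simp add: E_def)
  qed
  ultimately have "clique_join V K E t" unfolding clique_join_def by blast
  moreover have "E \<inter> K \<times> K = F" using F(1) by (auto simp: E_def Q_def R_def)
  moreover have "degsum E (V - K) = real (t * l * (t - 1))"
  proof -
    have "{x \<in> R. g x div t < l} = {x \<in> R. g x < t * l}"
      using t by (simp add: div_less_iff_less_mult mult.commute)
    moreover have "g ` {x \<in> R. g x < t * l} = {..<t * l}"
    proof
      show "{..<t * l} \<subseteq> g ` {x \<in> R. g x < t * l}"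
      proof
        fix a assume a: "a \<in> {..<t * l}"
        then have "a < M" using l by (simp add: M_def R_def)
        then obtain y where "y \<in> R" "a = g y" using g by (metis bij_betw_def imageE lessThan_iff)
        then show "a \<in> g ` {x \<in> R. g x < t * l}" using a by auto
      qed
    qed auto
    moreover have "card (g ` {x \<in> R. g x < t * l}) = card {x \<in> R. g x < t * l}"
      by (rule card_image) (use ginj in \<open>auto simp: inj_on_def\<close>)
    ultimately have c: "card {x \<in> R. g x div t < l} = t * l" by simp
    have "degsum E R = (\<Sum>x\<in>R. if g x div t < l then real (t - 1) else 0)"
      unfolding degsum_def ldeg_def using cN by (intro sum.cong) auto
    also have "\<dots> = (\<Sum>x | x \<in> R \<and> g x div t < l. real (t - 1))" using fR by (simp only: sum.inter_filter)
    also have "\<dots> = real (t * l * (t - 1))" using c by simp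
    finally show ?thesis by (simp add: R_def)
  qed
  ultimately show ?thesis by blast
qed

section \<open>Identification of clique joins\<close>

lemma pair_digraph_isoI:
  assumes ug: "ugraph (pverts G) (parcs G)" and bij: "bij_betw \<phi> (pverts G) (pverts H)"
    and arcs: "parcs H = map_prod \<phi> \<phi> ` parcs G"
  shows "digraph_iso (with_proj G) (with_proj H)"
proof -
  let ?h = "\<lparr>iso_verts = \<phi>, iso_arcs = map_prod \<phi> \<phi>, iso_head = snd, iso_tail = fst\<rparr>"
  have wf: "wf_digraph (with_proj G)" unfolding wf_digraph_def using ugraphD(6,7)[OF ug] by auto
  have inj: "inj_on \<phi> (pverts G)" using bij by (simp add: bij_betw_def)
  have "inj_on (map_prod \<phi> \<phi>) (parcs G)"
    by (rule inj_on_subset[OF map_prod_inj_on[OF inj inj]]) (rule ugraphD(3)[OF ug])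
  then have "pre_digraph.digraph_isomorphism (with_proj G) ?h"
    unfolding pre_digraph.digraph_isomorphism_def using wf inj by auto
  moreover have "with_proj H = app_iso ?h (with_proj G)"
    using bij arcs by (simp add: app_iso_def with_proj_def bij_betw_def)
  ultimately show ?thesis unfolding digraph_iso_def by blast
qed

lemma out_degree_pair: "out_degree (with_proj L) v = card (parcs L `` {v})"
proof -
  have "out_arcs (with_proj L) v = Pair v ` (parcs L `` {v})" by (auto simp: out_arcs_def)
  then show ?thesis unfolding out_degree_def by (simp add: card_image inj_on_def)
qed

lemma card_arcs_edge_set:
  assumes "L \<in> graphs_on k"
  shows "card (parcs L) = 2 * card (edge_set L)"
proof -
  have "pair_graph L" using assms by (simp add: graphs_on_def)
  then have ug: "ugraph (pverts L) (parcs L)" using pair_graph_iff_ugraph by blast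
  note u = ugraphD[OF ug]
  have s: "sym (parcs L)" "irrefl (parcs L)" using ug by (auto simp: ugraph_def)
  define A where "A = {(x, y) \<in> parcs L. x < y}"
  have "edge_set L = (\<lambda>(u, v). {u, v}) ` A"
  proof
    show "edge_set L \<subseteq> (\<lambda>(u, v). {u, v}) ` A"
    proof
      fix e assume "e \<in> edge_set L"
      then obtain x y where xy: "(x, y) \<in> parcs L" "e = {x, y}" by (auto simp: edge_set_def)
      have "x \<noteq> y" using xy u(5) by auto
      then consider "(x, y) \<in> A" | "(y, x) \<in> A" using xy u(4) by (auto simp: A_def) (meson linorder_neqE_nat)
      then show "e \<in> (\<lambda>(u, v). {u, v}) ` A"
      proof cases
        case 1
        then show ?thesis using xy(2) by (intro image_eqI[of _ _ "(x, y)"]) auto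
      next
        case 2
        then show ?thesis using xy(2) by (intro image_eqI[of _ _ "(y, x)"]) auto
      qed
    qed
  qed (auto simp: edge_set_def A_def)
  moreover have "inj_on (\<lambda>(u, v). {u, v}) A" by (auto simp: inj_on_def A_def doubleton_eq_iff)
  ultimately have "card (edge_set L) = card A" by (simp add: card_image)
  then show ?thesis using card_arcs_eq[OF u(2) s] by (simp add: A_def)
qed

definition hub_graph :: "nat set \<Rightarrow> (nat \<times> nat) set \<Rightarrow> nat pair_pre_digraph \<Rightarrow> (nat \<Rightarrow> nat) \<Rightarrow> bool" where
  "hub_graph K E L \<kappa> \<longleftrightarrow> L \<in> graphs_on (card K) \<and> bij_betw \<kappa> K {..<card K} \<and>
     (\<forall>x\<in>K. \<forall>y\<in>K. (x, y) \<in> E \<longleftrightarrow> (\<kappa> x, \<kappa> y) \<in> parcs L)"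

lemma hub_graph_of_hubs:
  assumes fK: "finite K" and E: "sym E" "irrefl E"
  shows "\<exists>L \<kappa>. hub_graph K E L \<kappa>"
proof -
  obtain \<kappa> where b: "bij_betw \<kappa> K {..<card K}" using fK by (metis finite_same_card_bij finite_lessThan card_lessThan)
  have inj: "x = y" if "x \<in> K" "y \<in> K" "\<kappa> x = \<kappa> y" for x y using b that by (auto simp: bij_betw_def inj_on_def)
  have im: "\<kappa> x < card K" if "x \<in> K" for x using b that by (auto simp: bij_betw_def)
  define L where "L = \<lparr>pverts = {..<card K}, parcs = map_prod \<kappa> \<kappa> ` (E \<inter> K \<times> K)\<rparr>"
  have "ugraph (pverts L) (parcs L)" unfolding ugraph_def
  proof (intro conjI)
    show "finite (pverts L)" by (simp add: L_def)
    show "parcs L \<subseteq> pverts L \<times> pverts L" using im by (auto simp: L_def)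
    show "sym (parcs L)"
    proof (rule symI)
      fix a b assume "(a, b) \<in> parcs L"
      then obtain x y where "(x, y) \<in> E" "x \<in> K" "y \<in> K" "a = \<kappa> x" "b = \<kappa> y" by (auto simp: L_def)
      then show "(b, a) \<in> parcs L" using symD[OF E(1)] by (auto simp: L_def intro!: image_eqI[of _ _ "(y, x)"])
    qed
    have False if a: "(a, a) \<in> parcs L" for a
    proof -
      obtain x y where xy: "(x, y) \<in> E" "x \<in> K" "y \<in> K" "a = \<kappa> x" "a = \<kappa> y" using a by (auto simp: L_def)
      have "x = y" by (rule inj) (use xy in simp_all)
      then show False using xy(1) E(2) by (simp add: irrefl_def)
    qed
    then show "irrefl (parcs L)" by (auto simp: irrefl_def)
  qed
  then have "L \<in> graphs_on (card K)" using pair_graph_iff_ugraph[of L] by (simp add: graphs_on_def) (simp add: L_def)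
  moreover have "(x, y) \<in> E \<longleftrightarrow> (\<kappa> x, \<kappa> y) \<in> parcs L" if "x \<in> K" "y \<in> K" for x y
  proof
    assume "(\<kappa> x, \<kappa> y) \<in> parcs L"
    then obtain x' y' where "(x', y') \<in> E" "x' \<in> K" "y' \<in> K" "\<kappa> x = \<kappa> x'" "\<kappa> y = \<kappa> y'" by (auto simp: L_def)
    note xy = this
    have "x = x'" "y = y'" by (rule inj; use xy that in simp)+
    then show "(x, y) \<in> E" using xy(1) by simp
  qed (use that in \<open>auto simp: L_def\<close>)
  ultimately show ?thesis unfolding hub_graph_def using b by blast
qed

lemma hubs_of_graph:
  assumes L: "L \<in> graphs_on (card K)" and fK: "finite K"
  shows "\<exists>F \<kappa>. F \<subseteq> K \<times> K \<and> sym F \<and> irrefl F \<and> hub_graph K F L \<kappa>"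
proof -
  obtain \<kappa> where b: "bij_betw \<kappa> K {..<card K}" using fK by (metis finite_same_card_bij finite_lessThan card_lessThan)
  have "pair_graph L" using L by (simp add: graphs_on_def)
  then have ug: "ugraph (pverts L) (parcs L)" using pair_graph_iff_ugraph by blast
  define F where "F = {(x, y) \<in> K \<times> K. (\<kappa> x, \<kappa> y) \<in> parcs L}"
  have "F \<subseteq> K \<times> K" "sym F" "irrefl F" using ugraphD(4,5)[OF ug] by (auto simp: F_def sym_def irrefl_def)
  moreover have "hub_graph K F L \<kappa>" unfolding hub_graph_def using L b by (auto simp: F_def)
  ultimately show ?thesis by blast
qed

text \<open>Here the degree moments of the spectral analysis become the edge number and the function
  \<open>psi\<close> of the theorem. The first is the handshake lemma, the second a rewriting of
  sums along the relabelling \<open>\<kappa>\<close>.\<close>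

lemma hub_graph_quantities:
  assumes hg: "hub_graph K E L \<kappa>" and fK: "finite K" "card K = s - 1" "s \<ge> 2" and t: "t \<ge> 1"
  shows "hb1 E K = 2 * card (edge_set L) / (real s - 1)"
    and "psival (real (t - 1)) (hb1 E K) (hb2 E K) = (real t - 1)\<^sup>2 + psi s t L / (real s - 1)"
proof -
  have L: "L \<in> graphs_on (card K)" and b: "bij_betw \<kappa> K {..<card K}"
    and iff: "\<And>x y. x \<in> K \<Longrightarrow> y \<in> K \<Longrightarrow> (x, y) \<in> E \<longleftrightarrow> (\<kappa> x, \<kappa> y) \<in> parcs L"
    using hg by (auto simp: hub_graph_def)
  have pv: "pverts L = {..<card K}" and "pair_graph L" using L by (auto simp: graphs_on_def)
  then have ug: "ugraph (pverts L) (parcs L)" using pair_graph_iff_ugraph by blast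
  note u = ugraphD[OF ug]
  have im: "\<kappa> ` K = pverts L" and inj: "inj_on \<kappa> K" using b pv by (auto simp: bij_betw_def)
  have d: "degree_of L (\<kappa> x) = ldeg E K x" if x: "x \<in> K" for x
  proof -
    have "parcs L `` {\<kappa> x} = \<kappa> ` (E `` {x} \<inter> K)"
    proof
      show "parcs L `` {\<kappa> x} \<subseteq> \<kappa> ` (E `` {x} \<inter> K)"
      proof
        fix a assume "a \<in> parcs L `` {\<kappa> x}"
        then have a: "(\<kappa> x, a) \<in> parcs L" by simp
        then have "a \<in> \<kappa> ` K" using u(7) im by auto
        then obtain y where "y \<in> K" "a = \<kappa> y" by auto
        then show "a \<in> \<kappa> ` (E `` {x} \<inter> K)" using a iff[OF x] by auto
      qed
      show "\<kappa> ` (E `` {x} \<inter> K) \<subseteq> parcs L `` {\<kappa> x}" using iff[OF x] by auto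
    qed
    then show ?thesis unfolding out_degree_pair ldeg_def using inj by (simp add: card_image inj_on_subset)
  qed
  have S: "(\<Sum>v\<in>pverts L. g (degree_of L v)) = (\<Sum>x\<in>K. g (ldeg E K x))" for g :: "real \<Rightarrow> real"
    unfolding im[symmetric] sum.reindex[OF inj] by (intro sum.cong) (auto simp: d)
  have k: "real (card K) = real s - 1" "real s - 1 > 0" using fK by auto
  have "(\<Sum>v\<in>pverts L. card (parcs L `` {v})) = card (Sigma (pverts L) (\<lambda>v. parcs L `` {v}))"
    by (rule card_SigmaI[symmetric]) (use u in auto)
  also have "Sigma (pverts L) (\<lambda>v. parcs L `` {v}) = parcs L" using u(3) by auto
  finally have "(\<Sum>v\<in>pverts L. card (parcs L `` {v})) = 2 * card (edge_set L)" using card_arcs_edge_set[OF L] by simp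
  then have "real (\<Sum>v\<in>pverts L. card (parcs L `` {v})) = real (2 * card (edge_set L))" by (rule arg_cong)
  then have "(\<Sum>v\<in>pverts L. degree_of L v) = 2 * card (edge_set L)" by (simp add: out_degree_pair)
  then show "hb1 E K = 2 * card (edge_set L) / (real s - 1)" using S[of "\<lambda>x. x"] by (simp add: hb1_def k)
  define k' where "k' = real s - 1"
  have t1: "real (t - 1) = real t - 1" using t by simp
  have h: "hb1 E K = (\<Sum>x\<in>K. ldeg E K x) / k'" "hb2 E K = (\<Sum>x\<in>K. (ldeg E K x)\<^sup>2) / k'" "k' \<noteq> 0"
    using k by (simp_all add: hb1_def hb2_def k'_def)
  show "psival (real (t - 1)) (hb1 E K) (hb2 E K) = (real t - 1)\<^sup>2 + psi s t L / (real s - 1)"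
    unfolding psi_def psival_def S[of "\<lambda>x. x"] S[of "\<lambda>x. x\<^sup>2"] t1 k'_def[symmetric] h(1,2)
    using h(3) by (simp add: field_simps power2_eq_square)
qed

lemma graph_join_arcs [simp]:
  "(Inl a, Inl b) \<in> parcs (graph_join G H) \<longleftrightarrow> (a, b) \<in> parcs G"
  "(Inr c, Inr d) \<in> parcs (graph_join G H) \<longleftrightarrow> (c, d) \<in> parcs H"
  "(Inl a, Inr d) \<in> parcs (graph_join G H) \<longleftrightarrow> a \<in> pverts G \<and> d \<in> pverts H"
  "(Inr c, Inl b) \<in> parcs (graph_join G H) \<longleftrightarrow> c \<in> pverts H \<and> b \<in> pverts G"
  by (auto simp: graph_join_def disjoint_union_def intro: map_prod_imageI)

lemma disjoint_union_arcs [simp]: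
  "(Inl a, Inl b) \<in> parcs (disjoint_union G H) \<longleftrightarrow> (a, b) \<in> parcs G"
  "(Inr c, Inr d) \<in> parcs (disjoint_union G H) \<longleftrightarrow> (c, d) \<in> parcs H"
  "(Inl a, Inr d) \<notin> parcs (disjoint_union G H)" "(Inr c, Inl b) \<notin> parcs (disjoint_union G H)"
  by (auto simp: disjoint_union_def intro: map_prod_imageI)

lemma copies_arcs [simp]:
  "((i, a), (j, b)) \<in> parcs (copies l G) \<longleftrightarrow> i = j \<and> i < l \<and> (a, b) \<in> parcs G"
  by (auto simp: copies_def)

text \<open>The components are the closed neighbourhoods \<open>q x\<close> of vertices with
  positive outside degree. The coordinate map is injective into a vertex set of the same size, so it
  is a bijection by counting.\<close>

theorem clique_join_iso:
  assumes cj: "clique_join {..<n} K E t" and t: "t \<ge> 2" and hg: "hub_graph K E L \<kappa>"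
    and G: "pverts G = {..<n}" "parcs G = E"
  shows "\<exists>l. card K + t * l \<le> n \<and> degsum E ({..<n} - K) = real (t * l * (t - 1)) \<and>
    digraph_iso (with_proj G) (with_proj (graph_join L
       (disjoint_union (copies l (complete_graph t)) (copies (n - card K - t * l) (complete_graph 1)))))"
proof -
  have hj: "hub_join {..<n} K E (t - 1)" using cj by (simp add: clique_join_def)
  note h = hub_joinD[OF hj] and Q = same_clique_equiv[OF cj]
  note ug = ugraphD[OF h(1)]
  define R where "R = {..<n} - K"
  define q where "q x = insert x (E `` {x} \<inter> R)" for x
  have q: "same_clique R E `` {x} = q x" if "x \<in> R" for x
    using same_clique_class[OF that] by (simp add: q_def)
  define R1 where "R1 = {x \<in> R. E `` {x} \<inter> R \<noteq> {}}"
  have fR: "finite R" "R1 \<subseteq> R" "finite R1" by (auto simp: R_def R1_def)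
  have qq: "q x = q y \<longleftrightarrow> x = y \<or> (x, y) \<in> E" if "x \<in> R" "y \<in> R" for x y
  proof -
    have "same_clique R E `` {x} = same_clique R E `` {y} \<longleftrightarrow> (x, y) \<in> same_clique R E"
      by (rule eq_equiv_class_iff[OF Q[folded R_def] that])
    then show ?thesis using that unfolding q[OF that(1)] q[OF that(2)] by (simp add: same_clique_def)
  qed
  have q0: "x \<in> q x" for x by (simp add: q_def)
  have qR: "q x \<subseteq> R" if "x \<in> R" for x using that by (auto simp: q_def)
  have qR1: "q x \<subseteq> R1" if "x \<in> R1" for x
  proof
    fix y assume y: "y \<in> q x"
    show "y \<in> R1"
    proof (cases "y = x")
      case False
      then have "(y, x) \<in> E" "y \<in> R" using y ug(4) by (auto simp: q_def)
      then show ?thesis using that by (auto simp: R1_def)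
    qed (use that in simp)
  qed
  have qmem: "q y = q x" if "y \<in> q x" "x \<in> R" for x y
    using that qq[of x y] by (auto simp: q_def)
  have cq: "card (q x) = t" if "x \<in> R1" for x
  proof -
    have xR: "x \<in> {..<n} - K" "E `` {x} \<inter> R \<noteq> {}" using that by (auto simp: R1_def R_def)
    have "finite (E `` {x} \<inter> R)" using fR by simp
    then have "card (E `` {x} \<inter> R) \<noteq> 0" using xR by simp
    moreover have "card (E `` {x} \<inter> R) \<in> {0, t - 1}"
      using cj xR(1) unfolding clique_join_def R_def by (elim conjE) (drule bspec)
    moreover have "x \<notin> E `` {x} \<inter> R" using ug(5) by auto
    ultimately show ?thesis using fR t by (simp add: q_def)
  qed
  define \<C> where "\<C> = q ` R1"
  define l where "l = card \<C>"
  have fC: "finite \<C>" using fR by (simp add: \<C>_def)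
  have UC: "\<Union>\<C> = R1" using qR1 q0 by (auto simp: \<C>_def)
  have "t * card \<C> = card (\<Union>\<C>)"
  proof (rule card_partition)
    show "card c = t" if "c \<in> \<C>" for c using that cq by (auto simp: \<C>_def)
    show "c1 \<inter> c2 = {}" if cc: "c1 \<in> \<C>" "c2 \<in> \<C>" "c1 \<noteq> c2" for c1 c2
    proof -
      obtain x y where xy: "x \<in> R1" "y \<in> R1" "c1 = q x" "c2 = q y" using cc by (auto simp: \<C>_def)
      show ?thesis
      proof (rule ccontr)
        assume "c1 \<inter> c2 \<noteq> {}"
        then obtain z where "z \<in> q x" "z \<in> q y" using xy by auto
        then have "q z = q x" "q z = q y" using qmem xy fR(2) by auto
        then show False using cc xy by simp
      qed
    qed
  qed (use fC UC fR in auto)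
  then have cR1: "card R1 = t * l" using UC by (simp add: l_def)
  have cR: "card R = n - card K" unfolding R_def using h(2,7) by (simp add: card_Diff_subset)
  have cKn: "card K \<le> n" using card_mono[OF _ h(2)] by simp
  have "card R1 \<le> card R" using fR by (intro card_mono)
  then have le: "card K + t * l \<le> n" using cR1 cR cKn by simp
  have deg: "degsum E R = real (t * l * (t - 1))"
  proof -
    have "degsum E R = (\<Sum>x\<in>R1. ldeg E R x)" unfolding degsum_def
      by (rule sum.mono_neutral_right) (use fR in \<open>auto simp: R1_def ldeg_def\<close>)
    also have "\<dots> = (\<Sum>x\<in>R1. real (t - 1))"
    proof (rule sum.cong)
      fix x assume x: "x \<in> R1"
      have "x \<notin> E `` {x} \<inter> R" using ug(5) by auto
      then have "card (q x) = Suc (card (E `` {x} \<inter> R))" using fR by (simp add: q_def)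
      then show "ldeg E R x = real (t - 1)" using cq[OF x] by (simp add: ldeg_def)
    qed simp
    finally show ?thesis using cR1 by simp
  qed
  define j where "j = n - card K - t * l"
  obtain c where c: "bij_betw c \<C> {..<l}" unfolding l_def using fC by (metis finite_same_card_bij finite_lessThan card_lessThan)
  have "\<forall>C\<in>\<C>. \<exists>b. bij_betw b C {..<t}"
  proof
    fix C assume "C \<in> \<C>"
    then have "card C = t" "finite C" using cq qR1 fR by (auto simp: \<C>_def intro: finite_subset)
    then show "\<exists>b. bij_betw b C {..<t}" by (metis finite_same_card_bij finite_lessThan card_lessThan)
  qed
  then obtain b where b: "\<And>C. C \<in> \<C> \<Longrightarrow> bij_betw (b C) C {..<t}" by metis
  have "card (R - R1) = j" using fR cR cR1 by (simp add: card_Diff_subset j_def)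
  then obtain \<iota> where \<iota>: "bij_betw \<iota> (R - R1) {..<j}" using fR by (metis finite_same_card_bij finite_lessThan card_lessThan finite_Diff)
  have L: "L \<in> graphs_on (card K)" and k: "bij_betw \<kappa> K {..<card K}"
    and iff: "\<And>x y. x \<in> K \<Longrightarrow> y \<in> K \<Longrightarrow> (x, y) \<in> E \<longleftrightarrow> (\<kappa> x, \<kappa> y) \<in> parcs L"
    using hg by (auto simp: hub_graph_def)
  have pL: "pverts L = {..<card K}" using L by (simp add: graphs_on_def)
  \<comment> \<open>A hub gets its label in \<open>L\<close>, a clique vertex the number of its
    clique and its position there, an isolated vertex its own number; the \<open>0\<close> is the
    only vertex of \<open>complete_graph 1\<close>.\<close>
  define \<phi> :: "nat \<Rightarrow> nat + nat \<times> nat + nat \<times> nat" where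
    "\<phi> v = (if v \<in> K then Inl (\<kappa> v) else if v \<in> R1 then Inr (Inl (c (q v), b (q v) v)) else Inr (Inr (\<iota> v, 0)))" for v
  have f1: "\<phi> v = Inl (\<kappa> v)" if "v \<in> K" for v using that by (simp add: \<phi>_def)
  have f2: "\<phi> v = Inr (Inl (c (q v), b (q v) v))" if "v \<in> R1" for v using that by (auto simp: \<phi>_def R1_def R_def)
  have f3: "\<phi> v = Inr (Inr (\<iota> v, 0))" if "v \<in> R - R1" for v using that by (auto simp: \<phi>_def R_def)
  have k1: "\<kappa> v < card K" if "v \<in> K" for v using k that by (auto simp: bij_betw_def)
  have k2: "\<kappa> v = \<kappa> w \<longleftrightarrow> v = w" if "v \<in> K" "w \<in> K" for v w using k that by (auto simp: bij_betw_def inj_on_def)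
  have qC: "q v \<in> \<C>" if "v \<in> R1" for v using that by (simp add: \<C>_def)
  have c1: "c (q v) < l" if "v \<in> R1" for v using c qC[OF that] by (auto simp: bij_betw_def)
  have c2: "c (q v) = c (q w) \<longleftrightarrow> q v = q w" if "v \<in> R1" "w \<in> R1" for v w
    using c qC[OF that(1)] qC[OF that(2)] by (auto simp: bij_betw_def inj_on_def)
  have b1: "b (q v) v < t" if "v \<in> R1" for v using b[OF qC[OF that]] q0[of v] by (auto simp: bij_betw_def)
  have b2: "b (q v) v = b (q w) w \<longleftrightarrow> v = w" if "v \<in> R1" "w \<in> R1" "q v = q w" for v w
    using b[OF qC[OF that(1)]] q0[of v] q0[of w] that(3) by (auto simp: bij_betw_def inj_on_def)
  have i1: "\<iota> v < j" if "v \<in> R - R1" for v using \<iota> that by (auto simp: bij_betw_def)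
  have i2: "\<iota> v = \<iota> w \<longleftrightarrow> v = w" if "v \<in> R - R1" "w \<in> R - R1" for v w using \<iota> that by (auto simp: bij_betw_def inj_on_def)
  let ?H = "graph_join L (disjoint_union (copies l (complete_graph t)) (copies j (complete_graph 1)))"
  have pH: "pverts ?H = {..<card K} <+> (({..<l} \<times> {..<t}) <+> ({..<j} \<times> {..<1}))"
    by (simp add: graph_join_def disjoint_union_def copies_def complete_graph_def pL)
  have V: "v \<in> K \<or> v \<in> R1 \<or> v \<in> R - R1" if "v < n" for v using that by (auto simp: R_def)
  have inH: "\<phi> v \<in> pverts ?H" if "v < n" for v
    using V[OF that] f1[of v] f2[of v] f3[of v] k1[of v] c1[of v] b1[of v] i1[of v] unfolding pH by auto
  have inj: "inj_on \<phi> {..<n}"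
  proof (rule inj_onI)
    fix v w assume "v \<in> {..<n}" "w \<in> {..<n}" and e: "\<phi> v = \<phi> w"
    then have vw: "v \<in> K \<or> v \<in> R1 \<or> v \<in> R - R1" "w \<in> K \<or> w \<in> R1 \<or> w \<in> R - R1" using V by auto
    show "v = w"
      using vw
    proof (elim disjE)
      assume a: "v \<in> K" "w \<in> K"
      then show ?thesis using e f1 k2 by simp
    next
      assume a: "v \<in> R1" "w \<in> R1"
      then have "c (q v) = c (q w)" "b (q v) v = b (q w) w" using e f2 by auto
      then show ?thesis using c2[OF a] b2[OF a] by simp
    next
      assume a: "v \<in> R - R1" "w \<in> R - R1"
      then show ?thesis using e f3[OF a(1)] f3[OF a(2)] i2[OF a] by simp
    qed (use e f1 f2 f3 in simp_all)
  qed
  have cH: "card (pverts ?H) = n"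
    unfolding pH using le by (simp add: card_Plus card_cartesian_product j_def mult.commute)
  have fH: "finite (pverts ?H)" unfolding pH by simp
  have bij: "bij_betw \<phi> {..<n} (pverts ?H)"
  proof -
    have "\<phi> ` {..<n} \<subseteq> pverts ?H" using inH by auto
    moreover have "card (\<phi> ` {..<n}) = card (pverts ?H)" using inj cH by (simp add: card_image)
    ultimately have "\<phi> ` {..<n} = pverts ?H" using fH by (intro card_subset_eq)
    then show ?thesis using inj by (simp add: bij_betw_def)
  qed
  have pc: "parcs (complete_graph m) = {(u, v). u < m \<and> v < m \<and> u \<noteq> v}" for m by (simp add: complete_graph_def)
  have arc: "(\<phi> v, \<phi> w) \<in> parcs ?H \<longleftrightarrow> (v, w) \<in> E" if "v < n" "w < n" for v w
  proof -
    have join: "(x, y) \<in> E" "(y, x) \<in> E" if "x \<in> K" "y \<in> R" for x y using h(4,5) that by (auto simp: R_def)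
    have verts: "Inl (c (q x), b (q x) x) \<in> pverts (disjoint_union (copies l (complete_graph t)) (copies j (complete_graph 1)))"
      if "x \<in> R1" for x using c1[OF that] b1[OF that] by (auto simp: disjoint_union_def copies_def complete_graph_def)
    have verts': "Inr (\<iota> x, 0) \<in> pverts (disjoint_union (copies l (complete_graph t)) (copies j (complete_graph 1)))"
      if "x \<in> R - R1" for x using i1[OF that] by (auto simp: disjoint_union_def copies_def complete_graph_def)
    have iso: "(x, y) \<notin> E" "(y, x) \<notin> E" if "x \<in> R - R1" "y \<in> R" for x y
      using that ug(4) by (auto simp: R1_def)
    show ?thesis
      using V[OF that(1)] V[OF that(2)]
    proof (elim disjE)
      assume a: "v \<in> K" "w \<in> K"
      then show ?thesis using f1 iff by simp
    next
      assume a: "v \<in> K" "w \<in> R1"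
      then show ?thesis using f1 f2 join fR(2) pL k1 verts by auto
    next
      assume a: "v \<in> K" "w \<in> R - R1"
      then show ?thesis using f1[of v] f3[of w] join[of v w] pL k1[of v] verts'[of w] by simp
    next
      assume a: "v \<in> R1" "w \<in> K"
      then show ?thesis using f1 f2 join fR(2) pL k1 verts by auto
    next
      assume a: "v \<in> R1" "w \<in> R1"
      have vR: "v \<in> R" "w \<in> R" using a fR by auto
      have "(\<phi> v, \<phi> w) \<in> parcs ?H \<longleftrightarrow> q v = q w \<and> b (q v) v \<noteq> b (q w) w"
        using f2[OF a(1)] f2[OF a(2)] c1[OF a(1)] c2[OF a] b1[OF a(1)] b1[OF a(2)] by (auto simp: pc)
      also have "\<dots> \<longleftrightarrow> q v = q w \<and> v \<noteq> w" using b2[OF a] by auto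
      also have "\<dots> \<longleftrightarrow> (v, w) \<in> E" using qq[OF vR] ug(5) by auto
      finally show ?thesis .
    next
      assume a: "v \<in> R1" "w \<in> R - R1"
      then show ?thesis using f2[of v] f3[of w] iso[of w v] fR(2) by auto
    next
      assume a: "v \<in> R - R1" "w \<in> K"
      then show ?thesis using f1[of w] f3[of v] join[of w v] pL k1[of w] verts'[of v] by simp
    next
      assume a: "v \<in> R - R1" "w \<in> R1"
      then show ?thesis using f2[of w] f3[of v] iso[of v w] fR(2) by auto
    next
      assume a: "v \<in> R - R1" "w \<in> R - R1"
      then show ?thesis using f3[of v] f3[of w] iso[of v w] by (auto simp: pc)
    qed
  qed
  have sub: "parcs ?H \<subseteq> pverts ?H \<times> pverts ?H"
  proof -
    have "pair_graph L" using L by (simp add: graphs_on_def)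
    then have "parcs L \<subseteq> pverts L \<times> pverts L" using pair_graph_iff_ugraph ugraphD(3) by blast
    then show ?thesis by (auto simp: graph_join_def disjoint_union_def copies_def complete_graph_def)
  qed
  have arcs: "parcs ?H = map_prod \<phi> \<phi> ` E"
  proof
    show "parcs ?H \<subseteq> map_prod \<phi> \<phi> ` E"
    proof (rule subrelI)
      fix x y assume xy: "(x, y) \<in> parcs ?H"
      then have "x \<in> \<phi> ` {..<n}" "y \<in> \<phi> ` {..<n}" using sub bij by (auto simp: bij_betw_def)
      then obtain v w where "v < n" "w < n" "x = \<phi> v" "y = \<phi> w" by auto
      then show "(x, y) \<in> map_prod \<phi> \<phi> ` E" using arc xy by auto
    qed
    show "map_prod \<phi> \<phi> ` E \<subseteq> parcs ?H"
    proof
      fix e assume "e \<in> map_prod \<phi> \<phi> ` E"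
      then obtain v w where "(v, w) \<in> E" "e = (\<phi> v, \<phi> w)" by auto
      then show "e \<in> parcs ?H" using arc[of v w] ug(6,7)[of v w] by auto
    qed
  qed
  have "digraph_iso (with_proj G) (with_proj ?H)"
    by (rule pair_digraph_isoI[of _ \<phi>]) (use h(1) G bij arcs in auto)
  then show ?thesis using le deg unfolding j_def R_def by blast
qed

section \<open>Extremal graphs\<close>

lemma extremal_eig_unique:
  assumes ug: "ugraph V E" and ex: "extremal_eig V E p q" "extremal_eig V E p' q'"
  shows "p = p'" "q = q'"
proof -
  have *: "p \<le> p' \<and> q' \<le> q" if e: "extremal_eig V E p q" "extremal_eig V E p' q'" for p q p' q'
  proof -
    obtain x z where xz: "eigvec V E p x" "eigvec V E q z" using e(1) unfolding extremal_eig_def by (elim conjE exE) (rule that; assumption)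
    have b: "qf E x \<le> p' * nrm2 V x" "q' * nrm2 V z \<le> qf E z" using e(2) by (auto simp: extremal_eig_def)
    note x = eigvec_qf[OF xz(1) ugraphD(1,3)[OF ug]] and z = eigvec_qf[OF xz(2) ugraphD(1,3)[OF ug]]
    show ?thesis using b x z by (simp add: mult_le_cancel_right)
  qed
  show "p = p'" "q = q'" using *[OF ex] *[OF ex(2,1)] by linarith+
qed

text \<open>Replacing an eigenvector for \<open>q\<close> by its modulus can only increase the form
  in absolute value, as in the Perron-Frobenius theorem.\<close>

lemma extremal_eig_abs:
  assumes ug: "ugraph V E" and ex: "extremal_eig V E p q"
  shows "- q \<le> p"
proof -
  obtain z where z: "eigvec V E q z" using ex unfolding extremal_eig_def by (elim conjE exE) (rule that; assumption)
  note z = eigvec_qf[OF z ugraphD(1,3)[OF ug]]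
  define y where "y v = \<bar>z v\<bar>" for v
  have "- q * nrm2 V z \<le> \<bar>qf E z\<bar>" using z(1) by simp
  also have "\<dots> \<le> (\<Sum>(u, v)\<in>E. \<bar>z u\<bar> * \<bar>z v\<bar>)" by (rule abs_qf_le)
  also have "\<dots> = qf E y" by (simp add: qf_def y_def)
  also have "\<dots> \<le> p * nrm2 V y" using ex by (simp add: extremal_eig_def)
  also have "nrm2 V y = nrm2 V z" by (simp add: y_def)
  finally show ?thesis using z(2) by (simp only: mult_le_cancel_right_pos)
qed

text \<open>The competitor. The average hub degree is at most \<open>s - 1\<close>, hence at most
  \<open>t - 1\<close> because \<open>s \<le> t\<close>; so the target degree sum is nonnegative and
  small enough for the cliques to fit.\<close>

lemma near_opt_clique_join_exists:
  fixes s t n :: nat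
  assumes st: "2 \<le> s" "s \<le> t" and K: "K \<subseteq> {..<n}" "card K = s - 1" and F: "F \<subseteq> K \<times> K" "sym F" "irrefl F"
  shows "\<exists>E. clique_join {..<n} K E t \<and> E \<inter> K \<times> K = F \<and> near_opt {..<n} K E (t - 1)"
proof -
  define \<tau> where "\<tau> = t - 1"
  have \<tau>: "real \<tau> \<ge> 1" "real t = real \<tau> + 1" using st by (auto simp: \<tau>_def)
  have fK: "finite K" "K \<noteq> {}" using K st finite_subset by auto
  define m where "m = card ({..<n} - K)"
  define a where "a = (2 * real \<tau> - hb1 F K) / 3"
  have "(\<Sum>h\<in>K. ldeg F K h) \<le> (\<Sum>h\<in>K. real (card K))" by (intro sum_mono ldeg_le_card fK)
  then have "(\<Sum>h\<in>K. ldeg F K h) \<le> real (card K) * real (card K)" by simp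
  moreover have "real (card K) > 0" using fK by (simp add: card_gt_0_iff)
  ultimately have "hb1 F K \<le> real (card K)" by (simp add: hb1_def divide_le_eq)
  also have "\<dots> \<le> real \<tau>" using K st by (simp add: \<tau>_def)
  finally have b1: "hb1 F K \<le> real \<tau>" .
  have "0 \<le> hb1 F K" unfolding hb1_def by (intro divide_nonneg_nonneg sum_nonneg ldeg_le_card(2)) auto
  then have a: "0 \<le> a" "a \<le> real \<tau>" using b1 \<tau> by (auto simp: a_def)
  define T where "T = real t * real \<tau>"
  have T: "T > 0" using \<tau> by (simp add: T_def)
  \<comment> \<open>Each clique contributes \<open>T\<close> to the degree sum, so rounding down
    misses the target by at most \<open>T\<close>, the tolerance of \<open>near_opt\<close>.\<close>
  define l where "l = nat \<lfloor>a * real m / T\<rfloor>"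
  have "a * real m / T \<ge> 0" using a T by simp
  then have l: "real l \<le> a * real m / T" "a * real m / T < real l + 1" by (auto simp: l_def)
  have l1: "real l * T \<le> a * real m" using l(1) T by (simp add: le_divide_eq)
  have l2: "a * real m < (real l + 1) * T" using l(2) T by (simp add: divide_less_eq)
  have "real t * real l * real \<tau> \<le> real m * real \<tau>"
    using l1 mult_right_mono[OF a(2), of "real m"] by (simp add: T_def mult.commute mult.left_commute)
  then have "real t * real l \<le> real m" using \<tau>(1) by (simp add: mult_le_cancel_right)
  then have "real (t * l) \<le> real m" by simp
  then have tl: "t * l \<le> card ({..<n} - K)" by (simp only: of_nat_le_iff m_def)
  have "\<exists>E. clique_join {..<n} K E t \<and> E \<inter> K \<times> K = F \<and> degsum E ({..<n} - K) = real (t * l * (t - 1))"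
    by (rule clique_join_exists) (use K fK F tl st in auto)
  then obtain E where E: "clique_join {..<n} K E t" "E \<inter> K \<times> K = F" "degsum E ({..<n} - K) = real (t * l * (t - 1))" by blast
  have "E \<inter> K \<times> K = F \<inter> K \<times> K" using E(2) F(1) by blast
  note cg = hub_quantities_cong(1)[OF this]
  have dT: "degsum E ({..<n} - K) = real l * T" unfolding E(3) T_def \<tau>_def by simp
  have "\<bar>real l * T - a * real m\<bar> \<le> T" using l1 l2 by (simp add: distrib_right abs_le_iff)
  then have "\<bar>degsum E ({..<n} - K) - (2 * real \<tau> - hb1 E K) / 3 * card ({..<n} - K)\<bar> \<le> (real \<tau> + 1) * real \<tau>"
    unfolding dT cg m_def[symmetric] a_def[symmetric] by (simp only: T_def \<tau>(2))
  moreover have "defect E ({..<n} - K) (t - 1) = 0" using clique_join_defect[OF E(1)] st by simp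
  ultimately have "near_opt {..<n} K E (t - 1)" unfolding near_opt_def \<tau>_def by blast
  then show ?thesis using E by blast
qed

definition max_spread_arcs :: "nat \<Rightarrow> nat \<Rightarrow> nat \<Rightarrow> (nat \<times> nat) set \<Rightarrow> real \<Rightarrow> real \<Rightarrow> bool" where
  "max_spread_arcs s t n E p q \<longleftrightarrow> ugraph {..<n} E \<and> Kst_free s t {..<n} E \<and> extremal_eig {..<n} E p q \<and>
     (\<forall>E' p' q'. ugraph {..<n} E' \<longrightarrow> Kst_free s t {..<n} E' \<longrightarrow> extremal_eig {..<n} E' p' q' \<longrightarrow> p' - q' \<le> p - q)"

lemma maximizes_spread_arcs:
  assumes G: "maximizes_spread s t n G" and n: "n > 0"
  shows "pverts G = {..<n}" "\<exists>p q. max_spread_arcs s t n (parcs G) p q \<and> spread G = p - q"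
proof -
  have g: "G \<in> Kst_minor_free_graphs s t n" and mx: "\<And>G'. G' \<in> Kst_minor_free_graphs s t n \<Longrightarrow> \<not> spread G < spread G'"
    using G by (auto simp: maximizes_spread_def is_arg_max_def)
  have G': "pverts G = {..<n}" "ugraph {..<n} (parcs G)" "Kst_free s t {..<n} (parcs G)"
    using g by (auto simp: Kst_minor_free_graphs_iff)
  show "pverts G = {..<n}" by (rule G')
  obtain p q where pq: "extremal_eig {..<n} (parcs G) p q" "spread G = p - q" using spread_eq[OF G'(2,1) n] by blast
  have "p' - q' \<le> p - q" if E': "ugraph {..<n} E'" "Kst_free s t {..<n} E'" "extremal_eig {..<n} E' p' q'" for E' p' q'
  proof -
    define G2 where "G2 = \<lparr>pverts = {..<n}, parcs = E'\<rparr>"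
    have G2: "pverts G2 = {..<n}" "parcs G2 = E'" by (auto simp: G2_def)
    then obtain p'' q'' where pq2: "extremal_eig {..<n} E' p'' q''" "spread G2 = p'' - q''"
      using spread_eq[of n G2] E'(1) n by auto
    have "G2 \<in> Kst_minor_free_graphs s t n" using E' G2 by (simp add: Kst_minor_free_graphs_iff)
    then have "spread G2 \<le> spread G" using mx[of G2] by simp
    then show ?thesis using extremal_eig_unique[OF E'(1,3) pq2(1)] pq(2) pq2(2) by simp
  qed
  then show "\<exists>p q. max_spread_arcs s t n (parcs G) p q \<and> spread G = p - q"
    unfolding max_spread_arcs_def using G' pq by blast
qed

text \<open>A clique join is minor-free and has spread at least \<open>2 * Q - D\<close>. As
  \<open>- q \<le> p\<close>, the extremal graph has \<open>p\<close> within a constant of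
  \<open>Q\<close>, which is the hypothesis of \<open>hubs_exist\<close>; the upper bound on
  \<open>p\<close> from the same theorem then keeps \<open>- q\<close> large too.\<close>

lemma max_spread_hubs:
  fixes s t :: nat and \<epsilon> :: real
  assumes st: "2 \<le> s" "s \<le> t" and ep: "0 < \<epsilon>"
  shows "\<exists>N. \<forall>n\<ge>N. \<forall>E p q. max_spread_arcs s t n E p q \<longrightarrow>
    sqrt ((real s - 1) * n) \<le> 2 * p \<and> sqrt ((real s - 1) * n) \<le> - 2 * q \<and>
    (\<exists>K\<subseteq>{..<n}. card K = s - 1 \<and> (\<forall>h\<in>K. (1 - \<epsilon>) * n \<le> card (E `` {h})))"
proof -
  define \<delta> where "\<delta> = min \<epsilon> (1 / 4)"
  have \<delta>: "0 < \<delta>" "\<delta> < 1" "\<delta> \<le> \<epsilon>" "\<delta> \<le> 1 / 4" using ep by (auto simp: \<delta>_def)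
  define k where "k = real s - 1"
  have k: "k \<ge> 1" using st by (simp add: k_def)
  \<comment> \<open>Twice \<open>k\<close> pays for replacing \<open>n - k\<close> by
    \<open>n\<close> under the two square roots, the rest is the loss in
    \<open>hub_join_extremal_bounds\<close>.\<close>
  define D where "D = 2 * k + (k + (real t - 1))"
  have D: "D \<ge> 0" using k st by (simp add: D_def)
  obtain N1 where N1: "\<forall>n\<ge>N1. \<forall>E. ugraph {..<n} E \<longrightarrow> Kst_free s t {..<n} E \<longrightarrow>
    (\<forall>x. qf E x \<le> (1 + \<delta>) * sqrt ((real s - 1) * n) * nrm2 {..<n} x) \<and>
    (\<forall>x. 0 < nrm2 {..<n} x \<longrightarrow> (sqrt ((real s - 1) * n) - D) * nrm2 {..<n} x \<le> qf E x \<longrightarrow>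
      (\<exists>H\<subseteq>{..<n}. card H = s - 1 \<and> (\<forall>h\<in>H. (1 - \<delta>) * n \<le> card (E `` {h}))))"
    using hubs_exist[OF st(1) \<delta>(1,2), of t D] by blast
  define N where "N = N1 + s + nat \<lceil>(4 * D)\<^sup>2\<rceil>"
  have main: "sqrt ((real s - 1) * n) \<le> 2 * p \<and> sqrt ((real s - 1) * n) \<le> - 2 * q \<and>
    (\<exists>K\<subseteq>{..<n}. card K = s - 1 \<and> (\<forall>h\<in>K. (1 - \<epsilon>) * n \<le> card (E `` {h})))"
    if n: "N \<le> n" and mx: "max_spread_arcs s t n E p q" for n E p q
  proof -
    have n1: "N1 \<le> n" "s \<le> n" using n by (auto simp: N_def)
    have n0: "n > 0" using n1 st by simp
    have "(4 * D)\<^sup>2 \<le> real N" unfolding N_def of_nat_add using real_nat_ceiling_ge[of "(4 * D)\<^sup>2"] by linarith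
    then have n2: "(4 * D)\<^sup>2 \<le> n" using n by (meson of_nat_le_iff order_trans)
    have ug: "ugraph {..<n} E" and free: "Kst_free s t {..<n} E" and ex: "extremal_eig {..<n} E p q"
      and opt: "\<And>E' p' q'. ugraph {..<n} E' \<Longrightarrow> Kst_free s t {..<n} E' \<Longrightarrow> extremal_eig {..<n} E' p' q' \<Longrightarrow> p' - q' \<le> p - q"
      using mx unfolding max_spread_arcs_def by blast+
    define Q where "Q = sqrt (k * real n)"
    have QD: "4 * D \<le> Q"
    proof -
      have "(4 * D)\<^sup>2 \<le> k * n" using n2 mult_right_mono[OF k, of "real n"] by simp
      then show ?thesis unfolding Q_def by (rule real_le_rsqrt)
    qed
    have "p - q \<ge> 2 * Q - D"
    proof -
      define K where "K = {..<s - 1}"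
      have K: "K \<subseteq> {..<n}" "card K = s - 1" using n1 by (auto simp: K_def)
      obtain E' where E': "clique_join {..<n} K E' t"
        using near_opt_clique_join_exists[OF st K, of "{}"] by (auto simp: sym_def irrefl_def)
      have hj: "hub_join {..<n} K E' (t - 1)" using E' by (simp add: clique_join_def)
      have free': "Kst_free s t {..<n} E'" using clique_join_Kst_free[OF E' st] K st by simp
      obtain p' q' where ex': "extremal_eig {..<n} E' p' q'"
        using extremal_eig_exists[OF hub_joinD(1)[OF hj]] n0 by (auto simp: lessThan_empty_iff)
      have cR: "card ({..<n} - K) = n - (s - 1)" using K by (subst card_Diff_subset) (auto simp: K_def)
      then have "card ({..<n} - K) \<noteq> 0" using n1 st by simp
      then have ne: "{..<n} - K \<noteq> {}" by (metis card.empty)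
      have km: "real (card K) = k" "real (card ({..<n} - K)) = real n - k" using K(2) cR st n1 by (auto simp: k_def of_nat_diff)
      have "2 * sqrt (k * (real n - k)) - (k + (real t - 1)) \<le> p' - q'"
        using hub_join_extremal_bounds(1,3)[OF hj ex' ne] st unfolding km of_nat_add by (simp add: of_nat_diff)
      moreover have "Q \<le> sqrt (k * (real n - k)) + k"
      proof -
        have "Q = sqrt (k * (real n - k) + k * k)" by (simp add: Q_def algebra_simps)
        also have "\<dots> \<le> sqrt (k * (real n - k)) + sqrt (k * k)"
          by (rule sqrt_add_le_add_sqrt) (use k n1 in \<open>auto simp: k_def\<close>)
        finally show ?thesis using k by simp
      qed
      ultimately have "2 * Q - D \<le> p' - q'" unfolding D_def by linarith
      also have "\<dots> \<le> p - q" by (rule opt[OF hub_joinD(1)[OF hj] free' ex'])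
      finally show ?thesis .
    qed
    moreover have "- q \<le> p" by (rule extremal_eig_abs[OF ug ex])
    ultimately have p: "Q - D \<le> p" using D by linarith
    obtain x where x: "eigvec {..<n} E p x" using ex unfolding extremal_eig_def by (elim conjE exE) (rule that; assumption)
    note x = eigvec_qf[OF x ugraphD(1,3)[OF ug]]
    note N1' = N1[rule_format, OF n1(1) ug free, folded k_def, folded Q_def]
    have "p * nrm2 {..<n} x \<le> (1 + \<delta>) * Q * nrm2 {..<n} x" using N1'[THEN conjunct1, rule_format, of x] x(1) by simp
    then have "p \<le> (1 + \<delta>) * Q" using x(2) by simp
    moreover have "\<delta> * Q \<le> 1 / 4 * Q" using \<delta>(4) QD D by (intro mult_right_mono) auto
    ultimately have "p \<le> Q + Q / 4" by (simp add: distrib_right)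
    with \<open>p - q \<ge> 2 * Q - D\<close> have q: "Q \<le> - 2 * q" using QD by simp
    have p2: "Q \<le> 2 * p" using p QD D by linarith
    have "(Q - D) * nrm2 {..<n} x \<le> qf E x" unfolding x(1) using p x(2) by (intro mult_right_mono) auto
    then obtain H where H: "H \<subseteq> {..<n}" "card H = s - 1" "\<forall>h\<in>H. (1 - \<delta>) * n \<le> card (E `` {h})"
      using N1'[THEN conjunct2, rule_format, OF x(2)] by blast
    have "(1 - \<epsilon>) * n \<le> (1 - \<delta>) * n" using \<delta>(3) by (intro mult_right_mono) auto
    then have "\<forall>h\<in>H. (1 - \<epsilon>) * n \<le> card (E `` {h})" using H(3) by (meson order_trans)
    then show ?thesis using H p2 q unfolding k_def[symmetric] Q_def by blast
  qed
  show ?thesis by (intro exI[of _ N] allI impI) (rule main)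
qed

text \<open>\<open>E'\<close> is not known to be minor-free, so
  \<open>regular_components_transitive\<close> is applied after deleting \<open>R1\<close>: what
  remains is a subgraph of the minor-free \<open>E\<close>. Nothing is lost, since in
  \<open>E'\<close> the vertices of \<open>R1\<close> are adjacent to hubs only.\<close>

lemma clique_join_of_regular:
  fixes s t n :: nat
  assumes st: "2 \<le> s" "s \<le> t" and free: "Kst_free s t {..<n} E" and hj: "hub_join {..<n} K E' (t - 1)"
    and cK: "card K = s - 1" and R1: "R1 \<subseteq> {..<n} - K" "12 * card R1 \<le> n"
      "E' = E \<inter> ({..<n} - R1) \<times> ({..<n} - R1) \<union> K \<times> R1 \<union> R1 \<times> K"
    and df: "defect E' ({..<n} - K) (t - 1) = 0"
    and dg: "degsum E' ({..<n} - K) \<le> 2 / 3 * real (t - 1) * real (card ({..<n} - K)) + C" "0 \<le> C"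
    and n: "4 * (2 * real s + C) \<le> n" "s \<le> n"
  shows "clique_join {..<n} K E' t"
proof -
  note h = hub_joinD[OF hj]
  note ug = ugraphD[OF h(1)]
  define R where "R = {..<n} - K"
  define \<tau> where "\<tau> = t - 1"
  have \<tau>: "real \<tau> \<ge> 1" using st by (simp add: \<tau>_def)
  have fR: "finite R" using h(8) by (simp add: R_def)
  have deg: "card (E' `` {u} \<inter> R) \<in> {0, \<tau>}" if u: "u \<in> R" for u
  proof -
    have "0 \<le> ldeg E' R u * (real \<tau> - ldeg E' R u)" if "u \<in> R" for u
      using h(6)[of u] that ldeg_le_card(2) unfolding R_def \<tau>_def by (intro mult_nonneg_nonneg) auto
    then have "\<forall>u\<in>R. ldeg E' R u * (real \<tau> - ldeg E' R u) = 0"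
      using df fR sum_nonneg_eq_0_iff[of R "\<lambda>u. ldeg E' R u * (real \<tau> - ldeg E' R u)"] unfolding defect_def R_def \<tau>_def by blast
    then show ?thesis using u by (auto simp: ldeg_def)
  qed
  define B where "B = {u \<in> R. E' `` {u} \<inter> R \<noteq> {}}"
  have cB: "real \<tau> * real (card B) = degsum E' R"
  proof -
    have "degsum E' R = (\<Sum>u\<in>B. ldeg E' R u)" unfolding degsum_def
      by (rule sum.mono_neutral_right) (use fR in \<open>auto simp: B_def ldeg_def\<close>)
    also have "\<dots> = (\<Sum>u\<in>B. real \<tau>)"
    proof (rule sum.cong)
      fix u assume u: "u \<in> B"
      then have "card (E' `` {u} \<inter> R) \<noteq> 0" using fR by (auto simp: B_def)
      then show "ldeg E' R u = real \<tau>" using deg[of u] u by (auto simp: ldeg_def B_def)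
    qed simp
    finally show ?thesis by simp
  qed
  have cR: "real (card R) = real n - real s + 1"
    using h(2,7) cK n(2) st unfolding R_def by (simp add: card_Diff_subset of_nat_diff)
  have cB2: "real (card B) \<le> 2 / 3 * real (card R) + C"
  proof -
    have "real \<tau> * real (card B) \<le> real \<tau> * (2 / 3 * real (card R)) + C"
      using dg(1) cB unfolding R_def \<tau>_def by simp
    also have "\<dots> \<le> real \<tau> * (2 / 3 * real (card R)) + real \<tau> * C"
      using mult_right_mono[OF \<tau> dg(2)] by simp
    also have "\<dots> = real \<tau> * (2 / 3 * real (card R) + C)" by (simp add: distrib_left)
    finally show ?thesis using \<tau> by simp
  qed
  define V where "V = {..<n} - R1"
  define E0 where "E0 = E \<inter> V \<times> V"
  have VK: "K \<subseteq> V" "V - K = R - R1" using h(2) R1(1) by (auto simp: V_def R_def)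
  have E0: "(x, y) \<in> E0 \<longleftrightarrow> (x, y) \<in> E'" if "x \<in> V" "y \<in> V" for x y
    using that R1 by (auto simp: E0_def V_def)
  have E0sub: "E0 \<subseteq> E'" using R1(3) by (auto simp: E0_def V_def)
  have noR1: "(x, y) \<notin> E'" "(y, x) \<notin> E'" if "x \<in> R1" "y \<in> R" for x y using that R1 by (auto simp: R_def)
  have nbr: "E0 `` {u} \<inter> (V - K) = E' `` {u} \<inter> R" if u: "u \<in> V - K" for u
  proof
    show "E0 `` {u} \<inter> (V - K) \<subseteq> E' `` {u} \<inter> R" using E0sub VK by auto
    show "E' `` {u} \<inter> R \<subseteq> E0 `` {u} \<inter> (V - K)"
    proof
      fix y assume y: "y \<in> E' `` {u} \<inter> R"
      then have "y \<notin> R1" using noR1(2)[of y u] u VK by auto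
      then have "y \<in> V - K" using y VK by auto
      then show "y \<in> E0 `` {u} \<inter> (V - K)" using E0[of u y] u y by auto
    qed
  qed
  have hj0: "hub_join V K E0 (t - 1)" unfolding hub_join_def
  proof (intro conjI ballI)
    show "ugraph V E0" unfolding ugraph_def
    proof (intro conjI)
      show "sym E0" using ug(4) E0 E0sub by (auto simp: sym_def E0_def)
      show "irrefl E0" using ug(5) E0sub by (auto simp: irrefl_def)
    qed (auto simp: V_def E0_def)
    show "K \<subseteq> V" by (rule VK)
    show "K \<noteq> {}" by (rule h(3))
    show "K \<times> (V - K) \<subseteq> E0"
    proof (rule subrelI)
      fix x y assume "(x, y) \<in> K \<times> (V - K)"
      then have xy: "x \<in> K" "x \<in> V" "y \<in> V" "y \<in> {..<n} - K" using VK by (auto simp: R_def)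
      then have "(x, y) \<in> E'" using h(4) by blast
      then show "(x, y) \<in> E0" using E0[OF xy(2,3)] by blast
    qed
    fix v assume v: "v \<in> V - K"
    then have "v \<in> R" using VK by auto
    then show "card (E0 `` {v} \<inter> (V - K)) \<le> t - 1" unfolding nbr[OF v] using deg[of v] by (auto simp: \<tau>_def)
  qed
  have free0: "Kst_free s t V E0"
  proof -
    have False if "model V E0 {..<s + t} (bip s t) f" for f
    proof -
      have "model {..<n} E {..<s + t} (bip s t) f" by (rule model_mono[OF that]) (auto simp: V_def E0_def)
      then show False using free unfolding Kst_free_def by blast
    qed
    then show ?thesis unfolding Kst_free_def by blast
  qed
  have cK1: "Suc (card K) = s" using cK st by simp
  \<comment> \<open>At most about two thirds of the outside vertices have positive degree and at
    most \<open>n / 12\<close> were deleted, so linearly many isolated ones remain.\<close>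
  have iso: "card K \<le> card {u \<in> V - K. E0 `` {u} \<inter> (V - K) = {}}" (is "_ \<le> card ?I")
  proof -
    have sub: "R - R1 \<subseteq> ?I \<union> B"
    proof
      fix u assume "u \<in> R - R1"
      then have "u \<in> V - K" "u \<in> R" using VK by auto
      then show "u \<in> ?I \<union> B" using nbr[of u] by (simp add: B_def)
    qed
    have fI: "finite ?I" "finite B" "finite R1" using fR VK R1(1) by (auto simp: B_def intro: finite_subset)
    have "card R - card R1 \<le> card (R - R1)" using fI(3) by (rule diff_card_le_card_Diff)
    also have "\<dots> \<le> card (?I \<union> B)" using fI by (intro card_mono sub) auto
    also have "\<dots> \<le> card ?I + card B" by (rule card_Un_le)
    finally have "real (card R) \<le> real (card ?I) + real (card B) + real (card R1)" by linarith
    moreover have "12 * real (card R1) \<le> real n" using R1(2) by linarith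
    moreover have "8 * real s + 4 * C \<le> real n" "real (card K) = real s - 1" using n(1) cK st by (auto simp: of_nat_diff)
    moreover have "real (card B) \<le> 2 / 3 * real n - 2 / 3 * real s + 2 / 3 + C" using cB2 unfolding cR by (simp add: algebra_simps add_divide_distrib diff_divide_distrib)
    ultimately have "real (card K) \<le> real (card ?I)" using cR of_nat_0_le_iff[of s] by linarith
    then show ?thesis by (simp only: of_nat_le_iff)
  qed
  have deg0: "card (E0 `` {u} \<inter> (V - K)) \<in> {0, t - 1}" if "u \<in> V - K" for u
    unfolding nbr[OF that] using deg[of u] that VK by (simp add: \<tau>_def)
  have tr: "(u, w) \<in> E'" if u: "u \<in> R" "v \<in> R" "w \<in> R" "(u, v) \<in> E'" "(v, w) \<in> E'" "u \<noteq> w" for u v w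
  proof -
    have "u \<notin> R1" "v \<notin> R1" "w \<notin> R1" using noR1 u by blast+
    then have V: "u \<in> V - K" "v \<in> V - K" "w \<in> V - K" using u VK by auto
    have "(u, v) \<in> E0" "(v, w) \<in> E0" using E0 V u by auto
    then have "(u, w) \<in> E0"
      using regular_components_transitive[OF st free0 hj0 cK1 deg0 iso] V u(6) by blast
    then show ?thesis using E0sub by blast
  qed
  show ?thesis unfolding clique_join_def using hj deg tr unfolding R_def \<tau>_def by blast
qed

text \<open>The upper bound is for the hub graph that actually occurs, the lower bound for every
  graph on \<open>s - 1\<close> vertices. Together they force the actual hub graph to be nearly
  optimal for \<open>psi\<close>.\<close>

definition spread_structure :: "real \<Rightarrow> nat \<Rightarrow> nat \<Rightarrow> nat \<Rightarrow> (nat \<times> nat) set \<Rightarrow> real \<Rightarrow> bool" where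
  "spread_structure C s t n E S \<longleftrightarrow>
     sqrt ((real s - 1) * (real n - real s + 1)) \<le> S \<and>
     (\<exists>K L \<kappa>. K \<subseteq> {..<n} \<and> card K = s - 1 \<and> clique_join {..<n} K E t \<and> hub_graph K E L \<kappa> \<and>
        \<bar>degsum E ({..<n} - K) - (2 * real (t - 1) - hb1 E K) / 3 * (real n - real s + 1)\<bar> \<le> C \<and>
        S\<^sup>2 \<le> 4 * ((real s - 1) * (real n - real s + 1)) + 4 / 3 * ((real t - 1)\<^sup>2 + psi s t L / (real s - 1))
          + C / (real n - real s + 1)) \<and>
     (\<forall>L\<in>graphs_on (s - 1). 4 * ((real s - 1) * (real n - real s + 1)) + 4 / 3 * ((real t - 1)\<^sup>2 + psi s t L / (real s - 1))
          - C / (real n - real s + 1) \<le> S\<^sup>2)"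

text \<open>The rewired graph produced by \<open>hub_join_dominates\<close> need not be minor-free a priori. Comparing it with a
  clique join shows that it is itself a clique join, hence minor-free, hence equal to the given graph.\<close>

theorem max_spread_structure:
  fixes s t :: nat
  assumes st: "2 \<le> s" "s \<le> t"
  shows "\<exists>C N. 0 \<le> C \<and> (\<forall>n\<ge>N. \<forall>E p q. max_spread_arcs s t n E p q \<longrightarrow> spread_structure C s t n E (p - q))"
proof -
  define k where "k = s - 1"
  define \<tau> where "\<tau> = t - 1"
  have k: "k \<ge> 1" "real k = real s - 1" using st by (auto simp: k_def)
  have t1: "1 \<le> t" using st by simp
  obtain C N1 where C: "0 \<le> C" and A: "\<forall>V K E p q. card K = k \<longrightarrow> N1 \<le> card (V - K) \<longrightarrow> hub_join V K E \<tau> \<longrightarrow> extremal_eig V E p q \<longrightarrow>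
     0 < p - q \<and> sqrt (real k * card (V - K)) \<le> p - q \<and>
     (p - q)\<^sup>2 \<le> 4 * (real k * card (V - K)) + 4 / 3 * psival \<tau> (hb1 E K) (hb2 E K) + C / card (V - K) \<and>
     (near_opt V K E \<tau> \<longrightarrow> 4 * (real k * card (V - K)) + 4 / 3 * psival \<tau> (hb1 E K) (hb2 E K) - C / card (V - K) \<le> (p - q)\<^sup>2) \<and>
     (\<forall>E' p' q'. hub_join V K E' \<tau> \<longrightarrow> extremal_eig V E' p' q' \<longrightarrow> E \<inter> K \<times> K = E' \<inter> K \<times> K \<longrightarrow> near_opt V K E' \<tau> \<longrightarrow>
        p' - q' \<le> p - q \<longrightarrow> defect E (V - K) \<tau> = 0 \<and> \<bar>degsum E (V - K) - (2 * real \<tau> - hb1 E K) / 3 * card (V - K)\<bar> \<le> C)"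
    using hub_join_asymptotics[OF k(1), of \<tau>] by (elim exE conjE) (rule that; assumption)
  obtain \<epsilon> :: real and N2 where ep: "0 < \<epsilon>" and Dm: "\<forall>n\<ge>N2. \<forall>E K p q. ugraph {..<n} E \<longrightarrow> Kst_free s t {..<n} E \<longrightarrow>
    K \<subseteq> {..<n} \<longrightarrow> card K = s - 1 \<longrightarrow> (\<forall>h\<in>K. (1 - \<epsilon>) * n \<le> card (E `` {h})) \<longrightarrow>
    extremal_eig {..<n} E p q \<longrightarrow> sqrt ((real s - 1) * n) \<le> 2 * p \<longrightarrow> sqrt ((real s - 1) * n) \<le> - 2 * q \<longrightarrow>
    (\<exists>E' p' q'. ugraph {..<n} E' \<and> K \<times> ({..<n} - K) \<subseteq> E' \<and>
       (\<forall>v\<in>{..<n} - K. card (E' `` {v} \<inter> ({..<n} - K)) \<le> t - 1) \<and> extremal_eig {..<n} E' p' q' \<and>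
       (\<exists>R1\<subseteq>{..<n} - K. 12 * card R1 \<le> n \<and>
         E' = E \<inter> ({..<n} - R1) \<times> ({..<n} - R1) \<union> K \<times> R1 \<union> R1 \<times> K) \<and>
       (E' = E \<and> p' = p \<and> q' = q \<or> p - q < p' - q'))"
    using hub_join_dominates[OF st(1) t1] by (elim exE conjE) (rule that; assumption)
  obtain N3 where Hb: "\<forall>n\<ge>N3. \<forall>E p q. max_spread_arcs s t n E p q \<longrightarrow>
    sqrt ((real s - 1) * n) \<le> 2 * p \<and> sqrt ((real s - 1) * n) \<le> - 2 * q \<and>
    (\<exists>K\<subseteq>{..<n}. card K = s - 1 \<and> (\<forall>h\<in>K. (1 - \<epsilon>) * n \<le> card (E `` {h})))"
    using max_spread_hubs[OF st ep] by (elim exE) (rule that)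
  define N where "N = N1 + N2 + N3 + s + nat \<lceil>4 * (2 * real s + C)\<rceil>"
  have main: "spread_structure C s t n E (p - q)" if n: "N \<le> n" and mx: "max_spread_arcs s t n E p q" for n E p q
  proof -
    have n1: "N1 + s \<le> n" "N2 \<le> n" "N3 \<le> n" "s \<le> n" "n > 0" using n st by (auto simp: N_def)
    have "4 * (2 * real s + C) \<le> real N" unfolding N_def of_nat_add using real_nat_ceiling_ge[of "4 * (2 * real s + C)"] by linarith
    then have n2: "4 * (2 * real s + C) \<le> n" using n by (meson of_nat_le_iff order_trans)
    have ug: "ugraph {..<n} E" and free: "Kst_free s t {..<n} E" and ex: "extremal_eig {..<n} E p q"
      and opt: "\<And>E' p' q'. ugraph {..<n} E' \<Longrightarrow> Kst_free s t {..<n} E' \<Longrightarrow> extremal_eig {..<n} E' p' q' \<Longrightarrow> p' - q' \<le> p - q"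
      using mx unfolding max_spread_arcs_def by blast+
    note Hb' = Hb[rule_format, OF n1(3) mx]
    obtain K where K: "K \<subseteq> {..<n}" "card K = s - 1" and hd: "\<forall>h\<in>K. (1 - \<epsilon>) * n \<le> card (E `` {h})"
      using Hb' by (elim exE conjE) (rule that; assumption)
    have fK: "finite K" "K \<noteq> {}" "card K = k" "Suc (card K) = s" using K st finite_subset by (auto simp: k_def)
    have cR: "card ({..<n} - K) = n - (s - 1)" using K fK by (simp add: card_Diff_subset)
    have m: "real (card ({..<n} - K)) = real n - real s + 1" unfolding cR using n1(4) st by (simp add: of_nat_diff)
    have N1R: "N1 \<le> card ({..<n} - K)" unfolding cR using n1(1) by simp
    obtain E' p' q' R1 where E': "ugraph {..<n} E'" "K \<times> ({..<n} - K) \<subseteq> E'"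
        "\<forall>v\<in>{..<n} - K. card (E' `` {v} \<inter> ({..<n} - K)) \<le> t - 1" "extremal_eig {..<n} E' p' q'"
      and R1: "R1 \<subseteq> {..<n} - K" "12 * card R1 \<le> n"
         "E' = E \<inter> ({..<n} - R1) \<times> ({..<n} - R1) \<union> K \<times> R1 \<union> R1 \<times> K"
      and or: "E' = E \<and> p' = p \<and> q' = q \<or> p - q < p' - q'"
      using Dm[THEN spec, THEN mp, OF n1(2), THEN spec, THEN spec, THEN spec, THEN spec, THEN mp, OF ug, THEN mp, OF free,
          THEN mp, OF K(1), THEN mp, OF K(2), THEN mp, OF hd, THEN mp, OF ex, THEN mp, OF Hb'[THEN conjunct1],
          THEN mp, OF Hb'[THEN conjunct2, THEN conjunct1]]
      by (elim exE conjE) (rule that; assumption)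
    have hj: "hub_join {..<n} K E' \<tau>" unfolding hub_join_def \<tau>_def using E' K fK by blast
    \<comment> \<open>A competitor with a prescribed hub graph on the same hubs. It is used with the
      hub graph of \<open>E'\<close> for rigidity, and with an arbitrary one for the lower
      bound.\<close>
    have cmp_ex: "\<exists>Ec pc qc. clique_join {..<n} K Ec t \<and> Ec \<inter> K \<times> K = F \<and> near_opt {..<n} K Ec \<tau> \<and>
        extremal_eig {..<n} Ec pc qc \<and> hub_join {..<n} K Ec \<tau> \<and> pc - qc \<le> p - q"
      if F: "F \<subseteq> K \<times> K" "sym F" "irrefl F" for F
    proof -
      obtain Ec where Ec: "clique_join {..<n} K Ec t" "Ec \<inter> K \<times> K = F" "near_opt {..<n} K Ec \<tau>"
        using near_opt_clique_join_exists[OF st K F, folded \<tau>_def] by (elim exE conjE) (rule that; assumption)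
      have hjc: "hub_join {..<n} K Ec \<tau>" using Ec(1) unfolding clique_join_def \<tau>_def by (rule conjunct1)
      note ugc = hub_joinD(1)[OF hjc]
      obtain pc qc where exc: "extremal_eig {..<n} Ec pc qc"
        using extremal_eig_exists[OF ugc] n1(5) by (auto simp: lessThan_empty_iff)
      have "Kst_free s t {..<n} Ec" by (rule clique_join_Kst_free[OF Ec(1) st fK(4)])
      then have "pc - qc \<le> p - q" by (rule opt[OF ugc _ exc])
      then show ?thesis using Ec exc hjc by blast
    qed
    note AE' = A[rule_format, OF fK(3) N1R hj E'(4)]
    have le0: "p - q \<le> p' - q'" using or by (elim disjE conjE) simp_all
    have symE': "sym E'" "irrefl E'" using E'(1) by (auto simp: ugraph_def)
    have F: "E' \<inter> K \<times> K \<subseteq> K \<times> K" "sym (E' \<inter> K \<times> K)" "irrefl (E' \<inter> K \<times> K)"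
      using symE' by (auto simp: sym_def irrefl_def)
    obtain Ec pc qc where Ec: "Ec \<inter> K \<times> K = E' \<inter> K \<times> K" "near_opt {..<n} K Ec \<tau>"
        "extremal_eig {..<n} Ec pc qc" "hub_join {..<n} K Ec \<tau>" "pc - qc \<le> p - q"
      using cmp_ex[OF F] by (elim exE conjE) (rule that; assumption)
    have "pc - qc \<le> p' - q'" using Ec(5) le0 by linarith
    then have "defect E' ({..<n} - K) \<tau> = 0 \<and>
        \<bar>degsum E' ({..<n} - K) - (2 * real \<tau> - hb1 E' K) / 3 * card ({..<n} - K)\<bar> \<le> C"
      using AE'[THEN conjunct2, THEN conjunct2, THEN conjunct2, THEN conjunct2, rule_format, OF Ec(4,3) Ec(1)[symmetric] Ec(2)] by blast
    then have df: "defect E' ({..<n} - K) (t - 1) = 0"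
      and dg: "\<bar>degsum E' ({..<n} - K) - (2 * real \<tau> - hb1 E' K) / 3 * card ({..<n} - K)\<bar> \<le> C"
      by (simp_all add: \<tau>_def)
    have dg2: "degsum E' ({..<n} - K) \<le> 2 / 3 * real (t - 1) * real (card ({..<n} - K)) + C"
    proof -
      have "0 \<le> hb1 E' K" unfolding hb1_def by (intro divide_nonneg_nonneg sum_nonneg ldeg_le_card(2)) auto
      then have "(2 * real \<tau> - hb1 E' K) / 3 * card ({..<n} - K) \<le> 2 / 3 * real \<tau> * card ({..<n} - K)"
        by (intro mult_right_mono) auto
      then show ?thesis using dg unfolding \<tau>_def by linarith
    qed
    have cj: "clique_join {..<n} K E' t"
      by (rule clique_join_of_regular[OF st free hj[unfolded \<tau>_def] K(2) R1 df dg2 C n2 n1(4)])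
    have "Kst_free s t {..<n} E'" by (rule clique_join_Kst_free[OF cj st fK(4)])
    then have "p' - q' \<le> p - q" by (rule opt[OF E'(1) _ E'(4)])
    then have eq: "E' = E" "p' = p" "q' = q" using or by auto
    obtain L \<kappa> where hg: "hub_graph K E L \<kappa>"
      using hub_graph_of_hubs[OF fK(1) symE'] unfolding eq by (elim exE) (rule that)
    note q2 = hub_graph_quantities(2)[OF _ fK(1) K(2) st(1) t1, folded \<tau>_def]
    note AE = AE'[unfolded eq, unfolded m k(2)]
    have up: "(p - q)\<^sup>2 \<le> 4 * ((real s - 1) * (real n - real s + 1)) + 4 / 3 * ((real t - 1)\<^sup>2 + psi s t L / (real s - 1))
          + C / (real n - real s + 1)"
      using AE[THEN conjunct2, THEN conjunct2, THEN conjunct1] unfolding q2[OF hg] .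
    have low: "4 * ((real s - 1) * (real n - real s + 1)) + 4 / 3 * ((real t - 1)\<^sup>2 + psi s t L / (real s - 1))
          - C / (real n - real s + 1) \<le> (p - q)\<^sup>2" if L: "L \<in> graphs_on (s - 1)" for L
    proof -
      have "L \<in> graphs_on (card K)" using L K(2) by simp
      from hubs_of_graph[OF this fK(1)] obtain F \<kappa> where F: "F \<subseteq> K \<times> K" "sym F" "irrefl F" and hF: "hub_graph K F L \<kappa>"
        by (elim exE conjE) (rule that; assumption)
      obtain Ec pc qc where Ec: "Ec \<inter> K \<times> K = F" "near_opt {..<n} K Ec \<tau>"
        "extremal_eig {..<n} Ec pc qc" "hub_join {..<n} K Ec \<tau>" "pc - qc \<le> p - q"
        using cmp_ex[OF F] by (elim exE conjE) (rule that; assumption)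
      have "(x, y) \<in> Ec \<longleftrightarrow> (x, y) \<in> F" if "x \<in> K" "y \<in> K" for x y using Ec(1) that by auto
      then have hg: "hub_graph K Ec L \<kappa>" using hF by (simp add: hub_graph_def)
      note Ac = A[rule_format, OF fK(3) N1R Ec(4,3), unfolded m k(2)]
      have "4 * ((real s - 1) * (real n - real s + 1)) + 4 / 3 * ((real t - 1)\<^sup>2 + psi s t L / (real s - 1))
          - C / (real n - real s + 1) \<le> (pc - qc)\<^sup>2"
        using Ac[THEN conjunct2, THEN conjunct2, THEN conjunct2, THEN conjunct1, THEN mp, OF Ec(2)] unfolding q2[OF hg] .
      also have "\<dots> \<le> (p - q)\<^sup>2" using Ac[THEN conjunct1] Ec(5) by (intro power_mono) auto
      finally show ?thesis .
    qed
    have "sqrt ((real s - 1) * (real n - real s + 1)) \<le> p - q" by (rule AE[THEN conjunct2, THEN conjunct1])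
    moreover have "\<bar>degsum E ({..<n} - K) - (2 * real (t - 1) - hb1 E K) / 3 * (real n - real s + 1)\<bar> \<le> C"
      using dg unfolding eq m \<tau>_def .
    ultimately show ?thesis unfolding spread_structure_def using K cj[unfolded eq] hg up low by blast
  qed
  show ?thesis by (intro exI[of _ C] exI[of _ N] conjI C allI impI) (rule main)
qed

section \<open>Optimality of the hub graph and the final expansion\<close>

lemma finite_graphs_on: "finite (graphs_on n)"
proof -
  have "graphs_on n \<subseteq> (\<lambda>E. \<lparr>pverts = {..<n}, parcs = E\<rparr>) ` Pow ({..<n} \<times> {..<n})"
  proof
    fix G assume G: "G \<in> graphs_on n"
    then have "pair_graph G" "pverts G = {..<n}" by (auto simp: graphs_on_def)
    then have "parcs G \<subseteq> {..<n} \<times> {..<n}" using pair_graph_iff_ugraph[of G] ugraphD(3) by auto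
    moreover have "G = \<lparr>pverts = {..<n}, parcs = parcs G\<rparr>" using \<open>pverts G = {..<n}\<close> by (cases G) auto
    ultimately show "G \<in> (\<lambda>E. \<lparr>pverts = {..<n}, parcs = E\<rparr>) ` Pow ({..<n} \<times> {..<n})" by blast
  qed
  then show ?thesis by (rule finite_subset) simp
qed

lemma maximizes_psi_iff:
  "maximizes_psi s t L \<longleftrightarrow> L \<in> graphs_on (s - 1) \<and> (\<forall>L'\<in>graphs_on (s - 1). psi s t L' \<le> psi s t L)"
  by (auto simp: maximizes_psi_def is_arg_max_def not_less)

lemma psi_gap:
  "\<exists>\<delta>>0. \<forall>L\<in>graphs_on (s - 1). (\<exists>L'\<in>graphs_on (s - 1). psi s t L < psi s t L') \<longrightarrow>
     (\<exists>L'\<in>graphs_on (s - 1). psi s t L + \<delta> \<le> psi s t L')"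
proof -
  \<comment> \<open>The element \<open>1\<close> keeps the set nonempty when \<open>psi\<close>
    takes a single value.\<close>
  define D where "D = insert 1 {psi s t L' - psi s t L |L L'. L \<in> graphs_on (s - 1) \<and> L' \<in> graphs_on (s - 1) \<and> psi s t L < psi s t L'}"
  have "D \<subseteq> insert 1 ((\<lambda>(L, L'). psi s t L' - psi s t L) ` (graphs_on (s - 1) \<times> graphs_on (s - 1)))"
    by (auto simp: D_def)
  then have fD: "finite D" by (rule finite_subset) (simp add: finite_graphs_on)
  have "D \<noteq> {}" "\<And>d. d \<in> D \<Longrightarrow> d > 0" by (auto simp: D_def)
  then have "Min D > 0" using fD by simp
  moreover have "\<exists>L'\<in>graphs_on (s - 1). psi s t L + Min D \<le> psi s t L'"
    if h: "L \<in> graphs_on (s - 1)" "L' \<in> graphs_on (s - 1)" "psi s t L < psi s t L'" for L L'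
  proof -
    have "psi s t L' - psi s t L \<in> D" using h by (auto simp: D_def)
    then have "Min D \<le> psi s t L' - psi s t L" using fD by simp
    then show ?thesis using h by (intro bexI[of _ L']) auto
  qed
  ultimately show ?thesis by blast
qed

text \<open>There are finitely many labelled graphs on \<open>n\<close> vertices, and a clique join
  shows that the family is not empty.\<close>

lemma maximizes_spread_exists:
  assumes st: "2 \<le> s" "s \<le> t" and n: "s \<le> n"
  shows "\<exists>G. maximizes_spread s t n G \<and> spread G = Max (spread ` Kst_minor_free_graphs s t n)"
proof -
  let ?F = "Kst_minor_free_graphs s t n"
  have fin: "finite ?F" by (rule finite_subset[OF _ finite_graphs_on[of n]]) (auto simp: Kst_minor_free_graphs_def)
  have K: "{..<s - 1} \<subseteq> {..<n}" "card {..<s - 1} = s - 1" using n by auto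
  obtain E where E: "clique_join {..<n} {..<s - 1} E t"
    using near_opt_clique_join_exists[OF st K, of "{}"] by (auto simp: sym_def irrefl_def)
  have "Kst_free s t {..<n} E" by (rule clique_join_Kst_free[OF E st]) (use st in simp)
  moreover have "ugraph {..<n} E" using E hub_joinD(1) unfolding clique_join_def by blast
  ultimately have "\<lparr>pverts = {..<n}, parcs = E\<rparr> \<in> ?F" by (simp add: Kst_minor_free_graphs_iff)
  then have "Max (spread ` ?F) \<in> spread ` ?F" using fin by (intro Max_in) auto
  then obtain G where G: "G \<in> ?F" "spread G = Max (spread ` ?F)" by auto
  then have "maximizes_spread s t n G" using fin by (auto simp: maximizes_spread_def is_arg_max_def not_less)
  then show ?thesis using G by blast
qed

text \<open>With \<open>b = P / (3 * a)\<close> the square of \<open>2 * a + b\<close> is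
  \<open>4 * a\<^sup>2 + 4 / 3 * P + b\<^sup>2\<close>, and \<open>b\<^sup>2\<close> is of the order
  of the permitted error. Dividing the difference of squares by the sum, which is at least
  \<open>a\<close>, gains the factor \<open>sqrt m\<close>.\<close>

lemma spread_expansion:
  fixes S a P C m :: real
  assumes a: "a > 0" "a \<le> S" and m: "m > 0" "m \<le> a\<^sup>2" "\<bar>P\<bar> \<le> m" and S: "\<bar>S\<^sup>2 - 4 * a\<^sup>2 - 4 / 3 * P\<bar> \<le> C / m"
  shows "\<bar>S - (2 * a + P / (3 * a))\<bar> \<le> (C + P\<^sup>2) / (m * sqrt m)"
proof -
  define b where "b = P / (3 * a)"
  have ab: "a * b = P / 3" using a by (simp add: b_def)
  have "\<bar>P\<bar> \<le> a * a" using m by (simp add: power2_eq_square)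
  then have "\<bar>b\<bar> \<le> a" using a by (simp add: b_def abs_mult divide_le_eq)
  then have sum: "a \<le> S + (2 * a + b)" using a by linarith
  have b2: "b\<^sup>2 \<le> P\<^sup>2 / m"
  proof -
    have "b\<^sup>2 = P\<^sup>2 / (9 * a\<^sup>2)" by (simp add: b_def power_divide power_mult_distrib)
    also have "\<dots> \<le> P\<^sup>2 / m" using m by (intro divide_left_mono mult_pos_pos) auto
    finally show ?thesis .
  qed
  have id: "(S - (2 * a + b)) * (S + (2 * a + b)) = (S\<^sup>2 - 4 * a\<^sup>2 - 4 / 3 * P) - b\<^sup>2"
    using ab by (simp add: power2_eq_square algebra_simps)
  have "\<bar>S - (2 * a + b)\<bar> * a \<le> \<bar>S - (2 * a + b)\<bar> * \<bar>S + (2 * a + b)\<bar>"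
    using sum a by (intro mult_left_mono) auto
  also have "\<dots> = \<bar>(S\<^sup>2 - 4 * a\<^sup>2 - 4 / 3 * P) - b\<^sup>2\<bar>" unfolding id[symmetric] abs_mult ..
  also have "\<dots> \<le> C / m + P\<^sup>2 / m" using S b2 zero_le_power2[of b] by linarith
  finally have "\<bar>S - (2 * a + b)\<bar> * a \<le> (C + P\<^sup>2) / m" by (simp add: add_divide_distrib)
  moreover have "sqrt m \<le> a" using m a by (intro real_le_lsqrt) auto
  then have "\<bar>S - (2 * a + b)\<bar> * sqrt m \<le> \<bar>S - (2 * a + b)\<bar> * a" by (intro mult_left_mono) auto
  ultimately have "\<bar>S - (2 * a + b)\<bar> * sqrt m \<le> (C + P\<^sup>2) / m" by linarith
  then show ?thesis using m(1) by (simp add: b_def field_simps)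
qed

theorem theorem1:
  fixes s t :: nat
  assumes "2 \<le> s" and "s \<le> t"
  shows
    "(\<exists>(N :: nat) (C :: real \<Rightarrow> real). \<forall>n\<ge>N. \<forall>G. maximizes_spread s t n G \<longrightarrow>
        (\<exists>(L :: nat pair_pre_digraph) (l :: nat).
           maximizes_psi s t L
           \<and> s - 1 + t * l \<le> n
           \<and> digraph_iso (with_proj G)
               (with_proj (graph_join L
                  (disjoint_union (copies l (complete_graph t))
                     (copies (n - (s - 1) - t * l) (complete_graph 1)))))
           \<and> (\<forall>\<epsilon>>0.
                \<bar>real l - (2 / (3 * real t)
                    - 2 * real (card (edge_set L)) / (3 * real t * (real t - 1) * (real s - 1)))
                  * (real n - real s + 1)\<bar> \<le> C \<epsilon> * real n powr \<epsilon>)))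
     \<and> (\<forall>L. maximizes_psi s t L \<longrightarrow>
         (\<lambda>n. Max (spread ` Kst_minor_free_graphs s t n)
            - (2 * sqrt ((real s - 1) * (real n - real s + 1))
               + ((real t - 1)\<^sup>2 + psi s t L / (real s - 1))
                   / (3 * sqrt ((real s - 1) * (real n - real s + 1)))))
         \<in> O(\<lambda>n. 1 / real n powr (3 / 2)))"
proof -
  note st = assms
  define k where "k = real s - 1"
  have k: "k \<ge> 1" using st by (simp add: k_def)
  obtain C N0 where C: "0 \<le> C"
    and str: "\<forall>n\<ge>N0. \<forall>E p q. max_spread_arcs s t n E p q \<longrightarrow> spread_structure C s t n E (p - q)"
    using max_spread_structure[OF st] by (elim exE conjE) (rule that; assumption)
  obtain \<delta> where \<delta>: "\<delta> > 0" and gap: "\<forall>L\<in>graphs_on (s - 1). (\<exists>L'\<in>graphs_on (s - 1). psi s t L < psi s t L') \<longrightarrow>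
     (\<exists>L'\<in>graphs_on (s - 1). psi s t L + \<delta> \<le> psi s t L')"
    using psi_gap[of s t] by (elim exE conjE) (rule that; assumption)
  \<comment> \<open>From here on the error \<open>2 * C / m\<close> is too small to hide the gap
    \<open>\<delta>\<close> in \<open>psi\<close>; the two copies of \<open>s\<close> give
    \<open>2 * s \<le> n\<close>.\<close>
  define N where "N = N0 + s + s + 1 + nat \<lceil>4 * k * C / \<delta>\<rceil>"
  have Nn: "N0 \<le> n" "s \<le> n" "n > 0" "2 * s \<le> n" if "N \<le> n" for n using that by (auto simp: N_def)
  have first: "\<exists>(L :: nat pair_pre_digraph) (l :: nat).
           maximizes_psi s t L
           \<and> s - 1 + t * l \<le> n
           \<and> digraph_iso (with_proj G)
               (with_proj (graph_join L
                  (disjoint_union (copies l (complete_graph t))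
                     (copies (n - (s - 1) - t * l) (complete_graph 1)))))
           \<and> (\<forall>\<epsilon>>0.
                \<bar>real l - (2 / (3 * real t)
                    - 2 * real (card (edge_set L)) / (3 * real t * (real t - 1) * (real s - 1)))
                  * (real n - real s + 1)\<bar> \<le> C * real n powr \<epsilon>)"
    if n: "N \<le> n" and G: "maximizes_spread s t n G" for n G
  proof -
    note Nn = Nn[OF n]
    define m where "m = real n - real s + 1"
    obtain p q where mx: "max_spread_arcs s t n (parcs G) p q" and pv: "pverts G = {..<n}"
      using maximizes_spread_arcs[OF G Nn(3)] by blast
    note S = str[rule_format, OF Nn(1) mx, unfolded spread_structure_def]
    obtain K L \<kappa> where K: "K \<subseteq> {..<n}" "card K = s - 1" "clique_join {..<n} K (parcs G) t" "hub_graph K (parcs G) L \<kappa>"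
      and dg: "\<bar>degsum (parcs G) ({..<n} - K) - (2 * real (t - 1) - hb1 (parcs G) K) / 3 * m\<bar> \<le> C"
      and up: "(p - q)\<^sup>2 \<le> 4 * (k * m) + 4 / 3 * ((real t - 1)\<^sup>2 + psi s t L / k) + C / m"
      using S[THEN conjunct2, THEN conjunct1, folded k_def m_def] by (elim exE conjE) (rule that; assumption)
    have low: "4 * (k * m) + 4 / 3 * ((real t - 1)\<^sup>2 + psi s t L' / k) - C / m \<le> (p - q)\<^sup>2" if "L' \<in> graphs_on (s - 1)" for L'
      using S[THEN conjunct2, THEN conjunct2, rule_format, OF that] unfolding k_def m_def .
    have m: "m > 0" "4 * k * C / \<delta> < m"
    proof -
      have "real N0 + real s + real s + 1 + 4 * k * C / \<delta> \<le> real N"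
        unfolding N_def of_nat_add using real_nat_ceiling_ge[of "4 * k * C / \<delta>"] by simp
      moreover have "real N \<le> real n" using n by simp
      moreover have "4 * k * C / \<delta> \<ge> 0" using k C \<delta> by simp
      ultimately show "m > 0" "4 * k * C / \<delta> < m" unfolding m_def by linarith+
    qed
    have fK: "finite K" using K(1) finite_subset by blast
    have L: "L \<in> graphs_on (s - 1)" using K by (simp add: hub_graph_def)
    \<comment> \<open>A hub graph with larger \<open>psi\<close> would give a lower bound for the
      squared spread that exceeds the upper bound coming from \<open>L\<close>.\<close>
    have psi_max: "maximizes_psi s t L"
    proof (rule ccontr)
      assume "\<not> maximizes_psi s t L"
      then have "\<exists>L'\<in>graphs_on (s - 1). psi s t L < psi s t L'" using L by (auto simp: maximizes_psi_iff not_le)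
      then obtain L' where L': "L' \<in> graphs_on (s - 1)" "psi s t L + \<delta> \<le> psi s t L'" using gap L by blast
      have "4 / 3 * (psi s t L' / k) - 4 / 3 * (psi s t L / k) \<le> 2 * (C / m)" using low[OF L'(1)] up by (simp add: distrib_left)
      moreover have "(psi s t L + \<delta>) / k \<le> psi s t L' / k" using L'(2) k by (intro divide_right_mono) auto
      ultimately have "4 / 3 * (\<delta> / k) \<le> 2 * (C / m)" by (simp add: add_divide_distrib)
      then have "4 / 3 * \<delta> * m \<le> 2 * C * k" using k m by (simp add: field_simps)
      moreover have "4 * k * C < \<delta> * m" using m(2) \<delta> by (simp add: divide_less_eq mult.commute)
      moreover have "C * k \<ge> 0" using C k by simp
      moreover have "\<delta> * m > 0" using \<delta> m by simp
      ultimately show False by (simp add: mult.assoc mult.commute mult.left_commute)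
    qed
    have t2: "t \<ge> 2" using st by simp
    obtain l where l: "s - 1 + t * l \<le> n" "degsum (parcs G) ({..<n} - K) = real (t * l * (t - 1))"
      and iso: "digraph_iso (with_proj G)
               (with_proj (graph_join L
                  (disjoint_union (copies l (complete_graph t))
                     (copies (n - (s - 1) - t * l) (complete_graph 1)))))"
      using clique_join_iso[OF K(3) t2 K(4) pv refl] unfolding K(2) by (elim exE conjE) (rule that; assumption)
    define e where "e = real (card (edge_set L))"
    define T where "T = real t * (real t - 1)"
    have t3: "real t - 1 \<ge> 1" using t2 by simp
    have T: "T \<ge> 1" unfolding T_def using mult_mono[of 1 "real t" 1 "real t - 1"] t3 by simp
    have b1: "hb1 (parcs G) K = 2 * e / k"
      using hub_graph_quantities(1)[OF K(4) fK K(2) st(1), of t] t2 by (simp add: e_def k_def)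
    have "\<bar>real l - (2 / (3 * real t) - 2 * e / (3 * real t * (real t - 1) * k)) * m\<bar> \<le> C"
    proof -
      have tt: "real (t - 1) = real t - 1" using t2 by (simp add: of_nat_diff)
      have nz: "real t - 1 \<noteq> 0" "real t \<noteq> 0" "k \<noteq> 0" using t3 k by linarith+
      have eq1: "(2 * (real t - 1) - 2 * e / k) / 3 * m = T * ((2 / (3 * real t) - 2 * e / (3 * real t * (real t - 1) * k)) * m)"
        unfolding T_def using nz by (simp add: field_simps)
      have eq2: "degsum (parcs G) ({..<n} - K) = T * real l" unfolding l(2) T_def tt[symmetric] by simp
      have "\<bar>T * real l - T * ((2 / (3 * real t) - 2 * e / (3 * real t * (real t - 1) * k)) * m)\<bar> \<le> C"
        using dg unfolding b1 tt eq1 eq2 .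
      then have "T * \<bar>real l - (2 / (3 * real t) - 2 * e / (3 * real t * (real t - 1) * k)) * m\<bar> \<le> C"
        using T unfolding right_diff_distrib[symmetric] abs_mult by simp
      moreover have "1 * \<bar>real l - (2 / (3 * real t) - 2 * e / (3 * real t * (real t - 1) * k)) * m\<bar> \<le>
          T * \<bar>real l - (2 / (3 * real t) - 2 * e / (3 * real t * (real t - 1) * k)) * m\<bar>"
        using T by (intro mult_right_mono) auto
      ultimately show ?thesis unfolding mult_1_left by (rule order_trans[rotated])
    qed
    \<comment> \<open>The error in the number of cliques is bounded, so the same constant works for
      all exponents.\<close>
    moreover have "C \<le> C * real n powr \<epsilon>" if "\<epsilon> > 0" for \<epsilon>
      using mult_left_mono[OF ge_one_powr_ge_zero[of "real n" \<epsilon>] C] Nn(3) that by simp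
    ultimately have "\<forall>\<epsilon>>0. \<bar>real l - (2 / (3 * real t) - 2 * e / (3 * real t * (real t - 1) * k)) * m\<bar> \<le> C * real n powr \<epsilon>"
      by (meson order_trans)
    then show ?thesis using psi_max l(1) iso unfolding e_def k_def m_def by blast
  qed
  have second: "(\<lambda>n. Max (spread ` Kst_minor_free_graphs s t n)
            - (2 * sqrt ((real s - 1) * (real n - real s + 1))
               + ((real t - 1)\<^sup>2 + psi s t L / (real s - 1))
                   / (3 * sqrt ((real s - 1) * (real n - real s + 1)))))
         \<in> O(\<lambda>n. 1 / real n powr (3 / 2))" if L: "maximizes_psi s t L" for L
  proof -
    define P where "P = (real t - 1)\<^sup>2 + psi s t L / k"
    define B where "B = C + P\<^sup>2"
    have B: "B \<ge> 0" using C by (simp add: B_def)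
    have "norm (Max (spread ` Kst_minor_free_graphs s t n)
            - (2 * sqrt (k * (real n - real s + 1)) + P / (3 * sqrt (k * (real n - real s + 1)))))
        \<le> (8 * B) * norm (1 / real n powr (3 / 2))" if n: "N + nat \<lceil>2 * \<bar>P\<bar>\<rceil> \<le> n" for n
    proof -
      have Nl: "N \<le> n" using n by simp
      note Nn = Nn[OF Nl]
      define m where "m = real n - real s + 1"
      have mn: "real n / 2 \<le> m" using Nn(4) by (simp add: m_def)
      then have m: "m > 0" using Nn(3) by linarith
      have "2 * \<bar>P\<bar> \<le> real n"
      proof -
        have "2 * \<bar>P\<bar> \<le> real (nat \<lceil>2 * \<bar>P\<bar>\<rceil>)" by (rule real_nat_ceiling_ge)
        also have "\<dots> \<le> real n" using n by simp
        finally show ?thesis .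
      qed
      then have Pm: "\<bar>P\<bar> \<le> m" using mn by linarith
      obtain G where G: "maximizes_spread s t n G" "spread G = Max (spread ` Kst_minor_free_graphs s t n)"
        using maximizes_spread_exists[OF st Nn(2)] by blast
      obtain p q where mx: "max_spread_arcs s t n (parcs G) p q" and sp: "spread G = p - q"
        using maximizes_spread_arcs[OF G(1) Nn(3)] by blast
      note S = str[rule_format, OF Nn(1) mx, unfolded spread_structure_def, folded k_def, folded m_def]
      obtain K L' \<kappa> where K: "card K = s - 1" "hub_graph K (parcs G) L' \<kappa>"
        and up: "(p - q)\<^sup>2 \<le> 4 * (k * m) + 4 / 3 * ((real t - 1)\<^sup>2 + psi s t L' / k) + C / m"
        using S[THEN conjunct2, THEN conjunct1] by (elim exE conjE) (rule that; assumption)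
      have "L' \<in> graphs_on (s - 1)" using K by (simp add: hub_graph_def)
      then have "psi s t L' \<le> psi s t L" using L by (simp add: maximizes_psi_iff)
      then have "psi s t L' / k \<le> psi s t L / k" using k by (intro divide_right_mono) auto
      then have "4 / 3 * ((real t - 1)\<^sup>2 + psi s t L' / k) \<le> 4 / 3 * P" unfolding P_def by (intro mult_left_mono add_left_mono) auto
      then have up': "(p - q)\<^sup>2 \<le> 4 * (k * m) + 4 / 3 * P + C / m" using up by linarith
      have "L \<in> graphs_on (s - 1)" using L by (simp add: maximizes_psi_iff)
      then have low: "4 * (k * m) + 4 / 3 * P - C / m \<le> (p - q)\<^sup>2"
        using S[THEN conjunct2, THEN conjunct2] unfolding P_def by blast
      define a where "a = sqrt (k * m)"
      have a2: "a\<^sup>2 = k * m" using k m by (simp add: a_def)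
      have ap: "a > 0" using k m by (simp add: a_def)
      have aS: "a \<le> p - q" using S[THEN conjunct1] unfolding a_def .
      have ma: "m \<le> a\<^sup>2" unfolding a2 using mult_right_mono[OF k, of m] m by simp
      have "\<bar>(p - q)\<^sup>2 - 4 * a\<^sup>2 - 4 / 3 * P\<bar> \<le> C / m" unfolding a2 using up' low by linarith
      then have "\<bar>(p - q) - (2 * a + P / (3 * a))\<bar> \<le> B / (m * sqrt m)"
        unfolding B_def by (rule spread_expansion[OF ap aS m ma Pm])
      \<comment> \<open>\<open>m\<close> is at least \<open>n / 2\<close>, which is more than enough
        for \<open>m \<ge> n / 4\<close> and \<open>sqrt m \<ge> sqrt n / 2\<close>; the product
        accounts for the factor \<open>8\<close>.\<close>
      also have "\<dots> \<le> B / ((real n / 4) * (sqrt (real n) / 2))"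
      proof (rule divide_left_mono)
        have "sqrt (real n) / 2 = sqrt (real n / 4)" by (simp add: real_sqrt_divide)
        also have "\<dots> \<le> sqrt m" using mn by (intro real_sqrt_le_mono) linarith
        finally show "(real n / 4) * (sqrt (real n) / 2) \<le> m * sqrt m" using mn m by (intro mult_mono) auto
        show "0 < m * sqrt m * ((real n / 4) * (sqrt (real n) / 2))" using m Nn(3) by simp
      qed (rule B)
      also have "\<dots> = (8 * B) * norm (1 / real n powr (3 / 2))"
      proof -
        have "real n powr (3 / 2) = real n powr (1 + 1 / 2)" by simp
        also have "\<dots> = real n * sqrt (real n)" using Nn(3) by (subst powr_add) (simp add: powr_half_sqrt)
        finally show ?thesis using Nn(3) by (simp add: field_simps)
      qed
      finally show ?thesis unfolding a_def m_def G(2)[symmetric] sp real_norm_def .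
    qed
    then have "eventually (\<lambda>n. norm (Max (spread ` Kst_minor_free_graphs s t n)
            - (2 * sqrt (k * (real n - real s + 1)) + P / (3 * sqrt (k * (real n - real s + 1)))))
        \<le> (8 * B) * norm (1 / real n powr (3 / 2))) sequentially"
      unfolding eventually_sequentially by blast
    then show ?thesis unfolding P_def k_def by (rule bigoI)
  qed
  show ?thesis
    by (intro conjI exI[of _ N] exI[of _ "\<lambda>_. C"] allI impI) (rule first second; assumption)+
qed

end
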